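(* Let $G=\mathrm{GL}_3$ and let $T$ be the maximal torus of diagonal matrices. Let $\gamma\in\mathfrak t(\mathcal O)$ be a regular element, and let $\{\alpha_1,\alpha_2\}$ be a set of simple roots of $\Phi(G,T)$ such that $\mathrm{val}(\alpha_1(\gamma))=\mathrm{val}((\alpha_1+\alpha_2)(\gamma))\le \mathrm{val}(\alpha_2(\gamma))$. Put $(n_1,n_2)=(\mathrm{val}(\alpha_1(\gamma)),\mathrm{val}(\alpha_2(\gamma)))\in\mathbf N^2$ (the root valuation of $\gamma$), so $n_1\le n_2$. For a root $\alpha$ let $M_\alpha$ be the Levi subgroup containing $T$ with root system $\{\pm\alpha\}$. For a Levi subgroup $M\supset T$ let $c_M=\mathrm{vol}\big(\mathfrak a^{\mathrm{SL}_3}_{M\cap \mathrm{SL}_3}/X_*(M\cap \mathrm{SL}_3)\big)$. Then $$J_T(\gamma)=c_T\Big[\sum_{i=1}^{n_1} i\,(q^{2i-1}+q^{2i-2})+\sum_{i=n_1+n_2}^{2n_1+n_2-1}(4n_1+2n_2-4i-3)\,q^i+(n_1^2+2n_1n_2)\,q^{2n_1+n_2}\Big],$$ $$J_{M_\alpha}(\gamma)=c_{M_\alpha}\Big[(n_1+n_2)q^{2n_1+n_2}-q^{n_1+n_2}(1+q+\cdots+q^{n_1-1})-q^{2n_1}(1+q+\cdots+q^{n_2-1})\Big]\quad\text{for }\alpha=\alpha_1\text{ and }\alpha=\alpha_1+\alpha_2$$ (in particular the values for $\alpha_1$ and $\alpha_1+\alpha_2$ coincide), and $$J_{M_{\alp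ha_2}}(\gamma)=c_{M_{\alpha_2}}\Big[2n_1q^{2n_1+n_2}-2q^{n_1+n_2}(1+q+\cdots+q^{n_1-1})\Big].$$
   Context: $F=\mathbf F_q((\epsilon))$, $\mathcal O=\mathbf F_q[[\epsilon]]$, $\mathrm{val}(\epsilon)=1$; the characteristic of $\mathbf F_q$ is $>|W|$, where $W$ is the Weyl group of $G$. $\mathfrak g,\mathfrak t$ are the Lie algebras of $G,T$. Empty sums are zero. For a Levi subgroup $M\supset T$, $X^*(M)$ is the group of rational characters, $X_*(M)=\mathrm{Hom}(X^*(M),\mathbf Z)$, $\mathfrak a_M=X_*(M)\otimes\mathbf R$, and $\mathfrak a_M^G\subset \mathfrak a_M$ is the subspace annihilated by $X^*(G)$, so that $\mathfrak a_M=\mathfrak a_G\oplus\mathfrak a_M^G$. The same notation is used for $\mathrm{SL}_3$ and $M\cap\mathrm{SL}_3$; there is a canonical identification $\mathfrak a^{\mathrm{SL}_3}_{M\cap\mathrm{SL}_3}=\mathfrak a_M^G$, and $X_*(M\cap \mathrm{SL}_3)$ is a lattice in it. Fix a $W$-invariant inner product on $\mathfrak a_T^G$ and give each subspace $\mathfrak a_M^G\subset\mathfrak a_T^G$ the Lebesgue measure for which the lattice generated by an orthonormal basis has covolume $1$. For a parabolic subgroup $P=MN$ with Levi factor $M$, define $H_P:G(F)\to\mathfrak a_M$ by $\chi(H_P(nmk))=\mathrm{val}(\chi(m))$ for all $\chi\in X^*(M)$, $n\in N(F)$, $m\in M(F)$, $k\in G(\mathcal O)$. Arthur's weight factor $\mathrm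 v_M(g)$ is the volume of the projection to $\mathfrak a_M^G$ of the convex hull of the points $H_P(g)$, $P$ running over the parabolic subgroups with Levi factor $M$. Arthur's weighted orbital integral is $$J_M(\gamma)=\int_{T(F)\backslash G(F)}\mathbf 1_{\mathfrak g(\mathcal O)}\big(\mathrm{Ad}(g)^{-1}\gamma\big)\,\mathrm v_M(g)\,\frac{dg}{dt},$$ where the Haar measures are normalized by $\mathrm{vol}(G(\mathcal O))=1$ and $\mathrm{vol}(T(\mathcal O))=1$. *)

theory Defs
  imports
    "HOL-Analysis.Analysis"
    "HOL-Algebra.Coset"
    "HOL-Computational_Algebra.Formal_Laurent_Series"
begin

text \<open>
  For a finite field \<open>'a\<close> = F_q the local field F is \<^typ>\<open>'a fls\<close>, with its library metric, and
  matrices carry the product topology.  An algebraic subgroup of \<open>GL\<^sub>3\<close> is represented by its group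
  of F-points, a set of matrices; since F is infinite and all groups below are connected and F-split,
  the F-points are Zariski dense, so an algebraic character is determined by its values on them.
\<close>

type_synonym 'a mat3 = "'a fls^3^3"


section \<open>The groups\<close>

definition GL3 :: "('a::field) mat3 monoid" where
  "GL3 = \<lparr>carrier = {g. invertible g}, mult = (**), one = mat 1\<rparr>"

definition SL3 :: "('a::field) mat3 set" where
  "SL3 = {g. det g = 1}"

definition torus :: "('a::field) mat3 set" where
  "torus = {g \<in> carrier GL3. \<forall>i j. i \<noteq> j \<longrightarrow> g $ i $ j = 0}"

definition integers :: "('a::field) fls set" where
  "integers = range fps_to_fls"

definition integral_matrices :: "('a::field) mat3 set" where
  "integral_matrices = {A. \<forall>i j. A $ i $ j \<in> integers}"

definition GL3_integers :: "('a::field) mat3 set" where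
  "GL3_integers = {g \<in> integral_matrices. \<exists>h \<in> integral_matrices. g ** h = mat 1 \<and> h ** g = mat 1}"

definition weyl_group :: "(3 \<Rightarrow> 3) set" where
  "weyl_group = {\<sigma>. bij \<sigma>}"


section \<open>Roots\<close>

text \<open>
  The character group of the diagonal torus is \<^typ>\<open>int^3\<close>, written additively: \<open>k\<close> stands for
  \<open>t \<mapsto> \<Prod>i. t\<^sub>i powi k\<^sub>i\<close>.  Dually, \<^typ>\<open>real^3\<close> is the space \<open>\<aa>\<^sub>T\<close>.
\<close>

definition roots :: "(int^3) set" where
  "roots = {axis i 1 - axis j 1 | i j. i \<noteq> j}"

definition simple_roots :: "(int^3) set \<Rightarrow> bool" where
  "simple_roots \<Delta> \<longleftrightarrow> \<Delta> \<subseteq> roots \<and>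
    (\<forall>c. (\<Sum>\<alpha>\<in>\<Delta>. c \<alpha> *s \<alpha>) = 0 \<longrightarrow> (\<forall>\<alpha>\<in>\<Delta>. c \<alpha> = 0)) \<and>
    (\<forall>\<beta>\<in>roots. \<exists>c. \<beta> = (\<Sum>\<alpha>\<in>\<Delta>. c \<alpha> *s \<alpha>) \<and> ((\<forall>\<alpha>\<in>\<Delta>. 0 \<le> c \<alpha>) \<or> (\<forall>\<alpha>\<in>\<Delta>. c \<alpha> \<le> 0)))"

text \<open>The differential of a character of the torus, as a linear form on diagonal matrices.\<close>

definition root_value :: "int^3 \<Rightarrow> ('a::field) mat3 \<Rightarrow> 'a fls" where
  "root_value \<alpha> \<gamma> = (\<Sum>i\<in>UNIV. of_int (\<alpha> $ i) * \<gamma> $ i $ i)"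

definition torus_lie_integers :: "('a::field) mat3 set" where
  "torus_lie_integers = {A \<in> integral_matrices. \<forall>i j. i \<noteq> j \<longrightarrow> A $ i $ j = 0}"

definition regular :: "('a::field) mat3 \<Rightarrow> bool" where
  "regular \<gamma> \<longleftrightarrow> (\<forall>\<alpha>\<in>roots. root_value \<alpha> \<gamma> \<noteq> 0)"

text \<open>The roots of a subgroup containing the torus: those whose root subgroup it contains.\<close>

definition roots_of :: "('a::field) mat3 set \<Rightarrow> (int^3) set" where
  "roots_of M = {axis i 1 - axis j 1 | i j.
     i \<noteq> j \<and> (\<forall>x. mat 1 + (\<chi> k l. if k = i \<and> l = j then x else 0) \<in> M)}"


section \<open>Parabolic and Levi subgroups\<close>

text \<open>
  A parabolic subgroup of \<open>GL\<^sub>3\<close> is the stabilizer \<open>P\<close> of a flag in \<open>F\<^sup>3\<close>, its unipotent radical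
  \<open>N\<close> consists of the elements acting trivially on the successive quotients, and its Levi factors
  \<open>M\<close> are the stabilizers of the splittings of the flag.
\<close>

definition splitting :: "('a::field fls^3) set list \<Rightarrow> bool" where
  "splitting Ws \<longleftrightarrow>
    (\<forall>W\<in>set Ws. vec.subspace W \<and> W \<noteq> {0}) \<and>
    (\<forall>v. \<exists>!w. w \<in> (\<Pi>\<^sub>E k\<in>{..<length Ws}. Ws ! k) \<and> v = (\<Sum>k<length Ws. w k))"

definition flag_part :: "('a::field fls^3) set list \<Rightarrow> nat \<Rightarrow> ('a fls^3) set" where
  "flag_part Ws k = vec.span (\<Union> (set (take k Ws)))"

definition levi_decomposition :: "('a::field) mat3 set \<Rightarrow> 'a mat3 set \<Rightarrow> 'a mat3 set \<Rightarrow> bool" where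
  "levi_decomposition P M N \<longleftrightarrow> (\<exists>Ws. splitting Ws \<and>
    P = {g \<in> carrier GL3. \<forall>k\<le>length Ws. (*v) g ` flag_part Ws k = flag_part Ws k} \<and>
    M = {g \<in> carrier GL3. \<forall>W\<in>set Ws. (*v) g ` W = W} \<and>
    N = {g \<in> P. \<forall>k<length Ws. \<forall>v\<in>flag_part Ws (Suc k). g *v v - v \<in> flag_part Ws k})"

definition levi_subgroup :: "('a::field) mat3 set \<Rightarrow> bool" where
  "levi_subgroup M \<longleftrightarrow> (\<exists>P N. levi_decomposition P M N)"

definition levi_of_root :: "int^3 \<Rightarrow> ('a::field) mat3 set" where
  "levi_of_root \<alpha> = (THE M. levi_subgroup M \<and> torus \<subseteq> M \<and> roots_of M = {\<alpha>, - \<alpha>})"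


section \<open>Rational characters and the spaces \<open>\<aa>\<^sub>M\<close>\<close>

inductive polynomial_fun :: "(('a::field) mat3 \<Rightarrow> 'a fls) \<Rightarrow> bool" where
  const: "polynomial_fun (\<lambda>g. c)"
| entry: "polynomial_fun (\<lambda>g. g $ i $ j)"
| add: "polynomial_fun f \<Longrightarrow> polynomial_fun h \<Longrightarrow> polynomial_fun (\<lambda>g. f g + h g)"
| mult: "polynomial_fun f \<Longrightarrow> polynomial_fun h \<Longrightarrow> polynomial_fun (\<lambda>g. f g * h g)"

text \<open>
  The regular functions on a closed subgroup of \<open>GL\<^sub>3\<close> are the restrictions of polynomials in the
  entries divided by a power of the determinant.  Characters are not extensional: only their values
  on \<open>H\<close> matter.
\<close>

definition rational_characters :: "('a::field) mat3 set \<Rightarrow> ('a mat3 \<Rightarrow> 'a fls) set" where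
  "rational_characters H = {\<psi>.
     (\<forall>g\<in>H. \<psi> g \<noteq> 0) \<and>
     (\<forall>g\<in>H. \<forall>h\<in>H. \<psi> (g ** h) = \<psi> g * \<psi> h) \<and>
     (\<exists>f n. polynomial_fun f \<and> (\<forall>g\<in>H. \<psi> g = f g / det g ^ n))}"

text \<open>
  The pairing of a character of \<open>H\<close> with \<open>\<aa>\<^sub>T\<close>, through the restriction of the character to the
  torus of \<open>H\<close>.  For \<open>H = M \<inter> SL\<^sub>3\<close> the exponents are determined only up to multiples of (1,1,1),
  which pair to zero with the trace zero vectors, the only ones for which the pairing is used.
\<close>

definition weight :: "('a::field) mat3 set \<Rightarrow> ('a mat3 \<Rightarrow> 'a fls) \<Rightarrow> int^3" where
  "weight H \<psi> = (SOME k. \<forall>t \<in> torus \<inter> H. \<psi> t = (\<Prod>i\<in>UNIV. (t $ i $ i) powi (k $ i)))"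

definition pairing :: "('a::field) mat3 set \<Rightarrow> ('a mat3 \<Rightarrow> 'a fls) \<Rightarrow> real^3 \<Rightarrow> real" where
  "pairing H \<psi> x = (\<Sum>i\<in>UNIV. of_int (weight H \<psi> $ i) * x $ i)"

text \<open>
  \<open>\<aa>\<^sub>M\<close> is embedded in \<open>\<aa>\<^sub>T\<close> in the usual way, through the cocharacters of the centre of \<open>M\<close>; that
  is, as the subspace killed by the roots of \<open>M\<close>.  The pairing identifies this subspace with
  \<open>Hom(X\<^sup>*(M), \<real>) = X\<^sub>*(M) \<otimes> \<real>\<close>.
\<close>

definition a_space :: "('a::field) mat3 set \<Rightarrow> (real^3) set" where
  "a_space M = {x. \<forall>\<alpha>\<in>roots_of M. (\<Sum>i\<in>UNIV. of_int (\<alpha> $ i) * x $ i) = 0}"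

definition a_space_G :: "('a::field) mat3 set \<Rightarrow> (real^3) set" where
  "a_space_G M = {x \<in> a_space M. \<forall>\<psi>\<in>rational_characters (carrier (GL3 :: 'a mat3 monoid)).
     pairing (carrier GL3) \<psi> x = 0}"

definition proj_G :: "('a::field) mat3 set \<Rightarrow> real^3 \<Rightarrow> real^3" where
  "proj_G M x = (THE y. y \<in> a_space_G M \<and> x - y \<in> a_space (carrier (GL3 :: 'a mat3 monoid)))"

text \<open>
  \<open>X\<^sub>*(M \<inter> SL\<^sub>3) = Hom(X\<^sup>*(M \<inter> SL\<^sub>3), \<int>)\<close>, as a lattice in \<open>\<aa>\<^sub>M\<^sup>G = Hom(X\<^sup>*(M \<inter> SL\<^sub>3), \<real>)\<close>.
  It is larger than the lattice of cocharacters of the centre of \<open>M \<inter> SL\<^sub>3\<close> in general.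
\<close>

definition cochar_lattice_SL :: "('a::field) mat3 set \<Rightarrow> (real^3) set" where
  "cochar_lattice_SL M = {x \<in> a_space_G M.
     \<forall>\<psi>\<in>rational_characters (M \<inter> SL3). pairing (M \<inter> SL3) \<psi> x \<in> \<int>}"


section \<open>Volumes\<close>

definition inner_product_on :: "(real^3) set \<Rightarrow> (real^3 \<Rightarrow> real^3 \<Rightarrow> real) \<Rightarrow> bool" where
  "inner_product_on V B \<longleftrightarrow>
    (\<forall>x\<in>V. \<forall>y\<in>V. \<forall>z\<in>V. B (x + y) z = B x z + B y z) \<and>
    (\<forall>x\<in>V. \<forall>y\<in>V. \<forall>c. B (c *\<^sub>R x) y = c * B x y) \<and>
    (\<forall>x\<in>V. \<forall>y\<in>V. B x y = B y x) \<and>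
    (\<forall>x\<in>V. x \<noteq> 0 \<longrightarrow> 0 < B x x)"

definition weyl_invariant_on :: "(real^3) set \<Rightarrow> (real^3 \<Rightarrow> real^3 \<Rightarrow> real) \<Rightarrow> bool" where
  "weyl_invariant_on V B \<longleftrightarrow>
    (\<forall>\<sigma>\<in>weyl_group. \<forall>x\<in>V. \<forall>y\<in>V. B (\<chi> i. x $ \<sigma> i) (\<chi> i. y $ \<sigma> i) = B x y)"

definition orthonormal_basis :: "(real^3 \<Rightarrow> real^3 \<Rightarrow> real) \<Rightarrow> (real^3) set \<Rightarrow> (real^3) set \<Rightarrow> bool" where
  "orthonormal_basis B U E \<longleftrightarrow> E \<subseteq> U \<and> finite E \<and> span E = U \<and>
    (\<forall>e\<in>E. \<forall>f\<in>E. B e f = (if e = f then 1 else 0))"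

text \<open>
  Lebesgue measure on a subspace \<open>U\<close>, as a measure on \<^typ>\<open>real^3\<close> carried by \<open>U\<close>, built from an
  orthonormal basis as \<^const>\<open>lborel\<close> is from the standard one.
\<close>

definition subspace_lborel :: "(real^3 \<Rightarrow> real^3 \<Rightarrow> real) \<Rightarrow> (real^3) set \<Rightarrow> (real^3) measure" where
  "subspace_lborel B U = (let E = (SOME E. orthonormal_basis B U E) in
     distr (\<Pi>\<^sub>M e\<in>E. lborel) borel (\<lambda>c. \<Sum>e\<in>E. c e *\<^sub>R e))"

definition fundamental_domain :: "(real^3) set \<Rightarrow> (real^3) set \<Rightarrow> (real^3) set \<Rightarrow> bool" where
  "fundamental_domain U L D \<longleftrightarrow> D \<in> sets borel \<and> D \<subseteq> U \<and> (\<forall>x\<in>U. \<exists>!l. l \<in> L \<and> x - l \<in> D)"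

definition covolume :: "(real^3 \<Rightarrow> real^3 \<Rightarrow> real) \<Rightarrow> (real^3) set \<Rightarrow> (real^3) set \<Rightarrow> real" where
  "covolume B U L = measure (subspace_lborel B U) (SOME D. fundamental_domain U L D)"

definition levi_covolume :: "(real^3 \<Rightarrow> real^3 \<Rightarrow> real) \<Rightarrow> ('a::field) mat3 set \<Rightarrow> real" where
  "levi_covolume B M = covolume B (a_space_G M) (cochar_lattice_SL M)"


section \<open>Arthur's weight factor\<close>

definition H_par :: "('a::field) mat3 set \<Rightarrow> 'a mat3 set \<Rightarrow> 'a mat3 \<Rightarrow> real^3" where
  "H_par M N g = (THE x. x \<in> a_space M \<and>
     (\<forall>n\<in>N. \<forall>m\<in>M. \<forall>k\<in>GL3_integers. g = n ** m ** k \<longrightarrow>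
        (\<forall>\<psi>\<in>rational_characters M. pairing M \<psi> x = of_int (fls_subdegree (\<psi> m)))))"

definition weight_factor :: "(real^3 \<Rightarrow> real^3 \<Rightarrow> real) \<Rightarrow> ('a::field) mat3 set \<Rightarrow> 'a mat3 \<Rightarrow> real" where
  "weight_factor B M g = measure (subspace_lborel B (a_space_G M))
     (proj_G M ` (convex hull {H_par M N g | P N. levi_decomposition P M N}))"


section \<open>Haar measures and the weighted orbital integral\<close>

text \<open>
  The groups involved are locally compact and second countable, so a left invariant Borel measure
  that is finite on compact sets is automatically regular; they are also unimodular.
\<close>

definition haar_measure :: "('g::topological_space) monoid \<Rightarrow> 'g measure \<Rightarrow> bool" where
  "haar_measure H \<mu> \<longleftrightarrow>
    sets \<mu> = sets (restrict_space borel (carrier H)) \<and>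
    (\<forall>g\<in>carrier H. \<forall>A\<in>sets \<mu>. emeasure \<mu> (g <#\<^bsub>H\<^esub> A) = emeasure \<mu> A) \<and>
    (\<forall>C. compact C \<and> C \<subseteq> carrier H \<longrightarrow> emeasure \<mu> C < \<infinity>) \<and>
    (\<forall>U. openin (top_of_set (carrier H)) U \<and> U \<noteq> {} \<longrightarrow> 0 < emeasure \<mu> U)"

abbreviation coset_rep :: "'g set \<Rightarrow> 'g" where
  "coset_rep c \<equiv> (SOME g. g \<in> c)"

text \<open>
  The quotient of a Haar measure on \<open>H\<close> by a Haar measure on a subgroup \<open>S\<close>: a measure on the Borel
  sets of the space of cosets \<open>S g\<close> (quotient topology), characterized by Weil's formula.  By
  invariance of \<open>\<mu>S\<close> the inner integral does not depend on the representative of the coset.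
\<close>

definition quotient_measure ::
  "('g::topological_space) monoid \<Rightarrow> 'g set \<Rightarrow> 'g measure \<Rightarrow> 'g measure \<Rightarrow> 'g set measure \<Rightarrow> bool" where
  "quotient_measure H S \<mu>H \<mu>S \<nu> \<longleftrightarrow>
    space \<nu> = rcosets\<^bsub>H\<^esub> S \<and>
    sets \<nu> = sigma_sets (rcosets\<^bsub>H\<^esub> S)
      {U. U \<subseteq> rcosets\<^bsub>H\<^esub> S \<and> openin (top_of_set (carrier H)) (\<Union> U)} \<and>
    (\<forall>f\<in>borel_measurable \<mu>H.
      (\<integral>\<^sup>+ g. f g \<partial>\<mu>H) = (\<integral>\<^sup>+ c. (\<integral>\<^sup>+ t. f (t \<otimes>\<^bsub>H\<^esub> coset_rep c) \<partial>\<mu>S) \<partial>\<nu>))"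

definition orbital_integrand ::
  "(real^3 \<Rightarrow> real^3 \<Rightarrow> real) \<Rightarrow> ('a::field) mat3 set \<Rightarrow> 'a mat3 \<Rightarrow> 'a mat3 \<Rightarrow> real" where
  "orbital_integrand B M \<gamma> g =
     indicator integral_matrices (matrix_inv g ** \<gamma> ** g) * weight_factor B M g"

definition weighted_orbital_integral ::
  "'a mat3 set measure \<Rightarrow> (real^3 \<Rightarrow> real^3 \<Rightarrow> real) \<Rightarrow> ('a::field) mat3 set \<Rightarrow> 'a mat3 \<Rightarrow> real" where
  "weighted_orbital_integral \<nu> B M \<gamma> = (\<integral> c. orbital_integrand B M \<gamma> (coset_rep c) \<partial>\<nu>)"

end

theory Submission
  imports Defs
begin

text \<open>
  The Iwasawa decomposition reduces the integral over the quotient by the torus to a finite sum over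
  unipotent matrices with entries x, y, z modulo the integers, subject to the condition that the
  conjugate of \<open>\<gamma>\<close> is integral; x and y are free polar parts of bounded order, and z runs over a
  translate by a multiple of xy of the polar parts of bounded order.  The points \<open>H\<^sub>P(g)\<close> are read off
  from the least valuations in the rows of g and in the columns of its inverse.  For the torus their
  convex hull is a hexagon, a rectangle without two corner triangles, and for a maximal Levi subgroup
  it is a segment; the measure of the subspace in coordinates and the covolume of the lattice involve the
  same factor.  The order of the coordinates is chosen so that the exceptional root is the highest
  one, which makes the bounds on x and y equal; for the other two maximal Levi subgroups it is chosen
  so that the root of the Levi subgroup is the highest one, because then the weight depends on the
  orders of x and y only.
\<close>

no_notation fps_nth (infixl \<open>$\<close> 75)

section \<open>Valuations and integral matrices\<close>

text \<open>The passage to a finite sum rests on a set that meets every coset Tg in exactly one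
  translate of the integral torus, of measure 1: the matrices whose torus part in the Iwasawa
  decomposition has valuations 0. Multiplying the integrand by its indicator turns the integral over
  the quotient into one over the group by Weil's formula. All functions involved are right invariant
  under the integral invertible matrices, hence locally constant, which settles measurability. The
  multiple of xy is \<kappa>xy with \<kappa> = (c_j - c_k)/(c_i - c_k), where c is the diagonal of
  \<gamma>. For the torus, with the bound n for x and y and N for the polar parts added to
  \<kappa>xy, both \<kappa> and 1 - \<kappa> have valuation n - N. So either the orders X, Y of x, y
  satisfy X + Y \<le> n and the translate is the set of polar parts of order at most N itself, or
  \<kappa>xy dominates and z and xy - z have one and the same fixed order. In the first case the
  area drops when z or xy - z has order below X + Y, and these corrections are the source of the
  terms q^(2i-1) + q^(2i-2).\<close>

definition fls_ge :: "int \<Rightarrow> ('a::field) fls \<Rightarrow> bool" where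
  "fls_ge n x \<longleftrightarrow> (\<forall>k<n. fls_nth x k = 0)"

text \<open>Zero satisfies every bound although its \<open>fls_subdegree\<close> is 0. Bounds are
  therefore kept in the form \<open>fls_ge\<close>, membership in \<epsilon>^n times the integers,
  and become inequalities of valuations only for nonzero elements.\<close>

lemma fls_ge_iff: "fls_ge n x \<longleftrightarrow> x = 0 \<or> n \<le> fls_subdegree x"
proof
  assume "fls_ge n x"
  thus "x = 0 \<or> n \<le> fls_subdegree x"
    unfolding fls_ge_def by (metis not_le nth_fls_subdegree_nonzero)
next
  assume "x = 0 \<or> n \<le> fls_subdegree x"
  thus "fls_ge n x" unfolding fls_ge_def by auto
qed

lemma fls_ge_0 [simp]: "fls_ge n 0"
  by (simp add: fls_ge_def)

lemma fls_ge_mono: "fls_ge n x \<Longrightarrow> m \<le> n \<Longrightarrow> fls_ge m x"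
  by (auto simp: fls_ge_def)

lemma fls_ge_add: "fls_ge n x \<Longrightarrow> fls_ge n y \<Longrightarrow> fls_ge n (x + y)"
  and fls_ge_diff: "fls_ge n x \<Longrightarrow> fls_ge n y \<Longrightarrow> fls_ge n (x - y)"
  and fls_ge_uminus [simp]: "fls_ge n (- x) \<longleftrightarrow> fls_ge n x"
  by (auto simp: fls_ge_def)

lemma fls_ge_sum: "(\<And>i. i \<in> I \<Longrightarrow> fls_ge n (f i)) \<Longrightarrow> fls_ge n (\<Sum>i\<in>I. f i)"
  by (induction I rule: infinite_finite_induct) (auto intro: fls_ge_add)

lemma fls_ge_mult: "fls_ge m x \<Longrightarrow> fls_ge n y \<Longrightarrow> fls_ge (m + n) (x * y)"
  by (cases "x = 0 \<or> y = 0") (auto simp: fls_ge_iff)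

lemma fls_ge_mult_iff: "x \<noteq> 0 \<Longrightarrow> fls_ge n (x * y) \<longleftrightarrow> fls_ge (n - fls_subdegree x) y"
  by (cases "y = 0") (auto simp: fls_ge_iff)

lemma fls_ge_0_1 [simp]: "fls_ge 0 1"
  by (simp add: fls_ge_iff)

lemma fls_ge_mult0: "fls_ge 0 x \<Longrightarrow> fls_ge n y \<Longrightarrow> fls_ge n (x * y)"
  and fls_ge_mult0': "fls_ge n x \<Longrightarrow> fls_ge 0 y \<Longrightarrow> fls_ge n (x * y)"
  using fls_ge_mult[of 0 x n y] fls_ge_mult[of n x 0 y] by auto

lemma integers_iff: "x \<in> integers \<longleftrightarrow> fls_ge 0 x"
proof
  show "x \<in> integers \<Longrightarrow> fls_ge 0 x" by (auto simp: integers_def fls_ge_def)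
  assume "fls_ge 0 x"
  hence "0 \<le> fls_subdegree x" by (auto simp: fls_ge_iff)
  hence "x = fps_to_fls (fls_regpart x)" by (simp add: fls_regpart_to_fls_trivial)
  thus "x \<in> integers" unfolding integers_def by (metis rangeI)
qed

text \<open>Truncation at 0 makes this a function of the class modulo the integers, equal to 0
  exactly on the integers.\<close>

definition pole :: "('a::field) fls \<Rightarrow> nat" where
  "pole x = nat (- fls_subdegree x)"

lemma pole_le_iff: "pole x \<le> n \<longleftrightarrow> fls_ge (- int n) x"
  by (cases "x = 0") (auto simp: pole_def fls_ge_iff)

text \<open>The sharp ultrametric inequality. Here \<open>pole x\<close> is positive, so
  \<open>pole x - 1\<close> is a proper bound; if the sum obeyed it, subtracting y would force it on
  x.\<close>

lemma pole_add_eq: "pole y < pole x \<Longrightarrow> pole (x + y) = pole x"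
proof -
  assume a: "pole y < pole x"
  have "pole (x + y) \<le> pole x"
    using a by (auto simp: pole_le_iff less_imp_le intro!: fls_ge_add) (meson less_imp_le order_refl pole_le_iff)+
  moreover have "\<not> pole (x + y) < pole x"
  proof
    assume "pole (x + y) < pole x"
    with a have "pole (x + y) \<le> pole x - 1" "pole y \<le> pole x - 1" by auto
    hence "pole (x + y - y) \<le> pole x - 1" unfolding pole_le_iff by (rule fls_ge_diff)
    with a show False by simp
  qed
  ultimately show ?thesis by simp
qed

lemma pole_uminus [simp]: "pole (- x) = pole x"
  by (simp add: pole_def)

lemma pole_add_le: "pole x \<le> n \<Longrightarrow> pole y \<le> n \<Longrightarrow> pole (x + y) \<le> n"
  and pole_diff_le: "pole x \<le> n \<Longrightarrow> pole y \<le> n \<Longrightarrow> pole (x - y) \<le> n"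
  by (auto simp: pole_le_iff intro: fls_ge_add fls_ge_diff)

lemma pole_0 [simp]: "pole 0 = 0"
  by (simp add: pole_def)

lemma pole_eq_0_iff: "pole x = 0 \<longleftrightarrow> fls_ge 0 x"
  using pole_le_iff[of x 0] by simp

lemma pole_add_integral [simp]: "fls_ge 0 y \<Longrightarrow> pole (x + y) = pole x"
proof (cases "pole x = 0")
  case True
  assume "fls_ge 0 y"
  with True show ?thesis using fls_ge_add[of 0 x y] pole_eq_0_iff by metis
next
  case False
  assume "fls_ge 0 y"
  with False show ?thesis by (intro pole_add_eq) (simp add: pole_eq_0_iff[symmetric])
qed

abbreviation val :: "('a::field) fls \<Rightarrow> int" where "val \<equiv> fls_subdegree"

text \<open>Sums, products and quantifiers over the index type are expanded along an arbitrary
  triple of distinct indices, because the later arguments run for an unspecified order of the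
  coordinates.\<close>

lemma UNIV_perm3: fixes i j k :: 3 assumes "distinct [i,j,k]" shows "UNIV = {i,j,k}"
proof -
  have "card {i,j,k} = CARD(3)" using assms by simp
  thus ?thesis by (intro card_subset_eq[symmetric]) auto
qed

lemma sum_perm3: fixes i j k :: 3 assumes "distinct [i,j,k]" shows "sum f UNIV = f i + f j + f k"
  using assms by (simp add: UNIV_perm3[OF assms] add.assoc)

lemma prod_perm3: fixes i j k :: 3 assumes "distinct [i,j,k]" shows "prod f UNIV = f i * f j * (f k :: 'b::comm_monoid_mult)"
  using assms by (simp add: UNIV_perm3[OF assms] mult.assoc)

lemma all_perm3: fixes i j k :: 3 assumes "distinct [i,j,k]" shows "(\<forall>a. P a) \<longleftrightarrow> P i \<and> P j \<and> P k"
  using UNIV_perm3[OF assms] by (metis UNIV_I empty_iff insert_iff)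

lemma ex_perm3: fixes i j :: 3 assumes "i \<noteq> j" shows "\<exists>k. distinct [i,j,k]"
proof -
  have "\<exists>k. k \<notin> {i,j}" 
  proof (rule ccontr)
    assume "\<not> ?thesis" hence "UNIV = {i,j}" by auto
    hence "CARD(3) = card {i,j}" by simp
    with assms show False by simp
  qed
  thus ?thesis using assms by auto
qed

section \<open>Integral matrices and the group of integral invertible matrices\<close>

lemma integral_mult: "A \<in> integral_matrices \<Longrightarrow> B \<in> integral_matrices \<Longrightarrow> A ** B \<in> integral_matrices"
  by (auto simp: integral_matrices_def integers_iff matrix_matrix_mult_def intro!: fls_ge_sum fls_ge_mult0)

lemma integral_one: "mat 1 \<in> integral_matrices"
  by (auto simp: integral_matrices_def integers_iff mat_def)

lemma GL3_carrier [simp]: "carrier GL3 = {g. invertible g}" and GL3_mult [simp]: "mult GL3 = (**)"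
  and GL3_one [simp]: "one GL3 = mat 1"
  by (simp_all add: GL3_def)

lemma mat3_inv: fixes g :: "('a::field) mat3" assumes "invertible g"
  shows mat3_inv_right: "g ** matrix_inv g = mat 1" and mat3_inv_left: "matrix_inv g ** g = mat 1"
  using someI_ex[OF assms[unfolded invertible_def]] by (auto simp: matrix_inv_def)

lemma mat3_inv_unique: fixes g :: "('a::field) mat3" assumes "g ** h = mat 1" 
  shows "matrix_inv g = h" "invertible g" "invertible h"
proof -
  have "h ** g = mat 1" using assms by (simp add: matrix_left_right_inverse)
  thus i: "invertible g" "invertible h" using assms by (auto simp: invertible_def)
  have "matrix_inv g = matrix_inv g ** (g ** h)" by (simp add: assms)
  also have "\<dots> = h" by (simp add: matrix_mul_assoc mat3_inv_left[OF i(1)])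
  finally show "matrix_inv g = h" .
qed

lemma mat3_inv_mult: fixes g h :: "('a::field) mat3" assumes "invertible g" "invertible h"
  shows "matrix_inv (g ** h) = matrix_inv h ** matrix_inv g"
proof (rule mat3_inv_unique)
  have "g ** h ** (matrix_inv h ** matrix_inv g) = g ** (h ** matrix_inv h) ** matrix_inv g"
    by (simp add: matrix_mul_assoc)
  thus "g ** h ** (matrix_inv h ** matrix_inv g) = mat 1"
    by (simp add: mat3_inv_right assms)
qed

lemma mat3_inv_invertible: fixes g :: "('a::field) mat3" assumes "invertible g" 
  shows "invertible (matrix_inv g)" "matrix_inv (matrix_inv g) = g"
  using mat3_inv_unique[OF mat3_inv_left[OF assms]] by auto

lemma invertible_det: "invertible (g :: ('a::field) mat3) \<longleftrightarrow> det g \<noteq> 0"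
  by (rule invertible_det_nz)

lemma mat3_invertible_mult: "invertible (g :: ('a::field) mat3) \<Longrightarrow> invertible (h :: 'a mat3) \<Longrightarrow> invertible (g ** h)"
  by (simp add: invertible_det det_mul)

lemma mat3_invertible_one [simp]: "invertible (mat 1 :: ('a::field) mat3)"
  by (simp add: invertible_det)

text \<open>With indices read modulo 3 the cofactors carry no signs.\<close>
definition adj3 :: "('a::field) mat3 \<Rightarrow> 'a mat3" where
  "adj3 g = (\<chi> a b. g$(b+1)$(a+1) * g$(b+2)$(a+2) - g$(b+1)$(a+2) * g$(b+2)$(a+1))"

lemma three_arith: "(1::3) + 1 = 2" "(1::3) + 2 = 3" "(2::3)+1 = 3" "(2::3)+2=1" "(3::3)+1 = 1" "(3::3)+2 = 2"
  by simp_all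

lemma adj3_mult: "g ** adj3 g = (\<chi> a b. if a = b then det g else 0)"
  by (simp add: vec_eq_iff forall_3 adj3_def matrix_matrix_mult_def sum_3 det_3 three_arith del: one_add_one numeral_plus_one one_plus_numeral numeral_plus_numeral add_numeral_left) (simp add: algebra_simps)

lemma integral_det: "g \<in> integral_matrices \<Longrightarrow> fls_ge 0 (det g)"
  by (auto simp: integral_matrices_def integers_iff det_3 intro!: fls_ge_add fls_ge_diff fls_ge_mult0)

text \<open>Cramer's rule: when the determinant is a unit, the inverse is the adjugate divided by
  the determinant and hence integral.\<close>

lemma GL3_integers_iff: "g \<in> GL3_integers \<longleftrightarrow> g \<in> integral_matrices \<and> det g \<noteq> 0 \<and> val (det g) = 0"
proof
  assume "g \<in> GL3_integers"
  then obtain h where g: "g \<in> integral_matrices" and h: "h \<in> integral_matrices" "g ** h = mat 1"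
    by (auto simp: GL3_integers_def)
  have 1: "det g * det h = 1" by (metis h(2) det_mul det_I)
  hence nz: "det g \<noteq> 0" "det h \<noteq> 0" by auto
  have "val (det g) + val (det h) = 0" using 1 nz by (metis fls_subdegree_mult fls_one_subdegree)
  moreover have "val (det g) \<ge> 0" "val (det h) \<ge> 0"
    using integral_det[OF g] integral_det[OF h(1)] nz by (auto simp: fls_ge_iff)
  ultimately show "g \<in> integral_matrices \<and> det g \<noteq> 0 \<and> val (det g) = 0" using g nz by auto
next
  assume g: "g \<in> integral_matrices \<and> det g \<noteq> 0 \<and> val (det g) = 0"
  define h where "h = (\<chi> a b. inverse (det g) * adj3 g $ a $ b)"
  have "h \<in> integral_matrices"
    using g by (auto simp: h_def integral_matrices_def integers_iff adj3_def fls_ge_iff[of _ "inverse (det g)"]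
        fls_inverse_subdegree intro!: fls_ge_mult0 fls_ge_diff)
  moreover have gh: "g ** h = mat 1"
  proof -
    have "(g ** h) $ a $ b = inverse (det g) * (g ** adj3 g) $ a $ b" for a b
      by (simp add: h_def matrix_matrix_mult_def sum_distrib_left algebra_simps)
    thus ?thesis using g by (simp add: adj3_mult vec_eq_iff mat_def)
  qed
  moreover have "h ** g = mat 1" using gh by (simp add: matrix_left_right_inverse)
  ultimately show "g \<in> GL3_integers" using g by (auto simp: GL3_integers_def)
qed

lemma GL3_integers_invertible: "g \<in> GL3_integers \<Longrightarrow> invertible g"
  by (simp add: GL3_integers_iff invertible_det)

lemma GL3_integers_mult: "g \<in> GL3_integers \<Longrightarrow> h \<in> GL3_integers \<Longrightarrow> g ** h \<in> GL3_integers"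
  by (auto simp: GL3_integers_iff det_mul integral_mult)

lemma GL3_integers_one: "mat 1 \<in> GL3_integers"
  by (auto simp: GL3_integers_iff integral_one)

lemma GL3_integers_inv: "g \<in> GL3_integers \<Longrightarrow> matrix_inv g \<in> GL3_integers"
  unfolding GL3_integers_def using mat3_inv_unique by fastforce

section \<open>Levi and parabolic subgroups\<close>

definition coord :: "3 set \<Rightarrow> ('a::field fls^3) set" where
  "coord S = {v. \<forall>i. i \<notin> S \<longrightarrow> v $ i = 0}"

text \<open>A function b on the indices encodes an ordered partition: its fibres are the blocks and
  the order of its values is the order of the flag. \<open>levi\<close> depends on the partition
  only, \<open>parab\<close> and \<open>unirad\<close> also on the order.\<close>

definition levi :: "(3 \<Rightarrow> nat) \<Rightarrow> ('a::field) mat3 set" where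
  "levi b = {g. invertible g \<and> (\<forall>i j. b i \<noteq> b j \<longrightarrow> g $ i $ j = 0)}"

definition parab :: "(3 \<Rightarrow> nat) \<Rightarrow> ('a::field) mat3 set" where
  "parab b = {g. invertible g \<and> (\<forall>i j. b j < b i \<longrightarrow> g $ i $ j = 0)}"

definition unirad :: "(3 \<Rightarrow> nat) \<Rightarrow> ('a::field) mat3 set" where
  "unirad b = {g. invertible g \<and> (\<forall>i j. b j \<le> b i \<longrightarrow> g $ i $ j = (if i = j then 1 else 0))}"

definition diag :: "(3 \<Rightarrow> ('a::field) fls) \<Rightarrow> 'a mat3" where
  "diag d = (\<chi> i j. if i = j then d i else 0)"

lemma diag_nth [simp]: "diag d $ i $ j = (if i = j then d i else 0)"
  by (simp add: diag_def)

lemma det_diag: "det (diag d) = d 1 * d 2 * d 3"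
  by (simp add: det_3)

lemma invertible_diag: "invertible (diag d) \<longleftrightarrow> (\<forall>i. d i \<noteq> 0)"
  by (simp add: invertible_det det_diag forall_3)

lemma torus_iff_diag: "t \<in> torus \<longleftrightarrow> (\<exists>d. (\<forall>i. d i \<noteq> 0) \<and> t = diag d)"
proof
  assume t: "t \<in> torus"
  let ?d = "\<lambda>i. t $ i $ i"
  have td: "diag ?d = t" using t unfolding vec_eq_iff by (simp add: torus_def)
  have "invertible (diag ?d)" unfolding td using t by (simp add: torus_def)
  hence "\<forall>i. ?d i \<noteq> 0" unfolding invertible_diag .
  hence "(\<forall>i. ?d i \<noteq> 0) \<and> t = diag ?d" using td by (rule_tac conjI) (assumption, rule sym)
  thus "\<exists>d. (\<forall>i. d i \<noteq> 0) \<and> t = diag d" by (rule exI[of _ ?d])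
next
  assume "\<exists>d. (\<forall>i. d i \<noteq> 0) \<and> t = diag d"
  then obtain d where d: "\<forall>i. d i \<noteq> 0" "t = diag d" by blast
  have "invertible t" unfolding d(2) invertible_diag by (rule d(1))
  thus "t \<in> torus" unfolding d(2) by (simp add: torus_def)
qed

lemma diag_vmult: "(diag d *v v) $ i = d i * v $ i"
  by (simp add: matrix_vector_mult_def if_distrib[where f = "\<lambda>x. x * _"] cong: if_cong)

lemma vmult_axis: "((g :: ('a::field) mat3) *v axis j 1) $ i = g $ i $ j"
  by (simp add: matrix_vector_mult_def axis_def if_distrib[where f = "\<lambda>x. _ * x"] cong: if_cong)

lemma vec_axis_sum: "(v :: ('a::field) fls^3) = (\<Sum>i\<in>UNIV. v $ i *s axis i 1)"
  by (simp add: vec_eq_iff axis_def if_distrib[where f = "\<lambda>x. _ * x"] cong: if_cong)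

lemma subspace_coord: "vec.subspace (coord S)"
  by (auto simp: vec.subspace_def coord_def)

lemma axis_in_coord [simp]: "axis i 1 \<in> (coord S :: ('a::field fls^3) set) \<longleftrightarrow> i \<in> S"
  by (auto simp: coord_def axis_def)

lemma coord_subset: "vec.subspace W \<Longrightarrow> (\<And>i. i \<in> S \<Longrightarrow> axis i 1 \<in> W) \<Longrightarrow> coord S \<subseteq> (W :: ('a::field fls^3) set)"
proof
  fix v :: "'a fls^3" assume W: "vec.subspace W" "\<And>i. i \<in> S \<Longrightarrow> axis i 1 \<in> W" and v: "v \<in> coord S"
  have "v $ i *s axis i 1 \<in> W" for i
  proof (cases "i \<in> S")
    case True thus ?thesis by (intro vec.subspace_scale W)
  next
    case False hence "v $ i = 0" using v by (simp add: coord_def)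
    thus ?thesis using W(1) by (simp add: vec.subspace_0)
  qed
  hence "(\<Sum>i\<in>UNIV. v $ i *s axis i 1) \<in> W" by (intro vec.subspace_sum W)
  thus "v \<in> W" using vec_axis_sum[of v] by simp
qed

text \<open>Subtracting the identity from a torus element with a single entry different from 1 gives a multiple of a coordinate projection.\<close>

lemma torus_stable_subspace:
  fixes W :: "('a::field fls^3) set"
  assumes W: "vec.subspace W" and st: "\<And>t. t \<in> torus \<Longrightarrow> (*v) t ` W \<subseteq> W"
  shows "W = coord {i. axis i 1 \<in> W}"
proof
  show "coord {i. axis i 1 \<in> W} \<subseteq> W" by (rule coord_subset[OF W]) simp
  show "W \<subseteq> coord {i. axis i 1 \<in> W}"
  proof
    fix v assume v: "v \<in> W"
    have "axis i 1 \<in> W" if "v $ i \<noteq> 0" for i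
    proof -
      let ?d = "\<lambda>j. if j = i then fls_X else 1 :: 'a fls"
      have "diag ?d \<in> torus" unfolding torus_iff_diag by (rule exI[of _ ?d]) simp
      hence "diag ?d *v v \<in> W" using st v by blast
      hence "diag ?d *v v - v \<in> W" using v W by (intro vec.subspace_diff)
      moreover have "diag ?d *v v - v = ((fls_X - 1) * v $ i) *s axis i 1"
        by (simp add: vec_eq_iff diag_vmult axis_def algebra_simps)
      ultimately have "inverse ((fls_X - 1) * v $ i) *s (((fls_X - 1) * v $ i) *s axis i 1) \<in> W"
        by (metis vec.subspace_scale W)
      moreover have "(fls_X :: 'a fls) \<noteq> 1" by (metis fls_X_subdegree fls_one_subdegree zero_neq_one)
      hence "(fls_X - 1) * v $ i \<noteq> 0" using that by simp
      ultimately show ?thesis by (metis left_inverse vec.scale_one vec.scale_scale)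
    qed
    thus "v \<in> coord {i. axis i 1 \<in> W}" by (auto simp: coord_def)
  qed
qed

text \<open>The summands are coordinate subspaces. A basis vector lies in one of them, because some
  component of it has a nonzero coordinate there, and in only one, because two would give it two
  decompositions. The function b sends an index to its summand.\<close>

lemma splitting_torus:
  fixes Ws :: "('a::field fls^3) set list"
  assumes sp: "splitting Ws" and st: "\<And>t W. t \<in> torus \<Longrightarrow> W \<in> set Ws \<Longrightarrow> (*v) t ` W = W"
  obtains b where "range b = {..<length Ws}" "Ws = map (\<lambda>k. coord (b -` {k})) [0..<length Ws]"
proof -
  let ?l = "length Ws"
  have W: "vec.subspace (Ws ! k)" "Ws ! k \<noteq> {0}" if "k < ?l" for k
    using sp that by (auto simp: splitting_def)
  have Wk: "Ws ! k = coord {i. axis i 1 \<in> Ws ! k}" if "k < ?l" for k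
    using that st by (intro torus_stable_subspace W) (simp_all add: nth_mem equalityD1)
  have uni: "\<exists>!w. w \<in> (\<Pi>\<^sub>E k\<in>{..<?l}. Ws ! k) \<and> v = (\<Sum>k<?l. w k)" for v
    using sp by (simp add: splitting_def)
  have ex1: "\<exists>!k. k < ?l \<and> axis i 1 \<in> Ws ! k" for i
  proof (rule ex_ex1I)
    obtain w where w: "w \<in> (\<Pi>\<^sub>E k\<in>{..<?l}. Ws ! k)" "axis i 1 = (\<Sum>k<?l. w k)" using uni by blast
    have "(\<Sum>k<?l. w k $ i) \<noteq> 0" using w(2) by (metis axis_nth sum_component zero_neq_one)
    then obtain k where k: "k < ?l" "w k $ i \<noteq> 0" by (metis (no_types, lifting) lessThan_iff sum.neutral)
    have "w k \<in> Ws ! k" using w(1) k(1) by (auto simp: PiE_def Pi_def)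
    hence "axis i 1 \<in> Ws ! k" using k Wk[OF k(1)] by (auto simp: coord_def)
    thus "\<exists>k. k < ?l \<and> axis i 1 \<in> Ws ! k" using k by blast
  next
    fix k k' assume k: "k < ?l \<and> axis i 1 \<in> Ws ! k" "k' < ?l \<and> axis i 1 \<in> Ws ! k'"
    let ?w = "\<lambda>k. \<lambda>m\<in>{..<?l}. if m = k then axis i 1 else 0 :: 'a fls^3"
    have "?w k \<in> (\<Pi>\<^sub>E k\<in>{..<?l}. Ws ! k) \<and> axis i 1 = (\<Sum>m<?l. ?w k m)" if "k < ?l \<and> axis i 1 \<in> Ws ! k" for k
      using that W by (auto simp: PiE_def Pi_def vec.subspace_0)
    note P = this
    obtain u where u: "\<And>w. w \<in> (\<Pi>\<^sub>E k\<in>{..<?l}. Ws ! k) \<and> axis i 1 = (\<Sum>k<?l. w k) \<Longrightarrow> w = u"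
      using uni[of "axis i 1"] by (elim ex1E) blast
    have "?w k = ?w k'" by (rule trans[OF u[OF P[OF k(1)]] sym[OF u[OF P[OF k(2)]]]])
    hence "?w k k = ?w k' k" by simp
    moreover have "axis i (1 :: 'a fls) \<noteq> 0" by (metis axis_nth zero_index zero_neq_one)
    ultimately show "k = k'" using k by (auto split: if_splits)
  qed
  define b where "b i = (THE k. k < ?l \<and> axis i 1 \<in> Ws ! k)" for i
  have b: "b i < ?l \<and> axis i 1 \<in> Ws ! b i" for i
    unfolding b_def by (rule theI'[OF ex1])
  have b_iff: "axis i 1 \<in> Ws ! k \<longleftrightarrow> b i = k" if "k < ?l" for i k
    using b[of i] ex1[of i] that by blast
  have Wb: "Ws ! k = coord (b -` {k})" if "k < ?l" for k
    using Wk[OF that] b_iff[OF that] by (simp add: vimage_def)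
  have "range b = {..<?l}"
  proof
    show "range b \<subseteq> {..<?l}" using b by auto
    show "{..<?l} \<subseteq> range b"
    proof
      fix k assume "k \<in> {..<?l}"
      hence k: "k < ?l" by simp
      have "b -` {k} \<noteq> {}"
      proof
        assume e: "b -` {k} = {}"
        have "coord {} = ({0} :: ('a fls^3) set)" by (auto simp: coord_def vec_eq_iff)
        thus False using Wb[OF k] W(2)[OF k] e by simp
      qed
      thus "k \<in> range b" by auto
    qed
  qed
  moreover have "map ((!) Ws) [0..<?l] = map (\<lambda>k. coord (b -` {k})) [0..<?l]"
    by (intro map_cong refl Wb) simp
  hence "Ws = map (\<lambda>k. coord (b -` {k})) [0..<?l]" unfolding map_nth .
  ultimately show ?thesis by (rule that[of b])
qed

text \<open>That b is onto an initial segment ensures that no summand is 0.\<close>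

lemma splitting_coord:
  fixes b :: "3 \<Rightarrow> nat"
  assumes b: "range b = {..<l}"
  shows "splitting (map (\<lambda>k. coord (b -` {k}) :: ('a::field fls^3) set) [0..<l])"
proof -
  let ?Ws = "map (\<lambda>k. coord (b -` {k}) :: ('a fls^3) set) [0..<l]"
  have "\<exists>!w. w \<in> (\<Pi>\<^sub>E k\<in>{..<l}. coord (b -` {k})) \<and> v = (\<Sum>k<l. w k)" for v :: "'a fls^3"
  proof -
    have iff: "v = (\<Sum>k<l. w k) \<longleftrightarrow> (\<forall>i. v $ i = w (b i) $ i)" if w: "w \<in> (\<Pi>\<^sub>E k\<in>{..<l}. coord (b -` {k}))" for w
    proof -
      have "(\<Sum>k<l. w k) $ i = w (b i) $ i" for i
      proof -
        have "b i < l" using b by blast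
        moreover have "w k $ i = 0" if "k < l" "k \<noteq> b i" for k
          using w that by (auto simp: PiE_def Pi_def coord_def)
        ultimately have "(\<Sum>k<l. w k $ i) = (\<Sum>k<l. if k = b i then w (b i) $ i else 0)"
          by (intro sum.cong) auto
        also have "\<dots> = w (b i) $ i" using \<open>b i < l\<close> by simp
        finally show ?thesis by simp
      qed
      thus ?thesis by (simp add: vec_eq_iff)
    qed
    let ?w = "\<lambda>k\<in>{..<l}. (\<chi> i. if b i = k then v $ i else 0)"
    have w: "?w \<in> (\<Pi>\<^sub>E k\<in>{..<l}. coord (b -` {k}))" by (auto simp: coord_def)
    have bl: "b i < l" for i using b by blast
    show ?thesis
    proof (rule ex1I[of _ ?w])
      show "?w \<in> (\<Pi>\<^sub>E k\<in>{..<l}. coord (b -` {k})) \<and> v = (\<Sum>k<l. ?w k)"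
        using w iff[OF w] bl by simp
    next
      fix u assume u: "u \<in> (\<Pi>\<^sub>E k\<in>{..<l}. coord (b -` {k})) \<and> v = (\<Sum>k<l. u k)"
      show "u = ?w"
      proof (rule PiE_ext[OF conjunct1[OF u] w])
        fix k assume k: "k \<in> {..<l}"
        have "u k $ i = (if b i = k then v $ i else 0)" for i
          using u iff[OF conjunct1[OF u]] k by (auto simp: PiE_def Pi_def coord_def)
        thus "u k = ?w k" using k by (simp add: vec_eq_iff)
      qed
    qed
  qed
  moreover have "vec.subspace W \<and> W \<noteq> {0}" if "W \<in> set ?Ws" for W
  proof -
    from that obtain k where k: "k < l" "W = coord (b -` {k})" by auto
    then obtain i where "b i = k" using b by (metis imageE lessThan_iff)
    hence "axis i 1 \<in> W" using k by simp
    hence "W \<noteq> {0}" by (metis axis_eq_0_iff singletonD zero_neq_one)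
    thus ?thesis using subspace_coord k(2) by blast
  qed
  moreover have "(\<Pi>\<^sub>E k\<in>{..<length ?Ws}. ?Ws ! k) = (\<Pi>\<^sub>E k\<in>{..<l}. coord (b -` {k}))"
    by (simp only: length_map length_upt diff_zero, rule PiE_cong) simp
  ultimately show ?thesis
    unfolding splitting_def by simp
qed

lemma flag_part_coord:
  fixes b :: "3 \<Rightarrow> nat"
  assumes k: "k \<le> l"
  shows "flag_part (map (\<lambda>k. coord (b -` {k}) :: ('a::field fls^3) set) [0..<l]) k = coord {i. b i < k}"
proof -
  have t: "set (take k (map (\<lambda>k. coord (b -` {k}) :: ('a fls^3) set) [0..<l])) = (\<lambda>k. coord (b -` {k})) ` {..<k}"
    using k by (auto simp: take_map take_upt)
  show ?thesis unfolding flag_part_def t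
  proof
    show "vec.span (\<Union> ((\<lambda>k. coord (b -` {k})) ` {..<k})) \<subseteq> coord {i. b i < k}"
      by (rule vec.span_minimal) (auto simp: subspace_coord, auto simp: coord_def)
    show "coord {i. b i < k} \<subseteq> vec.span (\<Union> ((\<lambda>k. coord (b -` {k}) :: ('a fls^3) set) ` {..<k}))"
      by (rule coord_subset) (auto intro!: vec.span_base)
  qed
qed

text \<open>The vanishing of entries gives only an inclusion; equality follows because an injective
  linear map preserves the dimension.\<close>

lemma image_coord_iff:
  fixes g :: "('a::field) mat3"
  assumes g: "invertible g"
  shows "(*v) g ` coord S = coord S \<longleftrightarrow> (\<forall>i j. i \<notin> S \<longrightarrow> j \<in> S \<longrightarrow> g $ i $ j = 0)"
proof
  assume eq: "(*v) g ` coord S = coord S"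
  show "\<forall>i j. i \<notin> S \<longrightarrow> j \<in> S \<longrightarrow> g $ i $ j = 0"
  proof (intro allI impI)
    fix i j assume "i \<notin> S" "j \<in> S"
    hence "g *v axis j 1 \<in> coord S" using eq by (metis axis_in_coord imageI)
    thus "g $ i $ j = 0" using \<open>i \<notin> S\<close> vmult_axis[of g j i] by (simp add: coord_def)
  qed
next
  assume z: "\<forall>i j. i \<notin> S \<longrightarrow> j \<in> S \<longrightarrow> g $ i $ j = 0"
  have sub: "(*v) g ` coord S \<subseteq> coord S"
  proof
    fix w assume "w \<in> (*v) g ` coord S"
    then obtain v where v: "v \<in> coord S" "w = g *v v" by auto
    have "w $ i = 0" if "i \<notin> S" for i
      unfolding v(2) matrix_vector_mult_def vec_lambda_beta
      using z that v(1) by (intro sum.neutral) (auto simp: coord_def)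
    thus "w \<in> coord S" by (auto simp: coord_def)
  qed
  have lin: "Vector_Spaces.linear (*s) (*s) ((*v) g)" by (rule matrix_vector_mul_linear_gen)
  have inj: "inj ((*v) g)"
    by (rule inj_on_inverseI[where g = "(*v) (matrix_inv g)"])
       (simp add: matrix_vector_mul_assoc mat3_inv_left[OF g])
  have "vec.dim ((*v) g ` coord S) = vec.dim (coord S :: ('a fls^3) set)"
    using inj by (intro vec.dim_image_eq[OF lin] inj_on_subset[OF inj]) auto
  thus "(*v) g ` coord S = coord S"
    by (intro vec.subspace_dim_equal sub subspace_coord vec.linear_subspace_image[OF lin]) auto
qed

lemma levi_decomposition_coord:
  fixes b :: "3 \<Rightarrow> nat"
  assumes b: "range b = {..<l}"
  defines "Ws \<equiv> map (\<lambda>k. coord (b -` {k}) :: ('a::field fls^3) set) [0..<l]"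
  shows "{g \<in> carrier GL3. \<forall>k\<le>length Ws. (*v) g ` flag_part Ws k = flag_part Ws k} = parab b" (is "?P = _")
    and "{g \<in> carrier GL3. \<forall>W\<in>set Ws. (*v) g ` W = W} = levi b" (is "?M = _")
    and "{g \<in> parab b. \<forall>k<length Ws. \<forall>v\<in>flag_part Ws (Suc k). g *v v - v \<in> flag_part Ws k} = unirad b" (is "?N = _")
proof -
  have bl: "b i < l" for i using b by blast
  have len: "length Ws = l" by (simp add: Ws_def)
  have fl: "flag_part Ws k = coord {i. b i < k}" if "k \<le> l" for k
    unfolding Ws_def by (rule flag_part_coord[OF that])
  have "g \<in> ?P \<longleftrightarrow> invertible g \<and> (\<forall>k\<le>l. \<forall>i j. \<not> b i < k \<longrightarrow> b j < k \<longrightarrow> g $ i $ j = 0)" for g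
  proof (cases "invertible g")
    case True
    have "(\<forall>k\<le>l. (*v) g ` flag_part Ws k = flag_part Ws k) \<longleftrightarrow> (\<forall>k\<le>l. \<forall>i j. \<not> b i < k \<longrightarrow> b j < k \<longrightarrow> g $ i $ j = 0)"
      by (simp add: fl image_coord_iff[OF True])
    thus ?thesis using True by (simp add: len)
  qed simp
  \<comment> \<open>For b j < b i the flag step k = b i separates the two indices.\<close>
  moreover have "(\<forall>k\<le>l. \<forall>i j. \<not> b i < k \<longrightarrow> b j < k \<longrightarrow> g $ i $ j = 0) \<longleftrightarrow> (\<forall>i j. b j < b i \<longrightarrow> g $ i $ j = 0)"
    for g :: "'a mat3" using bl by (meson less_imp_le linorder_not_less order_less_le_trans order_refl)
  ultimately show P: "?P = parab b" by (auto simp: parab_def)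
  have M1: "g \<in> ?M \<longleftrightarrow> invertible g \<and> (\<forall>k<l. \<forall>i j. b i \<noteq> k \<longrightarrow> b j = k \<longrightarrow> g $ i $ j = 0)" for g
  proof (cases "invertible g")
    case True
    have "(\<forall>W\<in>set Ws. (*v) g ` W = W) \<longleftrightarrow> (\<forall>k<l. (*v) g ` coord (b -` {k}) = coord (b -` {k}))"
    proof -
      have "set Ws = (\<lambda>k. coord (b -` {k})) ` {..<l}" by (simp add: Ws_def atLeast0LessThan)
      thus ?thesis by (simp only: ball_simps) (simp only: Ball_def lessThan_iff)
    qed
    also have "\<dots> \<longleftrightarrow> (\<forall>k<l. \<forall>i j. b i \<noteq> k \<longrightarrow> b j = k \<longrightarrow> g $ i $ j = 0)"
      by (simp add: image_coord_iff[OF True])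
    finally show ?thesis using True by simp
  qed simp
  have M2: "(\<forall>k<l. \<forall>i j. b i \<noteq> k \<longrightarrow> b j = k \<longrightarrow> g $ i $ j = 0) \<longleftrightarrow> (\<forall>i j. b i \<noteq> b j \<longrightarrow> g $ i $ j = 0)"
    for g :: "'a mat3" using bl by blast
  show "?M = levi b"
  proof (rule Set.set_eqI)
    show "g \<in> ?M \<longleftrightarrow> g \<in> levi b" for g
      unfolding M1 unfolding M2 levi_def mem_Collect_eq by (rule refl)
  qed
  have N: "(\<forall>v\<in>coord {i. b i < Suc k}. g *v v - v \<in> coord {i. b i < k}) \<longleftrightarrow>
     (\<forall>i j. k \<le> b i \<longrightarrow> b j \<le> k \<longrightarrow> g $ i $ j = (if i = j then 1 else 0))" for k and g :: "'a mat3"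
  proof
    assume a: "\<forall>v\<in>coord {i. b i < Suc k}. g *v v - v \<in> coord {i. b i < k}"
    show "\<forall>i j. k \<le> b i \<longrightarrow> b j \<le> k \<longrightarrow> g $ i $ j = (if i = j then 1 else 0)"
    proof (intro allI impI)
      fix i j assume ij: "k \<le> b i" "b j \<le> k"
      have "g *v axis j 1 - axis j 1 \<in> coord {i. b i < k}" using a ij by simp
      hence "(g *v axis j 1 - axis j 1) $ i = 0" using ij by (simp add: coord_def)
      thus "g $ i $ j = (if i = j then 1 else 0)" by (simp add: vmult_axis) (simp add: axis_def)
    qed
  next
    assume a: "\<forall>i j. k \<le> b i \<longrightarrow> b j \<le> k \<longrightarrow> g $ i $ j = (if i = j then 1 else 0)"
    show "\<forall>v\<in>coord {i. b i < Suc k}. g *v v - v \<in> coord {i. b i < k}"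
    proof
      fix v :: "'a fls^3" assume v: "v \<in> coord {i. b i < Suc k}"
      have "(g *v v) $ i = v $ i" if "k \<le> b i" for i
      proof -
        have "g $ i $ j * v $ j = (if i = j then v $ j else 0)" for j
          using a[rule_format, of i j] that v by (cases "b j \<le> k") (auto simp: coord_def less_Suc_eq_le)
        hence "(g *v v) $ i = (\<Sum>j\<in>UNIV. (if i = j then v $ j else 0))"
          unfolding matrix_vector_mult_def vec_lambda_beta by simp
        thus ?thesis by simp
      qed
      thus "g *v v - v \<in> coord {i. b i < k}" by (auto simp: coord_def)
    qed
  qed
  have "g \<in> ?N \<longleftrightarrow> g \<in> parab b \<and> (\<forall>k<l. \<forall>i j. k \<le> b i \<longrightarrow> b j \<le> k \<longrightarrow> g $ i $ j = (if i = j then 1 else 0))" for g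
    by (simp add: len fl N)
  moreover have "(\<forall>k<l. \<forall>i j. k \<le> b i \<longrightarrow> b j \<le> k \<longrightarrow> g $ i $ j = (if i = j then 1 else 0)) \<longleftrightarrow>
      (\<forall>i j. b j \<le> b i \<longrightarrow> g $ i $ j = (if i = j then 1 else 0))" for g :: "'a mat3"
    using bl by (meson order_refl order_trans)
  ultimately have "g \<in> ?N \<longleftrightarrow> g \<in> parab b \<and> (\<forall>i j. b j \<le> b i \<longrightarrow> g $ i $ j = (if i = j then 1 else 0))" for g
    by simp
  thus "?N = unirad b" unfolding parab_def unirad_def
    by (auto dest: less_imp_le)
qed

lemma torus_subset_levi: "torus \<subseteq> levi b"
proof
  fix t :: "'a mat3" assume "t \<in> torus"
  hence t: "invertible t" "\<And>i j. i \<noteq> j \<Longrightarrow> t $ i $ j = 0" by (simp_all add: torus_def)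
  have "t $ i $ j = 0" if "b i \<noteq> b j" for i j using that by (intro t(2)) auto
  thus "t \<in> levi b" using t(1) by (simp add: levi_def)
qed

text \<open>A Levi factor that contains the torus stabilizes a splitting into torus-stable
  subspaces, hence into coordinate subspaces, so the triples with such a Levi factor are exactly the
  standard ones. The values of b fill an initial segment because they are the positions in the list
  of summands.\<close>

lemma levi_decomposition_iff:
  fixes M :: "('a::field) mat3 set"
  shows "levi_decomposition P M N \<and> torus \<subseteq> M \<longleftrightarrow>
    (\<exists>b l. range b = {..<l} \<and> P = parab b \<and> M = levi b \<and> N = unirad b)"
proof
  assume a: "levi_decomposition P M N \<and> torus \<subseteq> M"
  then obtain Ws where Ws: "splitting Ws"
    "P = {g \<in> carrier GL3. \<forall>k\<le>length Ws. (*v) g ` flag_part Ws k = flag_part Ws k}"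
    "M = {g \<in> carrier GL3. \<forall>W\<in>set Ws. (*v) g ` W = W}"
    "N = {g \<in> P. \<forall>k<length Ws. \<forall>v\<in>flag_part Ws (Suc k). g *v v - v \<in> flag_part Ws k}"
    by (auto simp: levi_decomposition_def)
  have st: "(*v) t ` W = W" if "t \<in> torus" "W \<in> set Ws" for t W
    using a Ws(3) that by blast
  obtain b where b: "range b = {..<length Ws}" "Ws = map (\<lambda>k. coord (b -` {k})) [0..<length Ws]"
    by (rule splitting_torus[OF Ws(1) st])
  note L = levi_decomposition_coord[OF b(1), where 'a = 'a, folded b(2)]
  have P: "P = parab b" by (rule trans[OF Ws(2) L(1)])
  have N: "N = unirad b" by (rule trans[OF Ws(4)[unfolded P] L(3)])
  show "\<exists>b l. range b = {..<l} \<and> P = parab b \<and> M = levi b \<and> N = unirad b"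
    by (intro exI[of _ b] exI[of _ "length Ws"] conjI b(1) P N trans[OF Ws(3) L(2)])
next
  assume "\<exists>b l. range b = {..<l} \<and> P = parab b \<and> M = levi b \<and> N = unirad b"
  then obtain b l where b: "range b = {..<l}" "P = parab b" "M = levi b" "N = unirad b" by blast
  have "levi_decomposition P M N"
    unfolding levi_decomposition_def b(2-4)
    by (intro exI[of _ "map (\<lambda>k. coord (b -` {k})) [0..<l]"] conjI splitting_coord[OF b(1)]
        levi_decomposition_coord[OF b(1), symmetric])
  moreover have "torus \<subseteq> M" unfolding b by (rule torus_subset_levi)
  ultimately show "levi_decomposition P M N \<and> torus \<subseteq> M" by blast
qed

lemma levi_inj: "inj b \<Longrightarrow> levi b = torus"
  by (auto simp: torus_def levi_def inj_eq)

lemma levi_const: "levi (\<lambda>_. n) = carrier GL3"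
  by (simp add: levi_def)

section \<open>Root subgroups and the Levi subgroup of a root\<close>

lemma root_inject:
  assumes "i \<noteq> j" "axis i 1 - axis j 1 = (axis i' 1 - axis j' 1 :: int^3)" "i' \<noteq> j'"
  shows "i' = i \<and> j' = j"
proof -
  have e: "(axis i 1 - axis j 1 :: int^3) $ k = (axis i' 1 - axis j' 1 :: int^3) $ k" for k using assms by simp
  show ?thesis using e[of i] e[of j] assms(1,3) by (auto simp: axis_def split: if_splits)
qed

definition elementary :: "3 \<Rightarrow> 3 \<Rightarrow> ('a::field) fls \<Rightarrow> 'a mat3" where
  "elementary i j x = mat 1 + (\<chi> k l. if k = i \<and> l = j then x else 0)"

lemma elem_nth: "elementary i j x $ k $ l = (if k = l then 1 else 0) + (if k = i \<and> l = j then x else 0)"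
  by (simp add: elementary_def mat_def)

lemma det_elem: "i \<noteq> j \<Longrightarrow> det (elementary i j x) = 1"
  using exhaust_3[of i] exhaust_3[of j] by (auto simp: det_3 elem_nth)

lemma invertible_elem: "i \<noteq> j \<Longrightarrow> invertible (elementary i j x)"
  by (simp add: invertible_det det_elem)

lemma elem_in_levi: "i \<noteq> j \<Longrightarrow> (\<forall>x. elementary i j x \<in> levi b) \<longleftrightarrow> b i = b j"
proof
  assume ij: "i \<noteq> j" and "\<forall>x. elementary i j (x :: 'a fls) \<in> levi b"
  hence "elementary i j (1 :: 'a fls) \<in> levi b" by blast
  thus "b i = b j" using ij by (auto simp: levi_def elem_nth split: if_splits)
next
  assume "i \<noteq> j" "b i = b j"
  thus "\<forall>x. elementary i j x \<in> levi b" by (auto simp: levi_def elem_nth invertible_elem)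
qed

lemma roots_of_levi: "roots_of (levi b :: ('a::field) mat3 set) = {axis i 1 - axis j 1 | i j. i \<noteq> j \<and> b i = b j}"
proof -
  have "i \<noteq> j \<and> (\<forall>x. mat 1 + (\<chi> k l. if k = i \<and> l = j then x else 0) \<in> (levi b :: 'a mat3 set)) \<longleftrightarrow> i \<noteq> j \<and> b i = b j" for i j
    using elem_in_levi[of i j b, where 'a = 'a, unfolded elementary_def] by blast
  thus ?thesis unfolding roots_of_def by simp
qed

lemma levi_cong: "(\<And>i j. b i = b j \<longleftrightarrow> b' i = b' j) \<Longrightarrow> levi b = levi b'"
  by (simp add: levi_def)

text \<open>\<open>levi_of_root\<close> is a definite description, so existence and uniqueness are
  both due. The roots tell which indices share a block, and \<open>levi\<close> depends on nothing
  else.\<close>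

lemma levi_of_root_eq:
  fixes i j k :: 3
  assumes d: "distinct [i,j,k]" and b: "b i = b j" "b k \<noteq> b i"
  shows "levi_of_root (axis i 1 - axis j 1) = (levi b :: ('a::field) mat3 set)"
  unfolding levi_of_root_def
proof (rule the_equality)
  have all: "P" if "a = i \<or> a = j \<or> a = k \<Longrightarrow> P" for a P
    using UNIV_perm3[OF d] that by blast
  have iff: "roots_of (levi b' :: 'a mat3 set) = {axis i 1 - axis j 1, - (axis i 1 - axis j 1)} \<longleftrightarrow> b' i = b' j \<and> b' k \<noteq> b' i" for b'
  proof
    assume r: "roots_of (levi b' :: 'a mat3 set) = {axis i 1 - axis j 1, - (axis i 1 - axis j 1)}"
    have "axis i 1 - axis j 1 \<in> roots_of (levi b' :: 'a mat3 set)" using r by blast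
    hence "b' i = b' j" using d root_inject[of i j] unfolding roots_of_levi by fastforce
    moreover have "b' k \<noteq> b' i"
    proof
      assume "b' k = b' i"
      hence "axis k 1 - axis i 1 \<in> roots_of (levi b' :: 'a mat3 set)" using d unfolding roots_of_levi by fastforce
      hence "axis k 1 - axis i 1 = (axis i 1 - axis j 1 :: int^3) \<or> axis k 1 - axis i 1 = (axis j 1 - axis i 1 :: int^3)"
        unfolding r by auto
      thus False using d root_inject[of k i i j] root_inject[of k i j i] by auto
    qed
    ultimately show "b' i = b' j \<and> b' k \<noteq> b' i" by simp
  next
    assume b': "b' i = b' j \<and> b' k \<noteq> b' i"
    have "a \<noteq> c \<and> b' a = b' c \<longleftrightarrow> a = i \<and> c = j \<or> a = j \<and> c = i" for a c
      using b' d all[of a] all[of c] by (metis distinct_length_2_or_more)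
    thus "roots_of (levi b' :: 'a mat3 set) = {axis i 1 - axis j 1, - (axis i 1 - axis j 1)}"
      unfolding roots_of_levi by auto
  qed
  \<comment> \<open>The range of b need not be an initial segment; b0 has the same blocks and the
    range required of a flag.\<close>
  define b0 where "b0 a = (if a = k then 1 else 0 :: nat)" for a
  have "range b0 = {..<2}"
  proof -
    have v: "b0 k = 1" "b0 i = 0" using d by (auto simp: b0_def)
    have sub: "range b0 \<subseteq> {0,1}" by (auto simp: b0_def)
    have "1 \<in> range b0" "0 \<in> range b0" using v rangeI[of b0 k] rangeI[of b0 i] by simp_all
    hence "{0,1} \<subseteq> range b0" by simp
    with sub have "range b0 = {0,1}" by (rule equalityI)
    also have "{0,1} = {..<2::nat}" by auto
    finally show ?thesis .
  qed
  moreover have l: "levi b = levi b0"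
  proof (rule levi_cong)
    fix a c :: 3
    have "a \<in> {i,j,k}" "c \<in> {i,j,k}" using UNIV_perm3[OF d] by auto
    thus "(b a = b c) = (b0 a = b0 c)" using b d by (auto simp: b0_def)
  qed
  ultimately have "levi_decomposition (parab b0) (levi b0) (unirad b0 :: 'a mat3 set)"
    using levi_decomposition_iff by blast
  thus "levi_subgroup (levi b :: 'a mat3 set) \<and> torus \<subseteq> (levi b :: 'a mat3 set) \<and> roots_of (levi b :: 'a mat3 set) = {axis i 1 - axis j 1, - (axis i 1 - axis j 1)}"
    using iff[of b] b l torus_subset_levi unfolding levi_subgroup_def by metis
  fix M :: "'a mat3 set"
  assume M: "levi_subgroup M \<and> torus \<subseteq> M \<and> roots_of M = {axis i 1 - axis j 1, - (axis i 1 - axis j 1)}"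
  then obtain b' where b': "M = levi b'" using levi_decomposition_iff unfolding levi_subgroup_def by metis
  show "M = levi b" unfolding b'
  proof (rule levi_cong)
    fix a c show "(b' a = b' c) = (b a = b c)" using all[of a] all[of c] b d iff[of b'] M b' by metis
  qed
qed

section \<open>Lebesgue measure on subspaces\<close>

lemma inner_product_sum:
  assumes B: "inner_product_on V B" and V: "subspace V" and E: "finite E" "E \<subseteq> V" and f: "f \<in> V"
  shows "B (\<Sum>e\<in>E. c e *\<^sub>R e) f = (\<Sum>e\<in>E. c e * B e f)"
  using E
proof (induction E rule: finite_induct)
  case empty
  have "B (0 *\<^sub>R f) f = 0 * B f f" using B f unfolding inner_product_on_def by blast
  thus ?case by simp
next
  case (insert e E)
  have "(\<Sum>e\<in>E. c e *\<^sub>R e) \<in> V" using insert.prems V by (intro subspace_sum subspace_scale) auto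
  moreover have "c e *\<^sub>R e \<in> V" using insert.prems V by (intro subspace_scale) auto
  ultimately have "B (c e *\<^sub>R e + (\<Sum>e\<in>E. c e *\<^sub>R e)) f = B (c e *\<^sub>R e) f + B (\<Sum>e\<in>E. c e *\<^sub>R e) f"
    using B f unfolding inner_product_on_def by blast
  moreover have "B (c e *\<^sub>R e) f = c e * B e f"
    using B f insert.prems unfolding inner_product_on_def by blast
  ultimately show ?case using insert by simp
qed

lemma orthonormal_independent:
  assumes B: "inner_product_on V B" and V: "subspace V" and E: "finite E" "E \<subseteq> V"
    and on: "\<And>e f. e \<in> E \<Longrightarrow> f \<in> E \<Longrightarrow> B e f = (if e = f then 1 else 0)"
  shows "independent E"
  unfolding independent_explicit
proof (intro conjI E allI impI ballI)
  fix c f assume z: "(\<Sum>e\<in>E. c e *\<^sub>R e) = 0" and f: "f \<in> E"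
  have fV: "f \<in> V" using E f by auto
  have "B (\<Sum>e\<in>E. c e *\<^sub>R e) f = (\<Sum>e\<in>E. c e * B e f)"
    by (rule inner_product_sum[OF B V E fV])
  also have "\<dots> = (\<Sum>e\<in>E. if e = f then c f else 0)"
    by (intro sum.cong refl) (simp add: on f)
  also have "\<dots> = c f" using E f by simp
  finally have "B 0 f = c f" unfolding z .
  moreover have "B (\<Sum>e\<in>{}. c e *\<^sub>R e) f = (\<Sum>e\<in>{}. c e * B e f)"
    by (rule inner_product_sum[OF B V _ _ fV]) auto
  ultimately show "c f = 0" by simp
qed

text \<open>An orthonormal subset of U of greatest cardinality, which exists because the dimension
  bounds the cardinality, must span: otherwise one Gram-Schmidt step enlarges it.\<close>

lemma orthonormal_basis_exists:
  assumes B: "inner_product_on V B" and V: "subspace V" and U: "subspace U" "U \<subseteq> V"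
  shows "\<exists>E. orthonormal_basis B U E"
proof -
  define P where "P E \<longleftrightarrow> E \<subseteq> U \<and> finite E \<and> (\<forall>e\<in>E. \<forall>f\<in>E. B e f = (if e = f then 1 else 0))" for E
  have card: "card E \<le> DIM(real^3)" if "P E" for E
    using that U(2) orthonormal_independent[OF B V, of E] independent_bound[of E] by (auto simp: P_def)
  have "P {}" by (simp add: P_def)
  have "\<exists>E. P E \<and> (\<forall>E'. P E' \<longrightarrow> card E' \<le> card E)"
    by (rule ex_has_greatest_nat[of P "{}" card "Suc (DIM(real^3))"], rule \<open>P {}\<close>) (intro allI impI le_imp_less_Suc card)
  then obtain E where E: "P E" "\<And>E'. P E' \<Longrightarrow> card E' \<le> card E" by blast
  have EU: "E \<subseteq> U" "finite E" "\<And>e f. e \<in> E \<Longrightarrow> f \<in> E \<Longrightarrow> B e f = (if e = f then 1 else 0)"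
    using E(1) by (auto simp: P_def)
  have sub: "span E \<subseteq> U" using EU(1) U(1) by (rule span_minimal)
  have "U \<subseteq> span E"
  proof
    fix u assume u: "u \<in> U"
    show "u \<in> span E"
    proof (rule ccontr)
      assume nu: "u \<notin> span E"
      define s where "s = (\<Sum>e\<in>E. B u e *\<^sub>R e)"
      have s: "s \<in> span E" unfolding s_def by (intro span_sum span_scale span_base)
      have sU: "s \<in> U" using s sub by auto
      \<comment> \<open>The component of u orthogonal to E, written as a sum because additivity and
        homogeneity are the properties postulated for B.\<close>
      define w where "w = u + (-1) *\<^sub>R s"
      have wU: "w \<in> U" unfolding w_def using u sU U(1) by (intro subspace_add subspace_scale)
      have "w \<noteq> 0" using nu s by (auto simp: w_def)
      hence pos: "0 < B w w" using B wU U(2) unfolding inner_product_on_def by blast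
      have add: "B (x + y) z = B x z + B y z" if "x \<in> V" "y \<in> V" "z \<in> V" for x y z
        using B that unfolding inner_product_on_def by blast
      have scale: "B (a *\<^sub>R x) y = a * B x y" if "x \<in> V" "y \<in> V" for a x y
        using B that unfolding inner_product_on_def by blast
      have sym: "B x y = B y x" if "x \<in> V" "y \<in> V" for x y
        using B that unfolding inner_product_on_def by blast
      have VV: "u \<in> V" "s \<in> V" "w \<in> V" using u sU wU U(2) by auto
      have orth: "B w f = 0" if f: "f \<in> E" for f
      proof -
        have fV: "f \<in> V" using f EU U(2) by auto
        have "B s f = (\<Sum>e\<in>E. B u e * B e f)"
          unfolding s_def using EU U(2) fV by (intro inner_product_sum[OF B V]) auto
        also have "\<dots> = (\<Sum>e\<in>E. if e = f then B u f else 0)"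
          by (intro sum.cong refl) (simp add: EU(3) f)
        also have "\<dots> = B u f" using EU f by simp
        finally have sf: "B s f = B u f" .
        have "(-1) *\<^sub>R s \<in> V" using VV V by (intro subspace_scale)
        hence "B w f = B u f + B ((-1) *\<^sub>R s) f" unfolding w_def using VV fV by (intro add)
        also have "B ((-1) *\<^sub>R s) f = (-1) * B s f" using VV fV by (intro scale)
        finally show ?thesis by (simp add: sf)
      qed
      define v where "v = (1 / sqrt (B w w)) *\<^sub>R w"
      have vU: "v \<in> U" unfolding v_def using wU U(1) by (intro subspace_scale)
      hence vV: "v \<in> V" using U(2) by auto
      have vf: "B v f = (1 / sqrt (B w w)) * B w f" if "f \<in> V" for f
        unfolding v_def using VV that by (intro scale)
      have "B v v = (1 / sqrt (B w w)) * ((1 / sqrt (B w w)) * B w w)"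
        using vf[OF vV] sym[OF VV(3) vV] vf[OF VV(3)] by simp
      hence vv: "B v v = 1" using pos by (simp add: field_simps)
      have vE: "B v f = 0" "B f v = 0" if "f \<in> E" for f
        using vf[of f] orth[OF that] that EU U(2) sym[OF vV, of f] by auto
      have "v \<notin> E" using vE(1)[of v] vv by auto
      moreover have "P (insert v E)"
        unfolding P_def using vU EU vv vE \<open>v \<notin> E\<close> by auto
      ultimately show False using E(2)[of "insert v E"] EU by simp
    qed
  qed
  thus ?thesis using sub EU unfolding orthonormal_basis_def by (intro exI[of _ E]) auto
qed

section \<open>Lebesgue measure on a subspace in linear coordinates\<close>

lemma measurable_vec_PiM:
  fixes ee :: "'d::finite \<Rightarrow> 'b"
  assumes ee: "bij_betw ee UNIV E"
  shows "(\<lambda>c. \<chi> i. c (ee i)) \<in> (\<Pi>\<^sub>M e\<in>E. lborel) \<rightarrow>\<^sub>M (borel :: (real^'d) measure)"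
proof -
  have inE: "ee i \<in> E" for i using ee by (auto simp: bij_betw_def)
  have comp: "(\<lambda>c. c (ee i)) \<in> (\<Pi>\<^sub>M e\<in>E. lborel) \<rightarrow>\<^sub>M (borel :: real measure)" for i
    using measurable_component_singleton[OF inE[of i], of "\<lambda>_. lborel :: real measure"] by simp
  have "(\<lambda>c. (\<chi> i. c (ee i)) :: real^'d) = (\<lambda>c. \<Sum>i\<in>UNIV. c (ee i) *\<^sub>R axis i 1)"
    by (simp add: fun_eq_iff vec_eq_iff axis_def if_distrib[where f = "\<lambda>x. _ * x"] cong: if_cong)
  also have "\<dots> \<in> (\<Pi>\<^sub>M e\<in>E. lborel) \<rightarrow>\<^sub>M borel"
    using comp by (intro borel_measurable_sum borel_measurable_scaleR) auto
  finally show ?thesis .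
qed

text \<open>\<open>subspace_lborel\<close> starts from functions on an orthonormal basis. An
  enumeration of the basis turns their product measure into Lebesgue measure on vectors, for which
  the determinant formula for linear images is available.\<close>

lemma distr_PiM_lborel_cart:
  fixes ee :: "'d::finite \<Rightarrow> 'b"
  assumes ee: "bij_betw ee UNIV E"
  shows "distr (\<Pi>\<^sub>M e\<in>E. lborel) borel (\<lambda>c. \<chi> i. c (ee i)) = (lborel :: (real^'d) measure)"
proof (rule lborel_eqI[symmetric])
  have fin: "finite E" using bij_betw_finite[OF ee] by simp
  have inE: "ee i \<in> E" for i using ee by (auto simp: bij_betw_def)
  have meas: "(\<lambda>c. \<chi> i. c (ee i)) \<in> (\<Pi>\<^sub>M e\<in>E. lborel) \<rightarrow>\<^sub>M (borel :: (real^'d) measure)"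
    by (rule measurable_vec_PiM[OF ee])
  fix l u :: "real^'d" assume le: "\<And>b. b \<in> Basis \<Longrightarrow> l \<bullet> b \<le> u \<bullet> b"
  have le': "l $ i \<le> u $ i" for i using le[of "axis i 1"] by (simp add: inner_axis)
  interpret product_sigma_finite "\<lambda>_. lborel :: real measure" ..
  let ?i = "inv_into UNIV ee"
  have inv: "?i (ee j) = j" for j using ee by (simp add: bij_betw_def)
  have "(\<lambda>c. \<chi> i. c (ee i)) -` box l u \<inter> space (\<Pi>\<^sub>M e\<in>E. lborel) = (\<Pi>\<^sub>E e\<in>E. {l $ ?i e <..< u $ ?i e})"
  proof -
    have "c \<in> (\<Pi>\<^sub>E e\<in>E. {l $ ?i e <..< u $ ?i e}) \<longleftrightarrow> c \<in> extensional E \<and> (\<forall>j. l $ j < c (ee j) \<and> c (ee j) < u $ j)" for c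
    proof -
      have "E = range ee" using ee by (simp add: bij_betw_def)
      hence "(\<forall>e\<in>E. c e \<in> {l $ ?i e <..< u $ ?i e}) \<longleftrightarrow> (\<forall>j. c (ee j) \<in> {l $ ?i (ee j) <..< u $ ?i (ee j)})" by blast
      thus ?thesis by (simp add: PiE_iff inv conj_commute)
    qed
    thus ?thesis by (intro Set.set_eqI) (simp add: space_PiM mem_box_cart PiE_iff[of _ _ "\<lambda>_. UNIV"] conj_commute)
  qed
  hence "emeasure (distr (\<Pi>\<^sub>M e\<in>E. lborel) borel (\<lambda>c. \<chi> i. c (ee i))) (box l u)
      = emeasure (\<Pi>\<^sub>M e\<in>E. lborel) (\<Pi>\<^sub>E e\<in>E. {l $ ?i e <..< u $ ?i e})"
    by (subst emeasure_distr[OF meas]) auto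
  also have "\<dots> = (\<Prod>e\<in>E. emeasure lborel {l $ ?i e <..< u $ ?i e})"
    using fin by (intro emeasure_PiM) auto
  also have "\<dots> = (\<Prod>j\<in>UNIV. emeasure lborel {l $ ?i (ee j) <..< u $ ?i (ee j)})"
    by (rule prod.reindex_bij_betw[OF ee, symmetric])
  also have "\<dots> = (\<Prod>j\<in>UNIV. ennreal (u $ j - l $ j))"
    by (simp add: inv le')
  also have "\<dots> = ennreal (\<Prod>j\<in>UNIV. u $ j - l $ j)"
    using le' by (intro prod_ennreal) simp
  also have "(\<Prod>j\<in>UNIV. u $ j - l $ j) = (\<Prod>b\<in>Basis. (u - l) \<bullet> b)"
  proof -
    have "(Basis :: (real^'d) set) = range (\<lambda>i. axis i 1)" by (auto simp: Basis_vec_def)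
    moreover have "inj (\<lambda>i :: 'd. axis i (1::real))" by (auto simp: inj_def axis_eq_axis)
    note prod.reindex[OF this, of "\<lambda>b. (u - l) \<bullet> b"]
    ultimately show ?thesis by (simp add: inner_axis)
  qed
  finally show "emeasure (distr (\<Pi>\<^sub>M e\<in>E. lborel) borel (\<lambda>c. \<chi> i. c (ee i))) (box l u) = (\<Prod>b\<in>Basis. (u - l) \<bullet> b)" .
qed simp

text \<open>If L is the parametrization of U by the chosen orthonormal basis, then b is L composed
  with a linear R, so measuring in the coordinates b costs the factor |det R|. The norm formula says
  that R carries the form pulled back along b to the standard one; in dimension 1 it determines the
  factor.\<close>

lemma subspace_lborel_isometric_coordinates:
  fixes b :: "(real, 'd::{finite,wellorder}) vec \<Rightarrow> real^3"
  assumes B: "inner_product_on V B" and V: "subspace V" and U: "U \<subseteq> V"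
    and b: "linear b" "inj b" "range b = U"
  obtains R :: "(real, 'd) vec \<Rightarrow> (real, 'd) vec" where "linear R" "det (matrix R) \<noteq> 0"
    "\<And>x. B (b x) (b x) = (norm (R x))\<^sup>2"
    "\<And>A. A \<in> sets borel \<Longrightarrow> b -` A \<in> lmeasurable \<Longrightarrow>
      measure (subspace_lborel B U) A = \<bar>det (matrix R)\<bar> * measure lebesgue (b -` A)"
proof -
  have sU: "subspace U" using b by (metis linear_subspace_image subspace_UNIV)
  define E where "E = (SOME E. orthonormal_basis B U E)"
  have "orthonormal_basis B U E" unfolding E_def
    using orthonormal_basis_exists[OF B V sU U] by (rule someI_ex)
  hence E: "E \<subseteq> U" "finite E" "span E = U" "\<And>e f. e \<in> E \<Longrightarrow> f \<in> E \<Longrightarrow> B e f = (if e = f then 1 else 0)"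
    by (auto simp: orthonormal_basis_def)
  have indep: "independent E" using orthonormal_independent[OF B V E(2) _ E(4)] E(1) U by blast
  have "card E = dim U" using indep E(3) by (metis dim_span_eq_card_independent)
  also have "dim U = dim (UNIV :: ((real, 'd) vec) set)"
    using dim_image_eq[OF b(1), of UNIV] b by simp
  also have "\<dots> = CARD('d)" by simp
  finally obtain ee :: "'d \<Rightarrow> real^3" where ee: "bij_betw ee UNIV E"
    using finite_same_card_bij[of "UNIV :: 'd set" E] E(2) by auto
  define L where "L c = (\<Sum>i\<in>UNIV. c $ i *\<^sub>R ee i)" for c :: "(real, 'd) vec"
  have linL: "linear L" unfolding L_def by (intro linearI) (simp_all add: scaleR_add_left sum.distrib scaleR_sum_right)
  have L_sum: "(\<Sum>e\<in>E. c e *\<^sub>R e) = L (\<chi> i. c (ee i))" for c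
    unfolding L_def by (simp add: sum.reindex_bij_betw[OF ee, symmetric])
  have rangeL: "range L = U"
  proof
    show "range L \<subseteq> U" unfolding L_def using ee E(1) sU
      by (auto simp: bij_betw_def intro!: subspace_sum subspace_scale)
    have "U = range (\<lambda>c. \<Sum>e\<in>E. c e *\<^sub>R e)" unfolding E(3)[symmetric] by (rule span_finite[OF E(2)])
    thus "U \<subseteq> range L" using L_sum by auto
  qed
  have injL: "inj L"
    unfolding linear_injective_0[OF linL]
  proof (intro allI impI)
    fix c assume z: "L c = 0"
    have "L c = (\<Sum>e\<in>E. c $ inv_into UNIV ee e *\<^sub>R e)"
      unfolding L_def using ee by (simp add: sum.reindex_bij_betw[OF ee, symmetric] bij_betw_def)
    hence "(\<Sum>e\<in>E. c $ inv_into UNIV ee e *\<^sub>R e) = 0" using z by simp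
    moreover have "finite E \<and> (\<forall>c. (\<Sum>v\<in>E. c v *\<^sub>R v) = 0 \<longrightarrow> (\<forall>v\<in>E. c v = 0))"
      using indep unfolding independent_explicit .
    ultimately have "\<forall>e\<in>E. c $ inv_into UNIV ee e = 0" by (elim conjE allE[of _ "\<lambda>e. c $ inv_into UNIV ee e"] impE)
    hence "c $ i = 0" for i using ee by (auto simp: bij_betw_def)
    thus "c = 0" by (simp add: vec_eq_iff)
  qed
  obtain g where g: "linear g" "g \<circ> L = id" using linear_injective_left_inverse[OF linL injL] by blast
  define R where "R = g \<circ> b"
  have linR: "linear R" unfolding R_def using b(1) g(1) by (rule linear_compose)
  have LR: "L (R x) = b x" for x
  proof -
    have "b x \<in> range L" unfolding rangeL using b(3) by auto
    then obtain y where y: "b x = L y" by blast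
    thus ?thesis using g(2) by (simp add: R_def o_def id_def fun_eq_iff)
  qed
  have RL: "R y = x" if "L x = b y" for x y
    using that[symmetric] g(2) by (simp add: R_def o_def id_def fun_eq_iff)
  have injR: "inj R" by (rule injI) (metis LR b(2) injD)
  have det: "det (matrix R) \<noteq> 0" using det_nz_iff_inj[OF linR] injR by simp
  have meas_proj: "(\<lambda>c. \<chi> i. c (ee i)) \<in> (\<Pi>\<^sub>M e\<in>E. lborel) \<rightarrow>\<^sub>M (borel :: ((real, 'd) vec) measure)"
    by (rule measurable_vec_PiM[OF ee])
  have measL: "L \<in> borel \<rightarrow>\<^sub>M borel"
    by (intro borel_measurable_continuous_onI linear_continuous_on linL linear_conv_bounded_linear[THEN iffD1])
  have "subspace_lborel B U = distr (\<Pi>\<^sub>M e\<in>E. lborel) borel (L \<circ> (\<lambda>c. \<chi> i. c (ee i)))"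
    unfolding subspace_lborel_def Let_def E_def[symmetric] L_sum o_def ..
  also have "\<dots> = distr (distr (\<Pi>\<^sub>M e\<in>E. lborel) borel (\<lambda>c. \<chi> i. c (ee i))) borel L"
    by (rule distr_distr[OF measL meas_proj, symmetric])
  finally have sl: "subspace_lborel B U = distr lborel borel L"
    unfolding distr_PiM_lborel_cart[OF ee] .
  show ?thesis
  proof (rule that[of R])
    fix x
    let ?c = "\<lambda>e. R x $ inv_into UNIV ee e"
    have EV: "E \<subseteq> V" using E(1) U by blast
    have bE: "b x = (\<Sum>e\<in>E. ?c e *\<^sub>R e)"
      unfolding LR[symmetric] L_def using ee by (simp add: sum.reindex_bij_betw[OF ee, symmetric] bij_betw_def)
    have bV: "b x \<in> V" using b(3) U by blast
    have "B (b x) f = ?c f" if f: "f \<in> E" for f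
    proof -
      have "B (b x) f = (\<Sum>e\<in>E. ?c e * B e f)"
        unfolding bE using f EV by (intro inner_product_sum[OF B V E(2) EV]) blast
      also have "\<dots> = (\<Sum>e\<in>E. if e = f then ?c f else 0)"
        by (intro sum.cong refl) (simp add: E(4) f)
      finally show ?thesis using f E(2) by simp
    qed
    moreover have "B f (b x) = B (b x) f" if f: "f \<in> E" for f
      using B bV EV f unfolding inner_product_on_def by blast
    ultimately have Bf: "B f (b x) = ?c f" if "f \<in> E" for f using that by simp
    have "B (b x) (b x) = (\<Sum>e\<in>E. ?c e * B e (b x))"
      using inner_product_sum[OF B V E(2) EV bV, of ?c] unfolding bE[symmetric] .
    also have "\<dots> = (\<Sum>e\<in>E. ?c e * ?c e)" by (intro sum.cong refl) (simp add: Bf)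
    also have "\<dots> = (\<Sum>i\<in>UNIV. R x $ i * R x $ i)"
      using ee by (simp add: sum.reindex_bij_betw[OF ee, symmetric] bij_betw_def)
    also have "\<dots> = R x \<bullet> R x" by (simp add: inner_vec_def)
    finally show "B (b x) (b x) = (norm (R x))\<^sup>2" by (simp add: power2_norm_eq_inner)
  next
    fix A :: "(real^3) set" assume A: "A \<in> sets borel" "b -` A \<in> lmeasurable"
    have LA: "L -` A = R ` (b -` A)"
    proof (intro Set.set_eqI iffI)
      fix x assume x: "x \<in> L -` A"
      have "L x \<in> range b" unfolding b(3) rangeL[symmetric] by simp
      then obtain y where "L x = b y" by blast
      thus "x \<in> R ` (b -` A)" using RL x by (intro image_eqI[of _ _ y]) auto
    qed (auto simp: LR)
    have "L -` A \<in> sets borel" using measurable_sets[OF measL A(1)] by simp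
    hence "measure (subspace_lborel B U) A = measure lebesgue (L -` A)"
      unfolding sl using measL A(1) by (simp add: measure_distr measure_completion)
    also have "\<dots> = \<bar>det (matrix R)\<bar> * measure lebesgue (b -` A)"
      unfolding LA by (rule measure_linear_image[OF linR A(2)])
    finally show "measure (subspace_lborel B U) A = \<bar>det (matrix R)\<bar> * measure lebesgue (b -` A)" .
  qed (use det linR in simp_all)
qed

text \<open>\<open>covolume\<close> selects an arbitrary fundamental domain, so every Borel one has
  to be treated. The integer translates of the half-open cube Q cut D into pieces; moved back into
  Q, the pieces tile Q.\<close>

lemma integer_fundamental_domain_measure:
  fixes D :: "(real^'d) set"
  defines "Z \<equiv> {l. \<forall>i. l $ i \<in> \<int>}"
  assumes D: "D \<in> sets borel" and fd: "\<And>x. \<exists>!l. l \<in> Z \<and> x - l \<in> D"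
  shows "emeasure lborel D = 1"
proof -
  define Q where "Q = {x :: real^'d. \<forall>i. 0 \<le> x $ i \<and> x $ i < 1}"
  have cZ: "countable Z"
  proof -
    have "Z \<subseteq> range (\<lambda>f :: 'd \<Rightarrow> int. \<chi> i. of_int (f i))"
    proof
      fix l assume "l \<in> Z"
      hence "l = (\<chi> i. of_int \<lfloor>l $ i\<rfloor>)" by (simp add: Z_def vec_eq_iff)
      thus "l \<in> range (\<lambda>f :: 'd \<Rightarrow> int. \<chi> i. of_int (f i))" by (rule range_eqI[of _ _ "\<lambda>i. \<lfloor>l $ i\<rfloor>"])
    qed
    thus ?thesis by (rule countable_subset) simp
  qed
  have Q_eq: "Q = (\<Inter>i. (\<lambda>x. x $ i) -` {0..<1})" by (auto simp: Q_def)
  have Qs: "Q \<in> sets borel" unfolding Q_eq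
    by (intro sets.countable_INT'' ) (auto intro!: measurable_sets_borel[of _ borel] borel_measurable_continuous_onI continuous_intros)
  have "(1 :: real^'d) \<bullet> b = 1" if "b \<in> Basis" for b using that by (auto simp: Basis_vec_def inner_axis)
  hence prod1: "(\<Prod>b\<in>Basis. (1 :: real^'d) \<bullet> b) = 1" and le1: "\<forall>b\<in>Basis. 0 \<le> (1 :: real^'d) \<bullet> b"
    by (simp_all add: prod.neutral)
  have Q1: "emeasure lborel Q = 1"
  proof (rule antisym)
    have "Q \<subseteq> cbox 0 1" by (auto simp: Q_def mem_box_cart less_imp_le)
    hence "emeasure lborel Q \<le> emeasure lborel (cbox 0 1 :: (real^'d) set)" by (rule emeasure_mono) simp
    also have "\<dots> = 1" using le1 by (simp add: emeasure_lborel_cbox_eq prod1)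
    finally show "emeasure lborel Q \<le> 1" .
    have "box 0 1 \<subseteq> Q" by (auto simp: Q_def mem_box_cart less_imp_le)
    hence "emeasure lborel (box 0 1 :: (real^'d) set) \<le> emeasure lborel Q" by (rule emeasure_mono) (simp add: Qs)
    moreover have "emeasure lborel (box 0 1 :: (real^'d) set) = 1" using le1 by (simp add: emeasure_lborel_box_eq prod1)
    ultimately show "1 \<le> emeasure lborel Q" by simp
  qed
  have fdQ: "\<exists>!l. l \<in> Z \<and> x - l \<in> Q" for x
  proof (rule ex1I[of _ "\<chi> i. of_int \<lfloor>x $ i\<rfloor>"])
    show "(\<chi> i. of_int \<lfloor>x $ i\<rfloor>) \<in> Z \<and> x - (\<chi> i. of_int \<lfloor>x $ i\<rfloor>) \<in> Q"
      by (simp add: Z_def Q_def) linarith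
    fix l assume l: "l \<in> Z \<and> x - l \<in> Q"
    have "l $ i = of_int \<lfloor>x $ i\<rfloor>" for i
    proof -
      obtain k where k: "l $ i = of_int k" using l by (auto simp: Z_def elim: Ints_cases)
      have "0 \<le> x $ i - l $ i \<and> x $ i - l $ i < 1" using l unfolding Q_def by (metis (mono_tags, lifting) mem_Collect_eq vector_minus_component)
      hence "0 \<le> x $ i - of_int k" "x $ i - of_int k < 1" unfolding k by auto
      hence "\<lfloor>x $ i\<rfloor> = k" by linarith
      thus ?thesis using k by simp
    qed
    thus "l = (\<chi> i. of_int \<lfloor>x $ i\<rfloor>)" by (simp add: vec_eq_iff)
  qed
  have plus: "(+) l \<in> borel \<rightarrow>\<^sub>M (borel :: (real^'d) measure)" for l by simp
  have meas: "(+) l -` S \<in> sets borel" if "S \<in> sets borel" for l and S :: "(real^'d) set"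
    using measurable_sets[OF plus that] by simp
  have tr: "emeasure lborel ((+) l -` S) = emeasure lborel S" if "S \<in> sets borel" for l and S :: "(real^'d) set"
  proof -
    have "emeasure lborel S = emeasure (distr lborel borel ((+) l)) S" by (simp only: lborel_distr_plus)
    thus ?thesis using that by (simp add: emeasure_distr)
  qed
  have exQ: "\<exists>l\<in>Z. x - l \<in> Q" for x using fdQ[of x] by blast
  have "D = (\<Union>l\<in>Z. {x \<in> D. x - l \<in> Q})" using exQ by blast
  hence "emeasure lborel D = emeasure lborel (\<Union>l\<in>Z. {x \<in> D. x - l \<in> Q})" by simp
  also have "\<dots> = (\<integral>\<^sup>+ l. emeasure lborel {x \<in> D. x - l \<in> Q} \<partial>count_space Z)"
  proof (rule emeasure_UN_countable[OF _ cZ])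
    show "{x \<in> D. x - l \<in> Q} \<in> sets lborel" for l
    proof -
      have "{x \<in> D. x - l \<in> Q} = D \<inter> (+) (- l) -` Q" by auto
      thus ?thesis using D meas[OF Qs, of "- l"] by simp
    qed
    show "disjoint_family_on (\<lambda>l. {x \<in> D. x - l \<in> Q}) Z"
      using fdQ by (force simp: disjoint_family_on_def)
  qed
  also have "\<dots> = (\<integral>\<^sup>+ l. emeasure lborel {x \<in> Q. x + l \<in> D} \<partial>count_space Z)"
  proof (rule nn_integral_cong)
    fix l
    have "{x \<in> D. x - l \<in> Q} = D \<inter> (+) (- l) -` Q" by auto
    hence "{x \<in> D. x - l \<in> Q} \<in> sets borel" using D meas[OF Qs, of "- l"] by simp
    hence "emeasure lborel ((+) l -` {x \<in> D. x - l \<in> Q}) = emeasure lborel {x \<in> D. x - l \<in> Q}" by (rule tr)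
    also have "(+) l -` {x \<in> D. x - l \<in> Q} = {x \<in> Q. x + l \<in> D}" by (auto simp: add.commute)
    finally show "emeasure lborel {x \<in> D. x - l \<in> Q} = emeasure lborel {x \<in> Q. x + l \<in> D}" ..
  qed
  also have "\<dots> = emeasure lborel (\<Union>l\<in>Z. {x \<in> Q. x + l \<in> D})"
  proof (rule emeasure_UN_countable[OF _ cZ, symmetric])
    show "{x \<in> Q. x + l \<in> D} \<in> sets lborel" for l
    proof -
      have "{x \<in> Q. x + l \<in> D} = Q \<inter> (+) l -` D" by (auto simp: add.commute)
      thus ?thesis using Qs meas[OF D, of l] by simp
    qed
    show "disjoint_family_on (\<lambda>l. {x \<in> Q. x + l \<in> D}) Z"
      unfolding disjoint_family_on_def
    proof (intro ballI impI)
      fix l l' assume l: "l \<in> Z" "l' \<in> Z" "l \<noteq> l'"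
      have False if "x + l \<in> D" "x + l' \<in> D" for x
      proof -
        have "- l \<in> Z" "- l' \<in> Z" using l by (auto simp: Z_def)
        hence "- l = - l'" using fd[of x] that by (metis diff_minus_eq_add)
        thus False using l by simp
      qed
      thus "{x \<in> Q. x + l \<in> D} \<inter> {x \<in> Q. x + l' \<in> D} = {}" by auto
    qed
  qed
  also have "(\<Union>l\<in>Z. {x \<in> Q. x + l \<in> D}) = Q"
  proof -
    have "\<exists>l\<in>Z. x + l \<in> D" for x
    proof -
      obtain l where "l \<in> Z" "x - l \<in> D" using fd by blast
      thus ?thesis by (intro bexI[of _ "- l"]) (auto simp: Z_def)
    qed
    thus ?thesis by auto
  qed
  finally show ?thesis using Q1 by simp
qed

text \<open>\<Delta> is also the factor that converts coordinate volume into volume on U. Once the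
  lattice is the image of the integer vectors, volumes on U are thus coordinate volumes times the
  covolume.\<close>

lemma covolume_integer_lattice:
  fixes b :: "(real, 'd::{finite,wellorder}) vec \<Rightarrow> real^3"
  assumes b: "linear b" "inj b" "range b = U"
    and \<Delta>: "\<And>A. A \<in> sets borel \<Longrightarrow> b -` A \<in> lmeasurable \<Longrightarrow> measure (subspace_lborel B U) A = \<Delta> * measure lebesgue (b -` A)"
  shows "covolume B U (b ` {l. \<forall>i. l $ i \<in> \<int>}) = \<Delta>"
proof -
  let ?L = "b ` {l. \<forall>i. l $ i \<in> \<int>}"
  have measb: "b \<in> borel \<rightarrow>\<^sub>M borel"
    by (intro borel_measurable_continuous_onI linear_continuous_on linear_conv_bounded_linear[THEN iffD1] b)
  have fd_iff: "(\<forall>x\<in>U. \<exists>!l. l \<in> ?L \<and> x - l \<in> D) \<longleftrightarrow> (\<forall>x. \<exists>!l. l \<in> {l. \<forall>i. l $ i \<in> \<int>} \<and> x - l \<in> b -` D)" for D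
  proof -
    let ?Z = "{l :: (real, 'd) vec. \<forall>i. l $ i \<in> \<int>}"
    have dl: "b (x - l) = b x - b l" for x l using b(1) by (rule linear_diff)
    have "(\<exists>!l. l \<in> ?L \<and> b x - l \<in> D) \<longleftrightarrow> (\<exists>!l. l \<in> ?Z \<and> x - l \<in> b -` D)" for x
    proof
      assume "\<exists>!l. l \<in> ?L \<and> b x - l \<in> D"
      then obtain m where m: "m \<in> ?L \<and> b x - m \<in> D"
        and u: "\<forall>m'. m' \<in> ?L \<and> b x - m' \<in> D \<longrightarrow> m' = m" by (rule ex1E)
      from conjunct1[OF m] obtain l where l: "m = b l" "l \<in> ?Z" by (rule imageE)
      show "\<exists>!l. l \<in> ?Z \<and> x - l \<in> b -` D"
      proof (rule ex1I[of _ l])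
        show "l \<in> ?Z \<and> x - l \<in> b -` D" using l(2) m unfolding vimage_eq dl l(1)[symmetric] by (intro conjI) (assumption, rule conjunct2)
        fix l' assume l': "l' \<in> ?Z \<and> x - l' \<in> b -` D"
        have "b l' \<in> ?L \<and> b x - b l' \<in> D" using l' unfolding vimage_eq dl by (intro conjI imageI) (rule conjunct1, assumption, rule conjunct2)
        hence "b l' = b l" using u unfolding l(1)[symmetric] by (elim allE impE)
        thus "l' = l" by (rule injD[OF b(2)])
      qed
    next
      assume "\<exists>!l. l \<in> ?Z \<and> x - l \<in> b -` D"
      then obtain l where l: "l \<in> ?Z \<and> x - l \<in> b -` D"
        and u: "\<forall>l'. l' \<in> ?Z \<and> x - l' \<in> b -` D \<longrightarrow> l' = l" by (rule ex1E)
      show "\<exists>!l. l \<in> ?L \<and> b x - l \<in> D"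
      proof (rule ex1I[of _ "b l"])
        show "b l \<in> ?L \<and> b x - b l \<in> D" using l unfolding vimage_eq dl by (intro conjI imageI) (rule conjunct1, assumption, rule conjunct2)
        fix m' assume m': "m' \<in> ?L \<and> b x - m' \<in> D"
        from conjunct1[OF m'] obtain l' where l': "m' = b l'" "l' \<in> ?Z" by (rule imageE)
        have "l' \<in> ?Z \<and> x - l' \<in> b -` D" using l'(2) m' unfolding vimage_eq dl l'(1)[symmetric] by (intro conjI) (assumption, rule conjunct2)
        hence "l' = l" using u by (elim allE impE)
        thus "m' = b l" unfolding l'(1) by (rule arg_cong)
      qed
    qed
    thus ?thesis unfolding b(3)[symmetric] by auto
  qed
  obtain g where g: "linear g" "g \<circ> b = id" using linear_injective_left_inverse[OF b(1,2)] by blast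
  have gb: "g (b x) = x" for x using g(2) by (simp add: fun_eq_iff)
  \<comment> \<open>The half-open unit cube in the coordinates b; it shows that a fundamental domain
    exists, so that the choice made by \<open>covolume\<close> has the intended property.\<close>
  define D0 where "D0 = {y \<in> U. \<forall>i. 0 \<le> g y $ i \<and> g y $ i < 1}"
  have "fundamental_domain U ?L D0"
    unfolding fundamental_domain_def fd_iff
  proof (intro conjI allI)
    have "closed U" using b by (metis closed_subspace linear_subspace_image subspace_UNIV)
    moreover have "(\<lambda>y. g y $ i) \<in> borel \<rightarrow>\<^sub>M borel" for i
      using g(1) by (intro borel_measurable_continuous_onI continuous_intros linear_continuous_on linear_conv_bounded_linear[THEN iffD1])
    hence "(\<lambda>y. g y $ i) -` {0..<1} \<in> sets borel" for i by (rule measurable_sets_borel) simp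
    hence "(\<Inter>i. (\<lambda>y. g y $ i) -` {0..<1}) \<in> sets borel" by (intro sets.countable_INT'') auto
    moreover have "D0 = U \<inter> (\<Inter>i. (\<lambda>y. g y $ i) -` {0..<1})" by (auto simp: D0_def)
    ultimately show "D0 \<in> sets borel" by auto
    show "D0 \<subseteq> U" by (auto simp: D0_def)
    fix x
    have bU: "b y \<in> U" for y using b(3) by auto
    show "\<exists>!l. l \<in> {l. \<forall>i. l $ i \<in> \<int>} \<and> x - l \<in> b -` D0"
    proof (rule ex1I[of _ "\<chi> i. of_int \<lfloor>x $ i\<rfloor>"])
      show "(\<chi> i. of_int \<lfloor>x $ i\<rfloor>) \<in> {l. \<forall>i. l $ i \<in> \<int>} \<and> x - (\<chi> i. of_int \<lfloor>x $ i\<rfloor>) \<in> b -` D0"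
        by (simp add: D0_def gb bU) linarith
      fix l assume l: "l \<in> {l. \<forall>i. l $ i \<in> \<int>} \<and> x - l \<in> b -` D0"
      have "l $ i = of_int \<lfloor>x $ i\<rfloor>" for i
      proof -
        obtain k where k: "l $ i = of_int k" using l by (auto elim: Ints_cases)
        have "0 \<le> g (b (x - l)) $ i \<and> g (b (x - l)) $ i < 1" using l by (simp only: D0_def vimage_def mem_Collect_eq)
        hence "0 \<le> x $ i - of_int k" "x $ i - of_int k < 1" unfolding gb by (auto simp: k)
        hence "\<lfloor>x $ i\<rfloor> = k" by linarith
        thus ?thesis using k by simp
      qed
      thus "l = (\<chi> i. of_int \<lfloor>x $ i\<rfloor>)" by (simp add: vec_eq_iff)
    qed
  qed
  moreover define D where "D = (SOME D. fundamental_domain U ?L D)"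
  ultimately have "fundamental_domain U ?L D" by (simp only: someI)
  hence D: "D \<in> sets borel" "\<forall>x. \<exists>!l. l \<in> {l. \<forall>i. l $ i \<in> \<int>} \<and> x - l \<in> b -` D"
    unfolding fundamental_domain_def fd_iff by simp_all
  have bD: "b -` D \<in> sets borel" using measurable_sets[OF measb D(1)] by simp
  have e1: "emeasure lborel (b -` D) = 1"
    by (rule integer_fundamental_domain_measure[OF bD]) (use D(2) in blast)
  have "b -` D \<in> lmeasurable" using bD e1 by (intro fmeasurableI) (simp_all add: emeasure_completion)
  moreover have "measure lebesgue (b -` D) = 1"
    using bD e1 by (simp add: measure_completion measure_def)
  ultimately show ?thesis unfolding covolume_def D_def[symmetric] by (simp add: \<Delta> D(1))
qed

section \<open>Unfolding the quotient measure\<close>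

text \<open>The radius 2^(-|n|) serves both signs of n: it is at most 1, so closer points differ by
  an element of nonnegative valuation, and that valuation then exceeds |n|.\<close>

lemma open_fls_ge_ball: "open {y. fls_ge n (y - x)}"
proof (unfold open_fls_def, intro ballI)
  fix a assume a: "a \<in> {y. fls_ge n (y - x)}"
  show "\<exists>r>0. {y. dist y a < r} \<subseteq> {y. fls_ge n (y - x)}"
  proof (intro exI conjI)
    show "(0::real) < inverse (2 ^ nat \<bar>n\<bar>)" by simp
    show "{y. dist y a < inverse (2 ^ nat \<bar>n\<bar>)} \<subseteq> {y. fls_ge n (y - x)}"
    proof
      fix y assume y: "y \<in> {y. dist y a < inverse (2 ^ nat \<bar>n\<bar>)}"
      have "fls_ge n (y - a)"
      proof (cases "y = a")
        case False
        have "n \<le> val (y - a)"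
        proof (rule ccontr)
          assume n: "\<not> n \<le> val (y - a)"
          show False
          proof (cases "val (y - a) \<ge> 0")
            case True
            have "inverse (2 ^ nat (val (y - a))) < inverse (2 ^ nat \<bar>n\<bar> :: real)"
              using y False True by (simp add: dist_fls_def)
            hence "(2::real) ^ nat \<bar>n\<bar> < 2 ^ nat (val (y - a))" by simp
            hence "nat \<bar>n\<bar> < nat (val (y - a))" by (rule power_less_imp_less_exp[rotated]) simp
            with n True show False by linarith
          next
            case False2: False
            have "2 ^ nat (- val (y - a)) < inverse (2 ^ nat \<bar>n\<bar> :: real)"
              using y False False2 by (simp add: dist_fls_def)
            also have "\<dots> \<le> 1" by (simp add: inverse_le_1_iff)
            finally have "(2::real) ^ nat (- val (y - a)) < 1" .
            moreover have "(1::real) \<le> 2 ^ nat (- val (y - a))" by (rule one_le_power) simp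
            ultimately show False by simp
          qed
        qed
        thus ?thesis by (simp add: fls_ge_iff)
      qed simp
      moreover have "fls_ge n (a - x)" using a by simp
      ultimately have "fls_ge n ((y - a) + (a - x))" by (rule fls_ge_add)
      thus "y \<in> {y. fls_ge n (y - x)}" by simp
    qed
  qed
qed

lemma open_mat3_ball: "open {h :: ('a::field) mat3. \<forall>a b. fls_ge n (h $ a $ b - g $ a $ b)}"
proof -
  have "{h :: 'a mat3. \<forall>a b. fls_ge n (h $ a $ b - g $ a $ b)} =
     (\<Inter>a. \<Inter>b. (\<lambda>h. h $ a) -` ((\<lambda>h. h $ b) -` {y. fls_ge n (y - g $ a $ b)}))" by auto
  also have "open \<dots>"
    by (intro open_INT ballI finite_class.finite_UNIV open_vimage_vec_nth open_fls_ge_ball)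
  finally show ?thesis .
qed

text \<open>Every term on the right begins with one of the perturbing entries, so that divisibility
  of this first factor bounds the whole term.\<close>

lemma det3_minus_one_aux:
    "(1 + a) * (1 + b) * (1 + c) + d * e * f + g * h * i - (1 + a) * e * i - d * h * (1 + c) - g * (1 + b) * f - 1
      = a * ((1 + b) * (1 + c)) + b * (1 + c) + c + d * (e * f) + g * (h * i) - e * (i * (1 + a)) - d * (h * (1 + c)) - g * (f * (1 + b))"
      for a b c d e f g h i :: "'a::comm_ring_1" by (simp add: algebra_simps)

text \<open>Modulo \<epsilon> the matrix is the identity, so its determinant is 1 modulo \<epsilon>
  and therefore a unit.\<close>

lemma GL3_integers_near_one:
  fixes E :: "('a::field) mat3"
  assumes "\<And>a b. fls_ge 1 (E $ a $ b)"
  shows "mat 1 + E \<in> GL3_integers"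
proof -
  have E0: "fls_ge 0 (E $ a $ b)" for a b by (rule fls_ge_mono[OF assms]) simp
  have 1: "fls_ge 1 (x * y)" if "fls_ge 1 x" "fls_ge 0 y" for x y :: "'a fls"
    by (rule fls_ge_mult0'[OF that])
  have 2: "fls_ge 0 (x * y)" if "fls_ge 0 x" "fls_ge 0 y" for x y :: "'a fls"
    by (rule fls_ge_mult0[OF that])
  let ?d = "det (mat 1 + E)"
  have "?d - 1 = E$1$1 * ((1 + E$2$2) * (1 + E$3$3)) + E$2$2 * (1 + E$3$3) + E$3$3
     + E$1$2 * (E$2$3 * E$3$1) + E$1$3 * (E$2$1 * E$3$2)
     - E$2$3 * (E$3$2 * (1 + E$1$1)) - E$1$2 * (E$2$1 * (1 + E$3$3)) - E$1$3 * (E$3$1 * (1 + E$2$2))"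
  proof -
    have e: "(mat 1 + E) $ 1 $ 1 = 1 + E $ 1 $ 1" "(mat 1 + E) $ 2 $ 2 = 1 + E $ 2 $ 2" "(mat 1 + E) $ 3 $ 3 = 1 + E $ 3 $ 3"
      "(mat 1 + E) $ 1 $ 2 = E $ 1 $ 2" "(mat 1 + E) $ 1 $ 3 = E $ 1 $ 3" "(mat 1 + E) $ 2 $ 1 = E $ 2 $ 1"
      "(mat 1 + E) $ 2 $ 3 = E $ 2 $ 3" "(mat 1 + E) $ 3 $ 1 = E $ 3 $ 1" "(mat 1 + E) $ 3 $ 2 = E $ 3 $ 2"
      by (simp_all add: mat_def)
    show ?thesis unfolding det_3 e by (rule det3_minus_one_aux)
  qed
  also have "fls_ge 1 \<dots>"
    by (intro fls_ge_add fls_ge_diff 1 2 assms E0 fls_ge_0_1)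
  finally have d: "fls_ge 1 (?d - 1)" .
  hence "fls_nth (?d - 1) 0 = 0" by (simp add: fls_ge_def)
  hence d0: "fls_nth ?d 0 \<noteq> 0" by simp
  hence dnz: "?d \<noteq> 0" by auto
  have "fls_ge 0 (?d - 1 + 1)" by (intro fls_ge_add fls_ge_mono[OF d] fls_ge_0_1) simp
  hence "val ?d \<ge> 0" using dnz by (auto simp: fls_ge_iff)
  moreover have "val ?d \<le> 0" using d0 by (rule fls_subdegree_leI)
  moreover have "mat 1 + E \<in> integral_matrices"
    using E0 by (auto simp: integral_matrices_def integers_iff mat_def intro!: fls_ge_add)
  ultimately show ?thesis using dnz by (simp add: GL3_integers_iff)
qed

lemma mat3_bounded_below: "\<exists>m. \<forall>a b. fls_ge m ((g :: ('a::field) mat3) $ a $ b)"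
proof (intro exI allI)
  fix a b
  have "Min (range (\<lambda>(a,b). val (g $ a $ b))) \<le> val (g $ a $ b)" by (intro Min_le) auto
  thus "fls_ge (Min (range (\<lambda>(a,b). val (g $ a $ b)))) (g $ a $ b)" by (simp add: fls_ge_iff)
qed

text \<open>If the entries of the inverse of g have valuation at least m, then any h that agrees
  with g up to valuation 1 - m is g(1 + E) with E divisible by \<epsilon>. As a consequence every
  preimage under a right invariant function is open, whatever the target set.\<close>

lemma open_right_invariant:
  fixes S :: "('a::field) mat3 set"
  assumes inv: "\<And>g. g \<in> S \<Longrightarrow> invertible g"
    and K: "\<And>g k. g \<in> S \<Longrightarrow> k \<in> GL3_integers \<Longrightarrow> g ** k \<in> S"
  shows "open S"
proof (subst open_subopen, intro ballI)
  fix g assume g: "g \<in> S"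
  obtain m where m: "\<And>a b. fls_ge m (matrix_inv g $ a $ b)" using mat3_bounded_below by metis
  let ?T = "{h :: 'a mat3. \<forall>a b. fls_ge (1 - m) (h $ a $ b - g $ a $ b)}"
  have "?T \<subseteq> S"
  proof
    fix h assume h: "h \<in> ?T"
    define E where "E = matrix_inv g ** (h - g)"
    have "fls_ge 1 (E $ a $ b)" for a b
    proof -
      have "fls_ge (m + (1 - m)) (matrix_inv g $ a $ c * (h - g) $ c $ b)" for c
        using h m by (intro fls_ge_mult) auto
      thus ?thesis by (auto simp: E_def matrix_matrix_mult_def intro!: fls_ge_sum)
    qed
    hence "g ** (mat 1 + E) \<in> S" by (intro K g GL3_integers_near_one)
    moreover have "g ** (mat 1 + E) = g + g ** matrix_inv g ** (h - g)"
      by (simp add: E_def matrix_add_ldistrib matrix_mul_assoc)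
    hence "g ** (mat 1 + E) = h" by (simp add: mat3_inv_right[OF inv[OF g]])
    ultimately show "h \<in> S" by simp
  qed
  thus "\<exists>T. open T \<and> g \<in> T \<and> T \<subseteq> S" using open_mat3_ball[of "1 - m" g] by (intro exI[of _ ?T]) auto
qed

lemma coset_rep_in:
  fixes S :: "('a::field) mat3 set"
  assumes "c \<in> rcosets\<^bsub>GL3\<^esub> S" "S \<noteq> {}"
  obtains a where "invertible a" "c = {t ** a | t. t \<in> S}" "coset_rep c \<in> c"
proof -
  obtain a where a: "invertible a" "c = {t ** a | t. t \<in> S}"
    using assms by (auto simp: RCOSETS_def r_coset_def)
  moreover obtain t where "t \<in> S" using assms(2) by blast
  hence "t ** a \<in> c" using a(2) by blast
  hence "coset_rep c \<in> c" by (rule someI)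
  ultimately show ?thesis using that by blast
qed

lemma torus_invertible: "t \<in> torus \<Longrightarrow> invertible t"
  by (simp add: torus_def)

lemma torus_one: "mat 1 \<in> torus"
  by (simp add: torus_def) (simp add: mat_def)

text \<open>Weil's formula is applied to \<phi> times the indicator of A. The inner integral over
  the torus becomes \<phi> times the measure of one translate of the integral torus, which is 1. The
  integral over the group becomes a sum over disjoint cosets of \<open>GL3_integers\<close>, each of
  measure 1.\<close>

lemma quotient_integral_unfolding:
  fixes \<phi> :: "('a::{field,finite}) mat3 \<Rightarrow> real" and n :: "'i \<Rightarrow> 'a mat3"
  assumes haar_G: "haar_measure GL3 \<mu>G" "emeasure \<mu>G GL3_integers = 1"
    and haar_T: "haar_measure (GL3\<lparr>carrier := torus\<rparr>) \<mu>T" "emeasure \<mu>T (torus \<inter> GL3_integers) = 1"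
    and quotient: "quotient_measure GL3 torus \<mu>G \<mu>T \<nu>"
    and nonneg: "\<And>g. 0 \<le> \<phi> g"
    and T_inv: "\<And>t g. t \<in> torus \<Longrightarrow> invertible g \<Longrightarrow> \<phi> (t ** g) = \<phi> g"
    and K_inv: "\<And>g k. invertible g \<Longrightarrow> k \<in> GL3_integers \<Longrightarrow> \<phi> (g ** k) = \<phi> g"
    and A_K: "\<And>g k. invertible g \<Longrightarrow> k \<in> GL3_integers \<Longrightarrow> g ** k \<in> A \<longleftrightarrow> g \<in> A"
    and A_T: "\<And>g. invertible g \<Longrightarrow> \<exists>t0\<in>torus. \<forall>t\<in>torus. t ** g \<in> A \<longleftrightarrow> (\<exists>k\<in>torus \<inter> GL3_integers. t = t0 ** k)"
    and I: "finite I"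
    and n: "\<And>i. i \<in> I \<Longrightarrow> invertible (n i) \<and> n i \<in> A"
    and cover: "\<And>g. invertible g \<Longrightarrow> g \<in> A \<Longrightarrow> \<phi> g \<noteq> 0 \<Longrightarrow> \<exists>i\<in>I. \<exists>k\<in>GL3_integers. g = n i ** k"
    and disj: "\<And>i j k. i \<in> I \<Longrightarrow> j \<in> I \<Longrightarrow> k \<in> GL3_integers \<Longrightarrow> n i = n j ** k \<Longrightarrow> i = j"
  shows "integrable \<nu> (\<lambda>c. \<phi> (coset_rep c))"
    and "(\<integral>c. \<phi> (coset_rep c) \<partial>\<nu>) = (\<Sum>i\<in>I. \<phi> (n i))"
proof -
  let ?f = "\<lambda>g. ennreal (\<phi> g) * indicator A g"
  let ?K = "GL3_integers :: 'a mat3 set"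
  have setsG: "sets \<mu>G = sets (restrict_space borel {g. invertible g})"
    using haar_G by (simp add: haar_measure_def)
  have spaceG: "space \<mu>G = {g. invertible g}"
    using sets_eq_imp_space_eq[OF setsG] by (simp add: space_restrict_space)
  have spaceT: "space \<mu>T = torus"
    using haar_T(1) unfolding haar_measure_def
    by (auto dest!: sets_eq_imp_space_eq simp: space_restrict_space)
  have \<nu>: "space \<nu> = rcosets\<^bsub>GL3\<^esub> torus" "sets \<nu> = sigma_sets (rcosets\<^bsub>GL3\<^esub> torus)
      {U. U \<subseteq> rcosets\<^bsub>GL3\<^esub> torus \<and> openin (top_of_set (carrier GL3)) (\<Union> U)}"
    and weil: "\<And>f. f\<in>borel_measurable \<mu>G \<Longrightarrow>
      (\<integral>\<^sup>+ g. f g \<partial>\<mu>G) = (\<integral>\<^sup>+ c. (\<integral>\<^sup>+ t. f (t ** coset_rep c) \<partial>\<mu>T) \<partial>\<nu>)"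
    using quotient unfolding quotient_measure_def by simp_all
  have rep: "invertible (coset_rep c)" if c: "c \<in> rcosets\<^bsub>GL3\<^esub> torus" for c :: "'a mat3 set"
  proof -
    obtain a where "invertible a" "c = {t ** a | t. t \<in> torus}" "coset_rep c \<in> c"
      by (rule coset_rep_in[OF c]) (use torus_one in auto)
    then obtain t where "t \<in> torus" "coset_rep c = t ** a" by blast
    thus ?thesis using \<open>invertible a\<close> by (simp add: mat3_invertible_mult torus_invertible)
  qed
  have f_meas: "?f \<in> borel_measurable \<mu>G"
  proof (rule measurableI)
    fix X :: "ennreal set"
    have "open (?f -` X \<inter> {g. invertible g})"
      by (rule open_right_invariant)
         (auto simp: K_inv A_K indicator_def mat3_invertible_mult GL3_integers_invertible)
    thus "?f -` X \<inter> space \<mu>G \<in> sets \<mu>G"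
      by (auto simp: setsG spaceG sets_restrict_space intro!: image_eqI[where x = "?f -` X \<inter> {g. invertible g}"])
  qed auto
  define cos where "cos i = n i <#\<^bsub>GL3\<^esub> ?K" for i
  have cos_iff: "g \<in> cos i \<longleftrightarrow> (\<exists>k\<in>?K. g = n i ** k)" for g i
    by (auto simp: cos_def l_coset_def)
  have K_sets: "?K \<in> sets \<mu>G" using haar_G(2) emeasure_neq_0_sets[of \<mu>G ?K] by simp
  have cos1: "emeasure \<mu>G (cos i) = 1" if "i \<in> I" for i
    using haar_G K_sets n[OF that] by (auto simp: haar_measure_def cos_def)
  have cos_sets: "cos i \<in> sets \<mu>G" if "i \<in> I" for i
    using cos1[OF that] emeasure_neq_0_sets[of \<mu>G "cos i"] by simp
  have f_eq: "?f g = (\<Sum>i\<in>I. ennreal (\<phi> (n i)) * indicator (cos i) g)" if g: "invertible g" for g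
  proof (cases "\<exists>i\<in>I. g \<in> cos i")
    case True
    then obtain i k where i: "i \<in> I" "k \<in> ?K" "g = n i ** k" by (auto simp: cos_iff)
    have "j = i" if j: "j \<in> I" "g \<in> cos j" for j
    proof -
      obtain k' where k': "k' \<in> ?K" "g = n j ** k'" using j by (auto simp: cos_iff)
      have "n i = n i ** (k ** matrix_inv k)" using i by (simp add: mat3_inv_right GL3_integers_invertible)
      also have "\<dots> = n j ** (k' ** matrix_inv k)" using i k' by (simp add: matrix_mul_assoc)
      finally have "n i = n j ** (k' ** matrix_inv k)" .
      thus ?thesis using disj[of i j "k' ** matrix_inv k"] i j k' by (simp add: GL3_integers_mult GL3_integers_inv)
    qed
    hence "(\<Sum>j\<in>I. ennreal (\<phi> (n j)) * indicator (cos j) g) = (\<Sum>j\<in>I. if j = i then ennreal (\<phi> (n i)) else 0)"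
      using i by (intro sum.cong) (auto simp: indicator_def cos_iff)
    also have "\<dots> = ennreal (\<phi> (n i))" using I i by simp
    also have "\<dots> = ?f g" using i n[of i] by (simp add: K_inv A_K)
    finally show ?thesis by simp
  next
    case False
    hence "?f g = 0" using cover[OF g] by (cases "\<phi> g = 0") (auto simp: indicator_def cos_iff)
    moreover have "(\<Sum>j\<in>I. ennreal (\<phi> (n j)) * indicator (cos j) g) = 0"
      using False by (intro sum.neutral) (auto simp: indicator_def)
    ultimately show ?thesis by simp
  qed
  have "(\<integral>\<^sup>+ g. ?f g \<partial>\<mu>G) = (\<integral>\<^sup>+ g. (\<Sum>i\<in>I. ennreal (\<phi> (n i)) * indicator (cos i) g) \<partial>\<mu>G)"
    by (intro nn_integral_cong) (simp add: spaceG f_eq)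
  also have "\<dots> = (\<Sum>i\<in>I. \<integral>\<^sup>+ g. ennreal (\<phi> (n i)) * indicator (cos i) g \<partial>\<mu>G)"
    using cos_sets by (intro nn_integral_sum) auto
  also have "\<dots> = (\<Sum>i\<in>I. ennreal (\<phi> (n i)))"
    by (intro sum.cong refl) (simp add: nn_integral_cmult_indicator cos_sets cos1)
  also have "\<dots> = ennreal (\<Sum>i\<in>I. \<phi> (n i))" using nonneg by (simp add: sum_ennreal)
  finally have lhs: "(\<integral>\<^sup>+ g. ?f g \<partial>\<mu>G) = ennreal (\<Sum>i\<in>I. \<phi> (n i))" .
  have inner: "(\<integral>\<^sup>+ t. ?f (t ** coset_rep c) \<partial>\<mu>T) = ennreal (\<phi> (coset_rep c))" if c: "c \<in> space \<nu>" for c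
  proof -
    have g: "invertible (coset_rep c)" using c \<nu> rep by auto
    obtain t0 where t0: "t0\<in>torus" "\<And>t. t\<in>torus \<Longrightarrow> t ** coset_rep c \<in> A \<longleftrightarrow> (\<exists>k\<in>torus \<inter> ?K. t = t0 ** k)"
      using A_T[OF g] by blast
    define C where "C = t0 <#\<^bsub>GL3\<lparr>carrier := torus\<rparr>\<^esub> (torus \<inter> ?K)"
    have C: "t \<in> C \<longleftrightarrow> (\<exists>k\<in>torus \<inter> ?K. t = t0 ** k)" for t
      by (auto simp: C_def l_coset_def)
    have TK: "torus \<inter> ?K \<in> sets \<mu>T" using haar_T(2) emeasure_neq_0_sets[of \<mu>T "torus \<inter> ?K"] by simp
    have C1: "emeasure \<mu>T C = 1" using haar_T t0(1) TK unfolding C_def haar_measure_def by simp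
    hence Cs: "C \<in> sets \<mu>T" using emeasure_neq_0_sets[of \<mu>T C] by simp
    have "(\<integral>\<^sup>+ t. ?f (t ** coset_rep c) \<partial>\<mu>T) = (\<integral>\<^sup>+ t. ennreal (\<phi> (coset_rep c)) * indicator C t \<partial>\<mu>T)"
      by (intro nn_integral_cong) (simp add: spaceT T_inv g t0(2) C indicator_def)
    also have "\<dots> = ennreal (\<phi> (coset_rep c))" by (simp add: nn_integral_cmult_indicator Cs C1)
    finally show ?thesis .
  qed
  have int: "(\<integral>\<^sup>+ c. ennreal (\<phi> (coset_rep c)) \<partial>\<nu>) = ennreal (\<Sum>i\<in>I. \<phi> (n i))"
    using weil[OF f_meas] lhs inner by (simp cong: nn_integral_cong)
  \<comment> \<open>The sets of cosets with open union generate the measurable sets of the quotient,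
    and the union in question is right invariant.\<close>
  have meas: "(\<lambda>c. \<phi> (coset_rep c)) \<in> borel_measurable \<nu>"
  proof (rule measurableI)
    fix X :: "real set"
    let ?U = "(\<lambda>c. \<phi> (coset_rep c)) -` X \<inter> space \<nu>"
    have "open (\<phi> -` X \<inter> {g. invertible g})"
      by (rule open_right_invariant) (auto simp: K_inv mat3_invertible_mult GL3_integers_invertible)
    moreover have "\<Union> ?U = \<phi> -` X \<inter> {g. invertible g}"
    proof (intro equalityI subsetI)
      fix g assume "g \<in> \<Union> ?U"
      then obtain c where c: "c \<in> rcosets\<^bsub>GL3\<^esub> torus" "\<phi> (coset_rep c) \<in> X" "g \<in> c" using \<nu> by auto
      from c(1) torus_one obtain a where "invertible a" "c = {t ** a | t. t \<in> torus}" "coset_rep c \<in> c"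
        by (elim coset_rep_in) blast+
      thus "g \<in> \<phi> -` X \<inter> {g. invertible g}" using c(2,3)
        by (auto simp: T_inv mat3_invertible_mult torus_invertible)
    next
      fix g assume g: "g \<in> \<phi> -` X \<inter> {g. invertible g}"
      let ?c = "torus #>\<^bsub>GL3\<^esub> g"
      have c: "?c = {t ** g | t. t \<in> torus}" by (auto simp: r_coset_def)
      have c': "?c \<in> rcosets\<^bsub>GL3\<^esub> torus" using g by (auto simp: RCOSETS_def)
      have gc: "g \<in> ?c" unfolding c using torus_one by (auto intro!: exI[of _ "mat 1"])
      hence "coset_rep ?c \<in> ?c" by (rule someI)
      hence "\<phi> (coset_rep ?c) = \<phi> g" using g unfolding c by (auto simp: T_inv)
      thus "g \<in> \<Union> ?U" using c' gc g \<nu> by auto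
    qed
    ultimately have "openin (top_of_set (carrier GL3)) (\<Union> ?U)"
      by (simp add: open_subset)
    thus "?U \<in> sets \<nu>" unfolding \<nu> by (intro sigma_sets.Basic) auto
  qed auto
  show "integrable \<nu> (\<lambda>c. \<phi> (coset_rep c))"
    using meas int nonneg by (intro integrableI_nonneg) auto
  have "(\<integral>c. \<phi> (coset_rep c) \<partial>\<nu>) = enn2real (\<integral>\<^sup>+ c. ennreal (\<phi> (coset_rep c)) \<partial>\<nu>)"
    using meas nonneg by (intro integral_eq_nn_integral) auto
  thus "(\<integral>c. \<phi> (coset_rep c) \<partial>\<nu>) = (\<Sum>i\<in>I. \<phi> (n i))"
    using nonneg by (simp add: int sum_nonneg)
qed

section \<open>Evaluation of the counting sum\<close>

text \<open>Over a field with q elements this counts the polar parts whose pole has order exactly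
  k.\<close>

definition sphere_card :: "real \<Rightarrow> nat \<Rightarrow> real" where
  "sphere_card q k = (if k = 0 then 1 else q ^ k - q ^ (k - 1))"

lemma sphere_card_simps [simp]: "sphere_card q 0 = 1" "sphere_card q (Suc k) = q ^ Suc k - q ^ k"
  by (simp_all add: sphere_card_def)

text \<open>Summation by parts: the partial sums of \<open>sphere_card\<close> are the powers of q,
  so a sum over spheres becomes a sum of powers of q weighted with the increments of f.\<close>

lemma sum_sphere_card: "(\<Sum>k\<le>n. sphere_card q k * f k) = q ^ n * f n - (\<Sum>k<n. q ^ k * (f (Suc k) - f k))"
  by (induction n) (simp_all add: algebra_simps)

lemma sum_sphere_card_0: "(\<Sum>k\<le>n. sphere_card q k) = q ^ n"
  using sum_sphere_card[of q "\<lambda>_. 1" n] by simp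

lemma sum_sphere_card_1: "(\<Sum>k\<le>n. sphere_card q k * real k) = real n * q ^ n - (\<Sum>k<n. q ^ k)"
  using sum_sphere_card[of q real n] by (simp add: algebra_simps)

lemma sum_sphere_card_2: "(\<Sum>k\<le>n. sphere_card q k * (real k)\<^sup>2)
    = (real n)\<^sup>2 * q ^ n - 2 * (\<Sum>k<n. real k * q ^ k) - (\<Sum>k<n. q ^ k)"
proof -
  have "(\<Sum>k<n. q ^ k * ((real (Suc k))\<^sup>2 - (real k)\<^sup>2)) = (\<Sum>k<n. 2 * (real k * q ^ k) + q ^ k)"
    by (intro sum.cong refl) (simp add: power2_eq_square algebra_simps)
  thus ?thesis using sum_sphere_card[of q "\<lambda>k. (real k)\<^sup>2" n]
    by (simp add: sum.distrib sum_distrib_left mult.commute)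
qed

lemma sum_sphere_card_max:
  assumes "s \<le> n"
  shows "(\<Sum>k\<le>n. sphere_card q k * real (max s k)) = real n * q ^ n - (\<Sum>k=s..<n. q ^ k)"
proof -
  have "(\<Sum>k<n. q ^ k * (real (max s (Suc k)) - real (max s k))) = (\<Sum>k<n. if s \<le> k then q ^ k else 0)"
    by (intro sum.cong refl) (auto simp: max_def)
  also have "\<dots> = (\<Sum>k=s..<n. q ^ k)"
    by (rule sum.mono_neutral_cong_right) auto
  finally show ?thesis
    using sum_sphere_card[of q "\<lambda>k. real (max s k)" n] assms by (simp add: max_def)
qed

text \<open>The loss of area when max X Z stays below X + Y. The shortfall is u, where the truncated
  subtraction gives 0 for Z above X + Y; replacing X + Y by X + Y - u in the generic area removes X
  u + u^2/2.\<close>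

definition corner :: "nat \<Rightarrow> nat \<Rightarrow> nat \<Rightarrow> real" where
  "corner X Y Z = (let u = real (min Y (X + Y - Z)) in X * u + u\<^sup>2 / 2)"

definition corner_sum :: "real \<Rightarrow> nat \<Rightarrow> nat \<Rightarrow> real" where
  "corner_sum q X Y = (\<Sum>i=X..<X+Y. (real X + real (X + Y) - real i - 1/2) * q ^ i)"

text \<open>\<open>corner\<close> is constant in Z up to X and 0 from X + Y on. In between it drops
  from Z = i to i + 1 by X + (X + Y - i) - 1/2, which is the coefficient in
  \<open>corner_sum\<close>.\<close>

lemma sum_sphere_card_corner:
  assumes "X + Y \<le> n"
  shows "(\<Sum>k\<le>n. sphere_card q k * corner X Y k) = corner_sum q X Y"
proof -
  have "corner X Y n = 0" using assms by (simp add: corner_def)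
  have "q ^ k * (corner X Y (Suc k) - corner X Y k) =
      (if k \<in> {X..<X+Y} then - ((real X + real (X + Y) - real k - 1/2) * q ^ k) else 0)" for k
  proof -
    consider "k < X" | "X \<le> k" "k < X + Y" | "X + Y \<le> k" by linarith
    thus ?thesis
    proof cases
      case 1
      hence "min Y (X + Y - k) = Y" "min Y (X + Y - Suc k) = Y" by auto
      thus ?thesis using 1 by (simp add: corner_def)
    next
      case 2
      define w where "w = X + Y - Suc k"
      have w: "min Y (X + Y - k) = Suc w" "min Y (X + Y - Suc k) = w" using 2 by (auto simp: w_def)
      have D: "corner X Y (Suc k) - corner X Y k = - (real X + real w + 1/2)"
        unfolding corner_def Let_def w of_nat_Suc by (simp only: power2_eq_square) (simp add: algebra_simps)
      have E: "real X + real (X + Y) - real k - 1/2 = real X + real w + 1/2"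
        using 2 by (simp add: w_def of_nat_diff)
      have k: "k \<in> {X..<X+Y}" using 2 by simp
      show ?thesis unfolding D E if_P[OF k] by (simp only: mult_minus_right mult.commute)
    next
      case 3
      thus ?thesis by (simp add: corner_def)
    qed
  qed
  hence "(\<Sum>k<n. q ^ k * (corner X Y (Suc k) - corner X Y k)) =
     (\<Sum>k<n. if k \<in> {X..<X+Y} then - ((real X + real (X + Y) - real k - 1/2) * q ^ k) else 0)" by simp
  also have "\<dots> = (\<Sum>k=X..<X+Y. - ((real X + real (X + Y) - real k - 1/2) * q ^ k))"
    using assms by (intro sum.mono_neutral_cong_right) auto
  finally show ?thesis
    using sum_sphere_card[of q "corner X Y" n] \<open>corner X Y n = 0\<close> by (simp add: corner_sum_def sum_negf)
qed

section \<open>Pairs of polar parts with prescribed total order\<close>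

definition conv_card :: "real \<Rightarrow> nat \<Rightarrow> real" where
  "conv_card q s = (\<Sum>X\<le>s. sphere_card q X * sphere_card q (s - X))"

definition conv_corner :: "real \<Rightarrow> nat \<Rightarrow> real" where
  "conv_corner q s = (\<Sum>X\<le>s. sphere_card q X * sphere_card q (s - X) * corner_sum q X (s - X))"

lemma sphere_card_mult:
  assumes "q \<noteq> 0" "X \<le> p"
  shows "sphere_card q X * sphere_card q (Suc p - X) = (if X = 0 then (q - 1) * q ^ p else (q - 1)\<^sup>2 * q ^ p / q)"
proof (cases X)
  case (Suc X')
  obtain p' where p': "p = Suc X' + p'" using assms Suc le_Suc_ex by metis
  have "Suc p - X = Suc p'" using Suc p' by simp
  thus ?thesis using assms by (simp add: Suc p' power_add power2_eq_square field_simps)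
qed (simp add: algebra_simps)

text \<open>The two extreme pairs, where one of the orders is 0, contribute the factor q - 1 once,
  the p others contribute it twice. The division by q keeps the formula meaningful at p = 0.\<close>

lemma conv_card_Suc:
  assumes "q \<noteq> 0"
  shows "conv_card q (Suc p) = 2 * (q - 1) * q ^ p + real p * (q - 1)\<^sup>2 * q ^ p / q"
proof -
  have "conv_card q (Suc p) = (\<Sum>X\<le>p. sphere_card q X * sphere_card q (Suc p - X)) + sphere_card q (Suc p)"
    by (simp add: conv_card_def)
  also have "(\<Sum>X\<le>p. sphere_card q X * sphere_card q (Suc p - X)) =
      (\<Sum>X\<le>p. if X = 0 then (q - 1) * q ^ p else (q - 1)\<^sup>2 * q ^ p / q)"
    using assms by (intro sum.cong refl sphere_card_mult) auto
  also have "\<dots> = (q - 1) * q ^ p + (\<Sum>X<p. (q - 1)\<^sup>2 * q ^ p / q)"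
    by (subst sum.atMost_shift) simp
  finally show ?thesis by (simp add: algebra_simps)
qed

definition conv_moment :: "real \<Rightarrow> nat \<Rightarrow> real" where
  "conv_moment q n = (\<Sum>s\<le>n. real s * conv_card q s)"

lemma conv_moment_eq:
  assumes "q \<noteq> 0"
  shows "conv_moment q n = real n * (real n + 1) * (q - 1) * q ^ n / q"
proof (induction n)
  case (Suc n)
  have "conv_moment q (Suc n) = conv_moment q n + real (Suc n) * conv_card q (Suc n)"
    by (simp add: conv_moment_def)
  also have "\<dots> = real (Suc n) * (real (Suc n) + 1) * (q - 1) * q ^ Suc n / q"
    unfolding Suc.IH conv_card_Suc[OF assms] using assms
    by (simp add: field_simps power2_eq_square)
  finally show ?case .
qed (simp add: conv_moment_def)

text \<open>After exchanging the two summations the sum over i telescopes.\<close>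

lemma conv_corner_Suc:
  assumes "q \<noteq> 0"
  shows "conv_corner q (Suc p) = (real (Suc p))\<^sup>2 / 2 * (q - 1) * q ^ (2 * p)"
proof -
  let ?s = "Suc p"
  define c where "c X i = sphere_card q X * sphere_card q (?s - X) * ((real X + real ?s - real i - 1/2) * q ^ i)" for X i
  \<comment> \<open>Chosen so that, up to the factor (q - 1) q^p / q, the inner sum over X \<le> i
    is the increment of q^i f i; only the value f (p + 1) = (p + 1)^2 / 2 survives.\<close>
  define f where "f i = real i * real ?s - (real i)\<^sup>2 / 2" for i :: nat
  have "conv_corner q ?s = (\<Sum>X\<le>?s. \<Sum>i=X..<?s. c X i)"
  unfolding conv_corner_def corner_sum_def
  proof (rule sum.cong[OF refl])
    fix X assume "X \<in> {..?s}"
    hence e: "X + (?s - X) = ?s" by simp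
    show "sphere_card q X * sphere_card q (?s - X) * (\<Sum>i=X..<X + (?s - X). (real X + real (X + (?s - X)) - real i - 1/2) * q ^ i)
      = (\<Sum>i=X..<?s. c X i)"
      unfolding e c_def by (rule sum_distrib_left)
  qed
  also have "\<dots> = (\<Sum>X<?s. \<Sum>i=X..<?s. c X i)"
    by (simp add: lessThan_Suc_atMost)
  also have "\<dots> = (\<Sum>X<?s. \<Sum>i<?s. if X \<le> i then c X i else 0)"
    by (intro sum.cong refl sum.mono_neutral_cong_left) auto
  also have "\<dots> = (\<Sum>i<?s. \<Sum>X<?s. if X \<le> i then c X i else 0)"
    by (rule sum.swap)
  also have "\<dots> = (\<Sum>i<?s. \<Sum>X\<le>i. c X i)"
    by (intro sum.cong refl sum.mono_neutral_cong_right) auto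
  also have "\<dots> = (\<Sum>i<?s. (q - 1) * q ^ p / q * (q ^ Suc i * f (Suc i) - q ^ i * f i))"
  proof (intro sum.cong refl)
    fix i assume i: "i \<in> {..<?s}"
    have aux: "(\<Sum>X<j. real X + 1 + real ?s - real i - 1/2) = real j * (real ?s - real i) + (real j)\<^sup>2 / 2" for j
      by (induction j) (simp_all add: power2_eq_square field_simps)
    have "(\<Sum>X\<le>i. c X i) = c 0 i + (\<Sum>X<i. c (Suc X) i)"
      by (rule sum.atMost_shift)
    also have "c 0 i = (q - 1) * q ^ p * ((real ?s - real i - 1/2) * q ^ i)"
      unfolding c_def by (simp add: algebra_simps)
    also have "(\<Sum>X<i. c (Suc X) i) = (\<Sum>X<i. (q - 1)\<^sup>2 * q ^ p / q * q ^ i * (real X + 1 + real ?s - real i - 1/2))"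
    proof (intro sum.cong refl)
      fix X assume "X \<in> {..<i}"
      hence "Suc X \<le> p" using i by auto
      from sphere_card_mult[OF assms this]
      show "c (Suc X) i = (q - 1)\<^sup>2 * q ^ p / q * q ^ i * (real X + 1 + real ?s - real i - 1/2)"
        unfolding c_def by simp
    qed
    also have "\<dots> = (q - 1)\<^sup>2 * q ^ p / q * q ^ i * (real i * (real ?s - real i) + (real i)\<^sup>2 / 2)"
      unfolding aux[symmetric] by (simp add: sum_distrib_left)
    finally show "(\<Sum>X\<le>i. c X i) = (q - 1) * q ^ p / q * (q ^ Suc i * f (Suc i) - q ^ i * f i)"
      using assms by (simp add: f_def power2_eq_square field_simps)
  qed
  also have "\<dots> = (q - 1) * q ^ p / q * (\<Sum>i<?s. q ^ Suc i * f (Suc i) - q ^ i * f i)"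
    by (rule sum_distrib_left[symmetric])
  also have "(\<Sum>i<?s. q ^ Suc i * f (Suc i) - q ^ i * f i) = q ^ ?s * f ?s"
    by (subst sum_lessThan_telescope) (simp add: f_def)
  also have "f ?s = (real ?s)\<^sup>2 / 2" by (simp add: f_def power2_eq_square)
  finally have "conv_corner q ?s = (q - 1) * q ^ p / q * (q ^ ?s * ((real ?s)\<^sup>2 / 2))" .
  moreover have "q ^ (2 * p) = q ^ p * q ^ p" by (simp only: mult_2 power_add)
  ultimately show ?thesis using assms by (simp only: power_Suc) (simp add: field_simps)
qed

text \<open>The correction subtracted on the triangle X + Y \<le> n, without its part that depends
  on N. The two corner terms have equal sums by the symmetry of X and Y, whence the factor
  2.\<close>

definition triangle_part :: "real \<Rightarrow> nat \<Rightarrow> real" where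
  "triangle_part q n = (\<Sum>s\<le>n. real s * conv_card q s * (\<Sum>Z=s..<n. q ^ Z) + 2 * conv_corner q s)"

text \<open>Raising n by 1 adds q^n to every inner sum and one new layer s = n + 1 whose inner sum
  is empty. The increment is thus \<open>conv_moment\<close> times q^n plus twice
  \<open>conv_corner\<close>, both known in closed form.\<close>

lemma triangle_part_eq:
  assumes "q \<noteq> 0"
  shows "triangle_part q n = real n * (real n + 1) * q ^ (2 * n) / q - (\<Sum>i=1..n. real i * (q ^ (2*i-1) + q ^ (2*i-2)))"
proof (induction n)
  case 0
  show ?case by (simp add: triangle_part_def conv_corner_def corner_sum_def)
next
  case (Suc n)
  have "triangle_part q (Suc n) = (\<Sum>s\<le>n. real s * conv_card q s * (\<Sum>Z=s..<Suc n. q ^ Z) + 2 * conv_corner q s) + 2 * conv_corner q (Suc n)"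
    by (simp add: triangle_part_def)
  also have "(\<Sum>s\<le>n. real s * conv_card q s * (\<Sum>Z=s..<Suc n. q ^ Z) + 2 * conv_corner q s)
     = (\<Sum>s\<le>n. real s * conv_card q s * (\<Sum>Z=s..<n. q ^ Z) + 2 * conv_corner q s + real s * conv_card q s * q ^ n)"
    by (intro sum.cong refl) (simp add: algebra_simps)
  also have "\<dots> = triangle_part q n + conv_moment q n * q ^ n"
    by (simp add: triangle_part_def conv_moment_def sum.distrib sum_distrib_right)
  finally have r: "triangle_part q (Suc n) = triangle_part q n + conv_moment q n * q ^ n + 2 * conv_corner q (Suc n)" .
  have "(\<Sum>i=1..Suc n. real i * (q ^ (2*i-1) + q ^ (2*i-2)))
     = (\<Sum>i=1..n. real i * (q ^ (2*i-1) + q ^ (2*i-2))) + real (Suc n) * (q ^ (2 * n) * q + q ^ (2 * n))"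
    by simp
  moreover have "q ^ (2 * Suc n) = q * q * (q ^ n * q ^ n)" "q ^ (2 * n) = q ^ n * q ^ n"
    by (simp_all add: mult_2 power_add)
  moreover have "a + n * (n + 1) * (q - 1) * x / q * x + 2 * ((n + 1)\<^sup>2 / 2 * (q - 1) * (x * x)) =
      (n + 1) * (n + 1 + 1) * (q * q * (x * x)) / q - (b + (n + 1) * (x * x * q + x * x))"
    if "a = n * (n + 1) * (x * x) / q - b" for a b n x :: real
    using assms unfolding that by (simp add: power2_eq_square field_simps)
  note this[OF Suc.IH[unfolded \<open>q ^ (2 * n) = q ^ n * q ^ n\<close>]]
  ultimately show ?case unfolding r conv_moment_eq[OF assms] conv_corner_Suc[OF assms] of_nat_Suc
    by (simp only: add.commute of_nat_Suc)
qed

text \<open>The factor n - s is the excess of max n s over s. Raising n by 1 adds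
  \<open>conv_moment\<close> at n.\<close>

lemma conv_card_hill:
  assumes "q \<noteq> 0"
  shows "(\<Sum>s\<le>n. (real n - real s) * real s * conv_card q s) =
    real n * (real n + 1) * q ^ n / q - 2 * (\<Sum>k<n. real k * q ^ k) - 2 * (\<Sum>k<n. q ^ k)"
proof (induction n)
  case (Suc n)
  have st: "(\<Sum>s\<le>Suc n. (real (Suc n) - real s) * real s * conv_card q s)
      = (\<Sum>s\<le>n. (real n - real s) * real s * conv_card q s) + conv_moment q n"
  proof -
    have "(\<Sum>s\<le>Suc n. (real (Suc n) - real s) * real s * conv_card q s)
       = (\<Sum>s\<le>n. (real n - real s) * real s * conv_card q s + real s * conv_card q s)"
      by (simp add: algebra_simps)
    thus ?thesis by (simp only: sum.distrib conv_moment_def)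
  qed
  show ?case unfolding st Suc.IH conv_moment_eq[OF assms] using assms
    by (simp add: power2_eq_square field_simps)
qed simp

text \<open>The cross term XY produces a product of two first moments and with it the square of a
  geometric sum, whereas the final formula is linear in such sums; this identity eliminates the
  square.\<close>

lemma geometric_sum_square:
  "(\<Sum>k<n. q ^ k)\<^sup>2 = (\<Sum>k<n. real k * q ^ k) + (\<Sum>k<n. q ^ k)
     + q ^ n * ((real n - 1) * (\<Sum>k<n. q ^ k) - (\<Sum>k<n. real k * q ^ k :: real))"
proof (induction n)
  case (Suc n)
  have g: "(q - 1) * (\<Sum>k<n. q ^ k) = q ^ n - 1" by (induction n) (simp_all add: algebra_simps)
  have p: "(q - 1) * (\<Sum>k<n. real k * q ^ k) = real n * q ^ n - (\<Sum>k<n. q ^ k) * q" 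
    by (induction n) (simp_all add: algebra_simps)
  let ?G = "\<Sum>k<n. q ^ k" and ?P = "\<Sum>k<n. real k * q ^ k"
  have "(?G + q ^ n)\<^sup>2 - (?P + real n * q ^ n + (?G + q ^ n) + q ^ Suc n * (real n * (?G + q ^ n) - (?P + real n * q ^ n)))
     = ?G\<^sup>2 - (?P + ?G + q ^ n * ((real n - 1) * ?G - ?P))
       + q ^ n * ((1 + real n) * ?G + q ^ n - real n - 1 - ?P + q * ?P - q * real n * ?G)"
    by (simp add: power2_eq_square algebra_simps)
  also have "(1 + real n) * ?G + q ^ n - real n - 1 - ?P + q * ?P - q * real n * ?G
     = ?G - real n * ((q - 1) * ?G) + (q - 1) * ?P + q ^ n - real n - 1"
    by (simp add: algebra_simps)
  also have "\<dots> = 0" unfolding p unfolding g using g by (simp add: algebra_simps)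
  finally show ?case using Suc.IH by simp
qed simp

text \<open>
  The weights summed over the admissible upper right entries, X and Y being the orders of the poles
  of the two entries next to the diagonal.
\<close>

definition fiber_sum :: "real \<Rightarrow> nat \<Rightarrow> nat \<Rightarrow> nat \<Rightarrow> nat \<Rightarrow> real" where
  "fiber_sum q n N X Y = (if X + Y \<le> n
     then (\<Sum>Z\<le>N. sphere_card q Z * (real (max (X + Y) Z) * real (X + Y) - ((real X)\<^sup>2 + (real Y)\<^sup>2) / 2
           - corner X Y Z - corner Y X Z))
     else q ^ N * (real (X + Y + N - n) * real (X + Y) - ((real X)\<^sup>2 + (real Y)\<^sup>2) / 2))"

text \<open>Both cases receive the same main term, so that the case distinction is left only in
  corrections supported on the triangle X + Y \<le> n.\<close>

lemma fiber_sum_eq: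
  assumes "n \<le> N" "X \<le> n" "Y \<le> n"
  shows "fiber_sum q n N X Y = q ^ N * ((real N - real n + real (max n (X + Y))) * real (X + Y) - ((real X)\<^sup>2 + (real Y)\<^sup>2) / 2)
    - (if X + Y \<le> n then real (X + Y) * (\<Sum>Z=X+Y..<n. q ^ Z) + real (X + Y) * (\<Sum>Z=n..<N. q ^ Z)
          + corner_sum q X Y + corner_sum q Y X else 0)"
proof (cases "X + Y \<le> n")
  case True
  let ?s = "X + Y"
  have "fiber_sum q n N X Y = (\<Sum>Z\<le>N. sphere_card q Z * real (max ?s Z) * real ?s - sphere_card q Z * (((real X)\<^sup>2 + (real Y)\<^sup>2) / 2)
        - sphere_card q Z * corner X Y Z - sphere_card q Z * corner Y X Z)"
    unfolding fiber_sum_def using True by (simp add: algebra_simps)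
  also have "\<dots> = (\<Sum>Z\<le>N. sphere_card q Z * real (max ?s Z)) * real ?s - (\<Sum>Z\<le>N. sphere_card q Z) * (((real X)\<^sup>2 + (real Y)\<^sup>2) / 2)
     - (\<Sum>Z\<le>N. sphere_card q Z * corner X Y Z) - (\<Sum>Z\<le>N. sphere_card q Z * corner Y X Z)"
    by (simp add: sum_subtractf sum_distrib_right)
  also have "\<dots> = (real N * q ^ N - (\<Sum>Z=?s..<N. q ^ Z)) * real ?s - q ^ N * (((real X)\<^sup>2 + (real Y)\<^sup>2) / 2)
      - corner_sum q X Y - corner_sum q Y X"
    using True assms by (simp add: sum_sphere_card_max sum_sphere_card_0 sum_sphere_card_corner)
  also have "(\<Sum>Z=?s..<N. q ^ Z) = (\<Sum>Z=?s..<n. q ^ Z) + (\<Sum>Z=n..<N. q ^ Z)"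
    using True assms by (simp add: sum.atLeastLessThan_concat)
  finally show ?thesis using True assms by (simp add: algebra_simps)
next
  case False
  thus ?thesis using assms by (simp add: fiber_sum_def max_def of_nat_diff)
qed

lemma sum_triangle:
  fixes n :: nat
  shows
  "(\<Sum>X\<le>n. \<Sum>Y\<le>n. if X + Y \<le> n then F X Y else 0) = (\<Sum>s\<le>n. \<Sum>X\<le>s. F X (s - X) :: real)"
proof -
  have "(\<Sum>X\<le>n. \<Sum>Y\<le>n. if X + Y \<le> n then F X Y else 0) = (\<Sum>(X,Y)\<in>{..n}\<times>{..n}. if X + Y \<le> n then F X Y else 0)"
    by (simp add: sum.cartesian_product)
  also have "\<dots> = (\<Sum>(X,Y)\<in>{(i,j). i + j \<le> n}. F X Y)"
    by (rule sum.mono_neutral_cong_right) (auto split: if_splits)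
  also have "\<dots> = (\<Sum>s\<le>n. \<Sum>X\<le>s. F X (s - X))"
    by (rule sum.triangle_reindex_eq)
  finally show ?thesis .
qed

text \<open>The final comparison as an identity of rational functions: x is q^n, d is N - n, y is
  q^d, G and P are the sums of q^k and k q^k over k < n, and S is the sum contributed by
  \<open>triangle_part\<close>.\<close>

lemma hexagon_polynomial:
  fixes n d x y G P S q :: real
  assumes "q \<noteq> 0" and sq: "(n * x - G)\<^sup>2 = n\<^sup>2 * x\<^sup>2 - 2 * n * x * G + (P + G + x * ((n - 1) * G - P))"
  shows "x * y * (d * (2 * (n * x - G) * x) + ((n\<^sup>2 * x - 2 * P - G) * x + 2 * (n * x - G)\<^sup>2))
     + x * y * (n * (n + 1) * x / q - 2 * P - 2 * G) - n * (n + 1) * (x * y - x) * x / q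
     - (n * (n + 1) * (x * x) / q - S)
   = S + (x * x * y * (- (2 * (n + d)) - 3) * G - 4 * (x * x * y) * P) + (n\<^sup>2 + 2 * n * (n + d)) * (x * x * x * y)"
  unfolding sq using assms(1) by (simp add: power2_eq_square field_simps)

theorem hexagon_sum:
  assumes q: "q \<noteq> 0" and nN: "n \<le> N"
  shows "(\<Sum>X\<le>n. \<Sum>Y\<le>n. sphere_card q X * sphere_card q Y * fiber_sum q n N X Y) =
    (\<Sum>i=1..n. real i * (q ^ (2*i-1) + q ^ (2*i-2)))
    + (\<Sum>i=n+N..<2*n+N. (4 * real n + 2 * real N - 4 * real i - 3) * q ^ i)
    + ((real n)\<^sup>2 + 2 * real n * real N) * q ^ (2 * n + N)"
proof -
  let ?m = "sphere_card q"
  let ?G = "\<Sum>k<n. q ^ k" and ?P = "\<Sum>k<n. real k * q ^ k"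
  obtain d where N: "N = n + d" using nN le_Suc_ex by blast
  have geo: "(q - 1) * (\<Sum>Z=n..<n+j. q ^ Z) = q ^ (n + j) - q ^ n" for j
    by (induction j) (simp_all add: algebra_simps)
  have tri: "(\<Sum>X\<le>n. \<Sum>Y\<le>n. ?m X * ?m Y * (if X + Y \<le> n then F X Y else 0)) = (\<Sum>s\<le>n. \<Sum>X\<le>s. ?m X * ?m (s - X) * F X (s - X))" for F
  proof -
    have "(\<Sum>X\<le>n. \<Sum>Y\<le>n. ?m X * ?m Y * (if X + Y \<le> n then F X Y else 0)) =
       (\<Sum>X\<le>n. \<Sum>Y\<le>n. if X + Y \<le> n then ?m X * ?m Y * F X Y else 0)"
      by (intro sum.cong refl) simp
    thus ?thesis unfolding sum_triangle .
  qed
  \<comment> \<open>Here max n (X + Y) is X + Y plus the excess n - (X + Y) on the triangle. The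
    part without excess is a polynomial in X and Y, by (X + Y)^2 - (X^2 + Y^2)/2 = X^2/2 + Y^2/2 +
    2XY, and its double sum factors.\<close>
  have "(\<Sum>X\<le>n. \<Sum>Y\<le>n. ?m X * ?m Y * fiber_sum q n N X Y) =
     (\<Sum>X\<le>n. \<Sum>Y\<le>n. q ^ N * (real d * (?m X * real X * ?m Y + ?m X * (?m Y * real Y))
         + ((?m X * (real X)\<^sup>2) * ?m Y / 2 + ?m X * (?m Y * (real Y)\<^sup>2) / 2 + 2 * ((?m X * real X) * (?m Y * real Y))))
       + q ^ N * (?m X * ?m Y * (if X + Y \<le> n then (real n - real (X + Y)) * real (X + Y) else 0))
       - (\<Sum>Z=n..<N. q ^ Z) * (?m X * ?m Y * (if X + Y \<le> n then real (X + Y) else 0))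
       - ?m X * ?m Y * (if X + Y \<le> n then real (X + Y) * (\<Sum>Z=X+Y..<n. q ^ Z) + corner_sum q X Y + corner_sum q Y X else 0))"
    (is "_ = (\<Sum>X\<le>n. \<Sum>Y\<le>n. ?T X Y)")
  proof (intro sum.cong refl)
    fix X Y assume "X \<in> {..n}" "Y \<in> {..n}"
    hence XY: "X \<le> n" "Y \<le> n" by auto
    show "?m X * ?m Y * fiber_sum q n N X Y = ?T X Y"
    proof (cases "X + Y \<le> n")
      case True
      show ?thesis unfolding fiber_sum_eq[OF nN XY] using True N
        by (simp add: max_def power2_eq_square field_simps)
    next
      case False
      show ?thesis unfolding fiber_sum_eq[OF nN XY] using False N
        by (simp add: max_def power2_eq_square field_simps)
    qed
  qed
  also have "\<dots> = q ^ N * (real d * ((\<Sum>X\<le>n. ?m X * real X) * (\<Sum>Y\<le>n. ?m Y) + (\<Sum>X\<le>n. ?m X) * (\<Sum>Y\<le>n. ?m Y * real Y))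
       + ((\<Sum>X\<le>n. ?m X * (real X)\<^sup>2) * (\<Sum>Y\<le>n. ?m Y) / 2 + (\<Sum>X\<le>n. ?m X) * (\<Sum>Y\<le>n. ?m Y * (real Y)\<^sup>2) / 2
          + 2 * ((\<Sum>X\<le>n. ?m X * real X) * (\<Sum>Y\<le>n. ?m Y * real Y))))
     + q ^ N * (\<Sum>X\<le>n. \<Sum>Y\<le>n. ?m X * ?m Y * (if X + Y \<le> n then (real n - real (X + Y)) * real (X + Y) else 0))
     - (\<Sum>Z=n..<N. q ^ Z) * (\<Sum>X\<le>n. \<Sum>Y\<le>n. ?m X * ?m Y * (if X + Y \<le> n then real (X + Y) else 0))
     - (\<Sum>X\<le>n. \<Sum>Y\<le>n. ?m X * ?m Y * (if X + Y \<le> n then real (X + Y) * (\<Sum>Z=X+Y..<n. q ^ Z) + corner_sum q X Y + corner_sum q Y X else 0))"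
    by (simp only: sum_subtractf sum.distrib sum_distrib_left[symmetric] sum_distrib_right[symmetric] sum_divide_distrib[symmetric])
  also have "(\<Sum>X\<le>n. \<Sum>Y\<le>n. ?m X * ?m Y * (if X + Y \<le> n then (real n - real (X + Y)) * real (X + Y) else 0))
     = (\<Sum>s\<le>n. (real n - real s) * real s * conv_card q s)"
    unfolding tri conv_card_def sum_distrib_left by (intro sum.cong refl) (simp add: mult_ac)
  also have "(\<Sum>X\<le>n. \<Sum>Y\<le>n. ?m X * ?m Y * (if X + Y \<le> n then real (X + Y) else 0)) = conv_moment q n"
    unfolding tri conv_moment_def conv_card_def sum_distrib_left by (intro sum.cong refl) (simp add: mult_ac)
  also have "(\<Sum>X\<le>n. \<Sum>Y\<le>n. ?m X * ?m Y * (if X + Y \<le> n then real (X + Y) * (\<Sum>Z=X+Y..<n. q ^ Z) + corner_sum q X Y + corner_sum q Y X else 0))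
     = triangle_part q n"
    unfolding tri triangle_part_def
  proof (intro sum.cong refl)
    fix s
    have "(\<Sum>X\<le>s. ?m X * ?m (s - X) * corner_sum q (s - X) X) = (\<Sum>X\<le>s. ?m (s - X) * ?m (s - (s - X)) * corner_sum q (s - X) (s - (s - X)))"
      by (intro sum.cong refl) simp
    also have "\<dots> = conv_corner q s" unfolding conv_corner_def
      using sum.atLeastAtMost_rev[of "\<lambda>X. ?m X * ?m (s - X) * corner_sum q X (s - X)" 0 s]
      by (simp add: atMost_atLeast0)
    finally have sw: "(\<Sum>X\<le>s. ?m X * ?m (s - X) * corner_sum q (s - X) X) = conv_corner q s" .
    have "(\<Sum>X\<le>s. ?m X * ?m (s - X) * (real (X + (s - X)) * (\<Sum>Z=X+(s - X)..<n. q ^ Z) + corner_sum q X (s - X) + corner_sum q (s - X) X))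
      = (\<Sum>X\<le>s. ?m X * ?m (s - X) * (real s * (\<Sum>Z=s..<n. q ^ Z)) + ?m X * ?m (s - X) * corner_sum q X (s - X) + ?m X * ?m (s - X) * corner_sum q (s - X) X)"
      by (intro sum.cong refl) (simp add: ring_distribs)
    also have "\<dots> = conv_card q s * (real s * (\<Sum>Z=s..<n. q ^ Z)) + conv_corner q s + conv_corner q s"
      by (simp only: sum.distrib sum_distrib_right[symmetric] sw conv_card_def[symmetric] conv_corner_def[symmetric])
    finally show "(\<Sum>X\<le>s. ?m X * ?m (s - X) * (real (X + (s - X)) * (\<Sum>Z=X+(s - X)..<n. q ^ Z) + corner_sum q X (s - X) + corner_sum q (s - X) X))
      = real s * conv_card q s * (\<Sum>Z=s..<n. q ^ Z) + 2 * conv_corner q s" by simp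
  qed
  also have "(\<Sum>Z=n..<N. q ^ Z) * conv_moment q n = real n * (real n + 1) * (q ^ N - q ^ n) * q ^ n / q"
    unfolding conv_moment_eq[OF q] N geo[symmetric] by simp
  finally have J: "(\<Sum>X\<le>n. \<Sum>Y\<le>n. ?m X * ?m Y * fiber_sum q n N X Y) =
     q ^ N * (real d * (2 * (real n * q ^ n - ?G) * q ^ n) + (((real n)\<^sup>2 * q ^ n - 2 * ?P - ?G) * q ^ n + 2 * (real n * q ^ n - ?G)\<^sup>2))
     + q ^ N * (real n * (real n + 1) * q ^ n / q - 2 * ?P - 2 * ?G)
     - real n * (real n + 1) * (q ^ N - q ^ n) * q ^ n / q
     - (real n * (real n + 1) * q ^ (2 * n) / q - (\<Sum>i=1..n. real i * (q ^ (2*i-1) + q ^ (2*i-2))))"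
    unfolding sum_sphere_card_0 sum_sphere_card_1 sum_sphere_card_2 conv_card_hill[OF q] triangle_part_eq[OF q]
    by (simp add: power2_eq_square algebra_simps)
  \<comment> \<open>After a shift of the index by n + N the coefficient is -2N - 3 - 4j.\<close>
  have "(\<Sum>i=n+N..<2*n+N. (4 * real n + 2 * real N - 4 * real i - 3) * q ^ i)
     = (\<Sum>j<n. (4 * real n + 2 * real N - 4 * real (j + (n + N)) - 3) * q ^ (j + (n + N)))"
  proof -
    have e: "{n+N..<2*n+N} = {0+(n+N)..<n+(n+N)}" by (simp only: add_0 mult_2 add.assoc)
    show ?thesis unfolding e sum.shift_bounds_nat_ivl atLeast0LessThan by (rule refl)
  qed
  also have "\<dots> = (\<Sum>j<n. q ^ (n + N) * (- (2 * real N) - 3) * q ^ j - 4 * q ^ (n + N) * (real j * q ^ j))"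
    by (intro sum.cong refl) (simp add: power_add algebra_simps)
  also have "\<dots> = q ^ (n + N) * (- (2 * real N) - 3) * ?G - 4 * q ^ (n + N) * ?P"
    by (simp only: sum_subtractf sum_distrib_left[symmetric])
  finally have mid: "(\<Sum>i=n+N..<2*n+N. (4 * real n + 2 * real N - 4 * real i - 3) * q ^ i) =
      q ^ (n + N) * (- (2 * real N) - 3) * ?G - 4 * q ^ (n + N) * ?P" .
  have sq: "(real n * q ^ n - ?G)\<^sup>2 = (real n)\<^sup>2 * (q ^ n)\<^sup>2 - 2 * real n * q ^ n * ?G + (?P + ?G + q ^ n * ((real n - 1) * ?G - ?P))"
    unfolding geometric_sum_square[symmetric] by (simp add: power2_eq_square algebra_simps)
  have pw: "q ^ N = q ^ n * q ^ d" "q ^ (n + N) = q ^ n * q ^ n * q ^ d" "q ^ (2 * n + N) = q ^ n * q ^ n * q ^ n * q ^ d"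
    "q ^ (2 * n) = q ^ n * q ^ n" "real N = real n + real d"
    by (simp_all add: N power_add mult_2)
  show ?thesis unfolding J mid unfolding pw by (rule hexagon_polynomial[OF q sq])
qed

section \<open>Characters of Levi subgroups\<close>

text \<open>Artin's independence of characters.\<close>

lemma character_in_span:
  fixes \<psi> :: "'g \<Rightarrow> 'k::field" and L :: "('k \<times> ('g \<Rightarrow> 'k)) list"
  assumes H: "H \<noteq> {}" "\<And>g h. g \<in> H \<Longrightarrow> h \<in> H \<Longrightarrow> op g h \<in> H"
    and \<psi>: "\<And>g. g \<in> H \<Longrightarrow> \<psi> g \<noteq> 0" "\<And>g h. g \<in> H \<Longrightarrow> h \<in> H \<Longrightarrow> \<psi> (op g h) = \<psi> g * \<psi> h"
    and L: "\<And>c f g h. (c, f) \<in> set L \<Longrightarrow> g \<in> H \<Longrightarrow> h \<in> H \<Longrightarrow> f (op g h) = f g * f h"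
    and eq: "\<And>g. g \<in> H \<Longrightarrow> \<psi> g = (\<Sum>(c, f)\<leftarrow>L. c * f g)"
  shows "\<exists>(c, f)\<in>set L. \<forall>g\<in>H. f g = \<psi> g"
  using L eq
proof (induction L arbitrary: rule: measure_induct_rule[of length])
  case (less L)
  show ?case
  proof (cases L)
    case Nil
    obtain g where "g \<in> H" using H(1) by blast
    thus ?thesis using \<psi>(1)[of g] less.prems(2)[of g] Nil by simp
  next
    case (Cons a L')
    obtain c0 f0 where a: "a = (c0, f0)" by (cases a)
    show ?thesis
    proof (cases "\<forall>g\<in>H. f0 g = \<psi> g")
      case True
      thus ?thesis using Cons a by auto
    next
      case False
      then obtain h where h: "h \<in> H" "\<psi> h - f0 h \<noteq> 0" by auto
      \<comment> \<open>The identity at the product of h and g minus f0 h times the identity at g no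
        longer contains f0; the coefficient \<psi> h - f0 h that appears before \<psi> g is nonzero
        by the choice of h.\<close>
      define L2 where "L2 = map (\<lambda>(c, f). (c * (f h - f0 h) / (\<psi> h - f0 h), f)) L'"
      have "\<exists>(c, f)\<in>set L2. \<forall>g\<in>H. f g = \<psi> g"
      proof (rule less.IH)
        show "length L2 < length L" by (simp add: L2_def Cons)
        show "f (op g h) = f g * f h" if "(c, f) \<in> set L2" "g \<in> H" "h \<in> H" for c f g h
          using that less.prems(1)[of _ f g h] unfolding L2_def Cons by auto
        fix g assume g: "g \<in> H"
        have "\<psi> h * \<psi> g = \<psi> (op h g)" using \<psi>(2)[OF h(1) g] by simp
        also have "\<dots> = c0 * f0 (op h g) + (\<Sum>(c, f)\<leftarrow>L'. c * f (op h g))"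
          using less.prems(2)[OF H(2)[OF h(1) g]] by (simp add: Cons a)
        also have "(\<Sum>(c, f)\<leftarrow>L'. c * f (op h g)) = (\<Sum>(c, f)\<leftarrow>L'. c * (f h * f g))"
        proof (intro arg_cong[of _ _ sum_list] map_cong refl)
          fix x assume x: "x \<in> set L'"
          obtain c f where cf: "x = (c, f)" by (cases x)
          have "(c, f) \<in> set L" using x cf Cons by simp
          from less.prems(1)[OF this h(1) g]
          show "(case x of (c, f) \<Rightarrow> c * f (op h g)) = (case x of (c, f) \<Rightarrow> c * (f h * f g))" by (simp add: cf)
        qed
        also have "f0 (op h g) = f0 h * f0 g" using less.prems(1)[OF _ h(1) g, of c0 f0] by (simp add: Cons a)
        finally have 1: "\<psi> h * \<psi> g = c0 * (f0 h * f0 g) + (\<Sum>(c, f)\<leftarrow>L'. c * (f h * f g))" .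
        have "\<psi> g = c0 * f0 g + (\<Sum>(c, f)\<leftarrow>L'. c * f g)" using less.prems(2)[OF g] by (simp add: Cons a)
        hence 2: "f0 h * \<psi> g = c0 * (f0 h * f0 g) + f0 h * (\<Sum>(c, f)\<leftarrow>L'. c * f g)" by (simp add: algebra_simps)
        have "(\<psi> h - f0 h) * \<psi> g = (\<Sum>(c, f)\<leftarrow>L'. c * (f h * f g)) - f0 h * (\<Sum>(c, f)\<leftarrow>L'. c * f g)"
          using 1 2 by (simp add: algebra_simps)
        also have "\<dots> = (\<Sum>(c, f)\<leftarrow>L'. c * (f h - f0 h) * f g)"
          by (induction L') (auto simp: algebra_simps)
        finally have "\<psi> g = (\<Sum>(c, f)\<leftarrow>L'. c * (f h - f0 h) * f g) / (\<psi> h - f0 h)"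
          using h(2) by (simp add: field_simps)
        also have "\<dots> = (\<Sum>(c, f)\<leftarrow>L2. c * f g)"
          unfolding L2_def by (induction L') (auto simp: add_divide_distrib)
        finally show "\<psi> g = (\<Sum>(c, f)\<leftarrow>L2. c * f g)" .
      qed
      thus ?thesis unfolding L2_def Cons by auto
    qed
  qed
qed

definition monomial_fun :: "(3 \<Rightarrow> nat) \<Rightarrow> ('a::field) mat3 \<Rightarrow> 'a fls" where
  "monomial_fun k t = (\<Prod>i\<in>UNIV. (t $ i $ i) ^ k i)"

lemma polynomial_fun_diag:
  fixes f :: "('a::field) mat3 \<Rightarrow> 'a fls"
  assumes "polynomial_fun f"
  shows "\<exists>L. \<forall>t. (\<forall>i j. i \<noteq> j \<longrightarrow> t $ i $ j = 0) \<longrightarrow> f t = (\<Sum>(c, k)\<leftarrow>L. c * monomial_fun k t)"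
  using assms
proof induction
  case (const c)
  show ?case by (rule exI[of _ "[(c, \<lambda>_. 0)]"]) (simp add: monomial_fun_def)
next
  case (entry i j)
  show ?case
  proof (cases "i = j")
    case True
    have "(\<Prod>a\<in>UNIV. (t $ a $ a) ^ (if a = j then 1 else 0 :: nat)) = t $ j $ j" for t :: "'a mat3"
    proof -
      have "(\<Prod>a\<in>UNIV. (t $ a $ a) ^ (if a = j then 1 else 0 :: nat)) = (\<Prod>a\<in>UNIV. if a = j then t $ a $ a else 1)"
        by (intro prod.cong) auto
      thus ?thesis by simp
    qed
    thus ?thesis using True by (intro exI[of _ "[(1, \<lambda>a. if a = j then 1 else 0)]"]) (simp add: monomial_fun_def)
  next
    case False
    thus ?thesis by (intro exI[of _ "[]"]) simp
  qed
next
  case (add f h)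
  then obtain L1 L2 where "\<forall>t. (\<forall>i j. i \<noteq> j \<longrightarrow> t $ i $ j = 0) \<longrightarrow> f t = (\<Sum>(c, k)\<leftarrow>L1. c * monomial_fun k t)"
    "\<forall>t. (\<forall>i j. i \<noteq> j \<longrightarrow> t $ i $ j = 0) \<longrightarrow> h t = (\<Sum>(c, k)\<leftarrow>L2. c * monomial_fun k t)" by blast
  thus ?case by (intro exI[of _ "L1 @ L2"]) simp
next
  case (mult f h)
  then obtain L1 L2 where L: "\<forall>t. (\<forall>i j. i \<noteq> j \<longrightarrow> t $ i $ j = 0) \<longrightarrow> f t = (\<Sum>(c, k)\<leftarrow>L1. c * monomial_fun k t)"
    "\<forall>t. (\<forall>i j. i \<noteq> j \<longrightarrow> t $ i $ j = 0) \<longrightarrow> h t = (\<Sum>(c, k)\<leftarrow>L2. c * monomial_fun k t)" by blast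
  have mm: "monomial_fun (\<lambda>i. k i + k' i) t = monomial_fun k t * monomial_fun k' t" for k k' and t :: "'a mat3"
    by (simp add: monomial_fun_def power_add prod.distrib)
  have 1: "(\<Sum>(c', k')\<leftarrow>map (\<lambda>(c', k'). (c * c', \<lambda>i. k i + k' i)) L2. c' * monomial_fun k' t)
      = c * monomial_fun k t * (\<Sum>(c, k)\<leftarrow>L2. c * monomial_fun k t)" for c k and t :: "'a mat3"
    by (induction L2) (auto simp: mm algebra_simps)
  have "(\<Sum>(c, k)\<leftarrow>concat (map (\<lambda>(c, k). map (\<lambda>(c', k'). (c * c', \<lambda>i. k i + k' i)) L2) L1). c * monomial_fun k t)
      = (\<Sum>(c, k)\<leftarrow>L1. c * monomial_fun k t) * (\<Sum>(c, k)\<leftarrow>L2. c * monomial_fun k t)" for t :: "'a mat3"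
    by (induction L1) (auto simp: 1[unfolded map_map] ring_distribs)
  thus ?case using L by (intro exI[of _ "concat (map (\<lambda>(c, k). map (\<lambda>(c', k'). (c * c', \<lambda>i. k i + k' i)) L2) L1)"]) simp
qed

lemma diag_mult: "diag d ** diag e = diag (\<lambda>i. d i * e i)"
  by (simp add: vec_eq_iff matrix_matrix_mult_def if_distrib[where f = "\<lambda>x. x * _"] cong: if_cong)

lemma torus_mult:
  assumes "s \<in> torus" "t \<in> torus"
  shows "s ** t \<in> torus"
proof -
  obtain d where d: "\<forall>i. d i \<noteq> 0" "s = diag d" using assms(1) unfolding torus_iff_diag by (elim exE conjE)
  obtain e where e: "\<forall>i. e i \<noteq> 0" "t = diag e" using assms(2) unfolding torus_iff_diag by (elim exE conjE)
  have "\<forall>i. d i * e i \<noteq> 0" using d(1) e(1) by simp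
  thus ?thesis unfolding d(2) e(2) diag_mult torus_iff_diag by (intro exI[of _ "\<lambda>i. d i * e i"] conjI refl)
qed

lemma torus_nth_mult: "s \<in> torus \<Longrightarrow> t \<in> torus \<Longrightarrow> (s ** t) $ i $ i = s $ i $ i * t $ i $ i"
  unfolding torus_iff_diag by (auto simp: diag_mult)

lemma diag_in_torus: "(\<And>i. d i \<noteq> 0) \<Longrightarrow> diag d \<in> torus"
  unfolding torus_iff_diag by blast

text \<open>M and its intersection with SL3 are treated together: both are closed under products and
  contain the diagonal matrices of determinant 1 and the root subgroups of the blocks.\<close>

definition levi_like :: "(3 \<Rightarrow> nat) \<Rightarrow> ('a::field) mat3 set \<Rightarrow> bool" where
  "levi_like b H \<longleftrightarrow> H = levi b \<or> H = levi b \<inter> SL3"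

lemma levi_mult: "g \<in> levi b \<Longrightarrow> h \<in> levi b \<Longrightarrow> g ** h \<in> levi b"
proof -
  assume g: "g \<in> levi b" and h: "h \<in> levi b"
  have "(g ** h) $ i $ j = 0" if "b i \<noteq> b j" for i j
    unfolding matrix_matrix_mult_def vec_lambda_beta
  proof (intro sum.neutral ballI)
    fix a show "g $ i $ a * h $ a $ j = 0"
      using g h that by (cases "b i = b a") (simp_all add: levi_def)
  qed
  thus ?thesis using g h by (simp add: levi_def mat3_invertible_mult)
qed

lemma levi_like_mult: "levi_like b H \<Longrightarrow> g \<in> H \<Longrightarrow> h \<in> H \<Longrightarrow> g ** h \<in> H"
  by (auto simp: levi_like_def levi_mult SL3_def det_mul)

lemma levi_like_det: "levi_like b H \<Longrightarrow> g \<in> H \<Longrightarrow> det g \<noteq> 0"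
  by (auto simp: levi_like_def levi_def invertible_det)

lemma levi_like_diag: "levi_like b H \<Longrightarrow> (\<And>i. d i \<noteq> 0) \<Longrightarrow> d 1 * d 2 * d 3 = 1 \<Longrightarrow> diag d \<in> H"
  using diag_in_torus[of d] torus_subset_levi by (auto simp: levi_like_def SL3_def det_diag)

lemma levi_like_elem: "levi_like b H \<Longrightarrow> i \<noteq> j \<Longrightarrow> b i = b j \<Longrightarrow> elementary i j x \<in> H"
  using elem_in_levi[of i j b] by (auto simp: levi_like_def SL3_def det_elem)

text \<open>A power of the determinant clears the denominator. On diagonal matrices a polynomial is
  a combination of monomials, so by independence of characters \<psi> times that power is a single
  monomial, and subtracting n from its exponents gives a vector as sought by
  \<open>weight\<close>.\<close>

lemma weight_property:
  fixes \<psi> :: "('a::field) mat3 \<Rightarrow> 'a fls"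
  assumes H: "levi_like b H" and \<psi>: "\<psi> \<in> rational_characters H" and t: "t \<in> torus \<inter> H"
  shows "\<psi> t = (\<Prod>i\<in>UNIV. (t $ i $ i) powi (weight H \<psi> $ i))"
proof -
  obtain f n where f: "polynomial_fun f" "\<And>g. g \<in> H \<Longrightarrow> \<psi> g = f g / det g ^ n"
    and nz: "\<And>g. g \<in> H \<Longrightarrow> \<psi> g \<noteq> 0"
    and mult: "\<And>g h. g \<in> H \<Longrightarrow> h \<in> H \<Longrightarrow> \<psi> (g ** h) = \<psi> g * \<psi> h"
    using \<psi> by (auto simp: rational_characters_def)
  obtain L where L: "\<And>t. (\<forall>i j. i \<noteq> j \<longrightarrow> t $ i $ j = 0) \<Longrightarrow> f t = (\<Sum>(c, k)\<leftarrow>L. c * monomial_fun k t)"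
    using polynomial_fun_diag[OF f(1)] by blast
  define L' where "L' = map (\<lambda>(c, k). (c, monomial_fun k :: 'a mat3 \<Rightarrow> 'a fls)) L"
  have "\<exists>(c, h)\<in>set L'. \<forall>g\<in>torus \<inter> H. h g = \<psi> g * det g ^ n"
  proof (rule character_in_span[where op = "(**)"])
    show "torus \<inter> H \<noteq> {}" using t by blast
    show "g ** h \<in> torus \<inter> H" if "g \<in> torus \<inter> H" "h \<in> torus \<inter> H" for g h
      using that torus_mult levi_like_mult[OF H] by blast
    show "\<psi> g * det g ^ n \<noteq> 0" if "g \<in> torus \<inter> H" for g
      using that nz levi_like_det[OF H] by simp
    show "\<psi> (g ** h) * det (g ** h) ^ n = \<psi> g * det g ^ n * (\<psi> h * det h ^ n)" if "g \<in> torus \<inter> H" "h \<in> torus \<inter> H" for g h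
      using that mult[of g h] by (simp add: det_mul power_mult_distrib)
    show "F (g ** h) = F g * F h" if "(c, F) \<in> set L'" "g \<in> torus \<inter> H" "h \<in> torus \<inter> H" for c F g h
      using that unfolding L'_def by (auto simp: monomial_fun_def torus_nth_mult power_mult_distrib prod.distrib)
    show "\<psi> g * det g ^ n = (\<Sum>(c, h)\<leftarrow>L'. c * h g)" if g: "g \<in> torus \<inter> H" for g
    proof -
      have "\<psi> g * det g ^ n = f g" using f(2)[of g] levi_like_det[OF H, of g] g by simp
      also have "\<dots> = (\<Sum>(c, k)\<leftarrow>L. c * monomial_fun k g)" using g by (intro L) (simp add: torus_def)
      also have "\<dots> = (\<Sum>(c, h)\<leftarrow>L'. c * h g)" unfolding L'_def by (induction L) auto
      finally show ?thesis .
    qed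
  qed
  then obtain k where k: "\<And>g. g \<in> torus \<inter> H \<Longrightarrow> monomial_fun k g = \<psi> g * det g ^ n"
    unfolding L'_def by auto
  have "\<psi> g = (\<Prod>i\<in>UNIV. (g $ i $ i) powi ((\<chi> i. int (k i) - int n) $ i))" if g: "g \<in> torus \<inter> H" for g
  proof -
    obtain d where d: "\<And>i. d i \<noteq> 0" "g = diag d" using g torus_iff_diag by blast
    have "det g = (\<Prod>i\<in>UNIV. d i)" by (simp add: d det_diag prod_perm3[of 1 2 3])
    hence "\<psi> g * (\<Prod>i\<in>UNIV. d i ^ n) = (\<Prod>i\<in>UNIV. d i ^ k i)"
      using k[OF g] by (simp add: d monomial_fun_def prod_power_distrib)
    hence "\<psi> g = (\<Prod>i\<in>UNIV. d i ^ k i) / (\<Prod>i\<in>UNIV. d i ^ n)"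
      using d(1) by (simp add: nonzero_eq_divide_eq)
    also have "\<dots> = (\<Prod>i\<in>UNIV. d i ^ k i / d i ^ n)" by (rule prod_dividef[symmetric])
    also have "\<dots> = (\<Prod>i\<in>UNIV. d i powi (int (k i) - int n))"
      using d(1) by (intro prod.cong refl) (simp add: power_int_diff)
    finally show ?thesis by (simp add: d)
  qed
  hence "\<exists>k. \<forall>t\<in>torus \<inter> H. \<psi> t = (\<Prod>i\<in>UNIV. (t $ i $ i) powi (k $ i))" by blast
  hence "\<forall>t\<in>torus \<inter> H. \<psi> t = (\<Prod>i\<in>UNIV. (t $ i $ i) powi (weight H \<psi> $ i))"
    unfolding weight_def by (rule someI_ex)
  thus ?thesis using t by blast
qed

lemma val_weight:
  fixes \<psi> :: "('a::field) mat3 \<Rightarrow> 'a fls"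
  assumes H: "levi_like b H" and \<psi>: "\<psi> \<in> rational_characters H" and d: "\<And>i. d i \<noteq> 0" "diag d \<in> H"
  shows "val (\<psi> (diag d)) = (\<Sum>i\<in>UNIV. weight H \<psi> $ i * val (d i))"
proof -
  have "val (\<psi> (diag d)) = val (\<Prod>i\<in>UNIV. d i powi (weight H \<psi> $ i))"
    using weight_property[OF H \<psi>, of "diag d"] d diag_in_torus[of d] by simp
  also have "\<dots> = (\<Sum>i\<in>UNIV. val (d i powi (weight H \<psi> $ i)))"
    using d(1) by (simp add: prod_perm3[of 1 2 3] sum_perm3[of 1 2 3] power_int_not_zero)
  finally show ?thesis by simp
qed

lemma elem_mult_nth: "(elementary i j x ** A) $ a $ c = A $ a $ c + (if a = i then x * A $ j $ c else 0)"
proof -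
  have "(elementary i j x ** A) $ a $ c = (\<Sum>k\<in>UNIV. (if a = k then A $ k $ c else 0) + (if k = j then (if a = i then x * A $ j $ c else 0) else 0))"
    unfolding matrix_matrix_mult_def vec_lambda_beta by (intro sum.cong refl) (auto simp: elem_nth algebra_simps)
  thus ?thesis by (simp add: sum.distrib)
qed

lemma mult_elem_nth: "(A ** elementary i j x) $ a $ c = A $ a $ c + (if c = j then A $ a $ i * x else 0)"
proof -
  have "(A ** elementary i j x) $ a $ c = (\<Sum>k\<in>UNIV. (if k = c then A $ a $ c else 0) + (if k = i then (if c = j then A $ a $ i * x else 0) else 0))"
    unfolding matrix_matrix_mult_def vec_lambda_beta by (intro sum.cong refl) (auto simp: elem_nth algebra_simps)
  thus ?thesis by (simp add: sum.distrib)
qed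

lemma elem_add: "i \<noteq> j \<Longrightarrow> elementary i j x ** elementary i j y = elementary i j (x + y)"
  by (simp add: vec_eq_iff elem_mult_nth) (auto simp: elem_nth)

lemma fls_X_ne: "(fls_X :: 'a::field fls) \<noteq> 0" "fls_X * fls_X - (1 :: 'a fls) \<noteq> 0"
proof -
  show nz: "(fls_X :: 'a fls) \<noteq> 0" by simp
  have "val (fls_X * fls_X :: 'a fls) = 2" using nz by simp
  thus "fls_X * fls_X - (1 :: 'a fls) \<noteq> 0" by (metis fls_one_subdegree eq_iff_diff_eq_0 zero_neq_numeral)
qed

definition coroot_diag :: "3 \<Rightarrow> 3 \<Rightarrow> ('a::field) fls \<Rightarrow> 'a mat3" where
  "coroot_diag i j c = diag (\<lambda>a. if a = i then c else if a = j then inverse c else 1)"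

lemma coroot_diag_in: "levi_like b H \<Longrightarrow> i \<noteq> j \<Longrightarrow> c \<noteq> 0 \<Longrightarrow> coroot_diag i j c \<in> H"
  unfolding coroot_diag_def using exhaust_3[of i] exhaust_3[of j] by (intro levi_like_diag) auto

text \<open>Conjugation by the coroot element at \<open>fls_X\<close> multiplies the parameter of
  the root subgroup by \<open>fls_X * fls_X\<close>. So \<psi> agrees at y and at that multiple of
  y; when the multiple equals x + y, the value at x must be 1.\<close>

lemma character_elem:
  fixes \<psi> :: "('a::field) mat3 \<Rightarrow> 'a fls"
  assumes H: "levi_like b H" and \<psi>: "\<psi> \<in> rational_characters H" and ij: "i \<noteq> j" "b i = b j"
  shows "\<psi> (elementary i j x) = 1"
proof -
  have nz: "\<And>g. g \<in> H \<Longrightarrow> \<psi> g \<noteq> 0"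
    and mult: "\<And>g h. g \<in> H \<Longrightarrow> h \<in> H \<Longrightarrow> \<psi> (g ** h) = \<psi> g * \<psi> h"
    using \<psi> by (auto simp: rational_characters_def)
  let ?t = "coroot_diag i j (fls_X :: 'a fls)"
  have e: "elementary i j y \<in> H" for y using levi_like_elem[OF H ij] .
  have t: "?t \<in> H" using coroot_diag_in[OF H ij(1)] by simp
  define y where "y = x / (fls_X * fls_X - 1)"
  have "?t ** elementary i j y = elementary i j (fls_X * fls_X * y) ** ?t"
    using ij(1) by (simp add: vec_eq_iff elem_mult_nth mult_elem_nth coroot_diag_def)
  hence "\<psi> ?t * \<psi> (elementary i j y) = \<psi> (elementary i j (fls_X * fls_X * y)) * \<psi> ?t"
    unfolding mult[OF t e, symmetric] mult[OF e t, symmetric] by (rule arg_cong)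
  hence "\<psi> (elementary i j y) = \<psi> (elementary i j (fls_X * fls_X * y))" using nz[OF t] by simp
  moreover have "fls_X * fls_X * y = x + y"
    using fls_X_ne(2)[where 'a = 'a] by (simp add: y_def field_simps)
  moreover have "\<psi> (elementary i j (x + y)) = \<psi> (elementary i j x) * \<psi> (elementary i j y)"
    using mult[OF e e, of x y] by (simp add: elem_add ij)
  ultimately show ?thesis using nz[OF e, of y] by simp
qed

text \<open>The identity h(c) = w(c) w(-1) of SL2, each w being a product of three elementary
  matrices. Characters are trivial on these factors, hence on the coroot, which forces equal
  exponents within a block.\<close>

lemma coroot_diag_factor:
  fixes i j :: 3
  assumes "i \<noteq> j" "c \<noteq> 0"
  shows "elementary i j c ** (elementary j i (- inverse c) ** (elementary i j c ** (elementary i j (-1) ** (elementary j i 1 ** elementary i j (-1))))) = coroot_diag i j (c :: 'a::field fls)"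
  using assms by (simp add: vec_eq_iff elem_mult_nth coroot_diag_def) (auto simp: elem_nth)

lemma weight_eq:
  fixes \<psi> :: "('a::field) mat3 \<Rightarrow> 'a fls"
  assumes H: "levi_like b H" and \<psi>: "\<psi> \<in> rational_characters H" and ij: "b i = b j"
  shows "weight H \<psi> $ i = weight H \<psi> $ j"
proof (cases "i = j")
  case False
  have mult: "\<And>g h. g \<in> H \<Longrightarrow> h \<in> H \<Longrightarrow> \<psi> (g ** h) = \<psi> g * \<psi> h"
    using \<psi> by (auto simp: rational_characters_def)
  obtain k where k: "distinct [i,j,k]" using ex_perm3[OF False] by blast
  let ?X = "fls_X :: 'a fls"
  note e = levi_like_elem[OF H False ij] levi_like_elem[OF H False[symmetric] ij[symmetric]]
  note c = character_elem[OF H \<psi> False ij] character_elem[OF H \<psi> False[symmetric] ij[symmetric]]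
  have "\<psi> (coroot_diag i j ?X) = 1"
    unfolding coroot_diag_factor[OF False fls_X_ne(1), symmetric]
    by (simp add: mult e c levi_like_mult[OF H])
  moreover have "val (\<psi> (coroot_diag i j ?X)) = (\<Sum>a\<in>UNIV. weight H \<psi> $ a * val (if a = i then ?X else if a = j then inverse ?X else 1))"
    unfolding coroot_diag_def using coroot_diag_in[OF H False fls_X_ne(1)]
    by (intro val_weight[OF H \<psi>]) (auto simp: coroot_diag_def)
  moreover have "i \<noteq> j" "i \<noteq> k" "j \<noteq> i" "j \<noteq> k" "k \<noteq> i" "k \<noteq> j" using k by auto
  ultimately show ?thesis by (simp add: sum_perm3[OF k])
qed simp

lemma diag_mult_nth: "(diag d ** A) $ a $ c = d a * A $ a $ c"
  by (simp add: matrix_matrix_mult_def if_distrib[where f = "\<lambda>x. x * _"] cong: if_cong)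

lemma mult_diag_nth: "(A ** diag d) $ a $ c = A $ a $ c * d c"
  by (simp add: matrix_matrix_mult_def if_distrib[where f = "\<lambda>x. _ * x"] cong: if_cong)

lemma det_diag_perm3: "distinct [i,j,k] \<Longrightarrow> det (diag d) = d i * d j * d k"
  using prod_perm3[of i j k d] prod_perm3[of 1 2 3 d] by (simp add: det_diag)

text \<open>LDU decomposition of the 2x2 block with pivot \<open>m $ i $ i\<close>; characters do
  not see the elementary factors.\<close>

lemma levi_diagonalize:
  fixes \<psi> :: "('a::field) mat3 \<Rightarrow> 'a fls"
  assumes \<psi>: "\<psi> \<in> rational_characters (levi b)" and m: "m \<in> levi b"
    and k: "distinct [i,j,k]" and b: "b i = b j" "b k \<noteq> b i" and nz: "m $ i $ i \<noteq> 0"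
  shows "\<exists>d. (\<forall>a. d a \<noteq> 0) \<and> \<psi> m = \<psi> (diag d) \<and> det m = d i * d j * d k \<and> d k = m $ k $ k"
proof -
  have ll: "levi_like b (levi b)" by (simp add: levi_like_def)
  have mult: "\<And>g h. g \<in> levi b \<Longrightarrow> h \<in> levi b \<Longrightarrow> \<psi> (g ** h) = \<psi> g * \<psi> h"
    using \<psi> by (auto simp: rational_characters_def)
  have ne: "i \<noteq> j" "i \<noteq> k" "j \<noteq> i" "j \<noteq> k" "k \<noteq> i" "k \<noteq> j" using k by auto
  have z: "m $ i $ k = 0" "m $ j $ k = 0" "m $ k $ i = 0" "m $ k $ j = 0"
    using m b by (auto simp: levi_def)
  define d where "d a = (if a = i then m $ i $ i else if a = j then m $ j $ j - m $ j $ i * m $ i $ j / m $ i $ i else m $ k $ k)" for a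
  have eq: "elementary j i (m $ j $ i / m $ i $ i) ** (diag d ** elementary i j (m $ i $ j / m $ i $ i)) = m"
    unfolding vec_eq_iff
    by (intro iffD2[OF all_perm3[OF k]] conjI) (use ne z nz in \<open>simp_all add: elem_mult_nth diag_mult_nth elem_nth d_def\<close>)
  have "det (elementary j i (m $ j $ i / m $ i $ i) ** (diag d ** elementary i j (m $ i $ j / m $ i $ i))) = d i * d j * d k"
    unfolding det_mul det_elem[OF ne(1)] det_elem[OF ne(3)] det_diag_perm3[OF k] by simp
  hence det: "det m = d i * d j * d k" unfolding eq .
  have "det m \<noteq> 0" using m by (simp add: levi_def invertible_det)
  hence "\<forall>a. d a \<noteq> 0" unfolding all_perm3[OF k] using det by auto
  moreover have dl: "diag d \<in> levi b"
    by (rule subsetD[OF torus_subset_levi diag_in_torus]) (use calculation in simp)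
  note e = levi_like_elem[OF ll ne(1) b(1)] levi_like_elem[OF ll ne(3) b(1)[symmetric]]
  note c = character_elem[OF ll \<psi> ne(1) b(1)] character_elem[OF ll \<psi> ne(3) b(1)[symmetric]]
  have "\<psi> (elementary j i (m $ j $ i / m $ i $ i) ** (diag d ** elementary i j (m $ i $ j / m $ i $ i))) = \<psi> (diag d)"
    by (simp add: mult e c dl levi_mult)
  hence "\<psi> m = \<psi> (diag d)" unfolding eq .
  moreover have "d k = m $ k $ k" using ne by (simp add: d_def)
  ultimately show ?thesis using det by blast
qed

text \<open>A vanishing pivot is repaired by adding row j to row i, which changes neither the
  character, nor the determinant, nor the entry at k.\<close>

lemma levi_diagonalize':
  fixes \<psi> :: "('a::field) mat3 \<Rightarrow> 'a fls"
  assumes \<psi>: "\<psi> \<in> rational_characters (levi b)" and m: "m \<in> levi b"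
    and k: "distinct [i,j,k]" and b: "b i = b j" "b k \<noteq> b i"
  shows "\<exists>d. (\<forall>a. d a \<noteq> 0) \<and> \<psi> m = \<psi> (diag d) \<and> det m = d i * d j * d k \<and> d k = m $ k $ k"
proof (cases "m $ i $ i = 0")
  case True
  have ll: "levi_like b (levi b)" by (simp add: levi_like_def)
  have mult: "\<And>g h. g \<in> levi b \<Longrightarrow> h \<in> levi b \<Longrightarrow> \<psi> (g ** h) = \<psi> g * \<psi> h"
    using \<psi> by (auto simp: rational_characters_def)
  have ne: "i \<noteq> j" "i \<noteq> k" "j \<noteq> i" "j \<noteq> k" "k \<noteq> i" "k \<noteq> j" using k by auto
  let ?m = "elementary i j 1 ** m"
  have e: "elementary i j 1 \<in> levi b" by (rule levi_like_elem[OF ll ne(1) b(1)])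
  have mm: "?m \<in> levi b" by (rule levi_mult[OF e m])
  have z: "m $ k $ i = 0" using m b by (auto simp: levi_def)
  have "m $ j $ i \<noteq> 0"
  proof
    assume "m $ j $ i = 0"
    hence "\<forall>a. m $ a $ i = 0" unfolding all_perm3[OF k] using True z by simp
    hence "(matrix_inv m ** m) $ i $ i = 0" by (simp add: matrix_matrix_mult_def)
    moreover have "invertible m" using m by (simp add: levi_def)
    ultimately show False by (simp add: mat3_inv_left mat_def)
  qed
  hence "?m $ i $ i \<noteq> 0" using True by (simp add: elem_mult_nth)
  from levi_diagonalize[OF \<psi> mm k b this]
  show ?thesis using mult[OF e m] character_elem[OF ll \<psi> ne(1) b(1)] ne
    by (simp add: elem_mult_nth det_mul det_elem)
qed (rule levi_diagonalize[OF assms])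

section \<open>The spaces of real cocharacters and the cocharacter lattices\<close>

lemma root_pairing: "(\<Sum>a\<in>UNIV. of_int ((axis i 1 - axis j 1 :: int^3) $ a) * (x :: real^3) $ a) = x $ i - x $ j"
proof -
  have "(\<Sum>a\<in>UNIV. of_int ((axis i 1 - axis j 1 :: int^3) $ a) * x $ a)
     = (\<Sum>a\<in>UNIV. (if a = i then x $ i else 0) - (if a = j then x $ j else 0))"
    by (intro sum.cong refl) (auto simp: axis_def)
  thus ?thesis by (simp add: sum_subtractf)
qed

lemma a_space_levi: "a_space (levi b :: ('a::field) mat3 set) = {x. \<forall>i j. b i = b j \<longrightarrow> x $ i = x $ j}"
proof -
  have aux: "(\<forall>\<alpha>\<in>{f i j | i j. P i j}. Q \<alpha>) \<longleftrightarrow> (\<forall>i j. P i j \<longrightarrow> Q (f i j))" for f :: "3 \<Rightarrow> 3 \<Rightarrow> int^3" and P Q by blast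
  show ?thesis
  proof (rule Set.set_eqI)
    fix x :: "real^3"
    have "x \<in> a_space (levi b :: 'a mat3 set) \<longleftrightarrow> (\<forall>i j. i \<noteq> j \<and> b i = b j \<longrightarrow> x $ i - x $ j = 0)"
      unfolding a_space_def roots_of_levi mem_Collect_eq aux root_pairing by (rule refl)
    also have "\<dots> \<longleftrightarrow> (\<forall>i j. b i = b j \<longrightarrow> x $ i = x $ j)" by (metis right_minus_eq)
    finally show "x \<in> a_space (levi b :: 'a mat3 set) \<longleftrightarrow> x \<in> {x. \<forall>i j. b i = b j \<longrightarrow> x $ i = x $ j}" by simp
  qed
qed

lemma polynomial_fun_det: "polynomial_fun (det :: ('a::field) mat3 \<Rightarrow> 'a fls)"
proof -
  have ring: "a + b + c - d - e - f = a + (b + (c + (- 1) * (d + (e + f))))" for a b c d e f :: "'b::comm_ring_1" by simp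
  have "polynomial_fun (\<lambda>g :: 'a mat3. g$1$1 * g$2$2 * g$3$3 + (g$1$2 * g$2$3 * g$3$1 + (g$1$3 * g$2$1 * g$3$2
     + (- 1) * (g$1$1 * g$2$3 * g$3$2 + (g$1$2 * g$2$1 * g$3$3 + g$1$3 * g$2$2 * g$3$1)))))"
    by (rule polynomial_fun.intros)+
  also have "(\<lambda>g :: 'a mat3. g$1$1 * g$2$2 * g$3$3 + (g$1$2 * g$2$3 * g$3$1 + (g$1$3 * g$2$1 * g$3$2
     + (- 1) * (g$1$1 * g$2$3 * g$3$2 + (g$1$2 * g$2$1 * g$3$3 + g$1$3 * g$2$2 * g$3$1))))) = det"
    unfolding det_3 ring by (rule refl)
  finally show ?thesis .
qed

lemma det_character: "levi_like b H \<Longrightarrow> det \<in> rational_characters H"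
  using levi_like_det[of b H] polynomial_fun_det
  by (auto simp: rational_characters_def det_mul intro!: exI[of _ det] exI[of _ 0])

lemma levi_entry_mult:
  assumes "g \<in> levi b" "\<And>a. b a = b k \<Longrightarrow> a = k"
  shows "(g ** h) $ k $ c = g $ k $ k * h $ k $ c"
proof -
  have e: "g $ k $ a * h $ a $ c = (if a = k then g $ k $ k * h $ k $ c else 0)" for a
  proof (cases "a = k")
    case False
    hence "b k \<noteq> b a" using assms(2)[of a] by metis
    hence "g $ k $ a = 0" using assms(1) by (simp add: levi_def)
    thus ?thesis using False by simp
  qed simp
  have "(g ** h) $ k $ c = (\<Sum>a\<in>UNIV. if a = k then g $ k $ k * h $ k $ c else 0)"
    unfolding matrix_matrix_mult_def vec_lambda_beta by (intro sum.cong refl e)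
  thus ?thesis by simp
qed

lemma entry_character:
  fixes H :: "('a::field) mat3 set"
  assumes H: "levi_like b H" and k: "\<And>a. b a = b k \<Longrightarrow> a = k"
  shows "(\<lambda>g. g $ k $ k) \<in> rational_characters H"
proof -
  have HL: "H \<subseteq> levi b" using H by (auto simp: levi_like_def)
  have "g $ k $ k \<noteq> 0" if "g \<in> H" for g
  proof -
    have g: "g \<in> levi b" "invertible g" using that HL by (auto simp: levi_def)
    have "g $ k $ k * matrix_inv g $ k $ k = (g ** matrix_inv g) $ k $ k"
      by (rule levi_entry_mult[OF g(1) k, symmetric])
    also have "\<dots> = 1" unfolding mat3_inv_right[OF g(2)] by (simp add: mat_def)
    finally show ?thesis by auto
  qed
  moreover have "(g ** h) $ k $ k = g $ k $ k * h $ k $ k" if "g \<in> H" for g h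
    using that HL by (intro levi_entry_mult k) auto
  moreover have "\<exists>f n. polynomial_fun f \<and> (\<forall>g\<in>H. g $ k $ k = f g / det g ^ n)"
    by (intro exI[of _ "\<lambda>g. g $ k $ k"] exI[of _ 0]) (simp add: polynomial_fun.entry)
  ultimately show ?thesis by (simp add: rational_characters_def)
qed

text \<open>In the full Levi subgroup a diagonal matrix may have \<open>fls_X\<close> at a single
  place, so each exponent is read off separately; in SL3 only differences of exponents are
  accessible.\<close>

lemma weight_levi_eqI:
  fixes \<psi> :: "('a::field) mat3 \<Rightarrow> 'a fls"
  assumes \<psi>: "\<psi> \<in> rational_characters (levi b)"
    and w: "\<And>i. val (\<psi> (diag (\<lambda>a. if a = i then fls_X else 1))) = w $ i"
  shows "weight (levi b) \<psi> = w"
proof -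
  have ll: "levi_like b (levi b)" by (simp add: levi_like_def)
  have "weight (levi b) \<psi> $ i = w $ i" for i
  proof -
    have d: "diag (\<lambda>a. if a = i then fls_X else 1 :: 'a fls) \<in> levi b"
      by (rule subsetD[OF torus_subset_levi diag_in_torus]) simp
    have "w $ i = (\<Sum>a\<in>UNIV. weight (levi b) \<psi> $ a * val (if a = i then fls_X else 1 :: 'a fls))"
      unfolding w[symmetric] using d by (intro val_weight[OF ll \<psi>]) auto
    also have "\<dots> = (\<Sum>a\<in>UNIV. if a = i then weight (levi b) \<psi> $ a else 0)"
      by (intro sum.cong refl) auto
    finally show ?thesis by simp
  qed
  thus ?thesis by (simp add: vec_eq_iff)
qed

lemma pairing_det: "pairing (levi b :: ('a::field) mat3 set) det x = (\<Sum>i\<in>UNIV. x $ i)"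
proof -
  have "weight (levi b :: 'a mat3 set) det = (\<chi> i. 1)"
  proof (rule weight_levi_eqI)
    show "det \<in> rational_characters (levi b :: 'a mat3 set)" by (rule det_character[of b]) (simp add: levi_like_def)
    show "val (det (diag (\<lambda>a. if a = i then fls_X else 1 :: 'a fls))) = (\<chi> i. 1) $ i" for i
      using exhaust_3[of i] by (auto simp: det_diag)
  qed
  thus ?thesis by (simp add: pairing_def)
qed

lemma pairing_entry:
  assumes k: "\<And>a. b a = b k \<Longrightarrow> a = k"
  shows "pairing (levi b :: ('a::field) mat3 set) (\<lambda>g. g $ k $ k) x = x $ k"
proof -
  have "weight (levi b :: 'a mat3 set) (\<lambda>g. g $ k $ k) = (\<chi> i. if i = k then 1 else 0)"
  proof (rule weight_levi_eqI)
    show "(\<lambda>g. g $ k $ k) \<in> rational_characters (levi b :: 'a mat3 set)"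
      by (rule entry_character[OF _ k]) (simp_all add: levi_like_def)
    show "val (diag (\<lambda>a. if a = i then fls_X else 1 :: 'a fls) $ k $ k) = (\<chi> i. if i = k then 1 else 0) $ i" for i
      by simp
  qed
  thus ?thesis by (simp add: pairing_def if_distrib[where f = "\<lambda>x. of_int x * _"] cong: if_cong)
qed

lemma a_space_G_levi:
  "a_space_G (levi b :: ('a::field) mat3 set) = {x. (\<forall>i j. b i = b j \<longrightarrow> x $ i = x $ j) \<and> (\<Sum>i\<in>UNIV. x $ i) = 0}"
proof -
  let ?b0 = "\<lambda>_ :: 3. 0 :: nat"
  have ll: "levi_like ?b0 (levi ?b0 :: 'a mat3 set)" by (simp add: levi_like_def)
  have "(\<forall>\<psi>\<in>rational_characters (levi ?b0 :: 'a mat3 set). pairing (levi ?b0) \<psi> x = 0) \<longleftrightarrow> (\<Sum>i\<in>UNIV. x $ i) = 0" for x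
  proof
    assume "\<forall>\<psi>\<in>rational_characters (levi ?b0 :: 'a mat3 set). pairing (levi ?b0) \<psi> x = 0"
    hence "pairing (levi ?b0 :: 'a mat3 set) det x = 0" using det_character[OF ll] by (rule bspec)
    thus "(\<Sum>i\<in>UNIV. x $ i) = 0" unfolding pairing_det .
  next
    assume s: "(\<Sum>i\<in>UNIV. x $ i) = 0"
    show "\<forall>\<psi>\<in>rational_characters (levi ?b0 :: 'a mat3 set). pairing (levi ?b0) \<psi> x = 0"
    proof
      fix \<psi> :: "'a mat3 \<Rightarrow> 'a fls" assume \<psi>: "\<psi> \<in> rational_characters (levi ?b0)"
      have "weight (levi ?b0) \<psi> $ i = weight (levi ?b0) \<psi> $ 1" for i by (rule weight_eq[OF ll \<psi>]) simp
      hence "pairing (levi ?b0) \<psi> x = (\<Sum>i\<in>UNIV. of_int (weight (levi ?b0) \<psi> $ 1) * x $ i)"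
        unfolding pairing_def by (intro sum.cong refl) simp
      also have "\<dots> = of_int (weight (levi ?b0) \<psi> $ 1) * (\<Sum>i\<in>UNIV. x $ i)" by (rule sum_distrib_left[symmetric])
      finally show "pairing (levi ?b0) \<psi> x = 0" using s by simp
    qed
  qed
  thus ?thesis unfolding a_space_G_def a_space_levi levi_const[symmetric, of 0] by simp
qed

text \<open>The complement for the whole group consists of the constant vectors, so the projection
  subtracts the mean.\<close>

lemma proj_G_levi:
  fixes x :: "real^3"
  assumes x: "x \<in> a_space (levi b :: ('a::field) mat3 set)"
  shows "proj_G (levi b :: 'a mat3 set) x = (\<chi> i. x $ i - (\<Sum>a\<in>UNIV. x $ a) / 3)"
  unfolding proj_G_def levi_const[symmetric, of 0] a_space_G_levi a_space_levi
proof (rule the_equality)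
  note xb = CollectD[OF x[unfolded a_space_levi], rule_format]
  show "(\<chi> i. x $ i - (\<Sum>a\<in>UNIV. x $ a) / 3) \<in> {x. (\<forall>i j. b i = b j \<longrightarrow> x $ i = x $ j) \<and> (\<Sum>i\<in>UNIV. x $ i) = 0} \<and>
    x - (\<chi> i. x $ i - (\<Sum>a\<in>UNIV. x $ a) / 3) \<in> {x. \<forall>i j. (0::nat) = 0 \<longrightarrow> x $ i = x $ j}"
  proof (intro conjI CollectI allI impI)
    show "(\<Sum>i\<in>UNIV. (\<chi> i. x $ i - (\<Sum>a\<in>UNIV. x $ a) / 3) $ i) = 0" by (simp add: sum_3 field_simps)
    show "(x - (\<chi> i. x $ i - (\<Sum>a\<in>UNIV. x $ a) / 3)) $ i = (x - (\<chi> i. x $ i - (\<Sum>a\<in>UNIV. x $ a) / 3)) $ j" for i j by simp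
  next
    fix i j assume "b i = b j"
    hence "x $ i = x $ j" by (rule xb)
    thus "(\<chi> i. x $ i - (\<Sum>a\<in>UNIV. x $ a) / 3) $ i = (\<chi> i. x $ i - (\<Sum>a\<in>UNIV. x $ a) / 3) $ j" by simp
  qed
  fix y assume y: "y \<in> {x. (\<forall>i j. b i = b j \<longrightarrow> x $ i = x $ j) \<and> (\<Sum>i\<in>UNIV. x $ i) = 0} \<and>
    x - y \<in> {x. \<forall>i j. (0::nat) = 0 \<longrightarrow> x $ i = x $ j}"
  note s = conjunct2[OF CollectD[OF conjunct1[OF y]], unfolded sum_3]
  have e: "x $ i - y $ i = x $ j - y $ j" for i j
    using CollectD[OF conjunct2[OF y], rule_format, OF refl, of i j] by (simp only: vector_minus_component)
  have "y $ i = x $ i - (\<Sum>a\<in>UNIV. x $ a) / 3" for i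
  proof -
    have "x $ i - y $ i = (x $ 1 + x $ 2 + x $ 3) / 3" using s e[of i 1] e[of i 2] e[of i 3] by argo
    thus ?thesis unfolding sum_3 by argo
  qed
  thus "y = (\<chi> i. x $ i - (\<Sum>a\<in>UNIV. x $ a) / 3)" by (simp add: vec_eq_iff)
qed

text \<open>Evaluation at coroots shows that the exponent at k exceeds the two others by 1. The
  common summand remains unknown, but it pairs to 0 with vectors of trace zero.\<close>

lemma weight_SL_entry:
  fixes k :: 3
  assumes k: "\<And>a. b a = b k \<Longrightarrow> a = k" and s: "(\<Sum>i\<in>UNIV. x $ i) = 0"
  shows "pairing (levi b \<inter> SL3 :: ('a::field) mat3 set) (\<lambda>g. g $ k $ k) x = x $ k"
proof -
  let ?H = "levi b \<inter> SL3 :: 'a mat3 set" and ?\<psi> = "\<lambda>g :: 'a mat3. g $ k $ k"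
  let ?X = "fls_X :: 'a fls"
  have ll: "levi_like b ?H" by (simp add: levi_like_def)
  have \<psi>: "?\<psi> \<in> rational_characters ?H" by (rule entry_character[OF ll k])
  have w: "weight ?H ?\<psi> $ k - weight ?H ?\<psi> $ j = 1" if j: "j \<noteq> k" for j
  proof -
    obtain i where i: "distinct [j,k,i]" using ex_perm3[OF j] by blast
    hence ne: "k \<noteq> j" "i \<noteq> j" "i \<noteq> k" "j \<noteq> k" "j \<noteq> i" "k \<noteq> i" by auto
    have "val (?\<psi> (diag (\<lambda>a. if a = k then ?X else if a = j then inverse ?X else 1))) =
      (\<Sum>a\<in>UNIV. weight ?H ?\<psi> $ a * val (if a = k then ?X else if a = j then inverse ?X else 1))"
      using coroot_diag_in[OF ll ne(1) fls_X_ne(1)] by (intro val_weight[OF ll \<psi>]) (auto simp: coroot_diag_def)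
    thus ?thesis using ne by (simp add: sum_perm3[OF i])
  qed
  define w where "w = weight ?H ?\<psi> $ k - 1"
  have "of_int (weight ?H ?\<psi> $ a) * x $ a = of_int w * x $ a + (if a = k then x $ k else 0)" for a
    using w[of a] by (cases "a = k") (auto simp: w_def algebra_simps)
  hence "pairing ?H ?\<psi> x = of_int w * (\<Sum>i\<in>UNIV. x $ i) + x $ k"
    by (simp add: pairing_def sum.distrib sum_distrib_left)
  thus ?thesis using s by simp
qed

lemma cochar_lattice_torus:
  assumes b: "inj b"
  shows "cochar_lattice_SL (levi b :: ('a::field) mat3 set) = {x. (\<Sum>i\<in>UNIV. x $ i) = 0 \<and> (\<forall>i. x $ i \<in> \<int>)}"
proof (intro Set.set_eqI iffI)
  let ?H = "levi b \<inter> SL3 :: 'a mat3 set"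
  have ll: "levi_like b ?H" by (simp add: levi_like_def)
  have inj: "b i = b j \<longleftrightarrow> i = j" for i j using b by (simp add: inj_eq)
  {
    fix x assume x: "x \<in> cochar_lattice_SL (levi b :: 'a mat3 set)"
    note s = conjunct2[OF CollectD[OF conjunct1[OF CollectD[OF x[unfolded cochar_lattice_SL_def]], unfolded a_space_G_levi]]]
    have "x $ k \<in> \<int>" for k
    proof -
      have "(\<lambda>g. g $ k $ k) \<in> rational_characters ?H" by (rule entry_character[OF ll]) (simp add: inj)
      hence "pairing ?H (\<lambda>g. g $ k $ k) x \<in> \<int>"
        by (rule bspec[OF conjunct2[OF CollectD[OF x[unfolded cochar_lattice_SL_def]]]])
      also have "pairing ?H (\<lambda>g. g $ k $ k) x = x $ k" by (rule weight_SL_entry[OF _ s]) (simp add: inj)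
      finally show ?thesis .
    qed
    thus "x \<in> {x. (\<Sum>i\<in>UNIV. x $ i) = 0 \<and> (\<forall>i. x $ i \<in> \<int>)}" using s by simp
  next
    fix x assume "x \<in> {x :: real^3. (\<Sum>i\<in>UNIV. x $ i) = 0 \<and> (\<forall>i. x $ i \<in> \<int>)}"
    hence x: "(\<Sum>i\<in>UNIV. x $ i) = 0" "\<And>i. x $ i \<in> \<int>" by simp_all
    have "pairing ?H \<psi> x \<in> \<int>" for \<psi> unfolding pairing_def using x(2) by (intro Ints_sum Ints_mult Ints_of_int)
    thus "x \<in> cochar_lattice_SL (levi b :: 'a mat3 set)"
      using x(1) by (simp add: cochar_lattice_SL_def a_space_G_levi inj)
  }
qed

text \<open>The entry at k is a character, which forces \<open>x $ k\<close> to be an integer.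
  Conversely the exponents of a character agree on the block, so it pairs with x to an integer
  multiple of \<open>x $ k\<close>; the other coordinates may be half-integers.\<close>

lemma cochar_lattice_block:
  assumes k: "distinct [i,j,k]" and b: "b i = b j" "b k \<noteq> b i"
  shows "cochar_lattice_SL (levi b :: ('a::field) mat3 set) = {x. x $ i = - x $ k / 2 \<and> x $ j = - x $ k / 2 \<and> x $ k \<in> \<int>}"
proof (intro Set.set_eqI iffI)
  let ?H = "levi b \<inter> SL3 :: 'a mat3 set"
  have ll: "levi_like b ?H" by (simp add: levi_like_def)
  have sing: "a = k" if "b a = b k" for a
  proof -
    have "a \<in> {i,j,k}" using UNIV_perm3[OF k] by auto
    thus ?thesis using that b by auto
  qed
  have aG: "x \<in> a_space_G (levi b :: 'a mat3 set) \<longleftrightarrow> x $ i = - x $ k / 2 \<and> x $ j = - x $ k / 2" for x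
  proof -
    have "x $ j = x $ i \<and> x $ i + x $ j + x $ k = 0 \<longleftrightarrow> x $ i = - x $ k / 2 \<and> x $ j = - x $ k / 2" by argo
    moreover have "(\<forall>a c. b a = b c \<longrightarrow> x $ a = x $ c) \<longleftrightarrow> x $ j = x $ i"
      unfolding all_perm3[OF k] using b by (auto simp: eq_commute)
    ultimately show ?thesis unfolding a_space_G_levi mem_Collect_eq sum_perm3[OF k] by simp
  qed
  {
    fix x assume x: "x \<in> cochar_lattice_SL (levi b :: 'a mat3 set)"
    hence xG: "x \<in> a_space_G (levi b :: 'a mat3 set)" by (simp add: cochar_lattice_SL_def)
    note s = conjunct2[OF CollectD[OF xG[unfolded a_space_G_levi]]]
    have "(\<lambda>g. g $ k $ k) \<in> rational_characters ?H" by (rule entry_character[OF ll sing])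
    hence "pairing ?H (\<lambda>g. g $ k $ k) x \<in> \<int>"
      by (rule bspec[OF conjunct2[OF CollectD[OF x[unfolded cochar_lattice_SL_def]]]])
    also have "pairing ?H (\<lambda>g. g $ k $ k) x = x $ k" by (rule weight_SL_entry[OF sing s])
    finally show "x \<in> {x. x $ i = - x $ k / 2 \<and> x $ j = - x $ k / 2 \<and> x $ k \<in> \<int>}" using xG aG by simp
  next
    fix x assume x: "x \<in> {x :: real^3. x $ i = - x $ k / 2 \<and> x $ j = - x $ k / 2 \<and> x $ k \<in> \<int>}"
    have "pairing ?H \<psi> x \<in> \<int>" if \<psi>: "\<psi> \<in> rational_characters ?H" for \<psi>
    proof -
      have "weight ?H \<psi> $ i = weight ?H \<psi> $ j" by (rule weight_eq[OF ll \<psi> b(1)])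
      hence "pairing ?H \<psi> x = of_int (weight ?H \<psi> $ k - weight ?H \<psi> $ i) * x $ k"
        using x by (simp add: pairing_def sum_perm3[OF k] algebra_simps)
      thus ?thesis using x by (simp add: Ints_mult)
    qed
    thus "x \<in> cochar_lattice_SL (levi b :: 'a mat3 set)" using x aG by (simp add: cochar_lattice_SL_def)
  }
qed

section \<open>The Iwasawa decomposition\<close>

text \<open>
  The least valuation in a row of g is the Iwasawa coordinate of that row for every Borel subgroup
  whose flag ends with it; the columns of the inverse play the same role for the first flag step.
\<close>

definition row_val :: "('a::field) mat3 \<Rightarrow> 3 \<Rightarrow> int" where
  "row_val g a = (GREATEST n. \<forall>c. fls_ge n (g $ a $ c))"

text \<open>The sign undoes the inversion, so that on a diagonal matrix this is the valuation of the
  entry, like \<open>row_val\<close>.\<close>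

definition col_val :: "('a::field) mat3 \<Rightarrow> 3 \<Rightarrow> int" where
  "col_val g a = - row_val (transpose (matrix_inv g)) a"

lemma row_val_unique: "(\<And>n. (\<forall>c. fls_ge n (g $ a $ c)) \<longleftrightarrow> n \<le> r) \<Longrightarrow> row_val g a = r"
  unfolding row_val_def by (rule Greatest_equality) auto

lemma row_val_iff:
  fixes g :: "('a::field) mat3"
  assumes "invertible g"
  shows "(\<forall>c. fls_ge n (g $ a $ c)) \<longleftrightarrow> n \<le> row_val g a"
proof -
  define V where "V = {val (g $ a $ c) | c. g $ a $ c \<noteq> 0}"
  have fin: "finite V" unfolding V_def by simp
  have "\<exists>c. g $ a $ c \<noteq> 0"
  proof (rule ccontr)
    assume "\<not> (\<exists>c. g $ a $ c \<noteq> 0)"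
    hence "(g ** matrix_inv g) $ a $ a = 0" by (simp add: matrix_matrix_mult_def)
    thus False using assms by (simp add: mat3_inv_right mat_def)
  qed
  hence ne: "V \<noteq> {}" by (auto simp: V_def)
  have iff: "(\<forall>c. fls_ge n (g $ a $ c)) \<longleftrightarrow> n \<le> Min V" for n
  proof -
    have "(\<forall>c. fls_ge n (g $ a $ c)) \<longleftrightarrow> (\<forall>v\<in>V. n \<le> v)"
      unfolding V_def fls_ge_iff by auto
    thus ?thesis using fin ne by simp
  qed
  have "row_val g a = Min V" by (rule row_val_unique) (rule iff)
  thus ?thesis using iff by simp
qed

lemma transpose_invertible: "invertible (g :: ('a::field) mat3) \<Longrightarrow> invertible (transpose g)"
  by (simp add: invertible_det)

lemma col_val_iff:
  fixes g :: "('a::field) mat3"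
  assumes "invertible g"
  shows "(\<forall>c. fls_ge n (matrix_inv g $ c $ a)) \<longleftrightarrow> n \<le> - col_val g a"
proof -
  have "invertible (transpose (matrix_inv g))" using assms by (intro transpose_invertible mat3_inv_invertible)
  from row_val_iff[OF this, of n a] show ?thesis by (simp add: col_val_def transpose_def)
qed

lemma col_val_unique: "(\<And>n. (\<forall>c. fls_ge n (matrix_inv g $ c $ a)) \<longleftrightarrow> n \<le> - r) \<Longrightarrow> col_val g a = r"
  unfolding col_val_def by (subst row_val_unique[of _ _ "- r"]) (simp_all add: transpose_def)

lemma fls_ge_row_mult:
  assumes "\<forall>c. fls_ge n (g $ a $ c)" "k \<in> GL3_integers"
  shows "\<forall>c. fls_ge n ((g ** k) $ a $ c)"
  using assms unfolding matrix_matrix_mult_def vec_lambda_beta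
  by (auto simp: GL3_integers_def integral_matrices_def integers_iff intro!: fls_ge_sum fls_ge_mult0')

lemma fls_ge_col_mult:
  assumes "\<forall>c. fls_ge n (g $ c $ a)" "k \<in> GL3_integers"
  shows "\<forall>c. fls_ge n ((k ** g) $ c $ a)"
  using assms unfolding matrix_matrix_mult_def vec_lambda_beta
  by (auto simp: GL3_integers_def integral_matrices_def integers_iff intro!: fls_ge_sum fls_ge_mult0)

lemma row_val_mult_K:
  fixes g :: "('a::field) mat3"
  assumes g: "invertible g" and k: "k \<in> GL3_integers"
  shows "row_val (g ** k) a = row_val g a"
proof (rule row_val_unique)
  fix n
  have inv: "g ** k ** matrix_inv k = g"
    by (simp add: matrix_mul_assoc[symmetric] mat3_inv_right GL3_integers_invertible[OF k])
  have "(\<forall>c. fls_ge n ((g ** k) $ a $ c)) \<longleftrightarrow> (\<forall>c. fls_ge n (g $ a $ c))"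
    using fls_ge_row_mult[of n "g ** k" a "matrix_inv k"] fls_ge_row_mult[of n g a k] GL3_integers_inv[OF k] k
    unfolding inv by blast
  thus "(\<forall>c. fls_ge n ((g ** k) $ a $ c)) \<longleftrightarrow> n \<le> row_val g a" using row_val_iff[OF g] by simp
qed

lemma col_val_mult_K:
  fixes g :: "('a::field) mat3"
  assumes g: "invertible g" and k: "k \<in> GL3_integers"
  shows "col_val (g ** k) a = col_val g a"
proof (rule col_val_unique)
  fix n
  have ki: "invertible k" by (rule GL3_integers_invertible[OF k])
  have gk: "matrix_inv (g ** k) = matrix_inv k ** matrix_inv g" by (rule mat3_inv_mult[OF g ki])
  have inv: "k ** (matrix_inv k ** matrix_inv g) = matrix_inv g"
    by (simp add: matrix_mul_assoc mat3_inv_right ki)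
  have "(\<forall>c. fls_ge n ((matrix_inv k ** matrix_inv g) $ c $ a)) \<longleftrightarrow> (\<forall>c. fls_ge n (matrix_inv g $ c $ a))"
    using fls_ge_col_mult[of n "matrix_inv k ** matrix_inv g" a k] fls_ge_col_mult[of n "matrix_inv g" a "matrix_inv k"] GL3_integers_inv[OF k] k
    unfolding inv by blast
  thus "(\<forall>c. fls_ge n (matrix_inv (g ** k) $ c $ a)) \<longleftrightarrow> n \<le> - col_val g a" unfolding gk using col_val_iff[OF g] by simp
qed

lemma diag_inv: "(\<And>i. d i \<noteq> 0) \<Longrightarrow> matrix_inv (diag d) = diag (\<lambda>i. inverse (d i))"
  by (rule mat3_inv_unique(1)) (simp add: diag_mult, simp add: vec_eq_iff mat_def)

lemma row_val_diag_mult: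
  fixes g :: "('a::field) mat3"
  assumes g: "invertible g" and d: "\<And>i. d i \<noteq> 0"
  shows "row_val (diag d ** g) a = val (d a) + row_val g a"
proof (rule row_val_unique)
  fix n
  have "(\<forall>c. fls_ge n ((diag d ** g) $ a $ c)) \<longleftrightarrow> (\<forall>c. fls_ge (n - val (d a)) (g $ a $ c))"
    by (simp add: diag_mult_nth fls_ge_mult_iff d)
  thus "(\<forall>c. fls_ge n ((diag d ** g) $ a $ c)) \<longleftrightarrow> n \<le> val (d a) + row_val g a"
    using row_val_iff[OF g, of "n - val (d a)" a] by auto
qed

lemma col_val_diag_mult:
  fixes g :: "('a::field) mat3"
  assumes g: "invertible g" and d: "\<And>i. d i \<noteq> 0"
  shows "col_val (diag d ** g) a = val (d a) + col_val g a"
proof (rule col_val_unique)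
  fix n
  have "invertible (diag d)" using d invertible_diag by blast
  hence inv: "matrix_inv (diag d ** g) = matrix_inv g ** diag (\<lambda>i. inverse (d i))"
    using mat3_inv_mult[OF _ g] diag_inv[OF d] by simp
  have "fls_ge n (x * inverse (d a)) \<longleftrightarrow> fls_ge (n + val (d a)) x" for x
    using fls_ge_mult_iff[of "inverse (d a)" n x] d[of a] by (simp add: mult.commute)
  hence "(\<forall>c. fls_ge n (matrix_inv (diag d ** g) $ c $ a)) \<longleftrightarrow> (\<forall>c. fls_ge (n + val (d a)) (matrix_inv g $ c $ a))"
    unfolding inv by (simp add: mult_diag_nth)
  thus "(\<forall>c. fls_ge n (matrix_inv (diag d ** g) $ c $ a)) \<longleftrightarrow> n \<le> - (val (d a) + col_val g a)"
    using col_val_iff[OF g, of "n + val (d a)" a] by auto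
qed

text \<open>Upper unitriangular for the order i, j, k of the indices: x and y belong to the simple
  roots of this order, z to its highest root.\<close>

definition unip :: "3 \<Rightarrow> 3 \<Rightarrow> 3 \<Rightarrow> ('a::field) fls \<Rightarrow> 'a fls \<Rightarrow> 'a fls \<Rightarrow> 'a mat3" where
  "unip i j k x y z = (\<chi> a c. if a = c then 1 else if a = i \<and> c = j then x else if a = j \<and> c = k then y
      else if a = i \<and> c = k then z else 0)"

definition order_of :: "3 \<Rightarrow> 3 \<Rightarrow> 3 \<Rightarrow> 3 \<Rightarrow> nat" where
  "order_of i j k a = (if a = i then 0 else if a = j then 1 else 2)"

lemma perm3_ne: "distinct [i,j,k :: 3] \<Longrightarrow> i \<noteq> j \<and> i \<noteq> k \<and> j \<noteq> i \<and> j \<noteq> k \<and> k \<noteq> i \<and> k \<noteq> j"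
  by auto

lemma unip_nth:
  assumes "distinct [i,j,k]"
  shows "unip i j k x y z $ i $ i = 1" "unip i j k x y z $ j $ j = 1" "unip i j k x y z $ k $ k = 1"
    "unip i j k x y z $ i $ j = x" "unip i j k x y z $ j $ k = y" "unip i j k x y z $ i $ k = z"
    "unip i j k x y z $ j $ i = 0" "unip i j k x y z $ k $ i = 0" "unip i j k x y z $ k $ j = 0"
  using assms by (auto simp: unip_def)

lemma matrix_mult_perm3: "distinct [i,j,k :: 3] \<Longrightarrow> (A ** B) $ a $ c = A $ a $ i * B $ i $ c + A $ a $ j * B $ j $ c + A $ a $ k * B $ k $ c"
  unfolding matrix_matrix_mult_def vec_lambda_beta by (rule sum_perm3)

lemma mat3_eqI_perm3:
  assumes d: "distinct [i,j,k]"
    and "A $ i $ i = B $ i $ i" "A $ i $ j = B $ i $ j" "A $ i $ k = B $ i $ k"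
    "A $ j $ i = B $ j $ i" "A $ j $ j = B $ j $ j" "A $ j $ k = B $ j $ k"
    "A $ k $ i = B $ k $ i" "A $ k $ j = B $ k $ j" "A $ k $ k = B $ k $ k"
  shows "(A :: 'a^3^3) = B"
  unfolding vec_eq_iff by (intro iffD2[OF all_perm3[OF d]] conjI assms)

lemma unip_mult:
  assumes d: "distinct [i,j,k]"
  shows "unip i j k x y z ** unip i j k x' y' z' = unip i j k (x + x') (y + y') (z + z' + x * y')"
  by (rule mat3_eqI_perm3[OF d]) (simp_all add: matrix_mult_perm3[OF d] unip_nth[OF d])

lemma unip_0: "distinct [i,j,k] \<Longrightarrow> unip i j k 0 0 0 = mat 1"
  by (auto simp: unip_def mat_def vec_eq_iff)

lemma unip_inv:
  assumes d: "distinct [i,j,k]"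
  shows "matrix_inv (unip i j k x y z) = unip i j k (- x) (- y) (x * y - z)" "invertible (unip i j k x y z)"
proof -
  have "unip i j k x y z ** unip i j k (- x) (- y) (x * y - z) = mat 1"
    unfolding unip_mult[OF d] by (simp add: unip_0[OF d])
  thus "matrix_inv (unip i j k x y z) = unip i j k (- x) (- y) (x * y - z)" "invertible (unip i j k x y z)"
    by (rule mat3_inv_unique)+
qed

lemma unip_elem:
  assumes d: "distinct [i,j,k]"
  shows "unip i j k x y z = elementary j k y ** (elementary i j x ** elementary i k z)"
  by (rule mat3_eqI_perm3[OF d]) (use perm3_ne[OF d] in \<open>simp_all add: unip_nth[OF d] elem_mult_nth elem_nth\<close>)

lemma det_unip:
  assumes d: "distinct [i,j,k]"
  shows "det (unip i j k x y z) = 1"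
  unfolding unip_elem[OF d] using perm3_ne[OF d] by (simp add: det_mul det_elem)

lemma unirad_order:
  assumes d: "distinct [i,j,k]"
  shows "n \<in> unirad (order_of i j k) \<longleftrightarrow> (\<exists>x y z. n = unip i j k x y z)"
proof
  note ne = perm3_ne[OF d]
  assume n: "n \<in> unirad (order_of i j k)"
  have e: "n $ a $ c = (if a = c then 1 else 0)" if "order_of i j k c \<le> order_of i j k a" for a c
    using n that by (simp add: unirad_def)
  have "n = unip i j k (n $ i $ j) (n $ j $ k) (n $ i $ k)"
    by (rule mat3_eqI_perm3[OF d]) (use ne in \<open>simp_all add: unip_nth[OF d] e order_of_def\<close>)
  thus "\<exists>x y z. n = unip i j k x y z" by (intro exI)
next
  note ne = perm3_ne[OF d]
  assume "\<exists>x y z. n = unip i j k x y z"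
  then obtain x y z where n: "n = unip i j k x y z" by (elim exE)
  have "\<forall>a c. order_of i j k c \<le> order_of i j k a \<longrightarrow> n $ a $ c = (if a = c then 1 else 0)"
    by (intro iffD2[OF all_perm3[OF d]] conjI) (use ne in \<open>simp_all add: unip_nth[OF d] n order_of_def\<close>)
  thus "n \<in> unirad (order_of i j k)" unfolding unirad_def using unip_inv(2)[OF d] n by simp
qed

lemma range_order_of:
  assumes d: "distinct [i,j,k]"
  shows "range (order_of i j k) = {..<3}"
proof -
  have "range (order_of i j k) = order_of i j k ` {i,j,k}" using UNIV_perm3[OF d] by simp
  also have "\<dots> = {0,1,2}" using perm3_ne[OF d] by (auto simp: order_of_def)
  also have "\<dots> = {..<3}" by auto
  finally show ?thesis .
qed

lemma inj_order_of: "distinct [i,j,k] \<Longrightarrow> inj (order_of i j k)"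
  using range_order_of[of i j k] by (intro eq_card_imp_inj_on) auto

lemma inj_order:
  fixes b :: "3 \<Rightarrow> nat"
  assumes b: "inj b" "range b = {..<l}"
  obtains i j k where "distinct [i,j,k]" "b = order_of i j k"
proof -
  have "card (range b) = 3" using card_image[OF b(1)] by simp
  hence l: "l = 3" using b(2) by simp
  have "0 \<in> range b" "1 \<in> range b" "2 \<in> range b" unfolding b(2) l by auto
  then obtain i j k where ijk: "b i = 0" "b j = 1" "b k = 2" by (metis imageE)
  have d: "distinct [i,j,k]" using ijk by auto
  have "b a = order_of i j k a" for a
  proof -
    have "a \<in> {i,j,k}" using UNIV_perm3[OF d] by auto
    thus ?thesis using ijk perm3_ne[OF d] by (auto simp: order_of_def)
  qed
  thus ?thesis using that[OF d] by (simp add: fun_eq_iff)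
qed

section \<open>Existence of the Iwasawa decomposition by integral column operations\<close>

lemma invertible_column_nonzero: "invertible (g :: ('a::field) mat3) \<Longrightarrow> \<exists>a. g $ a $ c \<noteq> 0"
proof (rule ccontr)
  assume g: "invertible g" and "\<not> (\<exists>a. g $ a $ c \<noteq> 0)"
  hence "(matrix_inv g ** g) $ c $ c = 0" by (simp add: matrix_matrix_mult_def)
  thus False using g by (simp add: mat3_inv_left mat_def)
qed

lemma invertible_row_nonzero: "invertible (g :: ('a::field) mat3) \<Longrightarrow> \<exists>a. g $ c $ a \<noteq> 0"
proof (rule ccontr)
  assume g: "invertible g" and "\<not> (\<exists>a. g $ c $ a \<noteq> 0)"
  hence "(g ** matrix_inv g) $ c $ c = 0" by (simp add: matrix_matrix_mult_def)
  thus False using g by (simp add: mat3_inv_right mat_def)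
qed

lemma elem_GL3_integers: "i \<noteq> j \<Longrightarrow> fls_ge 0 x \<Longrightarrow> elementary i j x \<in> GL3_integers"
  by (auto simp: GL3_integers_iff det_elem integral_matrices_def integers_iff elem_nth intro!: fls_ge_add)

text \<open>A multiple of column c' clears the entry when its own entry in row a has the smaller or
  equal valuation. Otherwise column c is first added to column c', whose entry then gets the
  valuation of the entry to be cleared. The remaining conclusions keep the third column and the
  common zeros of the two columns.\<close>

lemma clear_entry:
  fixes g :: "('a::field) mat3"
  assumes c: "c \<noteq> c'"
  shows "\<exists>h\<in>GL3_integers. (g ** h) $ a $ c = 0 \<and> (\<forall>r b. b \<noteq> c \<longrightarrow> b \<noteq> c' \<longrightarrow> (g ** h) $ r $ b = g $ r $ b)
     \<and> (\<forall>r. g $ r $ c = 0 \<longrightarrow> g $ r $ c' = 0 \<longrightarrow> (g ** h) $ r $ c = 0 \<and> (g ** h) $ r $ c' = 0)" (is "\<exists>h\<in>_. ?P g h")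
proof -
  have main: "\<exists>h\<in>GL3_integers. ?P g h" if g: "g $ a $ c' \<noteq> 0" "fls_ge (val (g $ a $ c')) (g $ a $ c)" for g :: "'a mat3"
  proof (intro bexI)
    let ?x = "- (g $ a $ c / g $ a $ c')"
    have "fls_ge 0 (g $ a $ c / g $ a $ c')"
      using fls_ge_mult[OF g(2), of 0 "inverse (g $ a $ c')"] fls_ge_mult[OF g(2), of "- val (g $ a $ c')" "inverse (g $ a $ c')"] g(1)
      by (simp add: divide_inverse fls_ge_iff[of _ "inverse _"])
    thus "elementary c' c ?x \<in> GL3_integers" using c by (intro elem_GL3_integers) auto
    show "?P g (elementary c' c ?x)" using c g(1) by (simp add: mult_elem_nth)
  qed
  show ?thesis
  proof (cases "g $ a $ c = 0")
    case True
    thus ?thesis by (intro bexI[of _ "mat 1"]) (simp_all add: GL3_integers_one)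
  next
    case nz: False
    show ?thesis
    proof (cases "g $ a $ c' \<noteq> 0 \<and> val (g $ a $ c') \<le> val (g $ a $ c)")
      case True
      thus ?thesis by (intro main) (auto simp: fls_ge_iff)
    next
      case False
      let ?e = "elementary c c' 1" 
      have e: "?e \<in> GL3_integers" using c by (intro elem_GL3_integers) auto
      let ?g = "g ** ?e"
      have v: "g $ a $ c' + g $ a $ c \<noteq> 0 \<and> val (g $ a $ c' + g $ a $ c) = val (g $ a $ c)"
      proof (cases "g $ a $ c' = 0")
        case True thus ?thesis using nz by simp
      next
        case c'nz: False
        hence lt: "val (g $ a $ c) < val (g $ a $ c')" using False by simp
        have val: "val (g $ a $ c' + g $ a $ c) = val (g $ a $ c)"
          using fls_subdegree_add_eq2[OF nz lt] by (simp add: add.commute)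
        have "g $ a $ c' + g $ a $ c \<noteq> 0"
        proof
          assume "g $ a $ c' + g $ a $ c = 0"
          hence "g $ a $ c' = - g $ a $ c" by (simp add: eq_neg_iff_add_eq_0)
          thus False using lt by simp
        qed
        thus ?thesis using val by simp
      qed
      have "?g $ a $ c' = g $ a $ c' + g $ a $ c" "?g $ a $ c = g $ a $ c" using c by (simp_all add: mult_elem_nth)
      hence "\<exists>h\<in>GL3_integers. ?P ?g h" using v by (intro main) (auto simp: fls_ge_iff)
      then obtain h where h: "h \<in> GL3_integers" "?P ?g h" by blast
      have "?P g (?e ** h)"
      proof (intro conjI allI impI)
        have as: "g ** (?e ** h) = ?g ** h" by (simp add: matrix_mul_assoc)
        show "(g ** (?e ** h)) $ a $ c = 0" unfolding as using h(2) by simp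
        show "(g ** (?e ** h)) $ r $ b = g $ r $ b" if "b \<noteq> c" "b \<noteq> c'" for r b
          unfolding as using h(2) that by (simp add: mult_elem_nth)
        fix r assume "g $ r $ c = 0" "g $ r $ c' = 0"
        hence "?g $ r $ c = 0" "?g $ r $ c' = 0" by (simp_all add: mult_elem_nth)
        thus "(g ** (?e ** h)) $ r $ c = 0" "(g ** (?e ** h)) $ r $ c' = 0" unfolding as using h(2) by simp_all
      qed
      thus ?thesis using GL3_integers_mult[OF e h(1)] by blast
    qed
  qed
qed

lemma clear_entryE:
  fixes g :: "('a::field) mat3"
  assumes c: "c \<noteq> c'"
  obtains h where "h \<in> GL3_integers" "(g ** h) $ a $ c = 0"
    "\<forall>r b. b \<noteq> c \<longrightarrow> b \<noteq> c' \<longrightarrow> (g ** h) $ r $ b = g $ r $ b"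
    "\<forall>r. g $ r $ c = 0 \<longrightarrow> g $ r $ c' = 0 \<longrightarrow> (g ** h) $ r $ c = 0 \<and> (g ** h) $ r $ c' = 0"
  using clear_entry[OF c, of g a] by (elim bexE conjE) (rule that)

text \<open>The entries below the diagonal are cleared in the order (k,i), (k,j), (j,i), in which
  earlier zeros survive. The invertible triangular matrix that results is a unipotent matrix times
  its diagonal.\<close>

lemma iwasawa:
  fixes g :: "('a::field) mat3"
  assumes g: "invertible g" and d: "distinct [i,j,k]"
  obtains x y z e h where "\<forall>a. e a \<noteq> 0" "h \<in> GL3_integers" "g = unip i j k x y z ** diag e ** h"
proof -
  have ne: "i \<noteq> j" "i \<noteq> k" "j \<noteq> i" "j \<noteq> k" "k \<noteq> i" "k \<noteq> j" using d by auto
  obtain h1 where h1: "h1 \<in> GL3_integers" "(g ** h1) $ k $ i = 0" by (rule clear_entryE[OF ne(1)])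
  let ?g1 = "g ** h1"
  obtain h2 where h2: "h2 \<in> GL3_integers" "(?g1 ** h2) $ k $ j = 0"
    "\<forall>r b. b \<noteq> j \<longrightarrow> b \<noteq> k \<longrightarrow> (?g1 ** h2) $ r $ b = ?g1 $ r $ b"
    by (rule clear_entryE[OF ne(4)])
  let ?g2 = "?g1 ** h2"
  have r2: "?g2 $ k $ i = 0" using h2(3)[rule_format, OF ne(1,2), of k] h1(2) by simp
  obtain h3 where h3: "h3 \<in> GL3_integers" "(?g2 ** h3) $ j $ i = 0"
    and h3': "\<forall>r. ?g2 $ r $ i = 0 \<longrightarrow> ?g2 $ r $ j = 0 \<longrightarrow> (?g2 ** h3) $ r $ i = 0 \<and> (?g2 ** h3) $ r $ j = 0"
    by (rule clear_entryE[OF ne(1)])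
  note h3'' = h3'[rule_format, OF r2 h2(2)]
  define u where "u = ?g2 ** h3"
  define h where "h = h1 ** h2 ** h3"
  have K: "h \<in> GL3_integers" unfolding h_def by (intro GL3_integers_mult h1(1) h2(1) h3(1))
  have u: "u = g ** h" by (simp add: u_def h_def matrix_mul_assoc)
  have ui: "invertible u" unfolding u using g K by (simp add: mat3_invertible_mult GL3_integers_invertible)
  have z: "u $ j $ i = 0" "u $ k $ i = 0" "u $ k $ j = 0" using h3 h3'' by (simp_all add: u_def)
  have ei: "u $ i $ i \<noteq> 0"
  proof -
    obtain a where a: "u $ a $ i \<noteq> 0" using invertible_column_nonzero[OF ui] by (rule exE)
    have "a \<in> {i,j,k}" using UNIV_perm3[OF d] by auto
    thus ?thesis using a z by auto
  qed
  have ek: "u $ k $ k \<noteq> 0"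
  proof -
    obtain a where a: "u $ k $ a \<noteq> 0" using invertible_row_nonzero[OF ui] by (rule exE)
    have "a \<in> {i,j,k}" using UNIV_perm3[OF d] by auto
    thus ?thesis using a z by auto
  qed
  \<comment> \<open>Were the middle pivot 0, clearing the entry above it by means of the first pivot
    would produce a zero column.\<close>
  have ej: "u $ j $ j \<noteq> 0"
  proof
    assume 0: "u $ j $ j = 0"
    let ?v = "u ** elementary i j (- (u $ i $ j / u $ i $ i))"
    have "invertible ?v" using ui ne by (simp add: mat3_invertible_mult invertible_elem)
    moreover have "\<forall>a. ?v $ a $ j = 0"
      by (intro iffD2[OF all_perm3[OF d]] conjI) (use 0 z ei in \<open>simp_all add: mult_elem_nth\<close>)
    ultimately show False using invertible_column_nonzero[of ?v j] by simp
  qed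
  define e where "e a = u $ a $ a" for a
  have e: "\<forall>a. e a \<noteq> 0" by (intro iffD2[OF all_perm3[OF d]] conjI) (use ei ej ek in \<open>simp_all add: e_def\<close>)
  have "u = unip i j k (u $ i $ j / e j) (u $ j $ k / e k) (u $ i $ k / e k) ** diag e"
    by (rule mat3_eqI_perm3[OF d]) (use e z in \<open>simp_all add: mult_diag_nth unip_nth[OF d] e_def\<close>)
  moreover have "g = u ** matrix_inv h"
    by (simp add: u matrix_mul_assoc[symmetric] mat3_inv_right GL3_integers_invertible[OF K])
  ultimately have "g = unip i j k (u $ i $ j / e j) (u $ j $ k / e k) (u $ i $ k / e k) ** diag e ** matrix_inv h"
    by simp
  thus ?thesis by (rule that[OF e GL3_integers_inv[OF K]])
qed

text \<open>The unipotent factor does not affect the last row, nor the first column of the inverse,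
  and integral invertible factors preserve least valuations. Comparison with the diagonal entries of
  the triangular matrix and of its inverse gives the inequalities at the other indices, which become
  the bounds of the hexagon.\<close>

lemma iwasawa_coordinates:
  fixes g :: "('a::field) mat3"
  assumes d: "distinct [i,j,k]" and e': "\<forall>a. e a \<noteq> 0" and h: "h \<in> GL3_integers"
    and g: "g = unip i j k x y z ** diag e ** h"
  shows "col_val g i = val (e i)" "row_val g k = val (e k)" "val (det g) = val (e i) + val (e j) + val (e k)"
    "row_val g a \<le> val (e a)" "val (e a) \<le> col_val g a"
proof -
  note e = e'[rule_format]
  note ne = perm3_ne[OF d]
  let ?u = "unip i j k x y z"
  have di: "invertible (diag e)" using e invertible_diag by blast
  have ui: "invertible (?u ** diag e)" using unip_inv(2)[OF d] di by (rule mat3_invertible_mult)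
  have row: "row_val g a = row_val (?u ** diag e) a" for a unfolding g by (rule row_val_mult_K[OF ui h])
  have col: "col_val g a = col_val (?u ** diag e) a" for a unfolding g by (rule col_val_mult_K[OF ui h])
  have inv: "matrix_inv (?u ** diag e) = diag (\<lambda>a. inverse (e a)) ** unip i j k (- x) (- y) (x * y - z)"
    unfolding mat3_inv_mult[OF unip_inv(2)[OF d] di] unip_inv(1)[OF d] diag_inv[OF e] by (rule refl)
  have uaa: "unip i j k x y z $ a $ a = 1" for x y z :: "'a fls" by (simp add: unip_def)
  show "row_val g a \<le> val (e a)"
  proof -
    have "fls_ge (row_val g a) ((?u ** diag e) $ a $ a)" using row_val_iff[OF ui, of "row_val g a" a] row by simp
    thus ?thesis using e[of a] by (simp add: mult_diag_nth uaa fls_ge_iff)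
  qed
  show "val (e a) \<le> col_val g a"
  proof -
    have "fls_ge (- col_val g a) (matrix_inv (?u ** diag e) $ a $ a)" using col_val_iff[OF ui, of "- col_val g a" a] col by simp
    thus ?thesis using e[of a] unfolding inv by (simp add: diag_mult_nth uaa fls_ge_iff)
  qed
  show "row_val g k = val (e k)" unfolding row
  proof (rule row_val_unique)
    show "(\<forall>c. fls_ge n ((?u ** diag e) $ k $ c)) \<longleftrightarrow> n \<le> val (e k)" for n
      unfolding all_perm3[OF d] using e[of k] ne by (simp add: mult_diag_nth unip_nth[OF d] fls_ge_iff)
  qed
  show "col_val g i = val (e i)" unfolding col
  proof (rule col_val_unique)
    show "(\<forall>c. fls_ge n (matrix_inv (?u ** diag e) $ c $ i)) \<longleftrightarrow> n \<le> - val (e i)" for n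
      unfolding all_perm3[OF d] inv using e[of i] ne by (simp add: diag_mult_nth unip_nth[OF d] fls_ge_iff)
  qed
  have "det h \<noteq> 0 \<and> val (det h) = 0" using h by (simp add: GL3_integers_iff)
  thus "val (det g) = val (e i) + val (e j) + val (e k)"
    unfolding g det_mul det_unip[OF d] det_diag_perm3[OF d] using e by simp
qed

text \<open>The point of the Borel subgroup with first index i and last index k; the middle
  coordinate is determined by the determinant.\<close>

definition H_order :: "3 \<Rightarrow> 3 \<Rightarrow> ('a::field) mat3 \<Rightarrow> real^3" where
  "H_order i k g = (\<chi> a. if a = i then of_int (col_val g i) else if a = k then of_int (row_val g k)
     else of_int (val (det g) - col_val g i - row_val g k))"

lemma H_par_order:
  fixes g :: "('a::field) mat3"
  assumes g: "invertible g" and d: "distinct [i,j,k]"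
  defines "b \<equiv> order_of i j k"
  shows "H_par (levi b) (unirad b) g = H_order i k g"
  unfolding H_par_def
proof (rule the_equality)
  note ne = perm3_ne[OF d]
  have ll: "levi_like b (levi b :: 'a mat3 set)" by (simp add: levi_like_def)
  have inj: "inj b" unfolding b_def by (rule inj_order_of[OF d])
  have bij: "a = c" if "b a = b c" for a c using injD[OF inj that] .
  have coords: "H_order i k g $ a = of_int (val (e a))"
    if "\<forall>a. e a \<noteq> 0" "h \<in> GL3_integers" "g = unip i j k x y z ** diag e ** h" for e h x y z a
  proof -
    note ic = iwasawa_coordinates[OF d that]
    have "a \<in> {i,j,k}" using UNIV_perm3[OF d] by auto
    thus ?thesis using ne by (auto simp: H_order_def ic)
  qed
  show "H_order i k g \<in> a_space (levi b :: 'a mat3 set) \<and>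
    (\<forall>n\<in>unirad b. \<forall>m\<in>levi b. \<forall>k'\<in>GL3_integers. g = n ** m ** k' \<longrightarrow>
      (\<forall>\<psi>\<in>rational_characters (levi b). pairing (levi b) \<psi> (H_order i k g) = of_int (val (\<psi> m))))"
  proof (intro conjI ballI impI)
    show "H_order i k g \<in> a_space (levi b :: 'a mat3 set)"
      unfolding a_space_levi by (intro CollectI allI impI) (drule bij, simp)
    fix n m h \<psi> assume n: "n \<in> unirad b" and m: "m \<in> levi b" and h: "h \<in> GL3_integers" and gg: "g = n ** m ** h"
      and \<psi>: "\<psi> \<in> rational_characters (levi b :: 'a mat3 set)"
    obtain x y z where n': "n = unip i j k x y z" using n unfolding b_def unirad_order[OF d] by (elim exE)
    have "m \<in> torus" using m unfolding levi_inj[OF inj] .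
    then obtain e where e: "\<forall>i. e i \<noteq> 0" "m = diag e" unfolding torus_iff_diag by (elim exE conjE)
    have c: "H_order i k g $ a = of_int (val (e a))" for a
      by (rule coords[OF e(1) h gg[unfolded n' e(2)]])
    have "val (\<psi> m) = (\<Sum>a\<in>UNIV. weight (levi b) \<psi> $ a * val (e a))"
      unfolding e(2) by (rule val_weight[OF ll \<psi>]) (use e m in simp_all)
    thus "pairing (levi b) \<psi> (H_order i k g) = of_int (val (\<psi> m))"
      unfolding pairing_def c by simp
  qed
  fix x' assume x': "x' \<in> a_space (levi b :: 'a mat3 set) \<and>
    (\<forall>n\<in>unirad b. \<forall>m\<in>levi b. \<forall>k'\<in>GL3_integers. g = n ** m ** k' \<longrightarrow>
      (\<forall>\<psi>\<in>rational_characters (levi b). pairing (levi b) \<psi> x' = of_int (val (\<psi> m))))"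
  obtain x y z e h where ih: "\<forall>a. e a \<noteq> 0" "h \<in> GL3_integers" "g = unip i j k x y z ** diag e ** h"
    by (rule iwasawa[OF g d])
  have n: "unip i j k x y z \<in> unirad b" unfolding b_def unirad_order[OF d] by (intro exI) (rule refl)
  have m: "diag e \<in> levi b" by (rule subsetD[OF torus_subset_levi diag_in_torus]) (rule ih(1)[rule_format])
  have "x' $ a = H_order i k g $ a" for a
  proof -
    have "(\<lambda>g. g $ a $ a) \<in> rational_characters (levi b :: 'a mat3 set)" by (rule entry_character[OF ll bij])
    from x'[THEN conjunct2, rule_format, OF n m ih(2,3) this]
    have "pairing (levi b :: 'a mat3 set) (\<lambda>g. g $ a $ a) x' = of_int (val (diag e $ a $ a))" .
    moreover have "pairing (levi b :: 'a mat3 set) (\<lambda>g. g $ a $ a) x' = x' $ a" by (rule pairing_entry) (rule bij)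
    ultimately have "x' $ a = of_int (val (diag e $ a $ a))" by simp
    thus ?thesis unfolding coords[OF ih] by simp
  qed
  thus "x' = H_order i k g" by (simp add: vec_eq_iff)
qed

lemma inv_column:
  fixes m :: "('a::field) mat3"
  assumes m: "invertible m" and z: "\<And>a. a \<noteq> k \<Longrightarrow> m $ a $ k = 0"
  shows "matrix_inv m $ c $ k = (if c = k then inverse (m $ k $ k) else 0)"
proof -
  have "matrix_inv m $ c $ a * m $ a $ k = (if a = k then matrix_inv m $ c $ k * m $ k $ k else 0)" for a
    using z[of a] by auto
  hence "(matrix_inv m ** m) $ c $ k = (\<Sum>a\<in>UNIV. if a = k then matrix_inv m $ c $ k * m $ k $ k else 0)"
    unfolding matrix_matrix_mult_def vec_lambda_beta by (intro sum.cong refl)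
  hence e: "(if c = k then 1 else 0) = matrix_inv m $ c $ k * m $ k $ k"
    by (simp add: mat3_inv_left[OF m] mat_def)
  have "m $ k $ k \<noteq> 0" using invertible_column_nonzero[OF m, of k] z by metis
  thus ?thesis using e by (auto simp: field_simps split: if_splits)
qed

text \<open>Vectors in the space of M are constant on the block of size two, so the valuation D - v
  of the determinant of that block is shared equally.\<close>

definition H_block :: "3 \<Rightarrow> real \<Rightarrow> real \<Rightarrow> real^3" where
  "H_block k D v = (\<chi> a. if a = k then v else (D - v) / 2)"

text \<open>After diagonalization a character of M involves only the determinant and the entry at k,
  so their valuations fix all pairings. The hypothesis on v covers every decomposition of g because
  \<open>H_par\<close> quantifies over all of them; uniqueness uses one decomposition and these two
  characters.\<close>

lemma H_par_block:
  fixes g :: "('a::field) mat3"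
  assumes g: "invertible g" and d: "distinct [i,j,k]" and b: "b i = b j" "b k \<noteq> b i"
    and v: "\<And>n m h. n \<in> unirad b \<Longrightarrow> m \<in> levi b \<Longrightarrow> h \<in> GL3_integers \<Longrightarrow> g = n ** m ** h \<Longrightarrow>
        v = val (m $ k $ k) \<and> val (det g) = val (det m)"
    and ex: "\<exists>n\<in>unirad b. \<exists>m\<in>levi b. \<exists>h\<in>GL3_integers. g = n ** m ** h"
  shows "H_par (levi b) (unirad b) g = H_block k (of_int (val (det g))) (of_int v)"
  unfolding H_par_def
proof (rule the_equality)
  note ne = perm3_ne[OF d]
  let ?h = "H_block k (of_int (val (det g))) (of_int v)"
  have ll: "levi_like b (levi b :: 'a mat3 set)" by (simp add: levi_like_def)
  have sing: "a = k" if "b a = b k" for a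
  proof -
    have "a \<in> {i,j,k}" using UNIV_perm3[OF d] by auto
    thus ?thesis using that b by auto
  qed
  show "?h \<in> a_space (levi b :: 'a mat3 set) \<and>
    (\<forall>n\<in>unirad b. \<forall>m\<in>levi b. \<forall>k'\<in>GL3_integers. g = n ** m ** k' \<longrightarrow>
      (\<forall>\<psi>\<in>rational_characters (levi b). pairing (levi b) \<psi> ?h = of_int (val (\<psi> m))))"
  proof (intro conjI ballI impI)
    have "?h $ a = ?h $ c" if "b a = b c" for a c
    proof (cases "a = k \<or> c = k")
      case True
      hence "a = c" using sing[of a] sing[of c] that by auto
      thus ?thesis by simp
    qed (simp add: H_block_def)
    thus "?h \<in> a_space (levi b :: 'a mat3 set)" unfolding a_space_levi by (intro CollectI allI impI)
    fix n m h \<psi> assume n: "n \<in> unirad b" and m: "m \<in> levi b" and h: "h \<in> GL3_integers" and gg: "g = n ** m ** h"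
      and \<psi>: "\<psi> \<in> rational_characters (levi b :: 'a mat3 set)"
    note vm = v[OF n m h gg]
    obtain d' where d': "\<forall>a. d' a \<noteq> 0" "\<psi> m = \<psi> (diag d')" "det m = d' i * d' j * d' k" "d' k = m $ k $ k"
      using levi_diagonalize'[OF \<psi> m d b] by blast
    have dm: "diag d' \<in> levi b" by (rule subsetD[OF torus_subset_levi diag_in_torus]) (use d'(1) in simp)
    have "val (\<psi> m) = (\<Sum>a\<in>UNIV. weight (levi b) \<psi> $ a * val (d' a))"
      unfolding d'(2) by (rule val_weight[OF ll \<psi> _ dm]) (use d'(1) in simp)
    also have "\<dots> = weight (levi b) \<psi> $ i * (val (d' i) + val (d' j)) + weight (levi b) \<psi> $ k * val (d' k)"
      unfolding sum_perm3[OF d] weight_eq[OF ll \<psi> b(1)] by (simp add: algebra_simps)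
    also have "val (d' i) + val (d' j) = val (det g) - v"
      using vm d'(1)[rule_format, of i] d'(1)[rule_format, of j] d'(1)[rule_format, of k] unfolding d'(3) d'(4)[symmetric] by simp
    also have "val (d' k) = v" using vm unfolding d'(4) by simp
    finally have e: "of_int (val (\<psi> m)) = of_int (weight (levi b) \<psi> $ i) * (of_int (val (det g)) - of_int v) + of_int (weight (levi b) \<psi> $ k) * (of_int v :: real)"
      by simp
    show "pairing (levi b) \<psi> ?h = of_int (val (\<psi> m))"
      unfolding pairing_def sum_perm3[OF d] e using ne weight_eq[OF ll \<psi> b(1)] by (simp add: H_block_def field_simps)
  qed
  fix x' assume x': "x' \<in> a_space (levi b :: 'a mat3 set) \<and>
    (\<forall>n\<in>unirad b. \<forall>m\<in>levi b. \<forall>k'\<in>GL3_integers. g = n ** m ** k' \<longrightarrow>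
      (\<forall>\<psi>\<in>rational_characters (levi b). pairing (levi b) \<psi> x' = of_int (val (\<psi> m))))"
  obtain n m h where nmh: "n \<in> unirad b" "m \<in> levi b" "h \<in> GL3_integers" "g = n ** m ** h" using ex by blast
  note vm = v[OF nmh]
  note P = x'[THEN conjunct2, rule_format, OF nmh]
  have "x' $ k = of_int (val (m $ k $ k))"
  proof -
    have "pairing (levi b :: 'a mat3 set) (\<lambda>g. g $ k $ k) x' = x' $ k" by (rule pairing_entry) (rule sing)
    thus ?thesis using P[OF entry_character[OF ll sing]] by simp
  qed
  hence xk: "x' $ k = of_int v" using vm by simp
  have "(\<Sum>i\<in>UNIV. x' $ i) = of_int (val (det m))"
    using P[OF det_character[OF ll]] unfolding pairing_det .
  hence xs: "x' $ i + x' $ j + x' $ k = of_int (val (det g))" using vm unfolding sum_perm3[OF d] by simp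
  have xij: "x' $ i = x' $ j" using CollectD[OF x'[THEN conjunct1, unfolded a_space_levi]] b(1) by blast
  have "x' $ a = ?h $ a" for a
  proof -
    have "a \<in> {i,j,k}" using UNIV_perm3[OF d] by auto
    thus ?thesis using ne xk xs xij by (auto simp: H_block_def field_simps)
  qed
  thus "x' = ?h" by (simp add: vec_eq_iff)
qed

text \<open>The singleton k opens the flag. Elements of the unipotent radical and their inverses fix
  the basis vector at k, so column k of the inverse of g comes from the Levi part.\<close>

lemma H_par_block_first:
  fixes g :: "('a::field) mat3"
  assumes g: "invertible g" and d: "distinct [i,j,k]" and b: "b i = b j" "b k < b i"
  shows "H_par (levi b) (unirad b) g = H_block k (of_int (val (det g))) (of_int (col_val g k))"
proof (rule H_par_block[OF g d b(1)])
  show "b k \<noteq> b i" using b by simp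
  note ne = perm3_ne[OF d]
  have d': "distinct [k,i,j]" using ne by simp
  have un: "n \<in> unirad b \<longleftrightarrow> (\<exists>x z. n = unip k i j x 0 z)" for n :: "'a mat3"
  proof
    assume n: "n \<in> unirad b"
    have e: "n $ a $ c = (if a = c then 1 else 0)" if "b c \<le> b a" for a c using n that by (simp add: unirad_def)
    have "n = unip k i j (n $ k $ i) 0 (n $ k $ j)"
      by (rule mat3_eqI_perm3[OF d']) (use ne b in \<open>simp_all add: unip_nth[OF d'] e\<close>)
    thus "\<exists>x z. n = unip k i j x 0 z" by (intro exI)
  next
    assume "\<exists>x z. n = unip k i j x 0 z"
    then obtain x z where n: "n = unip k i j x 0 z" by (elim exE)
    have "\<forall>a c. b c \<le> b a \<longrightarrow> n $ a $ c = (if a = c then 1 else 0)"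
      by (intro iffD2[OF all_perm3[OF d']] conjI) (use ne b in \<open>simp_all add: unip_nth[OF d'] n\<close>)
    thus "n \<in> unirad b" unfolding unirad_def using unip_inv(2)[OF d'] n by simp
  qed
  {
    fix n m h assume n: "n \<in> unirad b" and m: "m \<in> levi b" and h: "h \<in> GL3_integers" and gg: "g = n ** m ** h"
    obtain x z where nu: "n = unip k i j x 0 z" using n un by blast
    have mi: "invertible m" using m by (simp add: levi_def)
    have ni: "invertible n" unfolding nu by (rule unip_inv(2)[OF d'])
    have mz: "m $ a $ k = 0" if "a \<noteq> k" for a
    proof -
      have "a \<in> {i,j,k}" using UNIV_perm3[OF d] by auto
      hence "b a \<noteq> b k" using that b by auto
      thus ?thesis using m by (simp add: levi_def)
    qed
    have mkk: "m $ k $ k \<noteq> 0" using invertible_column_nonzero[OF mi, of k] mz by metis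
    have "col_val g k = col_val (n ** m) k" unfolding gg by (rule col_val_mult_K[OF mat3_invertible_mult[OF ni mi] h])
    also have "\<dots> = val (m $ k $ k)"
    proof (rule col_val_unique)
      fix r
      have "matrix_inv (n ** m) $ c $ k = matrix_inv m $ c $ k" for c
        unfolding mat3_inv_mult[OF ni mi] unfolding nu unip_inv(1)[OF d'] matrix_mult_perm3[OF d'] by (simp add: unip_nth[OF d'])
      thus "(\<forall>c. fls_ge r (matrix_inv (n ** m) $ c $ k)) \<longleftrightarrow> r \<le> - val (m $ k $ k)"
        unfolding all_perm3[OF d] using ne mkk by (simp add: inv_column[OF mi mz] fls_ge_iff)
    qed
    moreover have "val (det g) = val (det m)"
    proof -
      have "det h \<noteq> 0 \<and> val (det h) = 0" using h by (simp add: GL3_integers_iff)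
      thus ?thesis unfolding gg nu det_mul det_unip[OF d'] using mi by (simp add: invertible_det)
    qed
    ultimately show "col_val g k = val (m $ k $ k) \<and> val (det g) = val (det m)" by simp
  }
  obtain x y z e h where ih: "\<forall>a. e a \<noteq> 0" "h \<in> GL3_integers" "g = unip k i j x y z ** diag e ** h"
    by (rule iwasawa[OF g d'])
  have el: "elementary i j y = unip k i j 0 y 0"
    by (rule mat3_eqI_perm3[OF d']) (use ne in \<open>simp_all add: unip_nth[OF d'] elem_nth\<close>)
  \<comment> \<open>The entry at (i, j) lies inside the block and is moved to the right, into the
    Levi part.\<close>
  have "unip k i j x y z = unip k i j x 0 (z - x * y) ** elementary i j y"
    unfolding el unip_mult[OF d'] by simp
  hence "g = unip k i j x 0 (z - x * y) ** (elementary i j y ** diag e) ** h" using ih(3) by (simp add: matrix_mul_assoc)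
  moreover have "elementary i j y ** diag e \<in> levi b"
  proof (rule levi_mult)
    show "elementary i j y \<in> levi b" by (rule levi_like_elem[where b = b]) (use ne b in \<open>simp_all add: levi_like_def\<close>)
    show "diag e \<in> levi b" by (rule subsetD[OF torus_subset_levi diag_in_torus]) (rule ih(1)[rule_format])
  qed
  moreover have "unip k i j x 0 (z - x * y) \<in> unirad b" using un by blast
  ultimately show "\<exists>n\<in>unirad b. \<exists>m\<in>levi b. \<exists>h\<in>GL3_integers. g = n ** m ** h" using ih(2) by blast
qed

text \<open>The singleton k ends the flag, so left multiplication by the unipotent radical leaves
  row k unchanged.\<close>

lemma H_par_block_last:
  fixes g :: "('a::field) mat3"
  assumes g: "invertible g" and d: "distinct [i,j,k]" and b: "b i = b j" "b i < b k"
  shows "H_par (levi b) (unirad b) g = H_block k (of_int (val (det g))) (of_int (row_val g k))"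
proof (rule H_par_block[OF g d b(1)])
  show "b k \<noteq> b i" using b by simp
  note ne = perm3_ne[OF d]
  have un: "n \<in> unirad b \<longleftrightarrow> (\<exists>y z. n = unip i j k 0 y z)" for n :: "'a mat3"
  proof
    assume n: "n \<in> unirad b"
    have e: "n $ a $ c = (if a = c then 1 else 0)" if "b c \<le> b a" for a c using n that by (simp add: unirad_def)
    have "n = unip i j k 0 (n $ j $ k) (n $ i $ k)"
      by (rule mat3_eqI_perm3[OF d]) (use ne b in \<open>simp_all add: unip_nth[OF d] e\<close>)
    thus "\<exists>y z. n = unip i j k 0 y z" by (intro exI)
  next
    assume "\<exists>y z. n = unip i j k 0 y z"
    then obtain y z where n: "n = unip i j k 0 y z" by (elim exE)
    have "\<forall>a c. b c \<le> b a \<longrightarrow> n $ a $ c = (if a = c then 1 else 0)"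
      by (intro iffD2[OF all_perm3[OF d]] conjI) (use ne b in \<open>simp_all add: unip_nth[OF d] n\<close>)
    thus "n \<in> unirad b" unfolding unirad_def using unip_inv(2)[OF d] n by simp
  qed
  {
    fix n m h assume n: "n \<in> unirad b" and m: "m \<in> levi b" and h: "h \<in> GL3_integers" and gg: "g = n ** m ** h"
    obtain y z where nu: "n = unip i j k 0 y z" using n un by blast
    have mi: "invertible m" using m by (simp add: levi_def)
    have ni: "invertible n" unfolding nu by (rule unip_inv(2)[OF d])
    have mz: "m $ k $ i = 0" "m $ k $ j = 0" using m b by (simp_all add: levi_def)
    have "m $ k $ k \<noteq> 0"
    proof -
      obtain a where a: "m $ k $ a \<noteq> 0" using invertible_row_nonzero[OF mi] by (rule exE)
      have "a \<in> {i,j,k}" using UNIV_perm3[OF d] by auto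
      thus ?thesis using a mz by auto
    qed
    have "row_val g k = row_val (n ** m) k" unfolding gg by (rule row_val_mult_K[OF mat3_invertible_mult[OF ni mi] h])
    also have "\<dots> = val (m $ k $ k)"
    proof (rule row_val_unique)
      fix r
      have "(n ** m) $ k $ c = m $ k $ c" for c
        unfolding nu matrix_mult_perm3[OF d] by (simp add: unip_nth[OF d])
      thus "(\<forall>c. fls_ge r ((n ** m) $ k $ c)) \<longleftrightarrow> r \<le> val (m $ k $ k)"
        unfolding all_perm3[OF d] using ne mz \<open>m $ k $ k \<noteq> 0\<close> by (simp add: fls_ge_iff)
    qed
    moreover have "val (det g) = val (det m)"
    proof -
      have "det h \<noteq> 0 \<and> val (det h) = 0" using h by (simp add: GL3_integers_iff)
      thus ?thesis unfolding gg nu det_mul det_unip[OF d] using mi by (simp add: invertible_det)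
    qed
    ultimately show "row_val g k = val (m $ k $ k) \<and> val (det g) = val (det m)" by simp
  }
  obtain x y z e h where ih: "\<forall>a. e a \<noteq> 0" "h \<in> GL3_integers" "g = unip i j k x y z ** diag e ** h"
    by (rule iwasawa[OF g d])
  have el: "elementary i j x = unip i j k x 0 0"
    by (rule mat3_eqI_perm3[OF d]) (use ne in \<open>simp_all add: unip_nth[OF d] elem_nth\<close>)
  have "unip i j k x y z = unip i j k 0 y z ** elementary i j x"
    unfolding el unip_mult[OF d] by simp
  hence "g = unip i j k 0 y z ** (elementary i j x ** diag e) ** h" using ih(3) by (simp add: matrix_mul_assoc)
  moreover have "elementary i j x ** diag e \<in> levi b"
  proof (rule levi_mult)
    show "elementary i j x \<in> levi b" by (rule levi_like_elem[where b = b]) (use ne b in \<open>simp_all add: levi_like_def\<close>)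
    show "diag e \<in> levi b" by (rule subsetD[OF torus_subset_levi diag_in_torus]) (rule ih(1)[rule_format])
  qed
  moreover have "unip i j k 0 y z \<in> unirad b" using un by blast
  ultimately show "\<exists>n\<in>unirad b. \<exists>m\<in>levi b. \<exists>h\<in>GL3_integers. g = n ** m ** h" using ih(2) by blast
qed

section \<open>Volumes of the weight polytopes\<close>

text \<open>Affine coordinates on the plane of vectors with coordinate sum D, the third coordinate
  being eliminated.\<close>

definition plane_point :: "3 \<Rightarrow> 3 \<Rightarrow> real \<Rightarrow> real \<Rightarrow> real \<Rightarrow> real^3" where
  "plane_point i k D x y = (\<chi> a. if a = i then x else if a = k then y else D - x - y)"

lemma plane_point_eqI:
  assumes d: "distinct [i,j,k]" and "h $ i = x" "h $ k = y" "h $ i + h $ j + h $ k = D"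
  shows "plane_point i k D x y = h"
proof -
  note ne = perm3_ne[OF d]
  have "plane_point i k D x y $ a = h $ a" for a
  proof -
    have "a \<in> {i,j,k}" using UNIV_perm3[OF d] by auto
    thus ?thesis using ne assms by (auto simp: plane_point_def)
  qed
  thus ?thesis by (simp add: vec_eq_iff)
qed

lemma convex_plane_point:
  assumes S: "convex S" and "plane_point i k D x y \<in> S" "plane_point i k D x' y' \<in> S" "0 \<le> u" "u \<le> 1"
  shows "plane_point i k D ((1 - u) * x + u * x') ((1 - u) * y + u * y') \<in> S"
proof -
  have "(1 - u) *\<^sub>R plane_point i k D x y + u *\<^sub>R plane_point i k D x' y' \<in> S"
    using assms by (intro convexD) auto
  also have "(1 - u) *\<^sub>R plane_point i k D x y + u *\<^sub>R plane_point i k D x' y' = plane_point i k D ((1 - u) * x + u * x') ((1 - u) * y + u * y')"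
    by (simp add: plane_point_def vec_eq_iff algebra_simps)
  finally show ?thesis .
qed

lemma between_coeff:
  fixes a b t :: real
  assumes "a \<le> t" "t \<le> b"
  obtains u where "0 \<le> u" "u \<le> 1" "t = (1 - u) * a + u * b"
proof (cases "a = b")
  case True
  thus ?thesis using assms that[of 0] by simp
next
  case False
  hence lt: "a < b" using assms by simp
  define u where "u = (t - a) / (b - a)"
  have u: "u * (b - a) = t - a" "0 \<le> u" "u \<le> 1" using assms lt by (simp_all add: u_def divide_le_eq)
  show ?thesis by (rule that[OF u(2,3)]) (use u(1) in \<open>simp add: algebra_simps\<close>)
qed

lemma plane_point_edge:
  assumes S: "convex S" and P: "plane_point i k D a (p + q * a) \<in> S" "plane_point i k D b (p + q * b) \<in> S" and t: "a \<le> t" "t \<le> b"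
  shows "plane_point i k D t (p + q * t) \<in> S"
proof -
  obtain u where u: "0 \<le> u" "u \<le> 1" "t = (1 - u) * a + u * b" by (rule between_coeff[OF t])
  have "(1 - u) * (p + q * a) + u * (p + q * b) = p + q * t" unfolding u(3) by (simp add: algebra_simps)
  thus ?thesis using convex_plane_point[OF S P u(1,2)] u(3) by simp
qed

lemma plane_point_vertical:
  assumes S: "convex S" and P: "plane_point i k D t c \<in> S" "plane_point i k D t d \<in> S" and y: "c \<le> y" "y \<le> d"
  shows "plane_point i k D t y \<in> S"
proof -
  obtain u where u: "0 \<le> u" "u \<le> 1" "y = (1 - u) * c + u * d" by (rule between_coeff[OF y])
  have "(1 - u) * t + u * t = t" by (simp add: algebra_simps)
  thus ?thesis using convex_plane_point[OF S P u(1,2)] u(3) by simp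
qed

text \<open>The slice through a point of the hexagon ends on two of its edges.\<close>

lemma hexagon_slice:
  fixes r s :: "3 \<Rightarrow> real"
  assumes d: "distinct [i,j,k]" and S: "convex S"
    and V: "plane_point i k D (s i) (r k) \<in> S" "plane_point i k D (D - s j - r k) (r k) \<in> S"
      "plane_point i k D (r i) (D - s j - r i) \<in> S" "plane_point i k D (r i) (s k) \<in> S"
      "plane_point i k D (D - s k - r j) (s k) \<in> S" "plane_point i k D (s i) (D - s i - r j) \<in> S"
    and x: "r i \<le> x" "x \<le> s i" and y: "r k \<le> y" "y \<le> s k" and z: "r j \<le> D - x - y" "D - x - y \<le> s j"
  shows "plane_point i k D x y \<in> S"
proof -
  have lower: "plane_point i k D x (max (r k) (D - x - s j)) \<in> S"
  proof (cases "D - x - s j \<le> r k")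
    case True
    have "plane_point i k D x (r k + 0 * x) \<in> S"
      by (rule plane_point_edge[OF S, of i k D "D - s j - r k" _ _ "s i"]) (use V x True in simp_all)
    thus ?thesis using True by (simp add: max_def)
  next
    case False
    have "plane_point i k D x ((D - s j) + (-1) * x) \<in> S"
      by (rule plane_point_edge[OF S, of i k D "r i" _ _ "D - s j - r k"]) (use V x False in \<open>simp_all add: algebra_simps\<close>)
    thus ?thesis using False by (simp add: max_def algebra_simps)
  qed
  have upper: "plane_point i k D x (min (s k) (D - x - r j)) \<in> S"
  proof (cases "s k \<le> D - x - r j")
    case True
    have "plane_point i k D x (s k + 0 * x) \<in> S"
      by (rule plane_point_edge[OF S, of i k D "r i" _ _ "D - s k - r j"]) (use V x True in simp_all)
    thus ?thesis using True by (simp add: min_def)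
  next
    case False
    have "plane_point i k D x ((D - r j) + (-1) * x) \<in> S"
      by (rule plane_point_edge[OF S, of i k D "D - s k - r j" _ _ "s i"]) (use V x False in \<open>simp_all add: algebra_simps\<close>)
    thus ?thesis using False by (simp add: min_def algebra_simps)
  qed
  show ?thesis by (rule plane_point_vertical[OF S lower upper]) (use y z in auto)
qed

definition hexagon :: "3 \<Rightarrow> 3 \<Rightarrow> 3 \<Rightarrow> (3 \<Rightarrow> real) \<Rightarrow> (3 \<Rightarrow> real) \<Rightarrow> real \<Rightarrow> (real^2) set" where
  "hexagon i j k r s D = {w. r i \<le> w $ 1 \<and> w $ 1 \<le> s i \<and> r k \<le> w $ 2 \<and> w $ 2 \<le> s k \<and> r j \<le> D - w $ 1 - w $ 2 \<and> D - w $ 1 - w $ 2 \<le> s j}"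

text \<open>The right triangle with vertex (p, q) and legs l; c = 1 serves the lower left corner of
  the rectangle, c = -1 the upper right one.\<close>

lemma corner_triangle_measure:
  fixes p q l c :: real
  assumes c: "c = 1 \<or> c = -1" and l: "0 \<le> l"
  defines "T \<equiv> {w :: real^2. 0 \<le> c * (w $ 1 - p) \<and> 0 \<le> c * (w $ 2 - q) \<and> c * (w $ 1 - p) + c * (w $ 2 - q) \<le> l}"
  shows "T \<in> lmeasurable" "measure lebesgue T = l\<^sup>2 / 2"
proof -
  define A B C where "A = (vector [p, q] :: real^2)" and "B = (vector [p + c * l, q] :: real^2)" and "C = (vector [p, q + c * l] :: real^2)"
  have cc: "c * c = 1" using c by auto
  have T: "T = convex hull {A, B, C}"
  proof (intro Set.set_eqI iffI)
    fix w assume "w \<in> T"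
    define X Y where "X = c * (w $ 1 - p)" and "Y = c * (w $ 2 - q)"
    have w: "0 \<le> X" "0 \<le> Y" "X + Y \<le> l" using \<open>w \<in> T\<close> by (simp_all add: T_def X_def Y_def)
    have bk: "w $ 1 = p + c * X" "w $ 2 = q + c * Y"
      using cc by (simp_all add: mult.assoc[symmetric] X_def Y_def)
    define \<alpha> \<beta> where "\<alpha> = (if l = 0 then 0 else X / l)" and "\<beta> = (if l = 0 then 0 else Y / l)"
    have ab: "0 \<le> \<alpha>" "0 \<le> \<beta>" "\<alpha> + \<beta> \<le> 1" "\<alpha> * l = X" "\<beta> * l = Y"
      using w l by (auto simp: \<alpha>_def \<beta>_def add_divide_distrib[symmetric] divide_le_eq)
    have "w = (1 - \<alpha> - \<beta>) *\<^sub>R A + \<alpha> *\<^sub>R B + \<beta> *\<^sub>R C"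
    proof -
      have "w $ 1 = p + c * (\<alpha> * l)" "w $ 2 = q + c * (\<beta> * l)" using bk ab by simp_all
      thus ?thesis by (simp add: vec_eq_iff forall_2 A_def B_def C_def algebra_simps)
    qed
    thus "w \<in> convex hull {A, B, C}" unfolding convex_hull_3 using ab
      by (intro CollectI exI[of _ "1 - \<alpha> - \<beta>"] exI[of _ \<alpha>] exI[of _ \<beta>]) simp
  next
    fix w assume "w \<in> convex hull {A, B, C}"
    then obtain u v t where u: "0 \<le> u" "0 \<le> v" "0 \<le> t" "u + v + t = 1" "w = u *\<^sub>R A + v *\<^sub>R B + t *\<^sub>R C"
      unfolding convex_hull_3 by (elim CollectE exE conjE)
    have "w $ 1 = (u + v + t) * p + c * (v * l)" "w $ 2 = (u + v + t) * q + c * (t * l)"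
      unfolding u(5) by (simp_all add: A_def B_def C_def algebra_simps)
    hence "w $ 1 - p = c * (v * l)" "w $ 2 - q = c * (t * l)" unfolding u(4) by simp_all
    hence e: "c * (w $ 1 - p) = v * l" "c * (w $ 2 - q) = t * l" using cc by (simp_all add: mult.assoc[symmetric])
    have "(v + t) * l \<le> 1 * l" using u l by (intro mult_right_mono) auto
    thus "w \<in> T" unfolding T_def using e u l by (simp add: algebra_simps)
  qed
  have "compact T" unfolding T by (intro compact_convex_hull finite_imp_compact) simp
  thus "T \<in> lmeasurable" by (rule lmeasurable_compact)
  have "measure lebesgue T = measure lborel T" using \<open>compact T\<close> by (simp add: measure_completion borel_compact)
  also have "\<dots> = l\<^sup>2 / 2"
    unfolding T content_triangle using c by (elim disjE) (simp_all add: A_def B_def C_def power2_eq_square)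
  finally show "measure lebesgue T = l\<^sup>2 / 2" .
qed

text \<open>The rectangle is covered by the hexagon and two corner triangles, on which the
  coordinate j is at most r j or at least s j. The bounds on l and m keep the triangles inside the
  rectangle, and the overlaps have measure zero.\<close>

lemma hexagon_measure:
  fixes r s :: "3 \<Rightarrow> real"
  assumes l: "l = s i + s k + r j - D" "0 \<le> l" "l \<le> s i - r i" "l \<le> s k - r k"
    and m: "m = D - s j - r i - r k" "0 \<le> m" "m \<le> s i - r i" "m \<le> s k - r k"
  shows "hexagon i j k r s D \<in> lmeasurable"
    and "measure lebesgue (hexagon i j k r s D) = (s i - r i) * (s k - r k) - l\<^sup>2 / 2 - m\<^sup>2 / 2"
proof -
  let ?R = "hexagon i j k r s D"
  let ?box = "cbox (vector [r i, r k]) (vector [s i, s k]) :: (real^2) set"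
  define T1 where "T1 = {w :: real^2. 0 \<le> (-1) * (w $ 1 - s i) \<and> 0 \<le> (-1) * (w $ 2 - s k) \<and> (-1) * (w $ 1 - s i) + (-1) * (w $ 2 - s k) \<le> l}"
  define T2 where "T2 = {w :: real^2. 0 \<le> 1 * (w $ 1 - r i) \<and> 0 \<le> 1 * (w $ 2 - r k) \<and> 1 * (w $ 1 - r i) + 1 * (w $ 2 - r k) \<le> m}"
  have T1: "T1 \<in> lmeasurable" "measure lebesgue T1 = l\<^sup>2 / 2" unfolding T1_def using corner_triangle_measure[of "-1" l "s i" "s k"] l(2) by auto
  have T2: "T2 \<in> lmeasurable" "measure lebesgue T2 = m\<^sup>2 / 2" unfolding T2_def using corner_triangle_measure[of 1 m "r i" "r k"] m(2) by auto
  have box: "w \<in> ?box \<longleftrightarrow> r i \<le> w $ 1 \<and> w $ 1 \<le> s i \<and> r k \<le> w $ 2 \<and> w $ 2 \<le> s k" for w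
    by (auto simp: mem_box_cart forall_2)
  have Req: "?R = ?box \<inter> {w. (vector [1, 1] :: real^2) \<bullet> w \<le> D - r j} \<inter> {w. (vector [1, 1] :: real^2) \<bullet> w \<ge> D - s j}"
    by (auto simp: box hexagon_def inner_vec_def sum_2)
  have "compact ?R" unfolding Req
    by (intro compact_Int_closed compact_cbox closed_halfspace_le closed_halfspace_ge)
  thus R: "?R \<in> lmeasurable" by (rule lmeasurable_compact)
  have line: "negligible {w. (vector [1, 1] :: real^2) \<bullet> w = e}" for e
    by (rule negligible_hyperplane) (simp add: vec_eq_iff forall_2)
  have "negligible (?R \<inter> T1)"
    by (rule negligible_subset[OF line[of "D - r j"]]) (auto simp: hexagon_def T1_def inner_vec_def sum_2 l)
  moreover have "negligible (?R \<inter> T2)"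
    by (rule negligible_subset[OF line[of "D - s j"]]) (auto simp: hexagon_def T2_def inner_vec_def sum_2 m)
  \<comment> \<open>The triangles can meet only if s j \<le> r j. The bounds on l and m exclude the
    strict inequality, and equality confines the intersection to a line.\<close>
  moreover have "negligible (T1 \<inter> T2)"
  proof (cases "s j = r j \<or> s j < r j")
    case True
    show ?thesis
      by (rule negligible_subset[OF line[of "D - r j"]]) (use True l m in \<open>auto simp: T1_def T2_def inner_vec_def sum_2\<close>)
  next
    case False
    hence "T1 \<inter> T2 = {}" using l m by (auto simp: T1_def T2_def)
    thus ?thesis by simp
  qed
  ultimately have "measure lebesgue (?R \<union> T1 \<union> T2) = measure lebesgue ?R + measure lebesgue T1 + measure lebesgue T2"
    by (intro measure_Un3_negligible R T1 T2) auto
  moreover have "?R \<union> T1 \<union> T2 = ?box"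
  proof (intro Set.set_eqI iffI)
    fix w assume "w \<in> ?R \<union> T1 \<union> T2"
    thus "w \<in> ?box" unfolding box using l m by (auto simp: hexagon_def T1_def T2_def)
  next
    fix w assume "w \<in> ?box"
    thus "w \<in> ?R \<union> T1 \<union> T2" unfolding box using l m by (auto simp: hexagon_def T1_def T2_def)
  qed
  moreover have "measure lebesgue ?box = (s i - r i) * (s k - r k)"
  proof -
    have "vector [r i, r k] \<in> ?box" unfolding box using l by simp
    hence "?box \<noteq> {}" by blast
    hence "measure lborel ?box = (s i - r i) * (s k - r k)" by (simp add: content_cbox_cart UNIV_2)
    thus ?thesis by (simp add: measure_completion)
  qed
  ultimately show "measure lebesgue ?R = (s i - r i) * (s k - r k) - l\<^sup>2 / 2 - m\<^sup>2 / 2" using T1 T2 by simp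
qed

definition hex_vertex :: "(3 \<Rightarrow> real) \<Rightarrow> (3 \<Rightarrow> real) \<Rightarrow> real \<Rightarrow> 3 \<Rightarrow> 3 \<Rightarrow> real^3" where
  "hex_vertex r s D a c = (\<chi> t. if t = a then s a else if t = c then r c else D - s a - r c)"

text \<open>The hypotheses say that the vertices obey the bounds, which gives one inclusion; for the
  other, the six vertices are matched with those required by \<open>hexagon_slice\<close>. Vertices
  may coincide, so degenerate hexagons are included.\<close>

lemma convex_hull_hexagon:
  fixes r s :: "3 \<Rightarrow> real"
  assumes c: "\<And>i j k. distinct [i,j,k] \<Longrightarrow> r j \<le> D - s i - r k \<and> D - s i - r k \<le> s j" and rs: "\<And>a. r a \<le> s a"
  shows "convex hull {hex_vertex r s D a c | a c. a \<noteq> c} = {h. (\<Sum>a\<in>UNIV. h $ a) = D \<and> (\<forall>a. r a \<le> h $ a \<and> h $ a \<le> s a)}"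
    (is "convex hull ?V = ?H")
proof
  have "convex ?H"
  proof (rule convexI)
    fix x y u v assume x: "x \<in> ?H" and y: "y \<in> ?H" and u: "0 \<le> u" "0 \<le> v" "u + v = (1::real)"
    have "(\<Sum>a\<in>UNIV. (u *\<^sub>R x + v *\<^sub>R y) $ a) = u * (\<Sum>a\<in>UNIV. x $ a) + v * (\<Sum>a\<in>UNIV. y $ a)"
      by (simp add: sum.distrib sum_distrib_left)
    also have "\<dots> = (u + v) * D" using x y by (simp add: algebra_simps)
    finally have 1: "(\<Sum>a\<in>UNIV. (u *\<^sub>R x + v *\<^sub>R y) $ a) = D" using u by simp
    have 2: "r a \<le> (u *\<^sub>R x + v *\<^sub>R y) $ a \<and> (u *\<^sub>R x + v *\<^sub>R y) $ a \<le> s a" for a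
    proof -
      have h: "r a \<le> x $ a" "x $ a \<le> s a" "r a \<le> y $ a" "y $ a \<le> s a" using x y by auto
      have "u * r a + v * r a \<le> u * x $ a + v * y $ a" "u * x $ a + v * y $ a \<le> u * s a + v * s a"
        using h u by (intro add_mono mult_left_mono; simp)+
      moreover have "u * r a + v * r a = r a" "u * s a + v * s a = s a" using u(3) by (simp_all add: distrib_right[symmetric])
      ultimately show ?thesis by simp
    qed
    show "u *\<^sub>R x + v *\<^sub>R y \<in> ?H" using 1 2 by blast
  qed
  moreover have "?V \<subseteq> ?H"
  proof
    fix v assume "v \<in> ?V"
    then obtain a c' where v: "v = hex_vertex r s D a c'" "a \<noteq> c'" by blast
    obtain b where "distinct [a,c',b]" using ex_perm3[OF v(2)] by blast
    hence d: "distinct [a,b,c']" by auto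
    note ne = perm3_ne[OF d]
    have "(\<Sum>t\<in>UNIV. v $ t) = D" unfolding sum_perm3[OF d] v(1) using ne by (simp add: hex_vertex_def)
    moreover have "\<forall>t. r t \<le> v $ t \<and> v $ t \<le> s t"
      by (intro iffD2[OF all_perm3[OF d]] conjI) (use ne c[OF d] rs in \<open>simp_all add: hex_vertex_def v(1)\<close>)
    ultimately show "v \<in> ?H" by simp
  qed
  ultimately show "convex hull ?V \<subseteq> ?H" by (intro hull_minimal)
  show "?H \<subseteq> convex hull ?V"
  proof
    fix h assume "h \<in> ?H"
    hence h: "(\<Sum>a\<in>UNIV. h $ a) = D" and hb: "\<And>a. r a \<le> h $ a" "\<And>a. h $ a \<le> s a" by auto
    have d: "distinct [1,2,3::3]" by simp
    have s3: "h $ 1 + h $ 2 + h $ 3 = D" using h by (simp add: sum_3)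
    have V: "hex_vertex r s D a c \<in> convex hull ?V" if "a \<noteq> c" for a c using that by (intro hull_inc) blast
    have "plane_point 1 3 D (h $ 1) (h $ 3) \<in> convex hull ?V"
    proof (rule hexagon_slice[OF d convex_convex_hull, where r = r and s = s])
      have "plane_point 1 3 D (s 1) (r 3) = hex_vertex r s D 1 3"
        by (rule plane_point_eqI[OF d]) (simp_all add: hex_vertex_def)
      thus "plane_point 1 3 D (s 1) (r 3) \<in> convex hull ?V" using V[of 1 3] by simp
      have "plane_point 1 3 D (D - s 2 - r 3) (r 3) = hex_vertex r s D 2 3"
        by (rule plane_point_eqI[OF d]) (simp_all add: hex_vertex_def)
      thus "plane_point 1 3 D (D - s 2 - r 3) (r 3) \<in> convex hull ?V" using V[of 2 3] by simp
      have "plane_point 1 3 D (r 1) (D - s 2 - r 1) = hex_vertex r s D 2 1"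
        by (rule plane_point_eqI[OF d]) (simp_all add: hex_vertex_def)
      thus "plane_point 1 3 D (r 1) (D - s 2 - r 1) \<in> convex hull ?V" using V[of 2 1] by simp
      have "plane_point 1 3 D (r 1) (s 3) = hex_vertex r s D 3 1"
        by (rule plane_point_eqI[OF d]) (simp_all add: hex_vertex_def)
      thus "plane_point 1 3 D (r 1) (s 3) \<in> convex hull ?V" using V[of 3 1] by simp
      have "plane_point 1 3 D (D - s 3 - r 2) (s 3) = hex_vertex r s D 3 2"
        by (rule plane_point_eqI[OF d]) (simp_all add: hex_vertex_def)
      thus "plane_point 1 3 D (D - s 3 - r 2) (s 3) \<in> convex hull ?V" using V[of 3 2] by simp
      have "plane_point 1 3 D (s 1) (D - s 1 - r 2) = hex_vertex r s D 1 2"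
        by (rule plane_point_eqI[OF d]) (simp_all add: hex_vertex_def)
      thus "plane_point 1 3 D (s 1) (D - s 1 - r 2) \<in> convex hull ?V" using V[of 1 2] by simp
      have e: "D - h $ 1 - h $ 3 = h $ 2" using s3 by argo
      show "r 2 \<le> D - h $ 1 - h $ 3" "D - h $ 1 - h $ 3 \<le> s 2" unfolding e by (rule hb)+
    qed (rule hb)+
    moreover have "plane_point 1 3 D (h $ 1) (h $ 3) = h" by (rule plane_point_eqI[OF d refl refl s3])
    ultimately show "h \<in> convex hull ?V" by simp
  qed
qed

section \<open>The weight factor of the torus\<close>

lemma levi_eq_iff: "levi b = (levi b' :: ('a::field) mat3 set) \<longleftrightarrow> (\<forall>i j. b i = b j \<longleftrightarrow> b' i = b' j)"
proof
  assume e: "levi b = (levi b' :: 'a mat3 set)"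
  show "\<forall>i j. b i = b j \<longleftrightarrow> b' i = b' j"
  proof (intro allI)
    fix i j show "b i = b j \<longleftrightarrow> b' i = b' j"
    proof (cases "i = j")
      case False
      show ?thesis unfolding elem_in_levi[OF False, of b, where 'a = 'a, symmetric] elem_in_levi[OF False, of b', where 'a = 'a, symmetric] e ..
    qed simp
  qed
qed (rule levi_cong, simp)

lemma levi_decomposition_levi:
  "levi_decomposition P (levi b :: ('a::field) mat3 set) N \<longleftrightarrow>
    (\<exists>b' l. range b' = {..<l} \<and> (\<forall>i j. b i = b j \<longleftrightarrow> b' i = b' j) \<and> P = parab b' \<and> N = unirad b')"
proof -
  have "levi_decomposition P (levi b :: 'a mat3 set) N \<longleftrightarrow> levi_decomposition P (levi b :: 'a mat3 set) N \<and> torus \<subseteq> (levi b :: 'a mat3 set)"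
    by (simp only: torus_subset_levi simp_thms)
  also have "\<dots> \<longleftrightarrow> (\<exists>b' l. range b' = {..<l} \<and> P = parab b' \<and> levi b = (levi b' :: 'a mat3 set) \<and> N = unirad b')"
    by (rule levi_decomposition_iff)
  finally show ?thesis unfolding levi_eq_iff by (simp only: conj_ac)
qed

text \<open>The middle expression is the valuation of the j-entry in the Iwasawa decomposition for
  the order i, j, k.\<close>

lemma hexagon_inequalities:
  fixes g :: "('a::field) mat3"
  assumes g: "invertible g" and d: "distinct [i,j,k]"
  shows "row_val g j \<le> val (det g) - col_val g i - row_val g k" "val (det g) - col_val g i - row_val g k \<le> col_val g j"
    "row_val g a \<le> col_val g a"
proof -
  obtain x y z e h where ih: "\<forall>a. e a \<noteq> 0" "h \<in> GL3_integers" "g = unip i j k x y z ** diag e ** h"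
    by (rule iwasawa[OF g d])
  note ic = iwasawa_coordinates[OF d ih]
  show "row_val g j \<le> val (det g) - col_val g i - row_val g k" "val (det g) - col_val g i - row_val g k \<le> col_val g j"
    using ic(4,5)[of j] by (simp_all add: ic(1-3))
  show "row_val g a \<le> col_val g a" using ic(4,5)[of a] by simp
qed

text \<open>
  The area of the rectangle cut out by the bounds on the coordinates i and k, minus the two corner
  triangles cut off by the bounds on the coordinate j.
\<close>

definition hex_weight :: "3 \<Rightarrow> 3 \<Rightarrow> 3 \<Rightarrow> ('a::field) mat3 \<Rightarrow> real" where
  "hex_weight i j k g = of_int (col_val g i - row_val g i) * of_int (col_val g k - row_val g k)
     - (of_int (col_val g i + col_val g k + row_val g j - val (det g)))\<^sup>2 / 2
     - (of_int (val (det g) - col_val g j - row_val g i - row_val g k))\<^sup>2 / 2"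

lemma sum_plane_point:
  assumes d: "distinct [i,j,k]"
  shows "(\<Sum>a\<in>UNIV. plane_point i k D x y $ a) = D"
  unfolding sum_perm3[OF d] using perm3_ne[OF d] by (simp add: plane_point_def)

lemma mem_translation_image_iff: "y \<in> (+) t ` S \<longleftrightarrow> y - t \<in> S" for t :: "'b::ab_group_add"
  by (metis add_diff_cancel_left' diff_add_cancel add.commute image_iff)

lemma H_par_torus_set:
  fixes g :: "('a::field) mat3"
  assumes g: "invertible g"
  shows "{H_par torus N g | P N. levi_decomposition P torus N} =
    {hex_vertex (\<lambda>a. of_int (row_val g a)) (\<lambda>a. of_int (col_val g a)) (of_int (val (det g))) a c | a c. a \<noteq> c}"
proof -
  have vert: "hex_vertex (\<lambda>a. of_int (row_val g a)) (\<lambda>a. of_int (col_val g a)) (of_int (val (det g))) i k = H_order i k g" for i k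
    by (simp add: hex_vertex_def H_order_def vec_eq_iff)
  have b0: "torus = (levi (order_of 1 2 3) :: 'a mat3 set)" by (rule levi_inj[symmetric]) (rule inj_order_of, simp)
  have i0: "order_of 1 2 3 i = order_of 1 2 3 j \<longleftrightarrow> i = j" for i j using inj_order_of[of 1 2 3] by (simp add: inj_eq)
  show ?thesis
  proof (intro Set.set_eqI iffI)
    fix h assume "h \<in> {H_par torus N g | P N. levi_decomposition P torus N}"
    then obtain P N where h: "h = H_par torus N g" "levi_decomposition P torus N" by blast
    then obtain b l where b: "range b = {..<l}" "\<forall>i j. i = j \<longleftrightarrow> b i = b j" "N = unirad b"
      unfolding b0 levi_decomposition_levi i0 by blast
    have inj: "inj b" using b(2) by (simp add: inj_def)
    obtain i j k where ijk: "distinct [i,j,k]" "b = order_of i j k" by (rule inj_order[OF inj b(1)])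
    have "torus = (levi b :: 'a mat3 set)" by (rule levi_inj[OF inj, symmetric])
    hence "h = H_order i k g" unfolding h(1) b(3) using H_par_order[OF g ijk(1)] ijk(2) by simp
    thus "h \<in> {hex_vertex (\<lambda>a. of_int (row_val g a)) (\<lambda>a. of_int (col_val g a)) (of_int (val (det g))) a c | a c. a \<noteq> c}"
      unfolding vert using ijk(1) by auto
  next
    fix h assume "h \<in> {hex_vertex (\<lambda>a. of_int (row_val g a)) (\<lambda>a. of_int (col_val g a)) (of_int (val (det g))) a c | a c. a \<noteq> c}"
    then obtain i k where h: "h = H_order i k g" "i \<noteq> k" unfolding vert by blast
    obtain j where "distinct [i,k,j]" using ex_perm3[OF h(2)] by blast
    hence d: "distinct [i,j,k]" by auto
    have inj: "inj (order_of i j k)" by (rule inj_order_of[OF d])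
    have t: "torus = (levi (order_of i j k) :: 'a mat3 set)" by (rule levi_inj[OF inj, symmetric])
    have "levi_decomposition (parab (order_of i j k)) (torus :: 'a mat3 set) (unirad (order_of i j k))"
      unfolding b0 levi_decomposition_levi using range_order_of[OF d] inj
      by (intro exI[of _ "order_of i j k"] exI[of _ 3]) (simp add: i0 inj_eq)
    moreover have "h = H_par torus (unirad (order_of i j k)) g" unfolding h(1) t by (rule H_par_order[OF g d, symmetric])
    ultimately show "h \<in> {H_par torus N g | P N. levi_decomposition P torus N}" by blast
  qed
qed

text \<open>In the coordinates i and k on trace zero vectors the cocharacter lattice is the integer
  lattice, so the undetermined factor of the measure is the covolume. All points of the hull have
  coordinate sum D, so there the projection is a translation and the area is that of the
  hexagon.\<close>

lemma weight_factor_torus: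
  fixes g :: "('a::field) mat3"
  assumes B: "inner_product_on (a_space_G (torus :: 'a mat3 set)) B" and g: "invertible g" and d: "distinct [i,j,k]"
  shows "weight_factor B torus g = levi_covolume B (torus :: 'a mat3 set) * hex_weight i j k g"
proof -
  note ne = perm3_ne[OF d]
  let ?U = "a_space_G (torus :: 'a mat3 set)"
  define b where "b = order_of 1 2 3"
  have injb: "inj b" unfolding b_def by (rule inj_order_of) simp
  have tb: "torus = (levi b :: 'a mat3 set)" by (rule levi_inj[OF injb, symmetric])
  have bb: "b i = b j \<longleftrightarrow> i = j" for i j using injb by (simp add: inj_eq)
  have U: "?U = {x. (\<Sum>a\<in>UNIV. x $ a) = 0}" unfolding tb a_space_G_levi bb by simp
  have subU: "subspace ?U" unfolding U subspace_def by (simp add: sum.distrib sum_distrib_left[symmetric])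
  define \<beta> :: "real^2 \<Rightarrow> real^3" where "\<beta> w = plane_point i k 0 (w $ 1) (w $ 2)" for w
  have lin: "linear \<beta>" by (rule linearI) (simp_all add: \<beta>_def plane_point_def vec_eq_iff algebra_simps)
  have comp: "\<beta> w $ i = w $ 1" "\<beta> w $ k = w $ 2" "\<beta> w $ j = - w $ 1 - w $ 2" for w
    using ne by (simp_all add: \<beta>_def plane_point_def)
  have inj: "inj \<beta>"
  proof (rule injI)
    fix v w assume "\<beta> v = \<beta> w"
    hence "\<beta> v $ i = \<beta> w $ i" "\<beta> v $ k = \<beta> w $ k" by simp_all
    thus "v = w" unfolding comp by (simp add: vec_eq_iff forall_2)
  qed
  have surj: "\<beta> (vector [x $ i, x $ k]) = x" if "x \<in> ?U" for x
    unfolding \<beta>_def using that by (intro plane_point_eqI[OF d]) (simp_all add: U sum_perm3[OF d])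
  have range: "range \<beta> = ?U"
  proof
    show "range \<beta> \<subseteq> ?U" unfolding U by (auto simp: \<beta>_def sum_plane_point[OF d])
    show "?U \<subseteq> range \<beta>" using surj by (metis rangeI subsetI)
  qed
  obtain \<Delta> where \<Delta>: "\<And>A. A \<in> sets borel \<Longrightarrow> \<beta> -` A \<in> lmeasurable \<Longrightarrow> measure (subspace_lborel B ?U) A = \<Delta> * measure lebesgue (\<beta> -` A)"
    using subspace_lborel_isometric_coordinates[OF B subU subset_refl lin inj range] by metis
  have lat: "cochar_lattice_SL (torus :: 'a mat3 set) = \<beta> ` {l. \<forall>i. l $ i \<in> \<int>}"
  proof -
    have "cochar_lattice_SL (torus :: 'a mat3 set) = {x. (\<Sum>i\<in>UNIV. x $ i) = 0 \<and> (\<forall>i. x $ i \<in> \<int>)}"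
      unfolding tb by (rule cochar_lattice_torus[OF injb])
    also have "\<dots> = \<beta> ` {l. \<forall>i. l $ i \<in> \<int>}"
    proof (intro Set.set_eqI iffI)
      fix x :: "real^3" assume x: "x \<in> {x. (\<Sum>i\<in>UNIV. x $ i) = 0 \<and> (\<forall>i. x $ i \<in> \<int>)}"
      hence "x = \<beta> (vector [x $ i, x $ k])" using surj[of x] by (simp add: U)
      thus "x \<in> \<beta> ` {l. \<forall>i. l $ i \<in> \<int>}" by (rule image_eqI) (use x in \<open>simp add: forall_2\<close>)
    next
      fix x assume "x \<in> \<beta> ` {l. \<forall>i. l $ i \<in> \<int>}"
      then obtain l where l: "x = \<beta> l" "\<forall>i. l $ i \<in> \<int>" by blast
      have "\<forall>a. x $ a \<in> \<int>" by (intro iffD2[OF all_perm3[OF d]] conjI) (use l in \<open>simp_all add: comp\<close>)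
      thus "x \<in> {x. (\<Sum>i\<in>UNIV. x $ i) = 0 \<and> (\<forall>i. x $ i \<in> \<int>)}" using l(1) by (simp add: \<beta>_def sum_plane_point[OF d])
    qed
    finally show ?thesis .
  qed
  have cov: "levi_covolume B (torus :: 'a mat3 set) = \<Delta>"
    unfolding levi_covolume_def lat by (rule covolume_integer_lattice[OF lin inj range \<Delta>])
  define r s D where "r a = real_of_int (row_val g a)" and "s a = real_of_int (col_val g a)" and "D = real_of_int (val (det g))" for a
  have ineq: "r j \<le> D - s i - r k \<and> D - s i - r k \<le> s j" if "distinct [i,j,k]" for i j k
    using hexagon_inequalities(1,2)[OF g that] unfolding r_def s_def D_def by (simp only: of_int_diff[symmetric] of_int_le_iff)
  have rs: "r a \<le> s a" for a using hexagon_inequalities(3)[OF g d, of a] by (simp add: r_def s_def)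
  let ?hull = "convex hull {hex_vertex r s D a c | a c. a \<noteq> c}"
  have hullset: "convex hull {H_par torus N g | P N. levi_decomposition P (torus :: 'a mat3 set) N} = ?hull"
    unfolding H_par_torus_set[OF g] r_def s_def D_def ..
  have hull: "?hull = {h. (\<Sum>a\<in>UNIV. h $ a) = D \<and> (\<forall>a. r a \<le> h $ a \<and> h $ a \<le> s a)}"
    by (rule convex_hull_hexagon[OF ineq rs])
  define \<tau> where "\<tau> = (\<chi> a :: 3. - (D / 3))"
  have proj: "proj_G (torus :: 'a mat3 set) ` ?hull = (+) \<tau> ` ?hull"
  proof (rule image_cong[OF refl])
    fix h assume "h \<in> ?hull"
    hence "(\<Sum>a\<in>UNIV. h $ a) = D" unfolding hull by simp
    moreover have "h \<in> a_space (levi b :: 'a mat3 set)" unfolding a_space_levi bb by simp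
    ultimately show "proj_G (torus :: 'a mat3 set) h = \<tau> + h"
      unfolding tb by (simp add: proj_G_levi \<tau>_def vec_eq_iff)
  qed
  have "finite {hex_vertex r s D a c | a c. a \<noteq> c}"
    by (rule finite_subset[of _ "range (\<lambda>(a, c). hex_vertex r s D a c)"]) auto
  hence "compact ?hull" by (intro compact_convex_hull finite_imp_compact)
  hence "compact ((+) \<tau> ` ?hull)" by (rule compact_translation)
  hence borel: "(+) \<tau> ` ?hull \<in> sets borel" by (rule borel_compact)
  have pre: "\<beta> -` ((+) \<tau> ` ?hull) = hexagon i j k (\<lambda>a. r a - D / 3) (\<lambda>a. s a - D / 3) 0"
  proof (rule Set.set_eqI)
    fix w
    have "w \<in> \<beta> -` ((+) \<tau> ` ?hull) \<longleftrightarrow> \<beta> w - \<tau> \<in> ?hull"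
      unfolding vimage_eq by (rule mem_translation_image_iff)
    also have "\<dots> \<longleftrightarrow> (\<forall>a. r a \<le> \<beta> w $ a + D / 3 \<and> \<beta> w $ a + D / 3 \<le> s a)"
    proof -
      have "(\<Sum>a\<in>UNIV. (\<beta> w - \<tau>) $ a) = (\<Sum>a\<in>UNIV. \<beta> w $ a) + D"
        by (simp add: \<tau>_def sum_3)
      also have "\<dots> = D" by (simp add: \<beta>_def sum_plane_point[OF d])
      finally have 1: "(\<Sum>a\<in>UNIV. (\<beta> w - \<tau>) $ a) = D" .
      have 2: "(\<beta> w - \<tau>) $ a = \<beta> w $ a + D / 3" for a by (simp add: \<tau>_def)
      show ?thesis unfolding hull mem_Collect_eq 1 2 by simp
    qed
    also have "\<dots> \<longleftrightarrow> w \<in> hexagon i j k (\<lambda>a. r a - D / 3) (\<lambda>a. s a - D / 3) 0"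
      unfolding all_perm3[OF d] comp hexagon_def mem_Collect_eq by (simp only: diff_le_eq le_diff_eq) argo
    finally show "w \<in> \<beta> -` ((+) \<tau> ` ?hull) \<longleftrightarrow> w \<in> hexagon i j k (\<lambda>a. r a - D / 3) (\<lambda>a. s a - D / 3) 0" .
  qed
  have d': "distinct [k,j,i]" "distinct [i,k,j]" "distinct [k,i,j]" "distinct [j,i,k]" "distinct [j,k,i]" using ne by simp_all
  note I = ineq[OF d] ineq[OF d'(1)] ineq[OF d'(2)] ineq[OF d'(3)] ineq[OF d'(4)] ineq[OF d'(5)]
  let ?l = "s i + s k + r j - D" and ?m = "D - s j - r i - r k"
  have l: "?l = (s i - D / 3) + (s k - D / 3) + (r j - D / 3) - 0" "?m = 0 - (s j - D / 3) - (r i - D / 3) - (r k - D / 3)" by argo+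
  have l': "0 \<le> ?l" "?l \<le> (s i - D / 3) - (r i - D / 3)" "?l \<le> (s k - D / 3) - (r k - D / 3)"
    "0 \<le> ?m" "?m \<le> (s i - D / 3) - (r i - D / 3)" "?m \<le> (s k - D / 3) - (r k - D / 3)"
    using I by argo+
  note hm = hexagon_measure[of ?l "\<lambda>a. s a - D / 3" i k "\<lambda>a. r a - D / 3" j 0 ?m, OF l(1) l'(1-3) l(2) l'(4-6)]
  have "weight_factor B torus g = \<Delta> * measure lebesgue (hexagon i j k (\<lambda>a. r a - D / 3) (\<lambda>a. s a - D / 3) 0)"
    unfolding weight_factor_def hullset proj using \<Delta>[OF borel] hm(1) unfolding pre by simp
  also have "\<dots> = \<Delta> * hex_weight i j k g"
  proof -
    have hw: "hex_weight i j k g = (s i - r i) * (s k - r k) - ?l\<^sup>2 / 2 - ?m\<^sup>2 / 2"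
      unfolding hex_weight_def r_def s_def D_def by simp
    have e: "(s a - D / 3) - (r a - D / 3) = s a - r a" for a by simp
    show ?thesis unfolding hw hm(2) e ..
  qed
  finally show ?thesis unfolding cov .
qed

text \<open>Parametrizes the line of the Levi subgroup with singleton block k by the coordinate at
  k. The value at 1 generates the cocharacter lattice; the type \<open>real^1\<close> makes it an
  instance of the general coordinate lemmas.\<close>

definition line_map :: "3 \<Rightarrow> real^1 \<Rightarrow> real^3" where
  "line_map k w = (\<chi> a. if a = k then w $ 1 else - w $ 1 / 2)"

lemma line_map_linear: "linear (line_map k)" and line_map_inj: "inj (line_map k)"
proof -
  show "linear (line_map k)" by (rule linearI) (simp_all add: line_map_def vec_eq_iff)
  show "inj (line_map k)"
  proof (rule injI)
    fix v w assume "line_map k v = line_map k w"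
    hence "line_map k v $ k = line_map k w $ k" by simp
    thus "v = w" by (simp add: line_map_def vec_eq_iff forall_1)
  qed
qed

lemma block_eq_iff:
  fixes b b' :: "3 \<Rightarrow> nat"
  assumes d: "distinct [i,j,k]" and b: "b i = b j" "b k \<noteq> b i"
  shows "(\<forall>a c. b a = b c \<longleftrightarrow> b' a = b' c) \<longleftrightarrow> b' i = b' j \<and> b' k \<noteq> b' i"
proof -
  note ne = perm3_ne[OF d]
  show ?thesis
  proof
    assume "b' i = b' j \<and> b' k \<noteq> b' i"
    hence h: "b' j = b' i" "b' k \<noteq> b' i" by simp_all
    show "\<forall>a c. b a = b c \<longleftrightarrow> b' a = b' c"
      unfolding all_perm3[OF d] by (simp add: b(1)[symmetric] b(2) b(2)[symmetric] h h(2)[symmetric])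
  next
    assume h: "\<forall>a c. b a = b c \<longleftrightarrow> b' a = b' c"
    show "b' i = b' j \<and> b' k \<noteq> b' i" using h[rule_format, of i j] h[rule_format, of k i] b by blast
  qed
qed

lemma a_space_G_block:
  assumes d: "distinct [i,j,k]" and b: "b i = b j" "b k \<noteq> b i"
  shows "a_space_G (levi b :: ('a::field) mat3 set) = range (line_map k)"
proof -
  note ne = perm3_ne[OF d]
  have eq: "(\<forall>a c. b a = b c \<longrightarrow> x $ a = x $ c) \<longleftrightarrow> x $ i = x $ j" for x :: "real^3"
  proof
    assume h: "x $ i = x $ j"
    show "\<forall>a c. b a = b c \<longrightarrow> x $ a = x $ c"
      unfolding all_perm3[OF d] by (simp add: b(1)[symmetric] b(2) b(2)[symmetric] h[symmetric])
  next
    assume "\<forall>a c. b a = b c \<longrightarrow> x $ a = x $ c"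
    thus "x $ i = x $ j" using b(1) by blast
  qed
  have "(x $ i = x $ j \<and> (\<Sum>a\<in>UNIV. x $ a) = 0) \<longleftrightarrow> x \<in> range (line_map k)" for x :: "real^3"
  proof
    assume x: "x $ i = x $ j \<and> (\<Sum>a\<in>UNIV. x $ a) = 0"
    hence "x $ i + x $ j + x $ k = 0" unfolding sum_perm3[OF d] by blast
    hence e: "x $ i = - x $ k / 2" "x $ j = - x $ k / 2" using x by simp_all
    have "\<forall>a. x $ a = line_map k (\<chi> _. x $ k) $ a"
      by (intro iffD2[OF all_perm3[OF d]] conjI) (use e ne in \<open>simp_all add: line_map_def\<close>)
    hence "x = line_map k (\<chi> _. x $ k)" unfolding vec_eq_iff .
    thus "x \<in> range (line_map k)" by (rule range_eqI)
  next
    assume "x \<in> range (line_map k)"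
    then obtain w where w: "x = line_map k w" by blast
    show "x $ i = x $ j \<and> (\<Sum>a\<in>UNIV. x $ a) = 0"
      unfolding sum_perm3[OF d] w using ne by (simp add: line_map_def)
  qed
  thus ?thesis unfolding a_space_G_levi eq by blast
qed

text \<open>In dimension 1 the factor |det R| is the norm of R 1, hence the length of the lattice
  generator.\<close>

lemma block_coordinates:
  assumes B: "inner_product_on (a_space_G (torus :: ('a::field) mat3 set)) B"
    and d: "distinct [i,j,k]" and b: "b i = b j" "b k \<noteq> b i"
  shows "levi_covolume B (levi b :: 'a mat3 set) = sqrt (B (line_map k 1) (line_map k 1))"
    and "\<And>A. A \<in> sets borel \<Longrightarrow> line_map k -` A \<in> lmeasurable \<Longrightarrow>
      measure (subspace_lborel B (a_space_G (levi b :: 'a mat3 set))) A =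
        levi_covolume B (levi b :: 'a mat3 set) * measure lebesgue (line_map k -` A)"
proof -
  note ne = perm3_ne[OF d]
  let ?V = "a_space_G (torus :: 'a mat3 set)" and ?U = "a_space_G (levi b :: 'a mat3 set)"
  have V: "?V = {x. (\<Sum>a\<in>UNIV. x $ a) = 0}"
  proof -
    have inj: "inj (order_of 1 2 3)" by (rule inj_order_of) simp
    have t: "torus = (levi (order_of 1 2 3) :: 'a mat3 set)" by (rule levi_inj[OF inj, symmetric])
    show ?thesis unfolding t a_space_G_levi using inj by (simp add: inj_eq)
  qed
  have subV: "subspace ?V" unfolding V subspace_def by (simp add: sum.distrib sum_distrib_left[symmetric])
  have UV: "?U \<subseteq> ?V" unfolding V a_space_G_levi by blast
  have range: "range (line_map k) = ?U" by (rule a_space_G_block[OF d b, symmetric])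
  obtain R :: "real^1 \<Rightarrow> real^1" where R: "linear R" "\<And>x. B (line_map k x) (line_map k x) = (norm (R x))\<^sup>2"
    "\<And>A. A \<in> sets borel \<Longrightarrow> line_map k -` A \<in> lmeasurable \<Longrightarrow>
      measure (subspace_lborel B ?U) A = \<bar>det (matrix R)\<bar> * measure lebesgue (line_map k -` A)"
    using subspace_lborel_isometric_coordinates[OF B subV UV line_map_linear line_map_inj range] by metis
  have lat: "cochar_lattice_SL (levi b :: 'a mat3 set) = line_map k ` {l. \<forall>i. l $ i \<in> \<int>}"
    unfolding cochar_lattice_block[OF d b]
  proof (intro Set.set_eqI iffI)
    fix x :: "real^3" assume x: "x \<in> {x. x $ i = - x $ k / 2 \<and> x $ j = - x $ k / 2 \<and> x $ k \<in> \<int>}"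
    have "\<forall>a. x $ a = line_map k (\<chi> _. x $ k) $ a"
      by (intro iffD2[OF all_perm3[OF d]] conjI) (use x ne in \<open>simp_all add: line_map_def\<close>)
    hence "x = line_map k (\<chi> _. x $ k)" unfolding vec_eq_iff .
    thus "x \<in> line_map k ` {l. \<forall>i. l $ i \<in> \<int>}" by (rule image_eqI) (use x in simp)
  next
    fix x assume "x \<in> line_map k ` {l. \<forall>i. l $ i \<in> \<int>}"
    thus "x \<in> {x. x $ i = - x $ k / 2 \<and> x $ j = - x $ k / 2 \<and> x $ k \<in> \<int>}"
      using ne by (auto simp: line_map_def)
  qed
  have cov: "levi_covolume B (levi b :: 'a mat3 set) = \<bar>det (matrix R)\<bar>"
    unfolding levi_covolume_def lat by (rule covolume_integer_lattice[OF line_map_linear line_map_inj range R(3)])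
  have "R 1 $ 1 = det (matrix R)" by (simp add: matrix_def det_1 axis_def one_vec_def)
  hence "norm (R 1) = \<bar>det (matrix R)\<bar>" by (simp add: norm_real)
  thus "levi_covolume B (levi b :: 'a mat3 set) = sqrt (B (line_map k 1) (line_map k 1))"
    unfolding cov R(2) by simp
  show "measure (subspace_lborel B ?U) A = levi_covolume B (levi b :: 'a mat3 set) * measure lebesgue (line_map k -` A)"
    if "A \<in> sets borel" "line_map k -` A \<in> lmeasurable" for A
    unfolding cov by (rule R(3)[OF that])
qed

text \<open>The transposition of k and k' carries one lattice generator to the other, and invariance
  of B makes their lengths equal.\<close>

lemma levi_covolume_block_eq:
  assumes B: "inner_product_on (a_space_G (torus :: ('a::field) mat3 set)) B"
    and inv: "weyl_invariant_on (a_space_G (torus :: 'a mat3 set)) B"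
    and d: "distinct [i,j,k]" and b: "b i = b j" "b k \<noteq> b i"
    and d': "distinct [i',j',k']" and b': "b' i' = b' j'" "b' k' \<noteq> b' i'"
  shows "levi_covolume B (levi b :: 'a mat3 set) = levi_covolume B (levi b' :: 'a mat3 set)"
proof -
  let ?s = "Transposition.transpose k k'"
  have s: "?s \<in> weyl_group" by (simp add: weyl_group_def)
  have e: "(\<chi> a. line_map k 1 $ ?s a) = line_map k' 1"
    by (auto simp: line_map_def vec_eq_iff Transposition.transpose_def)
  have "line_map k 1 \<in> a_space_G (levi b :: 'a mat3 set)" unfolding a_space_G_block[OF d b] by simp
  moreover have "a_space_G (levi b :: 'a mat3 set) \<subseteq> a_space_G (torus :: 'a mat3 set)"
  proof -
    have inj: "inj (order_of 1 2 3)" by (rule inj_order_of) simp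
    have t: "torus = (levi (order_of 1 2 3) :: 'a mat3 set)" by (rule levi_inj[OF inj, symmetric])
    show ?thesis unfolding t a_space_G_levi using inj by (auto simp: inj_eq)
  qed
  ultimately have "line_map k 1 \<in> a_space_G (torus :: 'a mat3 set)" by blast
  hence "B (\<chi> a. line_map k 1 $ ?s a) (\<chi> a. line_map k 1 $ ?s a) = B (line_map k 1) (line_map k 1)"
    using inv s unfolding weyl_invariant_on_def by blast
  thus ?thesis unfolding e block_coordinates(1)[OF B d b] block_coordinates(1)[OF B d' b'] by simp
qed

text \<open>There are two parabolic subgroups, since the singleton block either ends or opens the
  flag; they give the row and the column coordinate respectively.\<close>

lemma H_par_block_set:
  fixes g :: "('a::field) mat3"
  assumes g: "invertible g" and d: "distinct [i,j,k]" and b: "b i = b j" "b k \<noteq> b i"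
  shows "{H_par (levi b) N g | P N. levi_decomposition P (levi b) N} =
    {H_block k (of_int (val (det g))) (of_int (row_val g k)), H_block k (of_int (val (det g))) (of_int (col_val g k))}"
proof -
  note ne = perm3_ne[OF d]
  have lev: "levi b' = (levi b :: 'a mat3 set)" if "\<forall>a c. b a = b c \<longleftrightarrow> b' a = b' c" for b' :: "3 \<Rightarrow> nat"
    using that by (intro levi_cong) simp
  show ?thesis
  proof (intro Set.set_eqI iffI)
    fix h assume "h \<in> {H_par (levi b) N g | P N. levi_decomposition P (levi b) N}"
    then obtain P N where h: "h = H_par (levi b) N g" "levi_decomposition P (levi b) N" by blast
    then obtain b' where b': "\<forall>a c. b a = b c \<longleftrightarrow> b' a = b' c" "N = unirad b'"
      unfolding levi_decomposition_levi by (elim exE conjE)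
    have bb: "b' i = b' j" "b' k \<noteq> b' i" using b'(1)[unfolded block_eq_iff[OF d b]] by (rule conjunct1, rule conjunct2)
    have h': "h = H_par (levi b') (unirad b') g" unfolding h(1) b'(2) lev[OF b'(1)] ..
    consider "b' k < b' i" | "b' i < b' k" using bb(2) by linarith
    thus "h \<in> {H_block k (of_int (val (det g))) (of_int (row_val g k)), H_block k (of_int (val (det g))) (of_int (col_val g k))}"
    proof cases
      case 1 show ?thesis unfolding h' H_par_block_first[OF g d bb(1) 1] by simp
    next
      case 2 show ?thesis unfolding h' H_par_block_last[OF g d bb(1) 2] by simp
    qed
  next
    have aux: "H_par (levi b') (unirad b') g \<in> {H_par (levi b) N g | P N. levi_decomposition P (levi b) N}"
      if b': "b' i = b' j" "b' k \<noteq> b' i" "range b' = {..<2}" for b'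
    proof -
      have e: "\<forall>a c. b a = b c \<longleftrightarrow> b' a = b' c" using b'(1,2) unfolding block_eq_iff[OF d b] by (rule conjI)
      have "levi_decomposition (parab b') (levi b :: 'a mat3 set) (unirad b')"
        unfolding levi_decomposition_levi by (intro exI[of _ b'] exI[of _ 2] conjI refl e b'(3))
      hence "H_par (levi b) (unirad b') g \<in> {H_par (levi b) N g | P N. levi_decomposition P (levi b) N}" by blast
      thus ?thesis unfolding lev[OF e] .
    qed
    have r: "range f = {f i, f j, f k}" for f :: "3 \<Rightarrow> nat" unfolding UNIV_perm3[OF d] by simp
    fix h assume "h \<in> {H_block k (of_int (val (det g))) (of_int (row_val g k)), H_block k (of_int (val (det g))) (of_int (col_val g k))}"
    then consider "h = H_block k (of_int (val (det g))) (of_int (row_val g k))" | "h = H_block k (of_int (val (det g))) (of_int (col_val g k))" by blast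
    thus "h \<in> {H_par (levi b) N g | P N. levi_decomposition P (levi b) N}"
    proof cases
      case 1
      let ?b = "\<lambda>a. if a = k then 1 else 0 :: nat"
      have b': "?b i = ?b j" "?b i < ?b k" using ne by simp_all
      have "range ?b = {..<2}" unfolding r using ne by (auto simp: numeral_2_eq_2)
      hence "H_par (levi ?b) (unirad ?b) g \<in> {H_par (levi b) N g | P N. levi_decomposition P (levi b) N}"
        using b' by (intro aux) simp_all
      thus ?thesis unfolding 1 H_par_block_last[OF g d b'] .
    next
      case 2
      let ?b = "\<lambda>a. if a = k then 0 else 1 :: nat"
      have b': "?b i = ?b j" "?b k < ?b i" using ne by simp_all
      have "range ?b = {..<2}" unfolding r using ne by (auto simp: numeral_2_eq_2)
      hence "H_par (levi ?b) (unirad ?b) g \<in> {H_par (levi b) N g | P N. levi_decomposition P (levi b) N}"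
        using b' by (intro aux) simp_all
      thus ?thesis unfolding 2 H_par_block_first[OF g d b'] .
    qed
  qed
qed

text \<open>The two points differ only in the parameter v of \<open>H_block\<close>, and projection
  subtracts D/3 from it, so the length in the coordinate k is that of the interval between the two
  parameters.\<close>

lemma weight_factor_block:
  fixes g :: "('a::field) mat3"
  assumes B: "inner_product_on (a_space_G (torus :: 'a mat3 set)) B" and g: "invertible g"
    and d: "distinct [i,j,k]" and b: "b i = b j" "b k \<noteq> b i"
  shows "weight_factor B (levi b) g = levi_covolume B (levi b :: 'a mat3 set) * of_int (col_val g k - row_val g k)"
proof -
  note ne = perm3_ne[OF d]
  define r s D where "r = real_of_int (row_val g k)" and "s = real_of_int (col_val g k)" and "D = real_of_int (val (det g))"
  have rs: "r \<le> s" using hexagon_inequalities(3)[OF g d, of k] by (simp add: r_def s_def)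
  let ?hull = "closed_segment (H_block k D r) (H_block k D s)"
  have hullset: "convex hull {H_par (levi b) N g | P N. levi_decomposition P (levi b :: 'a mat3 set) N} = ?hull"
    unfolding H_par_block_set[OF g d b] r_def s_def D_def by (rule segment_convex_hull[symmetric])
  have pj: "proj_G (levi b :: 'a mat3 set) (H_block k D t) = line_map k (\<chi> _. t - D / 3)" for t
  proof -
    have bk: "b a = b c \<longrightarrow> (a = k \<longleftrightarrow> c = k)" for a c
    proof -
      have "\<forall>a c. b a = b c \<longrightarrow> (a = k \<longleftrightarrow> c = k)" unfolding all_perm3[OF d] using ne by (simp add: b(1)[symmetric] b(2) b(2)[symmetric])
      thus ?thesis by blast
    qed
    have "H_block k D t \<in> a_space (levi b :: 'a mat3 set)"
      unfolding a_space_levi mem_Collect_eq H_block_def vec_lambda_beta using bk by metis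
    hence 1: "proj_G (levi b :: 'a mat3 set) (H_block k D t) = (\<chi> i. H_block k D t $ i - (\<Sum>a\<in>UNIV. H_block k D t $ a) / 3)"
      by (rule proj_G_levi)
    have 2: "(\<Sum>a\<in>UNIV. H_block k D t $ a) = D" unfolding sum_perm3[OF d] H_block_def using ne by (simp add: field_simps)
    show ?thesis unfolding 1 2 by (simp add: H_block_def line_map_def vec_eq_iff field_simps)
  qed
  have seg: "?hull = (\<lambda>t. H_block k D t) ` {r..s}"
  proof -
    have "H_block k D ((1 - u) * r + u * s) = (1 - u) *\<^sub>R H_block k D r + u *\<^sub>R H_block k D s" for u
      by (simp add: H_block_def vec_eq_iff field_simps)
    hence "?hull = (\<lambda>t. H_block k D t) ` closed_segment r s"
      unfolding closed_segment_def by (auto simp: image_iff) metis+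
    thus ?thesis using rs by (simp add: closed_segment_eq_real_ivl)
  qed
  let ?J = "cbox (\<chi> _. r - D / 3) (\<chi> _. s - D / 3) :: (real^1) set"
  have J: "(\<lambda>t. (\<chi> _. t - D / 3) :: real^1) ` {r..s} = ?J"
  proof (intro Set.set_eqI iffI)
    fix w :: "real^1" assume "w \<in> ?J"
    hence "r \<le> w $ 1 + D / 3" "w $ 1 + D / 3 \<le> s" by (auto simp: mem_box_cart field_simps)
    thus "w \<in> (\<lambda>t. (\<chi> _. t - D / 3) :: real^1) ` {r..s}"
      by (intro image_eqI[of _ _ "w $ 1 + D / 3"]) (simp_all add: vec_eq_iff forall_1)
  qed (auto simp: mem_box_cart)
  have proj: "proj_G (levi b :: 'a mat3 set) ` ?hull = line_map k ` ?J"
    unfolding seg J[symmetric] image_image pj ..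
  have borel: "line_map k ` ?J \<in> sets borel"
    by (intro borel_compact compact_continuous_image linear_continuous_on compact_cbox
        linear_conv_bounded_linear[THEN iffD1] line_map_linear)
  have pre: "line_map k -` (line_map k ` ?J) = ?J" by (rule inj_vimage_image_eq[OF line_map_inj])
  have ne0: "?J \<noteq> {}" using rs by (auto simp: J[symmetric])
  have "measure lebesgue ?J = s - r"
    using content_cbox_cart[OF ne0] by simp
  thus ?thesis
    unfolding weight_factor_def hullset proj using block_coordinates(2)[OF B d b borel] unfolding pre
    by (simp add: r_def s_def)
qed

section \<open>Polar parts\<close>

text \<open>Rows of unipotent matrices contain a 1; together with it an entry allows exactly the
  bounds up to minus the order of its pole, even when that entry is integral or 0.\<close>

lemma fls_ge_1_and_iff: "fls_ge n (1 :: ('a::field) fls) \<and> fls_ge n x \<longleftrightarrow> n \<le> - int (pole x)"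
proof -
  have 1: "fls_ge n (1 :: 'a fls) \<longleftrightarrow> n \<le> 0" by (simp add: fls_ge_iff)
  show ?thesis
  proof (cases "n \<le> 0")
    case True
    have "fls_ge n x \<longleftrightarrow> pole x \<le> nat (- n)" unfolding pole_le_iff using True by simp
    thus ?thesis unfolding 1 using True by linarith
  next
    case False thus ?thesis unfolding 1 by linarith
  qed
qed

lemma le_minus_int_max: "n \<le> - int (max a b) \<longleftrightarrow> n \<le> - int a \<and> n \<le> - int b"
  by (auto simp: max_def)

lemma row_val_unip:
  fixes x y z :: "('a::field) fls"
  assumes d: "distinct [i,j,k]"
  shows "row_val (unip i j k x y z) i = - int (max (pole x) (pole z))"
    "row_val (unip i j k x y z) j = - int (pole y)" "row_val (unip i j k x y z) k = 0"
proof -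
  let ?g = "unip i j k x y z"
  show "row_val ?g i = - int (max (pole x) (pole z))"
  proof (rule row_val_unique)
    fix n
    have "(\<forall>c. fls_ge n (?g $ i $ c)) \<longleftrightarrow> (fls_ge n (1 :: 'a fls) \<and> fls_ge n x) \<and> (fls_ge n (1 :: 'a fls) \<and> fls_ge n z)"
      unfolding all_perm3[OF d] unip_nth[OF d] by blast
    thus "(\<forall>c. fls_ge n (?g $ i $ c)) \<longleftrightarrow> n \<le> - int (max (pole x) (pole z))" unfolding fls_ge_1_and_iff le_minus_int_max .
  qed
  show "row_val ?g j = - int (pole y)"
  proof (rule row_val_unique)
    fix n
    have "(\<forall>c. fls_ge n (?g $ j $ c)) \<longleftrightarrow> (fls_ge n (1 :: 'a fls) \<and> fls_ge n y)"
      unfolding all_perm3[OF d] unip_nth[OF d] by simp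
    thus "(\<forall>c. fls_ge n (?g $ j $ c)) \<longleftrightarrow> n \<le> - int (pole y)" unfolding fls_ge_1_and_iff .
  qed
  show "row_val ?g k = 0"
  proof (rule row_val_unique)
    fix n
    show "(\<forall>c. fls_ge n (?g $ k $ c)) \<longleftrightarrow> n \<le> 0"
      unfolding all_perm3[OF d] unip_nth[OF d] by (simp add: fls_ge_iff)
  qed
qed

text \<open>The inverse has x y - z in the corner, so for the last column this expression plays the
  role that z plays for the first row.\<close>

lemma col_val_unip:
  fixes x y z :: "('a::field) fls"
  assumes d: "distinct [i,j,k]"
  shows "col_val (unip i j k x y z) k = int (max (pole y) (pole (x * y - z)))"
    "col_val (unip i j k x y z) j = int (pole x)" "col_val (unip i j k x y z) i = 0"
proof -
  let ?g = "unip i j k x y z" and ?h = "unip i j k (- x) (- y) (x * y - z)"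
  note inv = unip_inv(1)[OF d, of x y z]
  show "col_val ?g k = int (max (pole y) (pole (x * y - z)))"
  proof (rule col_val_unique)
    fix n
    have "(\<forall>c. fls_ge n (?h $ c $ k)) \<longleftrightarrow> (fls_ge n (1 :: 'a fls) \<and> fls_ge n y) \<and> (fls_ge n (1 :: 'a fls) \<and> fls_ge n (x * y - z))"
      unfolding all_perm3[OF d] unip_nth[OF d] fls_ge_uminus by blast
    thus "(\<forall>c. fls_ge n (matrix_inv ?g $ c $ k)) \<longleftrightarrow> n \<le> - int (max (pole y) (pole (x * y - z)))"
      unfolding fls_ge_1_and_iff inv le_minus_int_max .
  qed
  show "col_val ?g j = int (pole x)"
  proof (rule col_val_unique)
    fix n
    have "(\<forall>c. fls_ge n (?h $ c $ j)) \<longleftrightarrow> (fls_ge n (1 :: 'a fls) \<and> fls_ge n x)"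
      unfolding all_perm3[OF d] unip_nth[OF d] fls_ge_uminus by auto
    thus "(\<forall>c. fls_ge n (matrix_inv ?g $ c $ j)) \<longleftrightarrow> n \<le> - int (pole x)" unfolding fls_ge_1_and_iff inv .
  qed
  show "col_val ?g i = 0"
  proof (rule col_val_unique)
    fix n
    show "(\<forall>c. fls_ge n (matrix_inv ?g $ c $ i)) \<longleftrightarrow> n \<le> - 0"
      unfolding inv all_perm3[OF d] unip_nth[OF d] by (simp add: fls_ge_iff)
  qed
qed

definition polar :: "('a::field) fls \<Rightarrow> 'a fls" where
  "polar x = x - fps_to_fls (fls_regpart x)"

text \<open>Representatives of \<epsilon>^(-n) times the integers modulo the integers: only
  exponents from -n to -1 occur.\<close>

definition Polar :: "nat \<Rightarrow> ('a::field) fls set" where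
  "Polar n = {w. \<forall>k. k < - int n \<or> 0 \<le> k \<longrightarrow> fls_nth w k = 0}"

lemma polar_nth: "fls_nth (polar x) k = (if k < 0 then fls_nth x k else 0)"
  by (simp add: polar_def)

lemma polar_integral: "fls_ge 0 (x - polar x)"
  by (simp add: fls_ge_def polar_nth)

lemma pole_polar [simp]: "pole (polar x) = pole x"
  using pole_add_integral[OF polar_integral[of x], of "polar x"] by simp

lemma polar_in_Polar: "pole x \<le> n \<Longrightarrow> polar x \<in> Polar n"
  by (auto simp: Polar_def polar_nth pole_le_iff fls_ge_def)

lemma Polar_pole_le: "w \<in> Polar n \<Longrightarrow> pole w \<le> n"
  by (auto simp: Polar_def pole_le_iff fls_ge_def)

lemma Polar_add: "u \<in> Polar n \<Longrightarrow> w \<in> Polar n \<Longrightarrow> u + w \<in> Polar n"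
  and Polar_diff: "u \<in> Polar n \<Longrightarrow> w \<in> Polar n \<Longrightarrow> u - w \<in> Polar n"
  by (auto simp: Polar_def)

lemma Polar_integral_eq: "u \<in> Polar n \<Longrightarrow> w \<in> Polar m \<Longrightarrow> fls_ge 0 (u - w) \<Longrightarrow> u = w"
proof (rule fls_eqI)
  fix k assume "u \<in> Polar n" "w \<in> Polar m" "fls_ge 0 (u - w)"
  thus "fls_nth u k = fls_nth w k" by (cases "k < 0") (auto simp: Polar_def fls_ge_def)
qed

lemma Polar_mono_iff: "w \<in> Polar n \<longleftrightarrow> w \<in> Polar (Suc n) \<and> pole w \<le> n"
proof
  assume w: "w \<in> Polar n"
  have "w \<in> Polar (Suc n)" using w by (simp add: Polar_def)
  thus "w \<in> Polar (Suc n) \<and> pole w \<le> n" using Polar_pole_le[OF w] by blast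
next
  assume "w \<in> Polar (Suc n) \<and> pole w \<le> n"
  thus "w \<in> Polar n" by (auto simp: Polar_def pole_le_iff fls_ge_def)
qed

text \<open>Splitting off the coefficient at -(n + 1) identifies the next set with pairs of a field
  element and a polar part of order at most n.\<close>

lemma finite_card_Polar:
  "finite (Polar n :: ('a::{field,finite}) fls set) \<and> card (Polar n :: 'a fls set) = CARD('a) ^ n"
proof (induction n)
  case 0
  have "(Polar 0 :: 'a fls set) = {0}"
  proof (intro Set.set_eqI iffI)
    fix w :: "'a fls" assume "w \<in> Polar 0"
    hence "fls_nth w k = 0" for k unfolding Polar_def using linorder_not_le[of 0 k] by auto
    thus "w \<in> {0}" by (simp add: fls_eq_iff)
  qed (simp add: Polar_def)
  thus ?case by simp
next
  case (Suc n)
  let ?m = "\<lambda>c :: 'a. fls_shift (int (Suc n)) (fls_const c)"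
  let ?f = "\<lambda>(c, w). ?m c + w"
  have m: "fls_nth (?m c) k = (if k = - int (Suc n) then c else 0)" for c k by auto
  have w0: "fls_nth w (- int (Suc n)) = 0" if "w \<in> Polar n" for w :: "'a fls" using that by (simp add: Polar_def)
  have im: "Polar (Suc n) = ?f ` (UNIV \<times> Polar n)"
  proof (intro Set.set_eqI iffI)
    fix w :: "'a fls" assume w: "w \<in> Polar (Suc n)"
    let ?c = "fls_nth w (- int (Suc n))"
    have "w - ?m ?c \<in> Polar n"
      unfolding Polar_def
    proof (intro CollectI allI impI)
      fix k assume k: "k < - int n \<or> 0 \<le> k"
      show "fls_nth (w - ?m ?c) k = 0"
      proof (cases "k = - int (Suc n)")
        case True thus ?thesis unfolding fls_minus_nth m by simp
      next
        case False
        hence "k < - int (Suc n) \<or> 0 \<le> k" using k by auto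
        hence "fls_nth w k = 0" using w unfolding Polar_def by blast
        thus ?thesis unfolding fls_minus_nth m using False by simp
      qed
    qed
    thus "w \<in> ?f ` (UNIV \<times> Polar n)" by (intro image_eqI[of _ _ "(?c, w - ?m ?c)"]) simp_all
  next
    fix w assume "w \<in> ?f ` (UNIV \<times> Polar n)"
    then obtain c v where v: "w = ?m c + v" "v \<in> Polar n" by auto
    have "?m c \<in> Polar (Suc n)" unfolding Polar_def mem_Collect_eq m by auto
    moreover have "v \<in> Polar (Suc n)" using v(2) Polar_mono_iff by blast
    ultimately show "w \<in> Polar (Suc n)" unfolding v(1) by (rule Polar_add)
  qed
  have inj: "inj_on ?f (UNIV \<times> Polar n)"
  proof (rule inj_onI)
    fix p p' :: "'a \<times> 'a fls" assume p: "p \<in> UNIV \<times> Polar n" "p' \<in> UNIV \<times> Polar n" and e: "?f p = ?f p'"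
    obtain c w where cw: "p = (c, w)" by (cases p)
    obtain c' w' where cw': "p' = (c', w')" by (cases p')
    have e': "?m c + w = ?m c' + w'" using e unfolding cw cw' by simp
    hence "fls_nth (?m c + w) (- int (Suc n)) = fls_nth (?m c' + w') (- int (Suc n))" by simp
    hence "c = c'" using p w0 unfolding fls_plus_nth m cw cw' by simp
    thus "p = p'" using e' unfolding cw cw' by simp
  qed
  have "card (Polar (Suc n) :: 'a fls set) = card (UNIV \<times> Polar n :: ('a \<times> 'a fls) set)"
    unfolding im by (rule card_image[OF inj])
  moreover have "finite (Polar (Suc n) :: 'a fls set)" unfolding im by (intro finite_imageI finite_cartesian_product) (use Suc.IH in simp_all)
  ultimately show ?case using Suc.IH by (simp add: card_cartesian_product)
qed

lemma finite_Polar [simp]: "finite (Polar n :: ('a::{field,finite}) fls set)"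
  using finite_card_Polar by blast

lemma sum_Polar_pole:
  fixes f :: "nat \<Rightarrow> real"
  shows "(\<Sum>w\<in>(Polar n :: ('a::{field,finite}) fls set). f (pole w)) = (\<Sum>k\<le>n. sphere_card (real CARD('a)) k * f k)"
proof (induction n)
  case 0
  have c: "card (Polar 0 :: 'a fls set) = 1" using finite_card_Polar[of 0, where 'a = 'a] by simp
  have "(\<Sum>w\<in>(Polar 0 :: 'a fls set). f (pole w)) = (\<Sum>w\<in>(Polar 0 :: 'a fls set). f 0)"
  proof (rule sum.cong[OF refl])
    fix w :: "'a fls" assume "w \<in> Polar 0"
    from Polar_pole_le[OF this] show "f (pole w) = f 0" by simp
  qed
  thus ?case using c by simp
next
  case (Suc n)
  have sub: "(Polar n :: 'a fls set) \<subseteq> Polar (Suc n)" using Polar_mono_iff by blast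
  have "(\<Sum>w\<in>(Polar (Suc n) :: 'a fls set). f (pole w)) =
      (\<Sum>w\<in>Polar (Suc n) - (Polar n :: 'a fls set). f (pole w)) + (\<Sum>w\<in>(Polar n :: 'a fls set). f (pole w))"
    by (rule sum.subset_diff[OF sub finite_Polar])
  also have "(\<Sum>w\<in>Polar (Suc n) - (Polar n :: 'a fls set). f (pole w)) = (\<Sum>w\<in>Polar (Suc n) - (Polar n :: 'a fls set). f (Suc n))"
  proof (rule sum.cong[OF refl])
    fix w :: "'a fls" assume w: "w \<in> Polar (Suc n) - Polar n"
    hence "\<not> pole w \<le> n" using Polar_mono_iff[of w n] by blast
    moreover have "pole w \<le> Suc n" using w by (intro Polar_pole_le) blast
    ultimately show "f (pole w) = f (Suc n)" by (simp add: le_Suc_eq)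
  qed
  also have "\<dots> = real (card (Polar (Suc n) - (Polar n :: 'a fls set))) * f (Suc n)" by simp
  also have "card (Polar (Suc n) - (Polar n :: 'a fls set)) = CARD('a) ^ Suc n - CARD('a) ^ n"
    using finite_card_Polar[of n, where 'a = 'a] finite_card_Polar[of "Suc n", where 'a = 'a] by (simp add: card_Diff_subset sub)
  also have "real (CARD('a) ^ Suc n - CARD('a) ^ n) = sphere_card (real CARD('a)) (Suc n)"
    unfolding sphere_card_simps by (subst of_nat_diff) (auto intro: power_increasing Suc_leI)
  finally show ?case unfolding Suc.IH by simp
qed

lemma val_one_plus_Polar:
  assumes "u \<in> Polar n"
  shows "1 + u \<noteq> 0" "val (1 + u) = - int (pole u)"
proof -
  have p: "pole (1 + u) = pole u" using pole_add_integral[OF fls_ge_0_1, of u] by (simp add: add.commute)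
  have n0: "fls_nth (1 + u) 0 = 1" using assms by (simp add: Polar_def)
  show "1 + u \<noteq> 0"
  proof
    assume "1 + u = 0"
    from n0[unfolded this] show False by simp
  qed
  have "val (1 + u) \<le> 0" by (rule fls_subdegree_leI, subst n0) (rule one_neq_zero)
  thus "val (1 + u) = - int (pole u)" using p unfolding pole_def by linarith
qed

section \<open>The hexagon areas summed over the polar parts\<close>

lemma pole_mult_val: "x \<noteq> 0 \<Longrightarrow> y \<noteq> 0 \<Longrightarrow> int (pole (x * y)) = max 0 (- val x - val y)"
  by (simp add: pole_def)

text \<open>Z and C are the orders of z and of xy - z, and the hypotheses are the ultrametric
  alternatives for xy of order X + Y. At most one corner term is nonzero. Apart from the first
  summand, Z and C occur in separate terms, which can be summed independently.\<close>

lemma hexagon_pointwise: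
  fixes X Y Z C :: nat
  assumes "Z < X + Y \<Longrightarrow> C = X + Y" "X + Y < Z \<Longrightarrow> C = Z" "Z = X + Y \<Longrightarrow> C \<le> X + Y"
  shows "real (max X Z) * real (max Y C) - (real (max Y C) - real Y)\<^sup>2 / 2 - (real (max X Z) - real X)\<^sup>2 / 2
    = real (max (X + Y) Z) * real (X + Y) - ((real X)\<^sup>2 + (real Y)\<^sup>2) / 2 - corner X Y Z - corner Y X C"
proof -
  consider "X + Y < Z" | "Z < X + Y" "Z \<le> X" | "Z < X + Y" "X < Z" | "Z = X + Y" "C \<le> Y" | "Z = X + Y" "Y < C" by linarith
  thus ?thesis
  proof cases
    case 1
    hence "max X Z = Z" "max Y C = Z" "max (X + Y) Z = Z" "min Y (X + Y - Z) = 0" "min X (Y + X - C) = 0" using assms(2) by auto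
    thus ?thesis by (simp add: corner_def Let_def power2_eq_square algebra_simps add_divide_distrib diff_divide_distrib)
  next
    case 2
    hence "max X Z = X" "max Y C = X + Y" "max (X + Y) Z = X + Y" "min Y (X + Y - Z) = Y" "min X (Y + X - C) = 0" using assms(1) by auto
    thus ?thesis by (simp add: corner_def Let_def power2_eq_square algebra_simps add_divide_distrib diff_divide_distrib)
  next
    case 3
    hence "max X Z = Z" "max Y C = X + Y" "max (X + Y) Z = X + Y" "min Y (X + Y - Z) = X + Y - Z" "min X (Y + X - C) = 0" "real (X + Y - Z) = real X + real Y - real Z"
      using assms(1) by auto
    thus ?thesis by (simp add: corner_def Let_def power2_eq_square algebra_simps add_divide_distrib diff_divide_distrib)
  next
    case 4
    hence "max X Z = X + Y" "max Y C = Y" "max (X + Y) Z = X + Y" "min Y (X + Y - Z) = 0" "min X (Y + X - C) = X" using assms(3) by auto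
    thus ?thesis by (simp add: corner_def Let_def power2_eq_square algebra_simps add_divide_distrib diff_divide_distrib)
  next
    case 5
    hence "max X Z = X + Y" "max Y C = C" "max (X + Y) Z = X + Y" "min Y (X + Y - Z) = 0" "min X (Y + X - C) = X + Y - C" "real (X + Y - C) = real X + real Y - real C"
      using assms(3) by auto
    thus ?thesis by (simp add: corner_def Let_def power2_eq_square algebra_simps add_divide_distrib diff_divide_distrib)
  qed
qed

lemma hex_weight_unip:
  fixes x y z :: "('a::field) fls"
  assumes d: "distinct [i,j,k]"
  shows "hex_weight i j k (unip i j k x y z) = (let e = real (max (pole x) (pole z)); c = real (max (pole y) (pole (x * y - z)))
    in e * c - (c - real (pole y))\<^sup>2 / 2 - (e - real (pole x))\<^sup>2 / 2)"
  unfolding hex_weight_def row_val_unip[OF d] col_val_unip[OF d] det_unip[OF d] Let_def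
  by (simp del: of_nat_max add: algebra_simps)

lemma sum_Polar_translate:
  assumes "v \<in> Polar n"
  shows "(\<Sum>w\<in>Polar n. f (v + w)) = sum f (Polar n)" "(\<Sum>w\<in>Polar n. f (v - w)) = sum f (Polar n)"
proof -
  show "(\<Sum>w\<in>Polar n. f (v + w)) = sum f (Polar n)"
    by (rule sum.reindex_bij_witness[where i = "\<lambda>z. z - v" and j = "\<lambda>w. v + w"])
      (auto intro: Polar_add[OF assms] Polar_diff[OF _ assms])
  show "(\<Sum>w\<in>Polar n. f (v - w)) = sum f (Polar n)"
    by (rule sum.reindex_bij_witness[where i = "\<lambda>z. v - z" and j = "\<lambda>w. v - w"])
      (auto intro: Polar_diff[OF assms])
qed

text \<open>For X + Y \<le> n the shift by \<kappa>xy is absorbed into \<open>Polar N\<close>, and z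
  \<mapsto> xy - z permutes the same set modulo integers, so the second corner may be evaluated at
  z. Otherwise \<kappa>xy and (1 - \<kappa>)xy both have order X + Y + N - n > N, so z and xy - z
  have this order and the area is constant on the fiber.\<close>

lemma fiber_sum_Polar:
  fixes \<kappa> x y :: "('a::{field,finite}) fls"
  assumes d: "distinct [i,j,k]" and x: "x \<noteq> 0" "val x = - int X" and y: "y \<noteq> 0" "val y = - int Y"
    and \<kappa>: "\<kappa> \<noteq> 0" "1 - \<kappa> \<noteq> 0" "val \<kappa> = int n - int N" "val (1 - \<kappa>) = int n - int N" and nN: "n \<le> N"
  shows "(\<Sum>w\<in>Polar N. hex_weight i j k (unip i j k x y (polar (\<kappa> * (x * y)) + w))) = fiber_sum (real CARD('a)) n N X Y"
proof -
  have px: "pole x = X" and py: "pole y = Y" using x y by (simp_all add: pole_def)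
  have xy: "x * y \<noteq> 0" "val (x * y) = - int (X + Y)" using x y by simp_all
  have pxy: "pole (x * y) = X + Y" unfolding pole_def xy(2) by simp
  show ?thesis
  proof (cases "X + Y \<le> n")
    case True
    let ?h = "\<lambda>z. hex_weight i j k (unip i j k x y z)"
    have "int (pole (\<kappa> * (x * y))) \<le> int N" unfolding pole_mult_val[OF \<kappa>(1) xy(1)] \<kappa>(3) xy(2) using True by simp
    hence "polar (\<kappa> * (x * y)) \<in> Polar N" by (intro polar_in_Polar) simp
    hence "(\<Sum>w\<in>Polar N. ?h (polar (\<kappa> * (x * y)) + w)) = sum ?h (Polar N)" by (rule sum_Polar_translate)
    also have "\<dots> = (\<Sum>z\<in>(Polar N :: 'a fls set). real (max (X + Y) (pole z)) * real (X + Y) - ((real X)\<^sup>2 + (real Y)\<^sup>2) / 2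
        - corner X Y (pole z) - corner Y X (pole (x * y - z)))"
    proof (rule sum.cong[OF refl])
      fix z :: "'a fls"
      have "pole (x * y - z) = X + Y" if "pole z < X + Y"
        using pole_add_eq[of "- z" "x * y"] that by (simp add: pxy)
      moreover have "pole (x * y - z) = pole z" if "X + Y < pole z"
        using pole_add_eq[of "x * y" "- z"] that by (simp add: pxy)
      moreover have "pole (x * y - z) \<le> X + Y" if "pole z = X + Y"
        using that by (intro pole_diff_le) (simp_all add: pxy)
      ultimately show "?h z = real (max (X + Y) (pole z)) * real (X + Y) - ((real X)\<^sup>2 + (real Y)\<^sup>2) / 2
          - corner X Y (pole z) - corner Y X (pole (x * y - z))"
        unfolding hex_weight_unip[OF d] Let_def px py by (intro hexagon_pointwise)
    qed
    also have "\<dots> = (\<Sum>z\<in>(Polar N :: 'a fls set). real (max (X + Y) (pole z)) * real (X + Y) - ((real X)\<^sup>2 + (real Y)\<^sup>2) / 2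
        - corner X Y (pole z)) - (\<Sum>z\<in>Polar N. corner Y X (pole (x * y - z)))"
      by (rule sum_subtractf)
    also have "(\<Sum>z\<in>Polar N. corner Y X (pole (x * y - z))) = (\<Sum>z\<in>Polar N. corner Y X (pole (polar (x * y) - z)))"
    proof (rule sum.cong[OF refl])
      fix z :: "'a fls"
      have "pole (polar (x * y) - z + (x * y - polar (x * y))) = pole (polar (x * y) - z)"
        by (rule pole_add_integral[OF polar_integral])
      thus "corner Y X (pole (x * y - z)) = corner Y X (pole (polar (x * y) - z))" by simp
    qed
    also have "\<dots> = (\<Sum>z\<in>(Polar N :: 'a fls set). corner Y X (pole z))"
    proof (rule sum_Polar_translate(2))
      show "polar (x * y) \<in> Polar N" using True nN pxy by (intro polar_in_Polar) simp
    qed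
    also have "(\<Sum>z\<in>(Polar N :: 'a fls set). real (max (X + Y) (pole z)) * real (X + Y) - ((real X)\<^sup>2 + (real Y)\<^sup>2) / 2
        - corner X Y (pole z)) - (\<Sum>z\<in>(Polar N :: 'a fls set). corner Y X (pole z))
      = (\<Sum>z\<in>(Polar N :: 'a fls set). real (max (X + Y) (pole z)) * real (X + Y) - ((real X)\<^sup>2 + (real Y)\<^sup>2) / 2
        - corner X Y (pole z) - corner Y X (pole z))"
      by (rule sum_subtractf[symmetric])
    also have "\<dots> = (\<Sum>Z\<le>N. sphere_card (real CARD('a)) Z * (real (max (X + Y) Z) * real (X + Y) - ((real X)\<^sup>2 + (real Y)\<^sup>2) / 2
        - corner X Y Z - corner Y X Z))"
      by (rule sum_Polar_pole)
    finally show ?thesis unfolding fiber_sum_def using True by simp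
  next
    case False
    define m where "m = X + Y + N - n"
    have m: "int m = int (X + Y) + int N - int n" "X \<le> m" "Y \<le> m" "N < m" using False nN by (auto simp: m_def)
    have p\<kappa>: "int (pole (c * (x * y))) = int m" if "c \<noteq> 0" "val c = int n - int N" for c
      unfolding pole_mult_val[OF that(1) xy(1)] that(2) xy(2) using m by simp
    have "hex_weight i j k (unip i j k x y (polar (\<kappa> * (x * y)) + w)) = real m * real (X + Y) - ((real X)\<^sup>2 + (real Y)\<^sup>2) / 2"
      if w: "w \<in> Polar N" for w
    proof -
      have pw: "pole w < m" using Polar_pole_le[OF w] m(4) by simp
      have "pole (polar (\<kappa> * (x * y)) + w) = pole (polar (\<kappa> * (x * y)))"
        by (rule pole_add_eq) (use pw p\<kappa>[OF \<kappa>(1,3)] in simp)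
      hence Z: "pole (polar (\<kappa> * (x * y)) + w) = m" using p\<kappa>[OF \<kappa>(1,3)] by simp
      have "pole ((1 - \<kappa>) * (x * y) + - w) = pole ((1 - \<kappa>) * (x * y))"
        by (rule pole_add_eq) (use pw p\<kappa>[OF \<kappa>(2,4)] in simp)
      hence "pole ((1 - \<kappa>) * (x * y) + - w + (\<kappa> * (x * y) - polar (\<kappa> * (x * y)))) = m"
        using p\<kappa>[OF \<kappa>(2,4)] unfolding pole_add_integral[OF polar_integral] by simp
      moreover have e: "(1 - \<kappa>) * (x * y) + - w + (\<kappa> * (x * y) - polar (\<kappa> * (x * y))) = x * y - (polar (\<kappa> * (x * y)) + w)"
        by (simp add: left_diff_distrib)
      ultimately have C: "pole (x * y - (polar (\<kappa> * (x * y)) + w)) = m" by (simp only:)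
      have mm: "max X m = m" "max Y m = m" using m by simp_all
      show ?thesis unfolding hex_weight_unip[OF d] Let_def px py Z C mm
        by (simp add: power2_eq_square algebra_simps add_divide_distrib diff_divide_distrib)
    qed
    hence "(\<Sum>w\<in>Polar N. hex_weight i j k (unip i j k x y (polar (\<kappa> * (x * y)) + w))) =
        (\<Sum>w\<in>(Polar N :: 'a fls set). real m * real (X + Y) - ((real X)\<^sup>2 + (real Y)\<^sup>2) / 2)"
      by (intro sum.cong refl)
    also have "\<dots> = real CARD('a) ^ N * (real m * real (X + Y) - ((real X)\<^sup>2 + (real Y)\<^sup>2) / 2)"
      using finite_card_Polar[of N, where 'a = 'a] by simp
    finally show ?thesis unfolding fiber_sum_def m_def using False by simp
  qed
qed

text \<open>
  Adding 1 to a polar part does not change its class modulo the integers, but makes the valuation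
  equal to minus the order of the pole even when the polar part is 0.
\<close>

definition orbit_point :: "3 \<Rightarrow> 3 \<Rightarrow> 3 \<Rightarrow> ('a::field) fls \<Rightarrow> 'a fls \<times> 'a fls \<times> 'a fls \<Rightarrow> 'a mat3" where
  "orbit_point i j k \<kappa> = (\<lambda>(u, v, w). unip i j k (1 + u) (1 + v) (polar (\<kappa> * ((1 + u) * (1 + v))) + w))"

lemma pole_one_plus: "pole (1 + u) = pole u"
  using pole_add_integral[OF fls_ge_0_1, of u] by (simp add: add.commute)

lemma sum_hex_weight:
  fixes \<kappa> :: "('a::{field,finite}) fls"
  assumes d: "distinct [i,j,k]"
    and \<kappa>: "\<kappa> \<noteq> 0" "1 - \<kappa> \<noteq> 0" "val \<kappa> = int n - int N" "val (1 - \<kappa>) = int n - int N" and nN: "n \<le> N"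
  defines "q \<equiv> real CARD('a)"
  shows "(\<Sum>p\<in>Polar n \<times> Polar n \<times> Polar N. hex_weight i j k (orbit_point i j k \<kappa> p)) =
    (\<Sum>X\<le>n. \<Sum>Y\<le>n. sphere_card q X * sphere_card q Y * fiber_sum q n N X Y)"
proof -
  have "(\<Sum>p\<in>Polar n \<times> Polar n \<times> Polar N. hex_weight i j k (orbit_point i j k \<kappa> p)) =
    (\<Sum>u\<in>Polar n. \<Sum>v\<in>Polar n. \<Sum>w\<in>Polar N. hex_weight i j k (orbit_point i j k \<kappa> (u, v, w)))"
    by (simp only: sum.cartesian_product case_prod_unfold) simp
  also have "\<dots> = (\<Sum>u\<in>(Polar n :: 'a fls set). \<Sum>v\<in>(Polar n :: 'a fls set). fiber_sum q n N (pole u) (pole v))"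
  proof (intro sum.cong refl)
    fix u v :: "'a fls" assume u: "u \<in> Polar n" and v: "v \<in> Polar n"
    show "(\<Sum>w\<in>Polar N. hex_weight i j k (orbit_point i j k \<kappa> (u, v, w))) = fiber_sum q n N (pole u) (pole v)"
      unfolding orbit_point_def prod.case q_def
      by (rule fiber_sum_Polar[OF d val_one_plus_Polar[OF u] val_one_plus_Polar[OF v] \<kappa> nN])
  qed
  also have "\<dots> = (\<Sum>u\<in>(Polar n :: 'a fls set). \<Sum>Y\<le>n. sphere_card q Y * fiber_sum q n N (pole u) Y)"
    unfolding q_def by (intro sum.cong refl sum_Polar_pole)
  also have "\<dots> = (\<Sum>X\<le>n. sphere_card q X * (\<Sum>Y\<le>n. sphere_card q Y * fiber_sum q n N X Y))"
    unfolding q_def by (rule sum_Polar_pole)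
  finally show ?thesis by (simp add: sum_distrib_left mult.assoc)
qed

text \<open>For the middle index the row of the matrix contains y and the column of the inverse
  contains x, so the weight is the sum of their orders and the third entry contributes the factor
  q^c.\<close>

lemma sum_block_weight:
  fixes \<kappa> :: "('a::{field,finite}) fls"
  assumes d: "distinct [i,j,k]"
  defines "q \<equiv> real CARD('a)"
  shows "(\<Sum>p\<in>Polar a \<times> Polar b \<times> Polar c. real_of_int (col_val (orbit_point i j k \<kappa> p) j - row_val (orbit_point i j k \<kappa> p) j)) =
    q ^ c * (q ^ b * (real a * q ^ a - (\<Sum>l<a. q ^ l)) + q ^ a * (real b * q ^ b - (\<Sum>l<b. q ^ l)))"
proof -
  have card: "real (card (Polar n :: 'a fls set)) = q ^ n" for n
    using finite_card_Polar[of n, where 'a = 'a] by (simp add: q_def)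
  have pt: "real_of_int (col_val (orbit_point i j k \<kappa> (u, v, w)) j - row_val (orbit_point i j k \<kappa> (u, v, w)) j) = real (pole u) + real (pole v)" for u v w
    unfolding orbit_point_def prod.case col_val_unip[OF d] row_val_unip[OF d] pole_one_plus by simp
  have S: "(\<Sum>u\<in>(Polar n :: 'a fls set). real (pole u)) = real n * q ^ n - (\<Sum>l<n. q ^ l)" for n
    unfolding sum_Polar_pole[of real] sum_sphere_card_1 q_def ..
  have "(\<Sum>p\<in>Polar a \<times> Polar b \<times> Polar c. real_of_int (col_val (orbit_point i j k \<kappa> p) j - row_val (orbit_point i j k \<kappa> p) j)) =
    (\<Sum>u\<in>(Polar a :: 'a fls set). \<Sum>v\<in>(Polar b :: 'a fls set). \<Sum>w\<in>(Polar c :: 'a fls set). real (pole u) + real (pole v))"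
    unfolding sum.cartesian_product by (intro sum.cong refl) (clarify, simp only: pt prod.case)
  also have "\<dots> = q ^ c * (q ^ b * (\<Sum>u\<in>(Polar a :: 'a fls set). real (pole u)) + q ^ a * (\<Sum>v\<in>(Polar b :: 'a fls set). real (pole v)))"
    by (simp add: sum.distrib card sum_distrib_left[symmetric] sum_distrib_right[symmetric] algebra_simps)
  finally show ?thesis unfolding S .
qed

section \<open>The orbital integrals\<close>

lemma diag_in_GL3_integers_iff:
  assumes "\<And>a. d a \<noteq> 0"
  shows "diag d \<in> GL3_integers \<longleftrightarrow> (\<forall>a. val (d a) = 0)"
proof -
  have d3: "distinct [1,2,3::3]" by simp
  have ne: "det (diag d) \<noteq> 0" unfolding det_diag_perm3[OF d3] using assms by simp
  have v: "val (det (diag d)) = val (d 1) + val (d 2) + val (d 3)"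
    unfolding det_diag_perm3[OF d3] using assms by simp
  have int: "diag d \<in> integral_matrices \<longleftrightarrow> (\<forall>a. 0 \<le> val (d a))"
  proof -
    have "d a \<in> integers \<longleftrightarrow> 0 \<le> val (d a)" for a unfolding integers_iff fls_ge_iff using assms by simp
    moreover have "(0 :: 'a fls) \<in> integers" by (simp add: integers_iff)
    ultimately show ?thesis unfolding integral_matrices_def mem_Collect_eq diag_nth by metis
  qed
  show ?thesis unfolding GL3_integers_iff int v using ne unfolding forall_3 by auto
qed

lemma integral_conj_iff:
  fixes M :: "('a::field) mat3"
  assumes k: "k \<in> GL3_integers"
  shows "matrix_inv k ** M ** k \<in> integral_matrices \<longleftrightarrow> M \<in> integral_matrices"
proof
  have int: "k \<in> integral_matrices" "matrix_inv k \<in> integral_matrices"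
    using k GL3_integers_inv[OF k] by (simp_all add: GL3_integers_iff)
  show "M \<in> integral_matrices \<Longrightarrow> matrix_inv k ** M ** k \<in> integral_matrices"
    using int by (intro integral_mult)
  assume h: "matrix_inv k ** M ** k \<in> integral_matrices"
  note kk = mat3_inv_right[OF GL3_integers_invertible[OF k]]
  have "k ** (matrix_inv k ** M ** k) ** matrix_inv k = (k ** matrix_inv k) ** M ** (k ** matrix_inv k)"
    by (simp only: matrix_mul_assoc)
  also have "\<dots> = M" unfolding kk by simp
  finally show "M \<in> integral_matrices" using integral_mult[OF integral_mult[OF int(1) h] int(2)] by simp
qed

lemma conj_mult:
  fixes g h :: "('a::field) mat3"
  assumes "invertible g" "invertible h"
  shows "matrix_inv (g ** h) ** M ** (g ** h) = matrix_inv h ** (matrix_inv g ** M ** g) ** h"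
  unfolding mat3_inv_mult[OF assms] by (simp only: matrix_mul_assoc)

lemma diag_conj_diag:
  assumes "\<And>a. d a \<noteq> 0"
  shows "matrix_inv (diag d) ** diag c ** diag d = diag c"
  unfolding diag_inv[OF assms] diag_mult using assms by (intro arg_cong[of _ _ diag] ext) simp

text \<open>The conjugate is upper triangular with the diagonal of c, so only its three upper
  entries impose conditions.\<close>

lemma unip_conj_integral_iff:
  assumes d: "distinct [i,j,k]" and c: "\<And>a. fls_ge 0 (c a)"
  shows "matrix_inv (unip i j k x y z) ** diag c ** unip i j k x y z \<in> integral_matrices \<longleftrightarrow>
    fls_ge 0 ((c i - c j) * x) \<and> fls_ge 0 ((c j - c k) * y) \<and> fls_ge 0 ((c i - c k) * z - (c j - c k) * (x * y))"
proof -
  let ?M = "matrix_inv (unip i j k x y z) ** diag c ** unip i j k x y z"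
  note simps = matrix_mult_perm3[OF d, of _ "unip i j k x y z"] mult_diag_nth unip_nth[OF d]
  have ring: "ci * z + - x * cj * y + (x * y - z) * ck = (ci - ck) * z - (cj - ck) * (x * y)"
    "ci * x + - x * cj = (ci - cj) * x" "cj * y + - y * ck = (cj - ck) * y" for ci cj ck x y z :: "'b::comm_ring_1"
    by (simp_all add: algebra_simps)
  have 1: "?M $ i $ i = c i" "?M $ j $ j = c j" "?M $ k $ k = c k" "?M $ j $ i = 0" "?M $ k $ i = 0" "?M $ k $ j = 0"
    unfolding unip_inv(1)[OF d] simps by simp_all
  have 2: "?M $ i $ j = (c i - c j) * x" "?M $ j $ k = (c j - c k) * y"
    "?M $ i $ k = (c i - c k) * z - (c j - c k) * (x * y)"
    unfolding ring[symmetric] unip_inv(1)[OF d] simps by simp_all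
  show ?thesis
    unfolding integral_matrices_def integers_iff mem_Collect_eq all_perm3[OF d] 1 2 using c by (simp add: conj_ac)
qed

lemma unip_in_GL3_integers: "distinct [i,j,k] \<Longrightarrow> fls_ge 0 x \<Longrightarrow> fls_ge 0 y \<Longrightarrow> fls_ge 0 z \<Longrightarrow> unip i j k x y z \<in> GL3_integers"
  unfolding GL3_integers_iff integral_matrices_def integers_iff mem_Collect_eq
  by (simp add: det_unip all_perm3[of i j k] unip_nth)

text \<open>Division by c i - c k turns the condition on the third entry into a bound on the order
  of z - \<kappa>xy, hence z runs over a translate by \<kappa>xy. The weight W stays abstract, to
  serve the torus and the maximal Levi subgroups.\<close>

lemma orbital_integral_eq_sum:
  fixes W :: "('a::{field,finite}) mat3 \<Rightarrow> real" and c :: "3 \<Rightarrow> 'a fls"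
  assumes haar: "haar_measure GL3 \<mu>G" "emeasure \<mu>G GL3_integers = 1"
      "haar_measure (GL3\<lparr>carrier := torus\<rparr>) \<mu>T" "emeasure \<mu>T (torus \<inter> GL3_integers) = 1"
    and quotient: "quotient_measure GL3 torus \<mu>G \<mu>T \<nu>"
    and d: "distinct [i,j,k]" and c: "\<And>a. fls_ge 0 (c a)"
    and vij: "c i - c j \<noteq> 0" "val (c i - c j) = int nij"
    and vjk: "c j - c k \<noteq> 0" "val (c j - c k) = int njk"
    and vik: "c i - c k \<noteq> 0" "val (c i - c k) = int nik"
    and W: "\<And>g. 0 \<le> W g" "\<And>e g. (\<And>a. e a \<noteq> 0) \<Longrightarrow> invertible g \<Longrightarrow> W (diag e ** g) = W g"
      "\<And>g h. invertible g \<Longrightarrow> h \<in> GL3_integers \<Longrightarrow> W (g ** h) = W g"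
  defines "\<phi> \<equiv> \<lambda>g. indicator integral_matrices (matrix_inv g ** diag c ** g) * W g"
    and "\<kappa> \<equiv> (c j - c k) / (c i - c k)"
  shows "integrable \<nu> (\<lambda>C. \<phi> (coset_rep C))"
    and "(\<integral>C. \<phi> (coset_rep C) \<partial>\<nu>) = (\<Sum>p\<in>Polar nij \<times> Polar njk \<times> Polar nik. W (orbit_point i j k \<kappa> p))"
proof -
  note ne = perm3_ne[OF d]
  \<comment> \<open>A selects the representative of the coset whose torus part in the Iwasawa decomposition is integral.\<close>
  define A where "A = {g :: 'a mat3. col_val g i = 0 \<and> row_val g k = 0 \<and> val (det g) = 0}"
  let ?I = "Polar nij \<times> Polar njk \<times> Polar nik :: ('a fls \<times> 'a fls \<times> 'a fls) set"
  have cond: "matrix_inv (unip i j k x y z) ** diag c ** unip i j k x y z \<in> integral_matrices \<longleftrightarrow>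
    pole x \<le> nij \<and> pole y \<le> njk \<and> pole (z - \<kappa> * (x * y)) \<le> nik" for x y z
  proof -
    have e: "(c i - c k) * z - (c j - c k) * (x * y) = (c i - c k) * (z - \<kappa> * (x * y))"
      unfolding right_diff_distrib \<kappa>_def using vik(1) by simp
    show ?thesis
      unfolding unip_conj_integral_iff[OF d c] e fls_ge_mult_iff[OF vij(1)] fls_ge_mult_iff[OF vjk(1)] fls_ge_mult_iff[OF vik(1)]
        vij(2) vjk(2) vik(2) pole_le_iff by simp
  qed
  have unip_A: "invertible (unip i j k x y z) \<and> unip i j k x y z \<in> A" for x y z
    unfolding A_def using unip_inv(2)[OF d] by (simp add: col_val_unip[OF d] row_val_unip[OF d] det_unip[OF d])
  have nonneg: "0 \<le> \<phi> g" for g unfolding \<phi>_def using W(1) by simp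
  have T_inv: "\<phi> (t ** g) = \<phi> g" if t: "t \<in> torus" and g: "invertible g" for t g
  proof -
    obtain e where e: "\<forall>a. e a \<noteq> 0" "t = diag e" using t unfolding torus_iff_diag by blast
    note e1 = e(1)[rule_format]
    have "invertible (diag e)" using e1 by (simp add: invertible_diag)
    hence "matrix_inv (t ** g) ** diag c ** (t ** g) = matrix_inv g ** diag c ** g"
      unfolding e(2) by (subst conj_mult[OF _ g]) (simp_all only: diag_conj_diag[OF e1])
    moreover have "W (t ** g) = W g" unfolding e(2) by (rule W(2)[OF e1 g])
    ultimately show ?thesis unfolding \<phi>_def by (simp only:)
  qed
  have K_inv: "\<phi> (g ** h) = \<phi> g" if g: "invertible g" and h: "h \<in> GL3_integers" for g h
  proof -
    have "matrix_inv (g ** h) ** diag c ** (g ** h) \<in> integral_matrices \<longleftrightarrow> matrix_inv g ** diag c ** g \<in> integral_matrices"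
      unfolding conj_mult[OF g GL3_integers_invertible[OF h]] by (rule integral_conj_iff[OF h])
    thus ?thesis unfolding \<phi>_def indicator_def W(3)[OF g h] by (simp only:)
  qed
  have A_K: "g ** h \<in> A \<longleftrightarrow> g \<in> A" if g: "invertible g" and h: "h \<in> GL3_integers" for g h
  proof -
    have "det h \<noteq> 0" "val (det h) = 0" "det g \<noteq> 0" using h g by (simp_all add: GL3_integers_iff invertible_det)
    hence "val (det (g ** h)) = val (det g)" by (simp add: det_mul)
    thus ?thesis unfolding A_def mem_Collect_eq row_val_mult_K[OF g h] col_val_mult_K[OF g h] by simp
  qed
  have A_T: "\<exists>t0\<in>torus. \<forall>t\<in>torus. t ** g \<in> A \<longleftrightarrow> (\<exists>h\<in>torus \<inter> GL3_integers. t = t0 ** h)" if g: "invertible g" for g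
  proof -
    \<comment> \<open>The valuations that a diagonal matrix must have in order to move g into
      A.\<close>
    define m where "m a = (if a = i then - col_val g i else if a = k then - row_val g k else col_val g i + row_val g k - val (det g))" for a
    define e :: "3 \<Rightarrow> 'a fls" where "e a = fls_shift (- m a) 1" for a
    have e: "e a \<noteq> 0" "val (e a) = m a" for a by (simp_all add: e_def)
    have main: "diag u ** g \<in> A \<longleftrightarrow> (\<exists>h\<in>torus \<inter> GL3_integers. diag u = diag e ** h)" if u: "\<And>a. u a \<noteq> 0" for u
    proof -
      have "det g \<noteq> 0" using g by (simp add: invertible_det)
      hence "val (det (diag u ** g)) = val (u i) + val (u j) + val (u k) + val (det g)"
        unfolding det_mul det_diag_perm3[OF d] using u by simp
      hence "diag u ** g \<in> A \<longleftrightarrow> val (u i) = m i \<and> val (u j) = m j \<and> val (u k) = m k"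
        unfolding A_def mem_Collect_eq row_val_diag_mult[OF g u] col_val_diag_mult[OF g u] m_def using ne by auto
      also have "\<dots> \<longleftrightarrow> (\<forall>a. val (u a) = m a)" by (rule all_perm3[OF d, symmetric])
      also have "\<dots> \<longleftrightarrow> (\<exists>h\<in>torus \<inter> GL3_integers. diag u = diag e ** h)"
      proof
        assume v: "\<forall>a. val (u a) = m a"
        let ?h = "\<lambda>a. u a / e a"
        have h0: "?h a \<noteq> 0" for a using u e(1) by simp
        have "val (?h a) = 0" for a
        proof -
          have "val (e a * ?h a) = val (e a) + val (?h a)" using e(1) h0 by (intro fls_subdegree_mult)
          thus ?thesis using e v by simp
        qed
        hence "diag ?h \<in> GL3_integers" by (intro diag_in_GL3_integers_iff[of ?h, OF h0, THEN iffD2] allI)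
        moreover have "diag ?h \<in> torus" by (rule diag_in_torus[of ?h, OF h0])
        ultimately have "diag ?h \<in> torus \<inter> GL3_integers" by (rule IntI[rotated])
        moreover have "diag u = diag e ** diag ?h" unfolding diag_mult using e(1) by (intro arg_cong[of _ _ diag] ext) simp
        ultimately show "\<exists>h\<in>torus \<inter> GL3_integers. diag u = diag e ** h" by blast
      next
        assume "\<exists>h\<in>torus \<inter> GL3_integers. diag u = diag e ** h"
        then obtain h where h: "h \<in> torus" "h \<in> GL3_integers" "diag u = diag e ** h" by blast
        obtain f where f: "\<forall>a. f a \<noteq> 0" "h = diag f" using h(1) unfolding torus_iff_diag by blast
        note f1 = f(1)[rule_format]
        have vf: "val (f a) = 0" for a using h(2) unfolding f(2) diag_in_GL3_integers_iff[of f, OF f1] by blast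
        have "diag u $ a $ a = (diag e ** diag f) $ a $ a" for a using h(3) unfolding f(2) by (simp only:)
        hence "u a = e a * f a" for a unfolding diag_mult by simp
        thus "\<forall>a. val (u a) = m a" using e f1 vf by simp
      qed
      finally show ?thesis .
    qed
    show ?thesis
    proof (rule bexI[of _ "diag e"])
      show "diag e \<in> torus" using e(1) by (rule diag_in_torus)
      show "\<forall>t\<in>torus. t ** g \<in> A \<longleftrightarrow> (\<exists>h\<in>torus \<inter> GL3_integers. t = diag e ** h)"
      proof
        fix t :: "'a mat3" assume "t \<in> torus"
        then obtain u where u: "\<forall>a. u a \<noteq> 0" "t = diag u" unfolding torus_iff_diag by blast
        show "t ** g \<in> A \<longleftrightarrow> (\<exists>h\<in>torus \<inter> GL3_integers. t = diag e ** h)"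
          unfolding u(2) by (rule main) (rule u(1)[rule_format])
      qed
    qed
  qed
  have fin: "finite ?I" by simp
  have nI: "invertible (orbit_point i j k \<kappa> p) \<and> orbit_point i j k \<kappa> p \<in> A" if "p \<in> ?I" for p
    unfolding orbit_point_def case_prod_unfold by (rule unip_A)
  have cover: "\<exists>p\<in>?I. \<exists>h\<in>GL3_integers. g = orbit_point i j k \<kappa> p ** h"
    if g: "invertible g" "g \<in> A" "\<phi> g \<noteq> 0" for g
  proof -
    obtain x y z e h where ih: "\<forall>a. e a \<noteq> 0" "h \<in> GL3_integers" "g = unip i j k x y z ** diag e ** h"
      by (rule iwasawa[OF g(1) d])
    note ic = iwasawa_coordinates[OF d ih]
    have "val (e i) = 0" "val (e k) = 0" "val (e j) = 0" using g(2) ic(1-3) unfolding A_def mem_Collect_eq by linarith+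
    hence "\<forall>a. val (e a) = 0" unfolding all_perm3[OF d] by blast
    hence eK: "diag e \<in> GL3_integers" using diag_in_GL3_integers_iff[of e, OF ih(1)[rule_format]] by blast
    \<comment> \<open>Modulo integers x and y are replaced by 1 plus a polar part. The change b of y
      enters the third entry through x' * b, which is why z is reduced only after subtracting this
      product.\<close>
    define u v where "u = polar (x - 1)" and "v = polar (y - 1)"
    define x' y' where "x' = 1 + u" and "y' = 1 + v"
    define b where "b = y - y'"
    define z' where "z' = polar (z - x' * b)"
    define w where "w = z' - polar (\<kappa> * (x' * y'))"
    have int: "fls_ge 0 (x - x')" "fls_ge 0 b" "fls_ge 0 (z - x' * b - z')"
      using polar_integral[of "x - 1"] polar_integral[of "y - 1"] polar_integral[of "z - x' * b"]
      by (simp_all add: x'_def y'_def u_def v_def b_def z'_def diff_diff_eq)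
    let ?k = "unip i j k (x - x') b (z - x' * b - z')"
    have kK: "?k \<in> GL3_integers" by (rule unip_in_GL3_integers[OF d int])
    have split: "unip i j k x y z = unip i j k x' y' z' ** ?k"
      unfolding unip_mult[OF d] b_def by simp
    have gg: "g = unip i j k x' y' z' ** (?k ** diag e ** h)"
      unfolding ih(3) split by (simp only: matrix_mul_assoc)
    have K: "?k ** diag e ** h \<in> GL3_integers" by (intro GL3_integers_mult kK eK ih(2))
    have "\<phi> (unip i j k x' y' z') \<noteq> 0"
      using g(3) K_inv[OF unip_inv(2)[OF d, of x' y' z'] K] unfolding gg by simp
    hence "matrix_inv (unip i j k x' y' z') ** diag c ** unip i j k x' y' z' \<in> integral_matrices"
      unfolding \<phi>_def indicator_def by (simp split: if_splits)
    hence p: "pole x' \<le> nij" "pole y' \<le> njk" "pole (z' - \<kappa> * (x' * y')) \<le> nik" unfolding cond by blast+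
    have uP: "u \<in> Polar nij"
    proof -
      have "pole u = pole x'" unfolding x'_def pole_one_plus ..
      thus ?thesis using p(1) unfolding u_def by (intro polar_in_Polar) simp
    qed
    have vP: "v \<in> Polar njk"
    proof -
      have "pole v = pole y'" unfolding y'_def pole_one_plus ..
      thus ?thesis using p(2) unfolding v_def by (intro polar_in_Polar) simp
    qed
    have wP: "w \<in> Polar nik"
    proof -
      have "w = polar w" unfolding w_def z'_def by (rule fls_eqI) (simp add: polar_nth)
      moreover have "pole w \<le> nik"
      proof -
        have "pole (z' - \<kappa> * (x' * y') + (\<kappa> * (x' * y') - polar (\<kappa> * (x' * y')))) = pole (z' - \<kappa> * (x' * y'))"
          by (rule pole_add_integral[OF polar_integral])
        moreover have "z' - \<kappa> * (x' * y') + (\<kappa> * (x' * y') - polar (\<kappa> * (x' * y'))) = w" unfolding w_def by simp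
        ultimately show ?thesis using p(3) by simp
      qed
      ultimately show ?thesis using polar_in_Polar by metis
    qed
    have "unip i j k x' y' z' = orbit_point i j k \<kappa> (u, v, w)"
      unfolding orbit_point_def prod.case x'_def[symmetric] y'_def[symmetric] w_def by simp
    hence "g = orbit_point i j k \<kappa> (u, v, w) ** (?k ** diag e ** h)" using gg by (simp only:)
    moreover have "(u, v, w) \<in> ?I" using uP vP wP by blast
    ultimately show ?thesis using K by blast
  qed
  have disj: "p = p'" if p: "p \<in> ?I" "p' \<in> ?I" and h: "h \<in> GL3_integers" and e: "orbit_point i j k \<kappa> p = orbit_point i j k \<kappa> p' ** h" for p p' h
  proof -
    obtain u v w where p1: "p = (u, v, w)" by (cases p)
    obtain u' v' w' where p2: "p' = (u', v', w')" by (cases p')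
    have P: "u \<in> Polar nij" "v \<in> Polar njk" "w \<in> Polar nik" "u' \<in> Polar nij" "v' \<in> Polar njk" "w' \<in> Polar nik"
      using p unfolding p1 p2 by auto
    define x y z where "x = 1 + u" and "y = 1 + v" and "z = polar (\<kappa> * ((1 + u) * (1 + v))) + w"
    define x' y' z' where "x' = 1 + u'" and "y' = 1 + v'" and "z' = polar (\<kappa> * ((1 + u') * (1 + v'))) + w'"
    have e': "unip i j k x y z = unip i j k x' y' z' ** h"
      using e unfolding p1 p2 orbit_point_def prod.case x_def y_def z_def x'_def y'_def z'_def .
    have "matrix_inv (unip i j k x' y' z') ** unip i j k x y z = h"
      unfolding e' matrix_mul_assoc mat3_inv_left[OF unip_inv(2)[OF d]] by simp
    hence eq: "unip i j k (x - x') (y - y') (x' * y' - z' + z - x' * y) = h"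
      unfolding unip_inv(1)[OF d] unip_mult[OF d] by (simp add: algebra_simps)
    hence "\<forall>a b. fls_ge 0 (unip i j k (x - x') (y - y') (x' * y' - z' + z - x' * y) $ a $ b)"
      using h unfolding eq GL3_integers_iff integral_matrices_def integers_iff mem_Collect_eq by (elim conjE)
    hence int: "fls_ge 0 (x - x')" "fls_ge 0 (y - y')" "fls_ge 0 (x' * y' - z' + z - x' * y)"
      unfolding all_perm3[OF d] unip_nth[OF d] by blast+
    have u: "u = u'" using int(1) P(1,4) by (intro Polar_integral_eq) (simp_all add: x_def x'_def)
    have v: "v = v'" using int(2) P(2,5) by (intro Polar_integral_eq) (simp_all add: y_def y'_def)
    \<comment> \<open>Once u = u' and v = v', the \<kappa>-terms and the products cancel.\<close>
    have "x' * y' - z' + z - x' * y = w - w'" unfolding x'_def y'_def y_def z_def z'_def u v by simp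
    hence w: "w = w'" using int(3) P(3,6) by (intro Polar_integral_eq) simp_all
    show ?thesis unfolding p1 p2 u v w ..
  qed
  note unfold = quotient_integral_unfolding[of \<mu>G \<mu>T \<nu> \<phi> A ?I "orbit_point i j k \<kappa>",
      OF haar quotient nonneg T_inv K_inv A_K A_T fin nI cover disj]
  show "integrable \<nu> (\<lambda>C. \<phi> (coset_rep C))" by (rule unfold(1))
  have "(\<integral>C. \<phi> (coset_rep C) \<partial>\<nu>) = (\<Sum>p\<in>?I. \<phi> (orbit_point i j k \<kappa> p))" by (rule unfold(2))
  also have "\<dots> = (\<Sum>p\<in>?I. W (orbit_point i j k \<kappa> p))"
  proof (rule sum.cong[OF refl])
    fix p assume "p \<in> ?I"
    then obtain u v w where p: "p = (u, v, w)" and P: "u \<in> Polar nij" "v \<in> Polar njk" "w \<in> Polar nik" by auto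
    have "pole (polar (\<kappa> * ((1 + u) * (1 + v))) + w - \<kappa> * ((1 + u) * (1 + v))) \<le> nik"
    proof -
      have "pole (w - (\<kappa> * ((1 + u) * (1 + v)) - polar (\<kappa> * ((1 + u) * (1 + v))))) \<le> nik"
        by (rule pole_diff_le[OF Polar_pole_le[OF P(3)]]) (simp add: polar_integral[folded pole_eq_0_iff])
      thus ?thesis by (simp add: diff_diff_eq2 add.commute)
    qed
    hence "matrix_inv (orbit_point i j k \<kappa> p) ** diag c ** orbit_point i j k \<kappa> p \<in> integral_matrices"
      unfolding p orbit_point_def prod.case cond pole_one_plus using Polar_pole_le P by blast
    thus "\<phi> (orbit_point i j k \<kappa> p) = W (orbit_point i j k \<kappa> p)" unfolding \<phi>_def by simp
  qed
  finally show "(\<integral>C. \<phi> (coset_rep C) \<partial>\<nu>) = (\<Sum>p\<in>?I. W (orbit_point i j k \<kappa> p))" .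
qed

lemma weight_factor_nonneg: "0 \<le> weight_factor B M g"
  unfolding weight_factor_def by (rule measure_nonneg)

lemma weighted_orbital_integral_torus:
  fixes c :: "3 \<Rightarrow> ('a::{field,finite}) fls"
  assumes haar: "haar_measure GL3 \<mu>G" "emeasure \<mu>G GL3_integers = 1"
      "haar_measure (GL3\<lparr>carrier := torus\<rparr>) \<mu>T" "emeasure \<mu>T (torus \<inter> GL3_integers) = 1"
    and quotient: "quotient_measure GL3 torus \<mu>G \<mu>T \<nu>"
    and B: "inner_product_on (a_space_G (torus :: 'a mat3 set)) B"
    and d: "distinct [i,j,k]" and c: "\<And>a. fls_ge 0 (c a)"
    and vij: "c i - c j \<noteq> 0" "val (c i - c j) = int n"
    and vjk: "c j - c k \<noteq> 0" "val (c j - c k) = int n"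
    and vik: "c i - c k \<noteq> 0" "val (c i - c k) = int N"
    and nN: "n \<le> N"
  defines "q \<equiv> real CARD('a)"
  shows "integrable \<nu> (\<lambda>C. orbital_integrand B torus (diag c) (coset_rep C))"
    and "weighted_orbital_integral \<nu> B torus (diag c) = levi_covolume B (torus :: 'a mat3 set) *
      ((\<Sum>i = 1..n. real i * (q ^ (2 * i - 1) + q ^ (2 * i - 2)))
              + (\<Sum>i = n + N..<2 * n + N. (4 * real n + 2 * real N - 4 * real i - 3) * q ^ i)
              + ((real n)\<^sup>2 + 2 * real n * real N) * q ^ (2 * n + N))"
proof -
  let ?W = "weight_factor B (torus :: 'a mat3 set)"
  define \<kappa> where "\<kappa> = (c j - c k) / (c i - c k)"
  have wf: "?W g = levi_covolume B (torus :: 'a mat3 set) * hex_weight i j k g" if "invertible g" for g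
    by (rule weight_factor_torus[OF B that d])
  have W2: "?W (diag e ** g) = ?W g" if e: "\<And>a. e a \<noteq> 0" and g: "invertible g" for e g
  proof -
    have dg: "invertible (diag e)" using e by (simp add: invertible_diag)
    have g0: "det g \<noteq> 0" using g by (simp add: invertible_det)
    have v: "val (det (diag e ** g)) = val (e i) + val (e j) + val (e k) + val (det g)"
      unfolding det_mul det_diag_perm3[OF d] using e g0 by simp
    have shift: "(x + a) - (x + b) = a - b" "(x + a) + (y + b) + (z + r) - (x + z + y + D) = a + b + r - D"
      "(x + z + y + D) - (z + s) - (x + r) - (y + t) = D - s - r - t" for x y z a b r s t D :: int
      by simp_all
    have "hex_weight i j k (diag e ** g) = hex_weight i j k g"
      unfolding hex_weight_def v row_val_diag_mult[OF g e] col_val_diag_mult[OF g e] shift ..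
    thus ?thesis unfolding wf[OF g] wf[OF mat3_invertible_mult[OF dg g]] by (simp only:)
  qed
  have W3: "?W (g ** h) = ?W g" if g: "invertible g" and h: "h \<in> GL3_integers" for g h
  proof -
    have "det h \<noteq> 0" "val (det h) = 0" "det g \<noteq> 0" using h g by (simp_all add: GL3_integers_iff invertible_det)
    hence v: "val (det (g ** h)) = val (det g)" by (simp add: det_mul)
    have "hex_weight i j k (g ** h) = hex_weight i j k g"
      unfolding hex_weight_def v row_val_mult_K[OF g h] col_val_mult_K[OF g h] ..
    thus ?thesis unfolding wf[OF g] wf[OF mat3_invertible_mult[OF g GL3_integers_invertible[OF h]]] by (simp only:)
  qed
  note main = orbital_integral_eq_sum[where W = ?W, OF haar quotient d c vij vjk vik weight_factor_nonneg W2 W3, folded orbital_integrand_def \<kappa>_def]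
  show "integrable \<nu> (\<lambda>C. orbital_integrand B torus (diag c) (coset_rep C))" by (rule main(1))
  \<comment> \<open>Since 1 - \<kappa> is (c i - c j) / (c i - c k), the equal bounds on x and y
    give \<kappa> and 1 - \<kappa> the same valuation n - N.\<close>
  have \<kappa>: "\<kappa> \<noteq> 0" "\<kappa> * (c i - c k) = c j - c k" "(1 - \<kappa>) * (c i - c k) = c i - c j"
    unfolding \<kappa>_def left_diff_distrib using vjk(1) vik(1) by simp_all
  have \<kappa>1: "1 - \<kappa> \<noteq> 0" using \<kappa>(3) vij(1) by auto
  have v\<kappa>: "val \<kappa> = int n - int N"
    using fls_subdegree_mult[OF \<kappa>(1) vik(1)] unfolding \<kappa>(2) vik(2) vjk(2) by simp
  have v\<kappa>1: "val (1 - \<kappa>) = int n - int N"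
    using fls_subdegree_mult[OF \<kappa>1 vik(1)] unfolding \<kappa>(3) vik(2) vij(2) by simp
  have q0: "q \<noteq> 0" by (simp add: q_def)
  have "weighted_orbital_integral \<nu> B torus (diag c) = (\<Sum>p\<in>Polar n \<times> Polar n \<times> Polar N. ?W (orbit_point i j k \<kappa> p))"
    unfolding weighted_orbital_integral_def by (rule main(2))
  also have "\<dots> = levi_covolume B (torus :: 'a mat3 set) * (\<Sum>p\<in>Polar n \<times> Polar n \<times> Polar N. hex_weight i j k (orbit_point i j k \<kappa> p))"
    unfolding sum_distrib_left by (intro sum.cong refl wf) (simp add: orbit_point_def case_prod_unfold unip_inv(2)[OF d])
  finally show "weighted_orbital_integral \<nu> B torus (diag c) = levi_covolume B (torus :: 'a mat3 set) *
      ((\<Sum>i = 1..n. real i * (q ^ (2 * i - 1) + q ^ (2 * i - 2)))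
              + (\<Sum>i = n + N..<2 * n + N. (4 * real n + 2 * real N - 4 * real i - 3) * q ^ i)
              + ((real n)\<^sup>2 + 2 * real n * real N) * q ^ (2 * n + N))"
    unfolding sum_hex_weight[OF d \<kappa>(1) \<kappa>1 v\<kappa> v\<kappa>1 nN, folded q_def] hexagon_sum[OF q0 nN] .
qed

text \<open>The singleton block j is the middle index, so the weight is the sum of the orders of x
  and y, and the third entry contributes the factor q^nik.\<close>

lemma weighted_orbital_integral_block:
  fixes c :: "3 \<Rightarrow> ('a::{field,finite}) fls"
  assumes haar: "haar_measure GL3 \<mu>G" "emeasure \<mu>G GL3_integers = 1"
      "haar_measure (GL3\<lparr>carrier := torus\<rparr>) \<mu>T" "emeasure \<mu>T (torus \<inter> GL3_integers) = 1"
    and quotient: "quotient_measure GL3 torus \<mu>G \<mu>T \<nu>"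
    and B: "inner_product_on (a_space_G (torus :: 'a mat3 set)) B"
    and d: "distinct [i,j,k]" and b: "b i = b k" "b j \<noteq> b i" and c: "\<And>a. fls_ge 0 (c a)"
    and vij: "c i - c j \<noteq> 0" "val (c i - c j) = int nij"
    and vjk: "c j - c k \<noteq> 0" "val (c j - c k) = int njk"
    and vik: "c i - c k \<noteq> 0" "val (c i - c k) = int nik"
  defines "q \<equiv> real CARD('a)"
  shows "integrable \<nu> (\<lambda>C. orbital_integrand B (levi b) (diag c) (coset_rep C))"
    and "weighted_orbital_integral \<nu> B (levi b) (diag c) = levi_covolume B (levi b :: 'a mat3 set) *
      (q ^ nik * (q ^ njk * (real nij * q ^ nij - (\<Sum>l<nij. q ^ l)) + q ^ nij * (real njk * q ^ njk - (\<Sum>l<njk. q ^ l))))"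
proof -
  let ?W = "weight_factor B (levi b :: 'a mat3 set)"
  have d': "distinct [i,k,j]" using d by auto
  define \<kappa> where "\<kappa> = (c j - c k) / (c i - c k)"
  have wf: "?W g = levi_covolume B (levi b :: 'a mat3 set) * of_int (col_val g j - row_val g j)" if "invertible g" for g
    by (rule weight_factor_block[OF B that d' b])
  have W2: "?W (diag e ** g) = ?W g" if e: "\<And>a. e a \<noteq> 0" and g: "invertible g" for e g
  proof -
    have dg: "invertible (diag e)" using e by (simp add: invertible_diag)
    show ?thesis
      unfolding wf[OF g] wf[OF mat3_invertible_mult[OF dg g]] row_val_diag_mult[OF g e] col_val_diag_mult[OF g e] by simp
  qed
  have W3: "?W (g ** h) = ?W g" if g: "invertible g" and h: "h \<in> GL3_integers" for g h
    unfolding wf[OF g] wf[OF mat3_invertible_mult[OF g GL3_integers_invertible[OF h]]] row_val_mult_K[OF g h] col_val_mult_K[OF g h] ..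
  note main = orbital_integral_eq_sum[where W = ?W, OF haar quotient d c vij vjk vik weight_factor_nonneg W2 W3, folded orbital_integrand_def \<kappa>_def]
  show "integrable \<nu> (\<lambda>C. orbital_integrand B (levi b) (diag c) (coset_rep C))" by (rule main(1))
  have "weighted_orbital_integral \<nu> B (levi b) (diag c) = (\<Sum>p\<in>Polar nij \<times> Polar njk \<times> Polar nik. ?W (orbit_point i j k \<kappa> p))"
    unfolding weighted_orbital_integral_def by (rule main(2))
  also have "\<dots> = levi_covolume B (levi b :: 'a mat3 set) *
      (\<Sum>p\<in>Polar nij \<times> Polar njk \<times> Polar nik. of_int (col_val (orbit_point i j k \<kappa> p) j - row_val (orbit_point i j k \<kappa> p) j))"
    unfolding sum_distrib_left by (intro sum.cong refl wf) (simp add: orbit_point_def case_prod_unfold unip_inv(2)[OF d])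
  finally show "weighted_orbital_integral \<nu> B (levi b) (diag c) = levi_covolume B (levi b :: 'a mat3 set) *
      (q ^ nik * (q ^ njk * (real nij * q ^ nij - (\<Sum>l<nij. q ^ l)) + q ^ nij * (real njk * q ^ njk - (\<Sum>l<njk. q ^ l))))"
    unfolding sum_block_weight[OF d, where \<kappa> = \<kappa>, folded q_def] .
qed

text \<open>Proportional roots do not span. Two roots sharing the first or the last index have a
  root as difference, with coefficients 1 and -1 of opposite sign. What remains is a chain, run
  through in one of two directions.\<close>

lemma simple_roots_cases:
  assumes s: "simple_roots {\<alpha>1, \<alpha>2}"
  obtains a b c where "distinct [a,b,c]" "\<alpha>1 = axis a 1 - axis b 1" "\<alpha>2 = axis b 1 - axis c 1"
  | a b c where "distinct [a,b,c]" "\<alpha>1 = axis b 1 - axis c 1" "\<alpha>2 = axis a 1 - axis b 1"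
proof -
  have nth: "(axis x 1 - axis y 1 :: int^3) $ z = (if z = x then 1 else 0) - (if z = y then 1 else 0)" for x y z
    by (auto simp: axis_def)
  have "{\<alpha>1, \<alpha>2} \<subseteq> roots" using s unfolding simple_roots_def by (rule conjunct1)
  hence roots: "\<alpha>1 \<in> roots" "\<alpha>2 \<in> roots" by simp_all
  obtain p q where pq: "\<alpha>1 = axis p 1 - axis q 1" "p \<noteq> q"
    using roots(1) unfolding roots_def by blast
  obtain r u where ru: "\<alpha>2 = axis r 1 - axis u 1" "r \<noteq> u"
    using roots(2) unfolding roots_def by blast
  obtain t where d: "distinct [p,q,t]" using ex_perm3[OF pq(2)] by blast
  note ne = perm3_ne[OF d]
  have comb: "\<exists>c1 c2. (\<forall>z. (axis x 1 - axis y 1 :: int^3) $ z = c1 * \<alpha>1 $ z + c2 * \<alpha>2 $ z) \<and> (0 \<le> c1 \<and> 0 \<le> c2 \<or> c1 \<le> 0 \<and> c2 \<le> 0)"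
    if xy: "x \<noteq> y" for x y
  proof -
    have "axis x 1 - axis y 1 \<in> roots" unfolding roots_def using xy by blast
    then obtain f where f: "axis x 1 - axis y 1 = (\<Sum>\<alpha>\<in>{\<alpha>1,\<alpha>2}. f \<alpha> *s \<alpha>)" "(\<forall>\<alpha>\<in>{\<alpha>1,\<alpha>2}. 0 \<le> f \<alpha>) \<or> (\<forall>\<alpha>\<in>{\<alpha>1,\<alpha>2}. f \<alpha> \<le> 0)"
      using s unfolding simple_roots_def by blast
    show ?thesis
    proof (cases "\<alpha>1 = \<alpha>2")
      \<comment> \<open>For equal roots the sum over the set has a single term, and 0 serves as
        second coefficient.\<close>
      case True
      have "\<forall>z. (axis x 1 - axis y 1 :: int^3) $ z = f \<alpha>1 * \<alpha>1 $ z + 0 * \<alpha>2 $ z" unfolding f(1) using True by simp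
      thus ?thesis using f(2) by (intro exI[of _ "f \<alpha>1"] exI[of _ 0]) auto
    next
      case False
      have "\<forall>z. (axis x 1 - axis y 1 :: int^3) $ z = f \<alpha>1 * \<alpha>1 $ z + f \<alpha>2 * \<alpha>2 $ z" unfolding f(1) using False by simp
      thus ?thesis using f(2) by (intro exI[of _ "f \<alpha>1"] exI[of _ "f \<alpha>2"]) auto
    qed
  qed
  have "r \<in> {p,q,t}" "u \<in> {p,q,t}" using UNIV_perm3[OF d] by blast+
  then consider "r = p \<and> u = q \<or> r = q \<and> u = p" | "r = p" "u = t" | "r = t" "u = q" | "r = q" "u = t" | "r = t" "u = p"
    using ru(2) by blast
  thus ?thesis
  proof cases
    case 1
    obtain c1 c2 where c: "\<And>z. (axis p 1 - axis t 1 :: int^3) $ z = c1 * \<alpha>1 $ z + c2 * \<alpha>2 $ z"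
      using comb[of p t] ne by blast
    have "\<alpha>2 $ t = 0" using 1 ne unfolding ru nth by auto
    hence False using c[of t] ne unfolding pq nth by simp
    thus ?thesis ..
  next
    case 2
    obtain c1 c2 where c: "\<And>z. (axis t 1 - axis q 1 :: int^3) $ z = c1 * \<alpha>1 $ z + c2 * \<alpha>2 $ z" "0 \<le> c1 \<and> 0 \<le> c2 \<or> c1 \<le> 0 \<and> c2 \<le> 0"
      using comb[of t q] ne by blast
    have "c1 = 1" "c2 = -1" using c(1)[of q] c(1)[of t] ne unfolding pq ru nth 2 by simp_all
    thus ?thesis using c(2) by simp
  next
    case 3
    obtain c1 c2 where c: "\<And>z. (axis p 1 - axis t 1 :: int^3) $ z = c1 * \<alpha>1 $ z + c2 * \<alpha>2 $ z" "0 \<le> c1 \<and> 0 \<le> c2 \<or> c1 \<le> 0 \<and> c2 \<le> 0"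
      using comb[of p t] ne by blast
    have "c1 = 1" "c2 = -1" using c(1)[of p] c(1)[of t] ne unfolding pq ru nth 3 by simp_all
    thus ?thesis using c(2) by simp
  next
    case 4
    show ?thesis by (rule that(1)[OF d pq(1) ru(1)[unfolded 4]])
  next
    case 5
    have d': "distinct [t,p,q]" using d by auto
    show ?thesis by (rule that(2)[OF d' pq(1) ru(1)[unfolded 5]])
  qed
qed

definition pair_flag :: "3 \<Rightarrow> 3 \<Rightarrow> nat" where
  "pair_flag k a = (if a = k then 1 else 0)"

lemma levi_of_root_pair_flag:
  assumes d: "distinct [i,j,k]"
  shows "levi_of_root (axis i 1 - axis j 1) = (levi (pair_flag k) :: ('a::field) mat3 set)"
  by (rule levi_of_root_eq[OF d]) (use perm3_ne[OF d] in \<open>simp_all add: pair_flag_def\<close>)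

lemma root_value_axis:
  assumes "distinct [i,j,k]"
  shows "root_value (axis i 1 - axis j 1) \<gamma> = \<gamma> $ i $ i - \<gamma> $ j $ j"
  unfolding root_value_def sum_perm3[OF assms] using perm3_ne[OF assms] by (simp add: axis_def)

text \<open>The index that does not occur in \<alpha>2 is put in the middle; valuations ignore
  signs, so \<alpha>1 and \<alpha>1 + \<alpha>2 become the two adjacent pairs. Which is which
  depends on the direction of the chain, hence the disjunction.\<close>

lemma root_valuation_cases:
  fixes \<gamma> :: "('a::field) mat3"
  assumes simple: "simple_roots {\<alpha>1, \<alpha>2}" and reg: "regular \<gamma>"
    and v: "val (root_value \<alpha>1 \<gamma>) = n1" "val (root_value (\<alpha>1 + \<alpha>2) \<gamma>) = n1" "val (root_value \<alpha>2 \<gamma>) = n2"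
  defines "c \<equiv> \<lambda>a. \<gamma> $ a $ a"
  obtains i j k where "distinct [i,j,k]" "\<forall>a b. a \<noteq> b \<longrightarrow> c a - c b \<noteq> 0"
    "val (c i - c j) = n1" "val (c j - c k) = n1" "val (c i - c k) = n2"
    "levi_of_root \<alpha>2 = (levi (pair_flag j) :: 'a mat3 set)"
    "levi_of_root \<alpha>1 = (levi (pair_flag k) :: 'a mat3 set) \<and> levi_of_root (\<alpha>1 + \<alpha>2) = (levi (pair_flag i) :: 'a mat3 set)
      \<or> levi_of_root \<alpha>1 = (levi (pair_flag i) :: 'a mat3 set) \<and> levi_of_root (\<alpha>1 + \<alpha>2) = (levi (pair_flag k) :: 'a mat3 set)"
proof -
  have cc: "\<gamma> $ a $ a = c a" for a by (simp add: c_def)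
  have ne0: "\<forall>a b. a \<noteq> b \<longrightarrow> c a - c b \<noteq> 0"
  proof (intro allI impI)
    fix a b :: 3 assume ab: "a \<noteq> b"
    obtain t where d: "distinct [a,b,t]" using ex_perm3[OF ab] by blast
    have "axis a 1 - axis b 1 \<in> roots" unfolding roots_def using ab by blast
    hence "root_value (axis a 1 - axis b 1) \<gamma> \<noteq> 0" using reg unfolding regular_def by blast
    thus "c a - c b \<noteq> 0" unfolding root_value_axis[OF d] cc .
  qed
  have sym: "val (c a - c b) = val (c b - c a)" for a b
    by (metis minus_diff_eq fls_uminus_subdegree)
  show ?thesis using simple
  proof (cases rule: simple_roots_cases)
    case (1 a b e)
    note d = 1(1)
    have d': "distinct [a,e,b]" "distinct [b,e,a]" "distinct [b,a,e]" using d by auto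
    have sum: "\<alpha>1 + \<alpha>2 = axis a 1 - axis e 1" unfolding 1 by simp
    show ?thesis
    proof (rule that[OF d'(3) ne0])
      show "val (c b - c a) = n1" using v(1) unfolding 1 root_value_axis[OF d] cc sym[of b a] .
      show "val (c a - c e) = n1" using v(2) unfolding sum root_value_axis[OF d'(1)] cc .
      show "val (c b - c e) = n2" using v(3) unfolding 1 root_value_axis[OF d'(2)] cc .
      show "levi_of_root \<alpha>2 = (levi (pair_flag a) :: 'a mat3 set)" unfolding 1 by (rule levi_of_root_pair_flag[OF d'(2)])
      show "levi_of_root \<alpha>1 = (levi (pair_flag e) :: 'a mat3 set) \<and> levi_of_root (\<alpha>1 + \<alpha>2) = (levi (pair_flag b) :: 'a mat3 set)
        \<or> levi_of_root \<alpha>1 = (levi (pair_flag b) :: 'a mat3 set) \<and> levi_of_root (\<alpha>1 + \<alpha>2) = (levi (pair_flag e) :: 'a mat3 set)"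
        unfolding sum unfolding 1 by (intro disjI1 conjI levi_of_root_pair_flag d d')
    qed
  next
    case (2 a b e)
    note d = 2(1)
    have d': "distinct [a,e,b]" "distinct [b,e,a]" "distinct [b,a,e]" using d by auto
    have sum: "\<alpha>1 + \<alpha>2 = axis a 1 - axis e 1" unfolding 2 by simp
    show ?thesis
    proof (rule that[OF d'(1) ne0])
      show "val (c a - c e) = n1" using v(2) unfolding sum root_value_axis[OF d'(1)] cc .
      show "val (c e - c b) = n1" using v(1) unfolding 2 root_value_axis[OF d'(2)] cc sym[of e b] .
      show "val (c a - c b) = n2" using v(3) unfolding 2 root_value_axis[OF d] cc .
      show "levi_of_root \<alpha>2 = (levi (pair_flag e) :: 'a mat3 set)" unfolding 2 by (rule levi_of_root_pair_flag[OF d])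
      show "levi_of_root \<alpha>1 = (levi (pair_flag b) :: 'a mat3 set) \<and> levi_of_root (\<alpha>1 + \<alpha>2) = (levi (pair_flag a) :: 'a mat3 set)
        \<or> levi_of_root \<alpha>1 = (levi (pair_flag a) :: 'a mat3 set) \<and> levi_of_root (\<alpha>1 + \<alpha>2) = (levi (pair_flag b) :: 'a mat3 set)"
        unfolding sum unfolding 2 by (intro disjI2 conjI levi_of_root_pair_flag d')
    qed
  qed
qed

text \<open>Integrability is asserted along with the values because the Bochner integral of a
  function that is not integrable is 0 by convention.\<close>

theorem theorem1p1:
  fixes \<gamma> :: "('a::{field,finite}) mat3"
    and \<alpha>1 \<alpha>2 :: "int^3"
    and n1 n2 :: nat
    and B :: "real^3 \<Rightarrow> real^3 \<Rightarrow> real"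
    and \<mu>G \<mu>T :: "'a mat3 measure"
    and \<nu> :: "'a mat3 set measure"
    and q :: real
  assumes q: "q = real CARD('a)"
    and char: "CHAR('a) > card weyl_group"
    and inner: "inner_product_on (a_space_G (torus :: 'a mat3 set)) B"
    and invariant: "weyl_invariant_on (a_space_G (torus :: 'a mat3 set)) B"
    and haar_G: "haar_measure GL3 \<mu>G" "emeasure \<mu>G GL3_integers = 1"
    and haar_T: "haar_measure (GL3\<lparr>carrier := torus\<rparr>) \<mu>T" "emeasure \<mu>T (torus \<inter> GL3_integers) = 1"
    and quotient: "quotient_measure GL3 torus \<mu>G \<mu>T \<nu>"
    and gamma: "\<gamma> \<in> torus_lie_integers" "regular \<gamma>"
    and simple: "simple_roots {\<alpha>1, \<alpha>2}"
    and val1: "fls_subdegree (root_value \<alpha>1 \<gamma>) = int n1"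
    and val12: "fls_subdegree (root_value (\<alpha>1 + \<alpha>2) \<gamma>) = int n1"
    and val2: "fls_subdegree (root_value \<alpha>2 \<gamma>) = int n2"
    and le: "n1 \<le> n2"
  shows "(\<forall>M \<in> {torus, levi_of_root \<alpha>1, levi_of_root (\<alpha>1 + \<alpha>2), levi_of_root \<alpha>2}.
            integrable \<nu> (\<lambda>c. orbital_integrand B M \<gamma> (coset_rep c)))
      \<and> weighted_orbital_integral \<nu> B torus \<gamma> =
           levi_covolume B (torus :: 'a mat3 set) *
             ((\<Sum>i = 1..n1. real i * (q ^ (2 * i - 1) + q ^ (2 * i - 2)))
              + (\<Sum>i = n1 + n2..<2 * n1 + n2.
                   (4 * real n1 + 2 * real n2 - 4 * real i - 3) * q ^ i)
              + ((real n1)\<^sup>2 + 2 * real n1 * real n2) * q ^ (2 * n1 + n2))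
      \<and> (\<forall>\<alpha> \<in> {\<alpha>1, \<alpha>1 + \<alpha>2}.
           weighted_orbital_integral \<nu> B (levi_of_root \<alpha>) \<gamma> =
             levi_covolume B (levi_of_root \<alpha> :: 'a mat3 set) *
               (real (n1 + n2) * q ^ (2 * n1 + n2)
                - q ^ (n1 + n2) * (\<Sum>i<n1. q ^ i)
                - q ^ (2 * n1) * (\<Sum>i<n2. q ^ i)))
      \<and> weighted_orbital_integral \<nu> B (levi_of_root \<alpha>1) \<gamma> =
           weighted_orbital_integral \<nu> B (levi_of_root (\<alpha>1 + \<alpha>2)) \<gamma>
      \<and> weighted_orbital_integral \<nu> B (levi_of_root \<alpha>2) \<gamma> =
           levi_covolume B (levi_of_root \<alpha>2 :: 'a mat3 set) *
             (2 * real n1 * q ^ (2 * n1 + n2)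
              - 2 * q ^ (n1 + n2) * (\<Sum>i<n1. q ^ i))"
proof -
  define c where "c a = \<gamma> $ a $ a" for a
  have \<gamma>: "\<gamma> = diag c"
    using gamma(1) unfolding torus_lie_integers_def vec_eq_iff diag_nth c_def by auto
  have c: "fls_ge 0 (c a)" for a
    using gamma(1) unfolding torus_lie_integers_def integral_matrices_def integers_iff c_def by blast
  obtain i j k where d: "distinct [i,j,k]" and ne0': "\<forall>a b. a \<noteq> b \<longrightarrow> c a - c b \<noteq> 0"
    and v: "val (c i - c j) = int n1" "val (c j - c k) = int n1" "val (c i - c k) = int n2"
    and L2: "levi_of_root \<alpha>2 = (levi (pair_flag j) :: 'a mat3 set)"
    and L1: "levi_of_root \<alpha>1 = (levi (pair_flag k) :: 'a mat3 set) \<and> levi_of_root (\<alpha>1 + \<alpha>2) = (levi (pair_flag i) :: 'a mat3 set)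
      \<or> levi_of_root \<alpha>1 = (levi (pair_flag i) :: 'a mat3 set) \<and> levi_of_root (\<alpha>1 + \<alpha>2) = (levi (pair_flag k) :: 'a mat3 set)"
    by (rule root_valuation_cases[OF simple gamma(2) val1 val12 val2, folded c_def])
  note ne = perm3_ne[OF d] and ne0 = ne0'[rule_format]
  have sym: "val (c a - c b) = val (c b - c a)" for a b
    by (metis minus_diff_eq fls_uminus_subdegree)
  have d': "distinct [i,k,j]" "distinct [j,i,k]" "distinct [j,k,i]" using ne by simp_all
  have fk: "pair_flag k i = pair_flag k j" "pair_flag k k \<noteq> pair_flag k i"
    and fi: "pair_flag i j = pair_flag i k" "pair_flag i i \<noteq> pair_flag i j"
    and fj: "pair_flag j i = pair_flag j k" "pair_flag j j \<noteq> pair_flag j i"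
    using ne by (simp_all add: pair_flag_def)
  let ?S = "\<lambda>n. \<Sum>l<n. q ^ l"
  note T = weighted_orbital_integral_torus[OF haar_G haar_T quotient inner d c
      ne0[of i j] v(1) ne0[of j k] v(2) ne0[of i k] v(3) le, folded q \<gamma>]
  \<comment> \<open>The order i, k, j puts the singleton k of this Levi subgroup in the middle; the
    next two instances do the same for i and j.\<close>
  note Mk = weighted_orbital_integral_block[OF haar_G haar_T quotient inner d'(1) fk c
      ne0[of i k] v(3) ne0[of k j] v(2)[unfolded sym[of j k]] ne0[of i j] v(1), folded q \<gamma>]
  note Mi = weighted_orbital_integral_block[OF haar_G haar_T quotient inner d'(2) fi c
      ne0[of j i] v(1)[unfolded sym[of i j]] ne0[of i k] v(3) ne0[of j k] v(2), folded q \<gamma>]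
  note Mj = weighted_orbital_integral_block[OF haar_G haar_T quotient inner d fj c
      ne0[of i j] v(1) ne0[of j k] v(2) ne0[of i k] v(3), folded q \<gamma>]
  \<comment> \<open>Equal covolumes turn the equal brackets for \<alpha>1 and \<alpha>1 + \<alpha>2
    into equal values.\<close>
  have cov: "levi_covolume B (levi (pair_flag k) :: 'a mat3 set) = levi_covolume B (levi (pair_flag i) :: 'a mat3 set)"
    by (rule levi_covolume_block_eq[OF inner invariant d fk d'(3) fi])
  let ?R = "real (n1 + n2) * q ^ (2 * n1 + n2) - q ^ (n1 + n2) * ?S n1 - q ^ (2 * n1) * ?S n2"
  have alg: "x * (y * (a * x - s) + x * (b * y - t)) = (a + b) * (x * x * y) - x * y * s - x * x * t"
    "y * (x * (a * x - s) + x * (a * x - s)) = 2 * a * (x * x * y) - 2 * (x * y) * s" for a b s t x y :: real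
    by (simp_all add: algebra_simps)
  have pow: "q ^ (2 * n1 + n2) = q ^ n1 * q ^ n1 * q ^ n2" "q ^ (n1 + n2) = q ^ n1 * q ^ n2" "q ^ (2 * n1) = q ^ n1 * q ^ n1"
    by (simp_all add: power_add mult_2)
  have R: "q ^ n1 * (q ^ n2 * (real n1 * q ^ n1 - ?S n1) + q ^ n1 * (real n2 * q ^ n2 - ?S n2)) = ?R"
    "q ^ n1 * (q ^ n1 * (real n2 * q ^ n2 - ?S n2) + q ^ n2 * (real n1 * q ^ n1 - ?S n1)) = ?R"
    "q ^ n2 * (q ^ n1 * (real n1 * q ^ n1 - ?S n1) + q ^ n1 * (real n1 * q ^ n1 - ?S n1)) =
      2 * real n1 * q ^ (2 * n1 + n2) - 2 * q ^ (n1 + n2) * ?S n1"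
    unfolding pow alg of_nat_add by (simp_all add: alg add.commute[of "_ * (_ - ?S n2)"])
  have Jk: "weighted_orbital_integral \<nu> B (levi (pair_flag k)) \<gamma> = levi_covolume B (levi (pair_flag k) :: 'a mat3 set) * ?R"
    using Mk(2) ne unfolding R by blast
  have Ji: "weighted_orbital_integral \<nu> B (levi (pair_flag i)) \<gamma> = levi_covolume B (levi (pair_flag i) :: 'a mat3 set) * ?R"
    using Mi(2) ne unfolding R by blast
  have Jj: "weighted_orbital_integral \<nu> B (levi (pair_flag j)) \<gamma> = levi_covolume B (levi (pair_flag j) :: 'a mat3 set) *
      (2 * real n1 * q ^ (2 * n1 + n2) - 2 * q ^ (n1 + n2) * ?S n1)"
    using Mj(2) ne unfolding R by blast
  have L: "levi_of_root \<alpha> \<in> {levi (pair_flag k), levi (pair_flag i) :: 'a mat3 set}" if "\<alpha> \<in> {\<alpha>1, \<alpha>1 + \<alpha>2}" for \<alpha>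
    using L1 that by (elim insertE disjE) auto
  have cov': "levi_covolume B (levi_of_root \<alpha> :: 'a mat3 set) = levi_covolume B (levi (pair_flag i) :: 'a mat3 set)"
    and J: "weighted_orbital_integral \<nu> B (levi_of_root \<alpha>) \<gamma> = levi_covolume B (levi_of_root \<alpha> :: 'a mat3 set) * ?R"
    if "\<alpha> \<in> {\<alpha>1, \<alpha>1 + \<alpha>2}" for \<alpha>
    using L[OF that] Jk Ji cov by auto
  show ?thesis
  proof (intro conjI ballI)
    fix M :: "'a mat3 set" assume "M \<in> {torus, levi_of_root \<alpha>1, levi_of_root (\<alpha>1 + \<alpha>2), levi_of_root \<alpha>2}"
    hence "M = torus \<or> M = levi (pair_flag k) \<or> M = levi (pair_flag i) \<or> M = levi (pair_flag j)"
      using L[of \<alpha>1] L[of "\<alpha>1 + \<alpha>2"] unfolding L2 by auto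
    thus "integrable \<nu> (\<lambda>c. orbital_integrand B M \<gamma> (coset_rep c))"
      using T(1) Mk(1) Mi(1) Mj(1) ne by blast
  next
    show "weighted_orbital_integral \<nu> B torus \<gamma> = levi_covolume B (torus :: 'a mat3 set) *
             ((\<Sum>i = 1..n1. real i * (q ^ (2 * i - 1) + q ^ (2 * i - 2)))
              + (\<Sum>i = n1 + n2..<2 * n1 + n2.
                   (4 * real n1 + 2 * real n2 - 4 * real i - 3) * q ^ i)
              + ((real n1)\<^sup>2 + 2 * real n1 * real n2) * q ^ (2 * n1 + n2))"
      using T(2) ne by blast
  next
    fix \<alpha> assume "\<alpha> \<in> {\<alpha>1, \<alpha>1 + \<alpha>2}"
    thus "weighted_orbital_integral \<nu> B (levi_of_root \<alpha>) \<gamma> = levi_covolume B (levi_of_root \<alpha> :: 'a mat3 set) * ?R" by (rule J)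
  next
    show "weighted_orbital_integral \<nu> B (levi_of_root \<alpha>1) \<gamma> = weighted_orbital_integral \<nu> B (levi_of_root (\<alpha>1 + \<alpha>2)) \<gamma>"
      using J[of \<alpha>1] J[of "\<alpha>1 + \<alpha>2"] cov'[of \<alpha>1] cov'[of "\<alpha>1 + \<alpha>2"] by simp
  next
    show "weighted_orbital_integral \<nu> B (levi_of_root \<alpha>2) \<gamma> = levi_covolume B (levi_of_root \<alpha>2 :: 'a mat3 set) *
             (2 * real n1 * q ^ (2 * n1 + n2) - 2 * q ^ (n1 + n2) * (\<Sum>i<n1. q ^ i))"
      unfolding L2 by (rule Jj)
  qed
qed

end
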